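(* Let $\delta>0$, $\rho=\frac{1+\delta}{2+\delta}$ and $\theta>0$ with $\rho\theta>2$. Let $X=(X_n)_{n\ge0}\in\mathcal W^\theta_{\delta,\phi}$ with $\sigma^2=\Gamma_0+2\sum_{j\ge1}\Gamma_j>0$, and let $p\in(2,2+\delta]$. Set $\bar\delta=\min(\delta,1)$, $c=\frac{\bar\delta}{2+\bar\delta}$, and assume $2\rho\theta c>1$ (equivalently $\rho\theta>\frac{2+\bar\delta}{2\bar\delta}$). Set $$\tilde\gamma^*=\tilde\gamma^*(p)=\frac{2\rho\theta\bar\delta-\bar\delta-2}{(2+\bar\delta)(2\rho\theta+3)-\frac2p(2\rho\theta+2+\bar\delta)},\qquad \gamma^*=\frac{2\rho\theta c-1}{2\rho\theta+3}.$$ Then there is a constant $K$, independent of $n$, such that for all $n\ge1$, with $N=2^n$, $$\operatorname{dist}_{KR(\mathbb D,L^\infty)}\bigl(\mathcal L(Y^n),\ \mathcal L(\sigma B)\bigr)\le K\,N^{-\tilde\gamma^*(1/2-1/p)}\log N.$$ Moreover, $\tilde\gamma^*>\gamma^*$ and (regarding $\tilde\gamma^*$ as given by the formula above for every $p>2$, the product $\rho\theta$ and $\bar\delta$ being fixed) $\tilde\gamma^*\to\gamma^*$ as $p\to\infty$. The exponent $\tilde\gamma^*(1/2-1/p)$ is increasing with respect to $p$; thus among $p\in(2,2+\delta]$ the best rate is obtained for $p=2+\delta$.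
   Context: All random variables are defined on a probability space with probability $\mathbf P$. $\mathcal L(Z)$ is the law of $Z$; $B$ is a standard Brownian motion on $[0,1]$. Mixing. For finite $V\subset\mathbf N$, $\mathcal F(V)=\sigma\{X_a: a\in V\}$, and $\varphi(V_1,V_2)=\sup\{|\mathbf P(B'\mid A')-\mathbf P(B')| : A'\in\mathcal F(V_1),\ B'\in\mathcal F(V_2),\ \mathbf P(A')>0\}$. The $\phi$-mixing coefficients of $X$ are $\phi(n)=\sup_{k\ge1}\sup_{l\ge0}\varphi(\{0,\dots,k\},\{k+n,\dots,k+n+l\})$; $X$ is $\phi$-mixing if $\phi(n)\to0$. Classes of sequences. $\mathcal W_\delta$ is the set of real random sequences $X=(X_n)_{n\ge0}$ that are centered, weakly stationary in $L^2$, and satisfy $\sup_k\|X_k\|_{L^{2+\delta}}<\infty$. $\mathcal W_{\delta,\phi}$ is the set of $X\in\mathcal W_\delta$ that are $\phi$-mixing with $\sum_{n\ge0}\phi(n)^{1/2}<\infty$. For $\rho\theta>2$, $\mathcal W^\theta_{\delta,\phi}$ is the set of $X\in\mathcal W_{\delta,\phi}$ with $\phi(n)\le n^{-\theta}$ for all $n\ge1$. $\Gamma_j=\mathbf E[X_0X_j]$ (the series defining $\sigma^2$ converges absolutely). $\mathbb D$ is the space of right-continuous functions on $[0,1]$ with left-hand limits, equipped with the uniform norm $L^\infty$. The piecewise constant random walk is $Y^n(t)=2^{-n/2}\sum_{k=0}^{\lfloor 2^nt\rfloor-1}X_k$. For a metric space $(E,d)$, $\operatorname{dist}_{KR(E)}(\mu,\nu)=\sup_f\bigl(\int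 f\,d\mu-\int f\,d\nu\bigr)$, the supremum being over $f:E\to\mathbf R$ with $|f(x)-f(y)|\le d(x,y)$; here $E=\mathbb D$ and $d$ is the uniform distance. *)

theory Defs
  imports "HOL-Probability.Probability"
begin

section \<open>Cadlag functions on the unit interval with the uniform distance\<close>

definition is_cadlag :: "(real \<Rightarrow> real) \<Rightarrow> bool" where
  "is_cadlag f \<longleftrightarrow>
     (\<forall>t\<in>{0..<1}. (f \<longlongrightarrow> f t) (at_right t)) \<and>
     (\<forall>t\<in>{0<..1}. \<exists>l. (f \<longlongrightarrow> l) (at_left t))"

text \<open>Elements of the type are functions on \<open>[0,1]\<close>; outside they have the value
  \<open>undefined\<close>, so that equality means equality on \<open>[0,1]\<close>.\<close>

typedef cadlag = "{f :: real \<Rightarrow> real. is_cadlag f \<and> f \<in> extensional {0..1}}"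
  morphisms apply_cadlag Abs_cadlag
proof
  have right: "(restrict (\<lambda>_. 0) {0..1} \<longlongrightarrow> (0::real)) (at_right t)" if "t \<in> {0..<1}" for t :: real
    by (rule tendsto_eventually)
      (use that in \<open>auto simp: eventually_at_right[of t 1] intro!: exI[of _ 1]\<close>)
  have left: "(restrict (\<lambda>_. 0) {0..1} \<longlongrightarrow> (0::real)) (at_left t)" if "t \<in> {0<..1}" for t :: real
    by (rule tendsto_eventually)
      (use that in \<open>auto simp: eventually_at_left[of 0 t] intro!: exI[of _ 0]\<close>)
  have "is_cadlag (restrict (\<lambda>_. 0) {0..1})"
    unfolding is_cadlag_def
  proof (intro conjI ballI)
    fix t :: real assume "t \<in> {0..<1}"
    then show "(restrict (\<lambda>_. 0) {0..1} \<longlongrightarrow> (restrict (\<lambda>_. 0) {0..1} t :: real)) (at_right t)"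
      using right[of t] by simp
  next
    fix t :: real assume "t \<in> {0<..1}"
    then show "\<exists>l. (restrict (\<lambda>_. 0) {0..1} \<longlongrightarrow> (l::real)) (at_left t)"
      using left by blast
  qed
  then show "restrict (\<lambda>_. 0) {0..1} \<in> {f :: real \<Rightarrow> real. is_cadlag f \<and> f \<in> extensional {0..1}}"
    by simp
qed

text \<open>The element of the path space given by a function that is cadlag on \<open>[0,1]\<close>.\<close>

definition to_cadlag :: "(real \<Rightarrow> real) \<Rightarrow> cadlag" where
  "to_cadlag f = Abs_cadlag (restrict f {0..1})"

lemma is_cadlag_restrict:
  assumes "is_cadlag f"
  shows "is_cadlag (restrict f {0..1})"
proof -
  have "(restrict f {0..1} \<longlongrightarrow> restrict f {0..1} t) (at_right t)" if t: "t \<in> {0..<1}" for t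
  proof -
    have "(f \<longlongrightarrow> f t) (at_right t)" using assms t by (auto simp: is_cadlag_def)
    moreover have "\<forall>\<^sub>F s in at_right t. restrict f {0..1} s = f s"
      using t by (auto simp: eventually_at_right[of t 1] intro!: exI[of _ 1])
    ultimately show ?thesis using t by (simp add: tendsto_cong)
  qed
  moreover have "\<exists>l. (restrict f {0..1} \<longlongrightarrow> l) (at_left t)" if t: "t \<in> {0<..1}" for t
  proof -
    obtain l where "(f \<longlongrightarrow> l) (at_left t)" using assms t unfolding is_cadlag_def by blast
    moreover have "\<forall>\<^sub>F s in at_left t. restrict f {0..1} s = f s"
      using t by (auto simp: eventually_at_left[of 0 t] intro!: exI[of _ 0])
    ultimately show ?thesis by (auto simp: tendsto_cong)
  qed
  ultimately show ?thesis unfolding is_cadlag_def by blast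
qed

lemma apply_to_cadlag:
  assumes "is_cadlag f" "t \<in> {0..1}"
  shows "apply_cadlag (to_cadlag f) t = f t"
  using is_cadlag_restrict[OF assms(1)] assms(2)
  by (simp add: to_cadlag_def Abs_cadlag_inverse)

lemma continuous_is_cadlag:
  assumes "continuous_on {0..1} f"
  shows "is_cadlag f"
proof -
  have "(f \<longlongrightarrow> f t) (at_right t)" if "t \<in> {0..<1}" for t
  proof (rule continuous_on_Icc_at_rightD)
    show "continuous_on {t..1} f" by (rule continuous_on_subset[OF assms]) (use that in auto)
  qed (use that in simp)
  moreover have "(f \<longlongrightarrow> f t) (at_left t)" if "t \<in> {0<..1}" for t
  proof (rule continuous_on_Icc_at_leftD)
    show "continuous_on {0..t} f" by (rule continuous_on_subset[OF assms]) (use that in auto)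
  qed (use that in simp)
  ultimately show ?thesis unfolding is_cadlag_def by blast
qed

lemma is_cadlag_bounded:
  assumes "is_cadlag f"
  shows "bounded (f ` {0..1})"
proof -
  have "bounded (f ` ({0..1} \<inter> {0..1}))"
  proof (rule Bolzano[where P = "\<lambda>a b. bounded (f ` ({a..b} \<inter> {0..1}))" and a = 0 and b = 1])
    fix a b c :: real
    assume "bounded (f ` ({a..b} \<inter> {0..1}))" "bounded (f ` ({b..c} \<inter> {0..1}))" "a \<le> b" "b \<le> c"
    moreover have "{a..c} \<inter> {0..1} = ({a..b} \<inter> {0..1}) \<union> ({b..c} \<inter> {0..1})"
      using \<open>a \<le> b\<close> \<open>b \<le> c\<close> by auto
    ultimately show "bounded (f ` ({a..c} \<inter> {0..1}))"
      by (simp add: image_Un)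
  next
    fix x :: real assume x: "0 \<le> x" "x \<le> 1"
    have "\<exists>d>0. \<exists>C. \<forall>y\<in>{x<..<x+d} \<inter> {0..1}. \<bar>f y\<bar> \<le> C"
    proof (cases "x < 1")
      case True
      then have "(f \<longlongrightarrow> f x) (at_right x)" using assms x by (auto simp: is_cadlag_def)
      then have "\<forall>\<^sub>F y in at_right x. dist (f y) (f x) < 1" by (rule tendstoD) simp
      then obtain b where b: "b > x" "\<forall>y>x. y < b \<longrightarrow> dist (f y) (f x) < 1"
        by (auto simp: eventually_at_right[of x "x+1"])
      have "\<bar>f y\<bar> \<le> \<bar>f x\<bar> + 1" if "y \<in> {x<..<x+(b-x)} \<inter> {0..1}" for y
      proof -
        have "dist (f y) (f x) < 1" using b(2) that by simp
        then show ?thesis unfolding dist_real_def by linarith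
      qed
      with b(1) show ?thesis by (intro exI[of _ "b - x"] conjI exI[of _ "\<bar>f x\<bar> + 1"]) auto
    qed (use x in \<open>auto intro!: exI[of _ 1]\<close>)
    then obtain d1 C1 where d1: "d1 > 0" "\<forall>y\<in>{x<..<x+d1} \<inter> {0..1}. \<bar>f y\<bar> \<le> C1" by blast
    have "\<exists>d>0. \<exists>C. \<forall>y\<in>{x-d<..<x} \<inter> {0..1}. \<bar>f y\<bar> \<le> C"
    proof (cases "0 < x")
      case True
      with x have "x \<in> {0<..1}" by simp
      then obtain l where "(f \<longlongrightarrow> l) (at_left x)" using assms unfolding is_cadlag_def by blast
      then have "\<forall>\<^sub>F y in at_left x. dist (f y) l < 1" by (rule tendstoD) simp
      then obtain b where b: "b < x" "\<forall>y>b. y < x \<longrightarrow> dist (f y) l < 1"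
        by (auto simp: eventually_at_left[of "x-1" x])
      have "\<bar>f y\<bar> \<le> \<bar>l\<bar> + 1" if "y \<in> {x-(x-b)<..<x} \<inter> {0..1}" for y
      proof -
        have "dist (f y) (l) < 1" using b(2) that by simp
        then show ?thesis unfolding dist_real_def by linarith
      qed
      with b(1) show ?thesis by (intro exI[of _ "x - b"] conjI exI[of _ "\<bar>l\<bar> + 1"]) auto
    qed (use x in \<open>auto intro!: exI[of _ 1]\<close>)
    then obtain d2 C2 where d2: "d2 > 0" "\<forall>y\<in>{x-d2<..<x} \<inter> {0..1}. \<bar>f y\<bar> \<le> C2" by blast
    have "bounded (f ` ({a..b} \<inter> {0..1}))" if "a \<le> x" "x \<le> b" "b - a < min d1 d2" for a b
    proof -
      have "\<bar>f y\<bar> \<le> max \<bar>f x\<bar> (max C1 C2)" if "y \<in> {a..b} \<inter> {0..1}" for y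
      proof -
        have "a \<le> y" "y \<le> b" "0 \<le> y" "y \<le> 1" "b - a < d1" "b - a < d2"
          using that \<open>b - a < min d1 d2\<close> by auto
        moreover from this \<open>a \<le> x\<close> \<open>x \<le> b\<close> have "x - d2 < y" "y < x + d1"
          by linarith+
        ultimately consider "y = x" | "y \<in> {x<..<x+d1} \<inter> {0..1}" | "y \<in> {x-d2<..<x} \<inter> {0..1}"
          by (cases y x rule: linorder_cases) auto
        then show ?thesis
          using d1(2) d2(2) by cases (auto simp: le_max_iff_disj)
      qed
      then show ?thesis
        by (intro boundedI[where B = "max \<bar>f x\<bar> (max C1 C2)"]) (metis imageE real_norm_def)
    qed
    then show "\<exists>d>0. \<forall>a b. a \<le> x \<and> x \<le> b \<and> b - a < d \<longrightarrow> bounded (f ` ({a..b} \<inter> {0..1}))"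
      using d1(1) d2(1) by (intro exI[of _ "min d1 d2"]) auto
  qed simp
  then show ?thesis by simp
qed

lemma bdd_above_cadlag_diff:
  "bdd_above ((\<lambda>t. \<bar>apply_cadlag x t - apply_cadlag y t\<bar>) ` {0..1})"
proof -
  have "bounded (apply_cadlag z ` {0..1})" for z
    using apply_cadlag[of z] by (simp add: is_cadlag_bounded)
  then have "\<exists>c. \<forall>t\<in>{0..1}. \<bar>apply_cadlag z t\<bar> \<le> c" for z
    by (simp add: bounded_iff)
  then obtain C where C: "\<And>z t. t \<in> {0..1} \<Longrightarrow> \<bar>apply_cadlag z t\<bar> \<le> C z"
    by metis
  have "\<bar>apply_cadlag x t - apply_cadlag y t\<bar> \<le> C x + C y" if "t \<in> {0..1}" for t
    using C[OF that, of x] C[OF that, of y] by linarith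
  then show ?thesis by (rule bdd_aboveI2)
qed

instantiation cadlag :: metric_space
begin

definition dist_cadlag :: "cadlag \<Rightarrow> cadlag \<Rightarrow> real" where
  "dist_cadlag x y = (SUP t\<in>{0..1}. \<bar>apply_cadlag x t - apply_cadlag y t\<bar>)"

definition uniformity_cadlag :: "(cadlag \<times> cadlag) filter" where
  "uniformity_cadlag = (INF e\<in>{0<..}. principal {(x, y). dist x y < e})"

definition open_cadlag :: "cadlag set \<Rightarrow> bool" where
  "open_cadlag S \<longleftrightarrow> (\<forall>x\<in>S. \<forall>\<^sub>F (x', y) in uniformity. x' = x \<longrightarrow> y \<in> S)"

instance
proof
  have upper: "\<bar>apply_cadlag x t - apply_cadlag y t\<bar> \<le> dist x y" if "t \<in> {0..1}" for x y t
    unfolding dist_cadlag_def by (rule cSUP_upper[OF that bdd_above_cadlag_diff])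
  have least: "dist x y \<le> c"
    if "\<And>t. t \<in> {0..1} \<Longrightarrow> \<bar>apply_cadlag x t - apply_cadlag y t\<bar> \<le> c" for x y c
    unfolding dist_cadlag_def by (rule cSUP_least) (use that in auto)
  show "dist x y = 0 \<longleftrightarrow> x = y" for x y :: cadlag
  proof
    assume eq: "dist x y = 0"
    have "apply_cadlag x t = apply_cadlag y t" if "t \<in> {0..1}" for t
      using upper[OF that, of x y] eq by simp
    moreover have "apply_cadlag x \<in> extensional {0..1}" "apply_cadlag y \<in> extensional {0..1}"
      using apply_cadlag by auto
    ultimately have "apply_cadlag x = apply_cadlag y" by (meson extensionalityI)
    then show "x = y" by (simp add: apply_cadlag_inject)
  qed (simp add: dist_cadlag_def)
  show "dist x y \<le> dist x z + dist y z" for x y z :: cadlag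
  proof (rule least)
    fix t :: real assume t: "t \<in> {0..1}"
    show "\<bar>apply_cadlag x t - apply_cadlag y t\<bar> \<le> dist x z + dist y z"
      using upper[OF t, of x z] upper[OF t, of y z] by linarith
  qed
qed (rule uniformity_cadlag_def open_cadlag_def)+

end

section \<open>Kantorovich--Rubinstein distance\<close>

text \<open>The supremum is taken in the extended reals: over an unbounded set of reals it would be
  an unspecified number.\<close>

definition KR_dist :: "'a::metric_space measure \<Rightarrow> 'a measure \<Rightarrow> ereal" where
  "KR_dist \<mu> \<nu> =
     (SUP f\<in>{f :: 'a \<Rightarrow> real. 1-lipschitz_on UNIV f}.
        ereal (integral\<^sup>L \<mu> f - integral\<^sup>L \<nu> f))"

section \<open>Mixing coefficients\<close>

definition gen_events :: "'a measure \<Rightarrow> (nat \<Rightarrow> 'a \<Rightarrow> real) \<Rightarrow> nat set \<Rightarrow> 'a set set" where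
  "gen_events M X V =
     sigma_sets (space M) (\<Union>a\<in>V. {X a -` S \<inter> space M | S. S \<in> sets borel})"

definition varphi_mix :: "'a measure \<Rightarrow> (nat \<Rightarrow> 'a \<Rightarrow> real) \<Rightarrow> nat set \<Rightarrow> nat set \<Rightarrow> real" where
  "varphi_mix M X V1 V2 =
     Sup {\<bar>measure M (B \<inter> A) / measure M A - measure M B\<bar> | A B.
            A \<in> gen_events M X V1 \<and> B \<in> gen_events M X V2 \<and> measure M A > 0}"

definition phi_coeff :: "'a measure \<Rightarrow> (nat \<Rightarrow> 'a \<Rightarrow> real) \<Rightarrow> nat \<Rightarrow> real" where
  "phi_coeff M X n = (SUP k\<in>{1..}. SUP l. varphi_mix M X {0..k} {k + n..k + n + l})"

definition phi_mixing :: "'a measure \<Rightarrow> (nat \<Rightarrow> 'a \<Rightarrow> real) \<Rightarrow> bool" where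
  "phi_mixing M X \<longleftrightarrow> phi_coeff M X \<longlonglongrightarrow> 0"

section \<open>Classes of sequences\<close>

definition W_class :: "'a measure \<Rightarrow> real \<Rightarrow> (nat \<Rightarrow> 'a \<Rightarrow> real) set" where
  "W_class M \<delta> = {X.
     (\<forall>k. X k \<in> borel_measurable M) \<and>
     (\<forall>k. integrable M (X k) \<and> integral\<^sup>L M (X k) = 0) \<and>
     (\<forall>k. integrable M (\<lambda>\<omega>. (X k \<omega>)\<^sup>2)) \<and>
     (\<forall>k j. (\<integral>\<omega>. X k \<omega> * X (k + j) \<omega> \<partial>M) = (\<integral>\<omega>. X 0 \<omega> * X j \<omega> \<partial>M)) \<and>
     (\<forall>k. integrable M (\<lambda>\<omega>. \<bar>X k \<omega>\<bar> powr (2 + \<delta>))) \<and>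
     bdd_above (range (\<lambda>k. (\<integral>\<omega>. \<bar>X k \<omega>\<bar> powr (2 + \<delta>) \<partial>M) powr (1 / (2 + \<delta>))))}"

definition W_phi_class :: "'a measure \<Rightarrow> real \<Rightarrow> (nat \<Rightarrow> 'a \<Rightarrow> real) set" where
  "W_phi_class M \<delta> =
     {X \<in> W_class M \<delta>. phi_mixing M X \<and> summable (\<lambda>n. phi_coeff M X n powr (1/2))}"

definition W_phi_theta_class :: "'a measure \<Rightarrow> real \<Rightarrow> real \<Rightarrow> (nat \<Rightarrow> 'a \<Rightarrow> real) set" where
  "W_phi_theta_class M \<delta> \<theta> =
     {X \<in> W_phi_class M \<delta>. \<forall>n\<ge>1. phi_coeff M X n \<le> real n powr (-\<theta>)}"

definition autocov :: "'a measure \<Rightarrow> (nat \<Rightarrow> 'a \<Rightarrow> real) \<Rightarrow> nat \<Rightarrow> real" where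
  "autocov M X j = (\<integral>\<omega>. X 0 \<omega> * X j \<omega> \<partial>M)"

section \<open>Random walk and Brownian motion\<close>

definition random_walk :: "(nat \<Rightarrow> 'a \<Rightarrow> real) \<Rightarrow> nat \<Rightarrow> real \<Rightarrow> 'a \<Rightarrow> real" where
  "random_walk X n t \<omega> = 2 powr (- real n / 2) * (\<Sum>k<nat \<lfloor>2 ^ n * t\<rfloor>. X k \<omega>)"

text \<open>All paths, not only almost all, are required to be continuous, so that Brownian motion
  is a map into the path space.\<close>

definition standard_BM01 :: "'a measure \<Rightarrow> (real \<Rightarrow> 'a \<Rightarrow> real) \<Rightarrow> bool" where
  "standard_BM01 M B \<longleftrightarrow>
     prob_space M \<and>
     (\<forall>t\<in>{0..1}. B t \<in> borel_measurable M) \<and>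
     (\<forall>\<omega>\<in>space M. B 0 \<omega> = 0 \<and> continuous_on {0..1} (\<lambda>t. B t \<omega>)) \<and>
     (\<forall>s t. 0 \<le> s \<longrightarrow> s < t \<longrightarrow> t \<le> 1 \<longrightarrow>
        distributed M lborel (\<lambda>\<omega>. B t \<omega> - B s \<omega>) (normal_density 0 (sqrt (t - s)))) \<and>
     (\<forall>(m::nat) \<tau>. 0 \<le> \<tau> 0 \<longrightarrow> \<tau> m \<le> 1 \<longrightarrow> (\<forall>i<m. \<tau> i < \<tau> (Suc i)) \<longrightarrow>
        prob_space.indep_vars M (\<lambda>_. borel) (\<lambda>i \<omega>. B (\<tau> (Suc i)) \<omega> - B (\<tau> i) \<omega>) {..<m})"

text \<open>The law, a Borel measure on the path space, of a process with cadlag paths on \<open>[0,1]\<close>.\<close>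

definition path_law :: "'a measure \<Rightarrow> (real \<Rightarrow> 'a \<Rightarrow> real) \<Rightarrow> cadlag measure" where
  "path_law M Z = distr M borel (\<lambda>\<omega>. to_cadlag (\<lambda>t. Z t \<omega>))"

section \<open>Rate exponents\<close>

text \<open>Below, \<open>r\<close> is the product \<open>\<rho>\<theta>\<close>, and \<open>d\<close> is \<open>min \<delta> 1\<close>.\<close>

definition gamma_tilde :: "real \<Rightarrow> real \<Rightarrow> real \<Rightarrow> real" where
  "gamma_tilde r d p =
     (2 * r * d - d - 2) / ((2 + d) * (2 * r + 3) - 2 / p * (2 * r + 2 + d))"

definition gamma_star :: "real \<Rightarrow> real \<Rightarrow> real" where
  "gamma_star r c = (2 * r * c - 1) / (2 * r + 3)"

end

theory Submission imports Defs begin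

text \<open>
  Replacing the walk by its values at \<open>2 ^ j\<close> equidistant times costs
  \<open>2 powr (- j * (1 / 2 - 1 / p))\<close>, by chaining over the dyadic levels above \<open>j\<close> and a bound of order
  \<open>m powr (p / 2)\<close> for the \<open>p\<close>-th moment of a sum of \<open>m\<close> terms; the same holds for Brownian motion.
  It remains to compare the \<open>2 ^ j\<close> block sums with independent Gaussian variables. They are replaced
  one at a time, the last one first. After the later blocks have been averaged out, the test function
  is a Lipschitz function of the current block sum with coefficients depending on the past, and
  Lindeberg's method applies to it: the Gaussian variables already exchanged smooth the test function,
  and the Taylor terms are telescoped over all lags, up to the memory length \<open>L\<close> directly and
  beyond it by mixing, to recover the full variance \<open>\<sigma>\<^sup>2\<close>. The covariances of the past with an unbounded variable are
  controlled by a layer-cake argument from the mixing coefficients of events. The choices of \<open>L\<close>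
  and of the level \<open>j\<close> balance the errors.
\<close>

section \<open>The rate exponents\<close>

text \<open>All estimates are made at the largest admissible moment order,
  \<open>2 + \<delta>\<close>; a smaller \<open>p\<close> asks for less, because the exponent
  increases with \<open>p\<close>. The error in \<phi>-mixing is proportional to the probability of
  the past event, so an arbitrary weight depending on the past is allowed on one side of a
  covariance. This dictates the backward order of the exchange: the test function is then a weight
  known before the current block starts, and no gaps between blocks are cut. Inside a block a
  summand is not centered given its past, so the first-order Taylor term survives; expanding its
  coefficient back to the start of the block is what produces the covariances in
  \<open>\<sigma>\<^sup>2\<close>. The exponent \<open>d = min \<delta> 1\<close> of the remainders
  has two sources: moments exist up to order \<open>2 + \<delta>\<close>, and three derivatives of
  the smoothed function are controlled. The number of blocks is prescribed by the claimed rate, and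
  the block estimate is then shown to be fast enough for it; equality of all errors is not
  sought.\<close>

lemma gamma_tilde_denom_pos:
  fixes r d q :: real
  assumes "r > 0" "d > 0" "q > 2"
  shows "(2 + d) * (2 * r + 3) - 2 / q * (2 * r + 2 + d) > 0"
proof -
  define F where "F = 2 * r + 2 + d"
  have "2 / q * F \<le> 1 * F"
    by (rule mult_right_mono) (use assms in \<open>auto simp: F_def\<close>)
  moreover have "(2 + d) * (2 * r + 3) - F = 2 * r * d + 2 * r + 4 + 2 * d"
    by (simp add: F_def algebra_simps)
  moreover have "2 * r * d > 0" using assms by simp
  ultimately have "(2 + d) * (2 * r + 3) - 2 / q * F > 0" using assms by linarith
  then show ?thesis by (simp add: F_def)
qed

text \<open>Multiplying numerator and denominator of \<open>gamma_star\<close> by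
  \<open>2 + d\<close> produces the numerator of \<open>gamma_tilde\<close>, which is positive by
  the last hypothesis; \<open>gamma_tilde\<close> only has the smaller denominator.\<close>

lemma gamma_tilde_gt_gamma_star:
  fixes r d q :: real
  assumes "r > 0" "d > 0" "q > 2" "2 * r * (d / (2 + d)) > 1"
  shows "gamma_tilde r d q > gamma_star r (d / (2 + d))"
proof -
  have A: "2 * r * d - d - 2 > 0"
    using assms by (simp add: field_simps)
  have "gamma_star r (d / (2 + d)) = (2 * r * d - d - 2) / ((2 + d) * (2 * r + 3))"
    using assms by (simp add: gamma_star_def field_simps)
  also have "\<dots> < gamma_tilde r d q"
    unfolding gamma_tilde_def
    by (rule divide_strict_left_mono)
      (use A assms gamma_tilde_denom_pos[of r d q] in \<open>auto intro!: mult_pos_pos\<close>)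
  finally show ?thesis .
qed

lemma gamma_tilde_tendsto_gamma_star:
  fixes r d :: real
  assumes "r > 0" "d > 0"
  shows "(gamma_tilde r d \<longlongrightarrow> gamma_star r (d / (2 + d))) at_top"
proof -
  have "((\<lambda>q. (2 * r * d - d - 2) / ((2 + d) * (2 * r + 3) - 2 / q * (2 * r + 2 + d)))
      \<longlongrightarrow> (2 * r * d - d - 2) / ((2 + d) * (2 * r + 3) - 0 * (2 * r + 2 + d))) at_top"
    by (intro tendsto_intros tendsto_divide_0[OF tendsto_const] filterlim_at_top_imp_at_infinity
        filterlim_ident) (use assms in auto)
  moreover have "(2 * r * d - d - 2) / ((2 + d) * (2 * r + 3) - 0 * (2 * r + 2 + d))
      = gamma_star r (d / (2 + d))"
    using assms by (simp add: gamma_star_def field_simps)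
  ultimately show ?thesis by (simp add: gamma_tilde_def[abs_def])
qed

text \<open>As a function of \<open>q\<close> the exponent is a positive multiple of the Moebius map
  \<open>(q - 2) / (E * q - 2 * F)\<close>, whose determinant \<open>2 * (E - F)\<close> is positive
  and whose pole lies to the left of \<open>q = 2\<close>.\<close>

lemma rate_exponent_strict_mono:
  fixes r d :: real
  assumes "r > 0" "d > 0" "2 * r * (d / (2 + d)) > 1"
  shows "strict_mono_on {2<..} (\<lambda>q. gamma_tilde r d q * (1 / 2 - 1 / q))"
proof (rule strict_mono_onI)
  fix x y :: real assume xy: "x \<in> {2<..}" "y \<in> {2<..}" "x < y"
  define A E F where "A = 2 * r * d - d - 2" and "E = (2 + d) * (2 * r + 3)"
    and "F = 2 * r + 2 + d"
  have A: "A > 0" unfolding A_def using assms by (simp add: field_simps)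
  have EF: "E > F"
  proof -
    have "E - F = 2 * r * d + 2 * r + 4 + 2 * d" by (simp add: E_def F_def algebra_simps)
    moreover have "2 * r * d > 0" using assms by simp
    ultimately show ?thesis using assms by linarith
  qed
  have pos: "E * q - 2 * F > 0" if "q > 2" for q
  proof -
    have "E * q > E * 2" using that EF assms by (auto simp: F_def intro!: mult_strict_left_mono)
    then show ?thesis using EF by linarith
  qed
  have form: "gamma_tilde r d q * (1 / 2 - 1 / q) = A / 2 * ((q - 2) / (E * q - 2 * F))" if "q > 2" for q
  proof -
    have "E - 2 / q * F = (E * q - 2 * F) / q" "1 / 2 - 1 / q = (q - 2) / (2 * q)"
      using that by (auto simp: field_simps)
    then have "gamma_tilde r d q * (1 / 2 - 1 / q) = A / ((E * q - 2 * F) / q) * ((q - 2) / (2 * q))"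
      by (simp add: gamma_tilde_def A_def E_def F_def)
    also have "\<dots> = A / 2 * ((q - 2) / (E * q - 2 * F))"
      using that pos[OF that] by (simp add: field_simps)
    finally show ?thesis .
  qed
  have "(x - 2) * (E * y - 2 * F) < (y - 2) * (E * x - 2 * F)"
  proof -
    have "(y - 2) * (E * x - 2 * F) - (x - 2) * (E * y - 2 * F) = 2 * (E - F) * (y - x)"
      by (simp add: algebra_simps)
    moreover have "2 * (E - F) * (y - x) > 0" using EF xy by simp
    ultimately show ?thesis by linarith
  qed
  then have "(x - 2) / (E * x - 2 * F) < (y - 2) / (E * y - 2 * F)"
    using pos[of x] pos[of y] xy by (simp add: divide_less_eq less_divide_eq)
  then show "gamma_tilde r d x * (1 / 2 - 1 / x) < gamma_tilde r d y * (1 / 2 - 1 / y)"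
    using form[of x] form[of y] xy A by (simp only: greaterThan_iff) (intro mult_strict_left_mono, auto)
qed

text \<open>With blocks of length \<open>m\<close>, the central limit theorem for one block holds at the rate
  \<open>m powr - (d * a / (2 * (2 * d + a)))\<close>. The inequality says that this is fast enough for the
  number \<open>N powr gamma_tilde\<close> of blocks.\<close>

lemma gamma_tilde_balance:
  fixes r d \<delta> :: real
  defines "a \<equiv> r * \<delta> / (1 + \<delta>)" and "g \<equiv> gamma_tilde r d (2 + \<delta>)"
  assumes r: "r > 2" and \<delta>: "\<delta> > 0" and d: "d = min \<delta> 1" and c: "2 * r * (d / (2 + d)) > 1"
  shows "0 < g" "g < 1" "g * (1 - 1 / (2 + \<delta>)) \<le> (1 - g) * (d * a / (2 * (2 * d + a)))"
proof -
  define A D v where "A = 2 * r * d - d - 2"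
    and "D = (2 + d) * (2 * r + 3) - 2 / (2 + \<delta>) * (2 * r + 2 + d)" and "v = 1 - 1 / (2 + \<delta>)"
  have d0: "d > 0" "d \<le> 1" using \<delta> d by auto
  have A: "A > 0" unfolding A_def using c d0 by (simp add: field_simps)
  have D: "D > 0" unfolding D_def by (rule gamma_tilde_denom_pos) (use r \<delta> d0 in auto)
  have g: "g = A / D" by (simp add: g_def gamma_tilde_def A_def D_def)
  have v: "0 < v" "v \<le> 1" using \<delta> by (auto simp: v_def field_simps)
  have DA: "D - A = 2 * (2 * r + 2 + d) * v + 4 + 2 * d"
  proof -
    have "D = (2 + d) * (2 * r + 3) - 2 * (1 - v) * (2 * r + 2 + d)" by (simp add: D_def v_def)
    then show ?thesis by (simp add: A_def algebra_simps)
  qed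
  show "0 < g" using A D g by simp
  have "0 < 2 * (2 * r + 2 + d) * v" using v d0 r by simp
  then have DA0: "D - A > 0" using DA d0 by simp
  then show "g < 1" using D g by simp
  define k where "k = d * a / (2 * (2 * d + a))"
  \<comment> \<open>Since \<open>g = A / D\<close>, this is the claimed balance multiplied by
    \<open>D\<close>. The two cases are \<open>d = \<delta>\<close> and
    \<open>d = 1\<close>.\<close>
  have main: "A * v \<le> (D - A) * k"
  proof (cases "\<delta> \<le> 1")
    case True
    then have d\<delta>: "\<delta> = d" using d by simp
    have "2 * d + a = d * (2 * (1 + d) + r) / (1 + d)" "d * a = d * (r * d) / (1 + d)"
      using d0 by (auto simp: a_def d\<delta> field_simps)
    then have k: "k = d * r / (2 * (2 + 2 * d + r))"
      using d0 r unfolding k_def times_divide_eq_right by (simp add: power2_eq_square)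
    have v: "v = (1 + d) / (2 + d)" using d0 by (simp add: v_def d\<delta> field_simps)
    \<comment> \<open>Cross-multiplied, the inequality is polynomial: the difference is linear in
      \<open>r\<close>, with coefficients that are nonnegative because
      \<open>d \<le> 1\<close>.\<close>
    have "0 \<le> ((2 * r + 2 + d) * (1 + d) + (2 + d)\<^sup>2) * d * r - A * (1 + d) * (2 + 2 * d + r)"
    proof -
      have "((2 * r + 2 + d) * (1 + d) + (2 + d)\<^sup>2) * d * r - A * (1 + d) * (2 + 2 * d + r)
         = r * (2 + 5 * d - 2 * d ^ 3) + (4 + 10 * d + 8 * d\<^sup>2 + 2 * d ^ 3)"
        by (simp add: A_def power2_eq_square power3_eq_cube algebra_simps)
      moreover have "d ^ 3 \<le> d" using power_decreasing[of 1 3 d] d0 by simp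
      then have "2 + 5 * d - 2 * d ^ 3 \<ge> 0" using d0 by linarith
      ultimately show ?thesis using d0 r by simp
    qed
    then have "A * (1 + d) * (2 + 2 * d + r) \<le> ((2 * r + 2 + d) * (1 + d) + (2 + d)\<^sup>2) * d * r"
      by simp
    then have "A * (1 + d) \<le> ((2 * r + 2 + d) * (1 + d) + (2 + d)\<^sup>2) * d * r / (2 + 2 * d + r)"
      using d0 r by (simp add: pos_le_divide_eq)
    then have "A * (1 + d) / (2 + d) \<le> ((2 * r + 2 + d) * (1 + d) + (2 + d)\<^sup>2) * d * r / (2 + 2 * d + r) / (2 + d)"
      using d0 by (intro divide_right_mono) auto
    also have "\<dots> = (D - A) * k"
    proof -
      have "D - A = 2 * ((2 * r + 2 + d) * (1 + d) + (2 + d)\<^sup>2) / (2 + d)"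
        unfolding DA v using d0 by (simp add: field_simps power2_eq_square)
      moreover have "\<And>Q x y z :: real. 2 * Q / y * (z / (2 * x)) = Q * z / x / y" by simp
      ultimately show ?thesis unfolding k by (simp only: mult.assoc)
    qed
    finally show ?thesis by (simp add: v)
  next
    case False
    then have d1: "d = 1" using d by simp
    \<comment> \<open>The quantity \<open>k\<close> increases with \<open>a\<close>, so inserting
      this lower bound leaves an inequality in \<open>r\<close> and \<open>v\<close> alone.\<close>
    have "a \<ge> r / 2" using False \<delta> r by (simp add: a_def field_simps)
    then have "k \<ge> (r / 2) / (2 * (2 + r / 2))"
      using r by (simp add: k_def d1 frac_le_eq field_simps)
    then have k: "k \<ge> r / (2 * (4 + r))" using r by (simp add: field_simps)
    \<comment> \<open>The factor changes sign at \<open>r = 6\<close>; on either side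
      \<open>0 < v \<le> 1\<close> suffices.\<close>
    have "v * (4 * r - 24) \<le> 6 * r"
    proof (cases "4 * r - 24 \<ge> 0")
      case True
      then have "v * (4 * r - 24) \<le> 1 * (4 * r - 24)" using v by (intro mult_right_mono) auto
      also have "1 * (4 * r - 24) \<le> 6 * r" using r by simp
      finally show ?thesis .
    next
      case False
      then have "v * (4 * r - 24) \<le> 0" using v by (intro mult_nonneg_nonpos) auto
      also have "0 \<le> 6 * r" using r by simp
      finally show ?thesis .
    qed
    then have "(2 * r - 3) * v * (2 * (4 + r)) \<le> ((4 * r + 6) * v + 6) * r"
      by (simp add: algebra_simps)
    moreover have "A = 2 * r - 3" "D - A = (4 * r + 6) * v + 6"
      unfolding DA by (simp_all add: A_def d1 algebra_simps)
    ultimately have "A * v * (2 * (4 + r)) \<le> (D - A) * r" by metis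
    then have "A * v \<le> (D - A) * (r / (2 * (4 + r)))"
      using r by (simp add: field_simps)
    also have "\<dots> \<le> (D - A) * k" using k DA0 by (intro mult_left_mono) auto
    finally show ?thesis .
  qed
  have "g * v \<le> (1 - g) * k"
  proof -
    have "g * v = A * v / D" "(1 - g) * k = (D - A) * k / D"
      using D by (auto simp: g field_simps)
    then show ?thesis using main D by (simp add: divide_right_mono)
  qed
  then show "g * (1 - 1 / (2 + \<delta>)) \<le> (1 - g) * (d * a / (2 * (2 * d + a)))"
    by (simp add: v_def k_def)
qed

section \<open>Covariance inequalities under mixing\<close>

text \<open>Both sides are additive and continuous from below in \<open>Y\<close>, so indicators
  decide. It is applied with the indicator of a future event, possibly shifted by a constant,
  against a constant weight; this turns the mixing inequality for events into one for integrals over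
  the past.\<close>

lemma (in prob_space) nn_integral_subalgebra_mono:
  assumes sub: "subalgebra M F"
    and w1 [measurable]: "w1 \<in> borel_measurable M" and w2 [measurable]: "w2 \<in> borel_measurable M"
    and le: "\<And>A. A \<in> sets F \<Longrightarrow> (\<integral>\<^sup>+ x. indicator A x * w1 x \<partial>M) \<le> (\<integral>\<^sup>+ x. indicator A x * w2 x \<partial>M)"
    and Y: "Y \<in> borel_measurable F"
  shows "(\<integral>\<^sup>+ x. Y x * w1 x \<partial>M) \<le> (\<integral>\<^sup>+ x. Y x * w2 x \<partial>M)"
  using Y
proof (induction rule: borel_measurable_induct)
  case (cong f g)
  have "space F = space M" using sub by (simp add: subalgebra_def)
  with cong(3) have "\<And>w. (\<integral>\<^sup>+ x. g x * w x \<partial>M) = (\<integral>\<^sup>+ x. f x * w x \<partial>M)"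
    by (intro nn_integral_cong) simp
  with cong(4) show ?case by simp
next
  case (set A)
  then show ?case by (rule le)
next
  case (mult u c)
  have [measurable]: "u \<in> borel_measurable M"
    using mult measurable_from_subalg[OF sub] by blast
  show ?case using mult by (simp add: mult.assoc nn_integral_cmult mult_left_mono)
next
  case (add u v)
  have [measurable]: "u \<in> borel_measurable M" "v \<in> borel_measurable M"
    using add measurable_from_subalg[OF sub] by blast+
  show ?case using add by (simp add: distrib_right nn_integral_add add_mono)
next
  case (seq U)
  have [measurable]: "U i \<in> borel_measurable M" for i
    using seq measurable_from_subalg[OF sub] by blast
  have *: "(\<integral>\<^sup>+ x. (SUP i. U i) x * w x \<partial>M) = (SUP i. \<integral>\<^sup>+ x. U i x * w x \<partial>M)"
    if [measurable]: "w \<in> borel_measurable M" for w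
  proof -
    have "(SUP i. U i) x * w x = (SUP i. U i x * w x)" for x
      by (simp add: SUP_mult_right_ennreal image_image)
    moreover have "incseq (\<lambda>i x. U i x * w x)"
      using seq(3) by (auto simp: incseq_def le_fun_def intro!: mult_right_mono)
    ultimately show ?thesis
      by (simp add: nn_integral_monotone_convergence_SUP)
  qed
  show ?case unfolding *[OF w1] *[OF w2] by (rule SUP_mono) (use seq(5) in blast)
qed

text \<open>Multiplying the conditional form through by \<open>prob A\<close> admits null events.
  \<open>\<phi>\<close> is any positive bound and not the coefficient itself, because a negative
  power of it is taken below.\<close>

locale mixing_algebras = prob_space +
  fixes F G :: "'a measure" and \<phi> :: real
  assumes sub_F: "subalgebra M F" and sub_G: "subalgebra M G" and \<phi>_pos: "\<phi> > 0"
    and mix: "\<And>A B. A \<in> sets F \<Longrightarrow> B \<in> sets G \<Longrightarrow> \<bar>prob (A \<inter> B) - prob A * prob B\<bar> \<le> \<phi> * prob A"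
begin

lemma measurable_F: "f \<in> measurable F N \<Longrightarrow> f \<in> measurable M N"
  using sub_F measurable_from_subalg by blast

lemma measurable_G: "f \<in> measurable G N \<Longrightarrow> f \<in> measurable M N"
  using sub_G measurable_from_subalg by blast

text \<open>The mixing error is proportional to \<open>prob A\<close>, hence it integrates to
  \<open>\<phi>\<close> times the integral of an arbitrary past weight \<open>Y\<close>. The two
  directions are separate inequalities, since differences of possibly infinite integrals are
  avoided.\<close>

lemma nn_integral_mixing_event:
  fixes Y :: "'a \<Rightarrow> ennreal"
  assumes Y: "Y \<in> borel_measurable F" and B: "B \<in> sets G"
  shows "(\<integral>\<^sup>+ x. Y x * indicator B x \<partial>M) \<le> (ennreal (prob B) + ennreal \<phi>) * (\<integral>\<^sup>+ x. Y x \<partial>M)"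
    and "ennreal (prob B) * (\<integral>\<^sup>+ x. Y x \<partial>M) \<le> (\<integral>\<^sup>+ x. Y x * indicator B x \<partial>M) + ennreal \<phi> * (\<integral>\<^sup>+ x. Y x \<partial>M)"
proof -
  have [measurable]: "Y \<in> borel_measurable M" using Y by (rule measurable_F)
  have [measurable]: "B \<in> sets M" using B sub_G by (auto simp: subalgebra_def)
  have FM: "A \<in> sets M" if "A \<in> sets F" for A using that sub_F by (auto simp: subalgebra_def)
  have ind: "(\<integral>\<^sup>+ x. indicator A x * indicator B x \<partial>M) = ennreal (prob (A \<inter> B))" if "A \<in> sets F" for A
  proof -
    have "(\<integral>\<^sup>+ x. indicator A x * indicator B x \<partial>M) = (\<integral>\<^sup>+ x. indicator (A \<inter> B) x \<partial>M)"
      by (intro nn_integral_cong) (simp split: split_indicator)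
    then show ?thesis using FM[OF that] by (simp add: emeasure_eq_measure)
  qed
  have "(\<integral>\<^sup>+ x. Y x * indicator B x \<partial>M) \<le> (\<integral>\<^sup>+ x. Y x * (ennreal (prob B) + ennreal \<phi>) \<partial>M)"
  proof (rule nn_integral_subalgebra_mono[OF sub_F _ _ _ Y])
    fix A assume A: "A \<in> sets F"
    have "(\<integral>\<^sup>+ x. indicator A x * (ennreal (prob B) + ennreal \<phi>) \<partial>M) = ennreal (prob A * (prob B + \<phi>))"
      using FM[OF A] \<phi>_pos by (simp add: nn_integral_multc emeasure_eq_measure ennreal_mult)
    moreover have "prob (A \<inter> B) \<le> prob A * (prob B + \<phi>)"
      using mix[OF A B] by (simp add: algebra_simps abs_le_iff)
    ultimately show "(\<integral>\<^sup>+ x. indicator A x * indicator B x \<partial>M) \<le> (\<integral>\<^sup>+ x. indicator A x * (ennreal (prob B) + ennreal \<phi>) \<partial>M)"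
      by (simp add: ind[OF A] ennreal_leI)
  qed auto
  then show "(\<integral>\<^sup>+ x. Y x * indicator B x \<partial>M) \<le> (ennreal (prob B) + ennreal \<phi>) * (\<integral>\<^sup>+ x. Y x \<partial>M)"
    by (simp add: nn_integral_multc mult.commute)
  have "(\<integral>\<^sup>+ x. Y x * ennreal (prob B) \<partial>M) \<le> (\<integral>\<^sup>+ x. Y x * (indicator B x + ennreal \<phi>) \<partial>M)"
  proof (rule nn_integral_subalgebra_mono[OF sub_F _ _ _ Y])
    fix A assume A: "A \<in> sets F"
    have "(\<integral>\<^sup>+ x. indicator A x * (indicator B x + ennreal \<phi>) \<partial>M) = ennreal (prob (A \<inter> B) + prob A * \<phi>)"
      using FM[OF A] \<phi>_pos
      by (simp add: distrib_left nn_integral_add nn_integral_multc emeasure_eq_measure ennreal_mult ind[OF A])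
    moreover have "prob A * prob B \<le> prob (A \<inter> B) + prob A * \<phi>"
      using mix[OF A B] by (simp add: algebra_simps abs_le_iff)
    moreover have "(\<integral>\<^sup>+ x. indicator A x * ennreal (prob B) \<partial>M) = ennreal (prob A * prob B)"
      using FM[OF A] by (simp add: nn_integral_multc emeasure_eq_measure ennreal_mult)
    ultimately show "(\<integral>\<^sup>+ x. indicator A x * ennreal (prob B) \<partial>M) \<le> (\<integral>\<^sup>+ x. indicator A x * (indicator B x + ennreal \<phi>) \<partial>M)"
      by (simp add: ennreal_leI)
  qed auto
  then show "ennreal (prob B) * (\<integral>\<^sup>+ x. Y x \<partial>M) \<le> (\<integral>\<^sup>+ x. Y x * indicator B x \<partial>M) + ennreal \<phi> * (\<integral>\<^sup>+ x. Y x \<partial>M)"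
    by (simp add: distrib_left nn_integral_add nn_integral_multc nn_integral_cmult mult.commute)
qed

text \<open>Large values of \<open>Y\<close> are handled by mixing, small ones by the trivial bound \<open>y\<close>.\<close>

lemma nn_integral_mixing_split:
  fixes Y :: "'a \<Rightarrow> real"
  assumes Y: "Y \<in> borel_measurable F" and B: "B \<in> sets G" and Y0: "\<And>x. 0 \<le> Y x" and y: "0 \<le> y"
  defines "e \<equiv> ennreal \<phi> * (\<integral>\<^sup>+ x. ennreal (Y x) * indicator {y<..} (Y x) \<partial>M) + ennreal y * ennreal (prob B)"
  shows "(\<integral>\<^sup>+ x. ennreal (Y x) * indicator B x \<partial>M) \<le> ennreal (prob B) * (\<integral>\<^sup>+ x. ennreal (Y x) \<partial>M) + e"
    and "ennreal (prob B) * (\<integral>\<^sup>+ x. ennreal (Y x) \<partial>M) \<le> (\<integral>\<^sup>+ x. ennreal (Y x) * indicator B x \<partial>M) + e"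
proof -
  have [measurable]: "Y \<in> borel_measurable M" using Y by (rule measurable_F)
  have [measurable]: "B \<in> sets M" using B sub_G by (auto simp: subalgebra_def)
  define Z where "Z x = ennreal (Y x) * indicator {y<..} (Y x)" for x
  define W where "W x = ennreal (Y x) * indicator {..y} (Y x)" for x
  have Z: "Z \<in> borel_measurable F" using Y unfolding Z_def by measurable
  have [measurable]: "Z \<in> borel_measurable M" "W \<in> borel_measurable M" unfolding Z_def W_def by measurable
  have YZW: "ennreal (Y x) = Z x + W x" for x by (simp add: Z_def W_def split: split_indicator)
  have Wy: "W x \<le> ennreal y" for x using y by (auto simp: W_def ennreal_leI split: split_indicator)
  have WB: "(\<integral>\<^sup>+ x. W x * indicator B x \<partial>M) \<le> ennreal y * ennreal (prob B)"
  proof -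
    have "(\<integral>\<^sup>+ x. W x * indicator B x \<partial>M) \<le> (\<integral>\<^sup>+ x. ennreal y * indicator B x \<partial>M)"
      by (intro nn_integral_mono mult_right_mono Wy) simp
    then show ?thesis by (simp add: nn_integral_cmult emeasure_eq_measure)
  qed
  have W1: "(\<integral>\<^sup>+ x. W x \<partial>M) \<le> ennreal y"
  proof -
    have "(\<integral>\<^sup>+ x. W x \<partial>M) \<le> (\<integral>\<^sup>+ x. ennreal y \<partial>M)" by (intro nn_integral_mono Wy)
    then show ?thesis by (simp add: emeasure_space_1)
  qed
  note ev = nn_integral_mixing_event[OF Z B]
  have int: "(\<integral>\<^sup>+ x. ennreal (Y x) \<partial>M) = (\<integral>\<^sup>+ x. Z x \<partial>M) + (\<integral>\<^sup>+ x. W x \<partial>M)"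
    unfolding YZW by (rule nn_integral_add) auto
  have intB: "(\<integral>\<^sup>+ x. ennreal (Y x) * indicator B x \<partial>M) = (\<integral>\<^sup>+ x. Z x * indicator B x \<partial>M) + (\<integral>\<^sup>+ x. W x * indicator B x \<partial>M)"
    unfolding YZW distrib_right by (rule nn_integral_add) auto
  have "(\<integral>\<^sup>+ x. ennreal (Y x) * indicator B x \<partial>M) \<le> (ennreal (prob B) + ennreal \<phi>) * (\<integral>\<^sup>+ x. Z x \<partial>M) + ennreal y * ennreal (prob B)"
    unfolding intB by (rule add_mono[OF ev(1) WB])
  also have "\<dots> \<le> ennreal (prob B) * (\<integral>\<^sup>+ x. ennreal (Y x) \<partial>M) + e"
  proof -
    have "ennreal (prob B) * (\<integral>\<^sup>+ x. Z x \<partial>M) \<le> ennreal (prob B) * (\<integral>\<^sup>+ x. ennreal (Y x) \<partial>M)"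
      unfolding int by (intro mult_left_mono) auto
    then show ?thesis unfolding e_def Z_def[symmetric] distrib_right by (simp add: add.assoc add_right_mono)
  qed
  finally show "(\<integral>\<^sup>+ x. ennreal (Y x) * indicator B x \<partial>M) \<le> ennreal (prob B) * (\<integral>\<^sup>+ x. ennreal (Y x) \<partial>M) + e" .
  have "ennreal (prob B) * (\<integral>\<^sup>+ x. ennreal (Y x) \<partial>M) \<le>
      ((\<integral>\<^sup>+ x. Z x * indicator B x \<partial>M) + ennreal \<phi> * (\<integral>\<^sup>+ x. Z x \<partial>M)) + ennreal (prob B) * ennreal y"
    unfolding int distrib_left by (intro add_mono ev(2) mult_left_mono W1) auto
  also have "\<dots> = (\<integral>\<^sup>+ x. Z x * indicator B x \<partial>M) + e"
    unfolding e_def Z_def[symmetric] by (simp add: add.assoc mult.commute)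
  also have "\<dots> \<le> (\<integral>\<^sup>+ x. ennreal (Y x) * indicator B x \<partial>M) + e"
    unfolding intB by (intro add_right_mono) auto
  finally show "ennreal (prob B) * (\<integral>\<^sup>+ x. ennreal (Y x) \<partial>M) \<le> (\<integral>\<^sup>+ x. ennreal (Y x) * indicator B x \<partial>M) + e" .
qed

text \<open>Reduces a covariance with \<open>X\<close> to its level sets, which are future events
  and thus within reach of the bounds for events.\<close>

lemma nn_integral_layer_cake:
  fixes Y X :: "'a \<Rightarrow> real"
  assumes [measurable]: "Y \<in> borel_measurable M" "X \<in> borel_measurable M" and X0: "\<And>x. 0 \<le> X x"
  shows "(\<integral>\<^sup>+ x. ennreal (Y x) * ennreal (X x) \<partial>M)
      = (\<integral>\<^sup>+ t. indicator {0<..} t * (\<integral>\<^sup>+ x. ennreal (Y x) * indicator {x \<in> space M. t < X x} x \<partial>M) \<partial>lborel)"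
proof -
  interpret L: pair_sigma_finite M "lborel :: real measure" ..
  have "(\<integral>\<^sup>+ x. ennreal (Y x) * ennreal (X x) \<partial>M)
      = (\<integral>\<^sup>+ x. (\<integral>\<^sup>+ t. ennreal (Y x) * indicator {0<..<X x} t \<partial>lborel) \<partial>M)"
    using X0 by (intro nn_integral_cong) (simp add: nn_integral_cmult)
  also have "\<dots> = (\<integral>\<^sup>+ t. (\<integral>\<^sup>+ x. ennreal (Y x) * indicator {0<..<X x} t \<partial>M) \<partial>lborel)"
  proof (rule L.Fubini'[symmetric])
    have "(\<lambda>p. ennreal (Y (fst p)) * indicator {q \<in> space (M \<Otimes>\<^sub>M lborel). 0 < snd q \<and> snd q < X (fst q)} p)
        \<in> borel_measurable (M \<Otimes>\<^sub>M lborel)"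
      by measurable
    then show "(\<lambda>(x, y). ennreal (Y x) * indicator {0<..<X x} y) \<in> borel_measurable (M \<Otimes>\<^sub>M lborel)"
      by (rule measurable_cong[THEN iffD1, rotated])
        (auto simp: space_pair_measure split: split_indicator)
  qed
  also have "\<dots> = (\<integral>\<^sup>+ t. indicator {0<..} t * (\<integral>\<^sup>+ x. ennreal (Y x) * indicator {x \<in> space M. t < X x} x \<partial>M) \<partial>lborel)"
  proof (intro nn_integral_cong)
    fix t :: real
    have "(\<integral>\<^sup>+ x. ennreal (Y x) * indicator {0<..<X x} t \<partial>M) =
      (\<integral>\<^sup>+ x. indicator {0<..} t * (ennreal (Y x) * indicator {x \<in> space M. t < X x} x) \<partial>M)"
      by (intro nn_integral_cong) (auto split: split_indicator)
    then show "(\<integral>\<^sup>+ x. ennreal (Y x) * indicator {0<..<X x} t \<partial>M) =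
      indicator {0<..} t * (\<integral>\<^sup>+ x. ennreal (Y x) * indicator {x \<in> space M. t < X x} x \<partial>M)"
      by (simp add: nn_integral_cmult)
  qed
  finally show ?thesis .
qed

end

lemma (in prob_space) borel_measurable_nn_integral_snd:
  assumes "f \<in> borel_measurable (M \<Otimes>\<^sub>M N)"
  shows "(\<lambda>t. \<integral>\<^sup>+ x. f (x, t) \<partial>M) \<in> borel_measurable N"
  using borel_measurable_nn_integral_fst[OF measurable_compose[OF measurable_pair_swap' assms]]
  by simp

context mixing_algebras
begin

text \<open>\<open>e t\<close> is the error of the split at level \<open>t\<close>, with a threshold
  growing like a power of \<open>t\<close>. The powers \<open>b - 1\<close> and \<open>a - 1\<close>
  are inverse to each other, so Fubini turns the two parts into multiples of the integrals of
  \<open>Y powr a\<close> and \<open>X powr b\<close>, exactly the moments at hand.\<close>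

lemma nn_integral_mixing_error:
  fixes Y X :: "'a \<Rightarrow> real" and a b lam :: real
  assumes Y: "Y \<in> borel_measurable F" and X: "X \<in> borel_measurable G"
    and Y0: "\<And>x. 0 \<le> Y x" and X0: "\<And>x. 0 \<le> X x"
    and ab: "a > 1" "b > 1" "1 / a + 1 / b = 1" and lam: "lam > 0"
  defines "e \<equiv> \<lambda>t. ennreal \<phi> * (\<integral>\<^sup>+ x. ennreal (Y x) * indicator {(t / lam) powr (b - 1)<..} (Y x) \<partial>M)
      + ennreal ((t / lam) powr (b - 1)) * ennreal (prob {x \<in> space M. t < X x})"
  shows "(\<integral>\<^sup>+ t. indicator {0<..} t * e t \<partial>lborel)
     \<le> ennreal (\<phi> * lam) * (\<integral>\<^sup>+ x. ennreal (Y x powr a) \<partial>M) + ennreal (lam powr (1 - b)) * (\<integral>\<^sup>+ x. ennreal (X x powr b) \<partial>M)"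
proof -
  interpret L: pair_sigma_finite M "lborel :: real measure" ..
  have [measurable]: "Y \<in> borel_measurable M" "X \<in> borel_measurable M"
    using Y X measurable_F measurable_G by blast+
  define y where "y t = (t / lam) powr (b - 1)" for t
  have [measurable]: "y \<in> borel_measurable borel" unfolding y_def by measurable
  have ab1: "(b - 1) * (a - 1) = 1" using ab by (simp add: field_simps)
  define e1 where "e1 t = (\<integral>\<^sup>+ x. ennreal (Y x) * indicator {(x, t). 0 < t \<and> y t < Y x} (x, t) \<partial>M)" for t
  define e2 where "e2 t = (\<integral>\<^sup>+ x. ennreal (y t) * indicator {(x, t). 0 < t \<and> t < X x} (x, t) \<partial>M)" for t
  have m1 [measurable]: "(\<lambda>p. ennreal (Y (fst p)) * indicator {(x, t). 0 < t \<and> y t < Y x} p) \<in> borel_measurable (M \<Otimes>\<^sub>M lborel)"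
  proof -
    have "(\<lambda>p. ennreal (Y (fst p)) * indicator {q \<in> space (M \<Otimes>\<^sub>M lborel). 0 < snd q \<and> y (snd q) < Y (fst q)} p)
        \<in> borel_measurable (M \<Otimes>\<^sub>M lborel)"
      by measurable
    then show ?thesis
      by (rule measurable_cong[THEN iffD1, rotated]) (auto simp: space_pair_measure split: split_indicator)
  qed
  have m2 [measurable]: "(\<lambda>p. ennreal (y (snd p)) * indicator {(x, t). 0 < t \<and> t < X x} p) \<in> borel_measurable (M \<Otimes>\<^sub>M lborel)"
  proof -
    have "(\<lambda>p. ennreal (y (snd p)) * indicator {q \<in> space (M \<Otimes>\<^sub>M lborel). 0 < snd q \<and> snd q < X (fst q)} p)
        \<in> borel_measurable (M \<Otimes>\<^sub>M lborel)"
      by measurable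
    then show ?thesis
      by (rule measurable_cong[THEN iffD1, rotated]) (auto simp: space_pair_measure split: split_indicator)
  qed
  have f1: "(\<lambda>(x, t). ennreal (Y x) * indicator {(x, t). 0 < t \<and> y t < Y x} (x, t)) \<in> borel_measurable (M \<Otimes>\<^sub>M lborel)"
    using m1 by (simp add: case_prod_unfold)
  have f2: "(\<lambda>(x, t). ennreal (y t) * indicator {(x, t). 0 < t \<and> t < X x} (x, t)) \<in> borel_measurable (M \<Otimes>\<^sub>M lborel)"
    using m2 by (simp add: case_prod_unfold)
  have [measurable]: "e1 \<in> borel_measurable lborel" "e2 \<in> borel_measurable lborel"
  proof -
    have "(\<lambda>t. \<integral>\<^sup>+ x. (\<lambda>(x, t). ennreal (Y x) * indicator {(x, t). 0 < t \<and> y t < Y x} (x, t)) (x, t) \<partial>M) \<in> borel_measurable lborel"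
      by (rule borel_measurable_nn_integral_snd) (rule f1)
    then show "e1 \<in> borel_measurable lborel" unfolding e1_def by simp
    have "(\<lambda>t. \<integral>\<^sup>+ x. (\<lambda>(x, t). ennreal (y t) * indicator {(x, t). 0 < t \<and> t < X x} (x, t)) (x, t) \<partial>M) \<in> borel_measurable lborel"
      by (rule borel_measurable_nn_integral_snd) (rule f2)
    then show "e2 \<in> borel_measurable lborel" unfolding e2_def by simp
  qed
  have e: "indicator {0<..} t * e t = ennreal \<phi> * e1 t + e2 t" for t
  proof (cases "t > 0")
    case True
    have "e1 t = (\<integral>\<^sup>+ x. ennreal (Y x) * indicator {y t<..} (Y x) \<partial>M)"
      unfolding e1_def using True by (intro nn_integral_cong) (auto split: split_indicator)
    moreover have "e2 t = ennreal (y t) * ennreal (prob {x \<in> space M. t < X x})"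
    proof -
      have "e2 t = (\<integral>\<^sup>+ x. ennreal (y t) * indicator {x \<in> space M. t < X x} x \<partial>M)"
        unfolding e2_def using True by (intro nn_integral_cong) (auto split: split_indicator)
      then show ?thesis by (simp add: nn_integral_cmult emeasure_eq_measure)
    qed
    ultimately show ?thesis using True by (simp add: e_def y_def)
  qed (simp add: e1_def e2_def)
  have I1: "(\<integral>\<^sup>+ t. e1 t \<partial>lborel) \<le> ennreal lam * (\<integral>\<^sup>+ x. ennreal (Y x powr a) \<partial>M)"
  proof -
    have "(\<integral>\<^sup>+ t. e1 t \<partial>lborel) = (\<integral>\<^sup>+ x. (\<integral>\<^sup>+ t. ennreal (Y x) * indicator {(x, t). 0 < t \<and> y t < Y x} (x, t) \<partial>lborel) \<partial>M)"
      unfolding e1_def by (rule L.Fubini'[OF f1])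
    also have "\<dots> \<le> (\<integral>\<^sup>+ x. ennreal lam * ennreal (Y x powr a) \<partial>M)"
    proof (rule nn_integral_mono)
      fix x
      \<comment> \<open>The condition \<open>y t < Y x\<close> is solved for \<open>t\<close>: it
        confines \<open>t\<close> to an interval whose length, times \<open>Y x\<close>, is a
        multiple of \<open>Y x powr a\<close>.\<close>
      have sub: "t < lam * Y x powr (a - 1)" if "0 < t" "y t < Y x" for t
      proof -
        have "((t / lam) powr (b - 1)) powr (a - 1) < Y x powr (a - 1)"
          using that ab by (intro powr_less_mono2) (auto simp: y_def)
        then have "t / lam < Y x powr (a - 1)"
          using that lam by (simp add: powr_powr ab1)
        then show ?thesis using lam by (simp add: field_simps)
      qed
      have "(\<integral>\<^sup>+ t. ennreal (Y x) * indicator {(x, t). 0 < t \<and> y t < Y x} (x, t) \<partial>lborel)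
         \<le> (\<integral>\<^sup>+ t. ennreal (Y x) * indicator {0<..<lam * Y x powr (a - 1)} t \<partial>lborel)"
        by (intro nn_integral_mono mult_left_mono) (use sub in \<open>auto split: split_indicator\<close>)
      also have "\<dots> = ennreal (Y x) * ennreal (lam * Y x powr (a - 1))"
        using lam by (simp add: nn_integral_cmult)
      also have "\<dots> = ennreal (Y x * (lam * Y x powr (a - 1)))"
        by (rule ennreal_mult[symmetric]) (use Y0 lam in auto)
      also have "Y x * (lam * Y x powr (a - 1)) = lam * Y x powr a"
        using Y0[of x] by (cases "Y x = 0") (auto simp: powr_diff)
      also have "ennreal (lam * Y x powr a) = ennreal lam * ennreal (Y x powr a)"
        by (rule ennreal_mult) (use lam in auto)
      finally show "(\<integral>\<^sup>+ t. ennreal (Y x) * indicator {(x, t). 0 < t \<and> y t < Y x} (x, t) \<partial>lborel) \<le> ennreal lam * ennreal (Y x powr a)" .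
    qed
    also have "\<dots> = ennreal lam * (\<integral>\<^sup>+ x. ennreal (Y x powr a) \<partial>M)"
      by (simp add: nn_integral_cmult)
    finally show ?thesis .
  qed
  have I2: "(\<integral>\<^sup>+ t. e2 t \<partial>lborel) \<le> ennreal (lam powr (1 - b)) * (\<integral>\<^sup>+ x. ennreal (X x powr b) \<partial>M)"
  proof -
    have "(\<integral>\<^sup>+ t. e2 t \<partial>lborel) = (\<integral>\<^sup>+ x. (\<integral>\<^sup>+ t. ennreal (y t) * indicator {(x, t). 0 < t \<and> t < X x} (x, t) \<partial>lborel) \<partial>M)"
      unfolding e2_def by (rule L.Fubini'[OF f2])
    also have "\<dots> \<le> (\<integral>\<^sup>+ x. ennreal (lam powr (1 - b)) * ennreal (X x powr b) \<partial>M)"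
    proof (rule nn_integral_mono)
      fix x
      have "(\<integral>\<^sup>+ t. ennreal (y t) * indicator {(x, t). 0 < t \<and> t < X x} (x, t) \<partial>lborel)
         \<le> (\<integral>\<^sup>+ t. ennreal (y (X x)) * indicator {0<..<X x} t \<partial>lborel)"
      proof (intro nn_integral_mono)
        fix t
        have "y t \<le> y (X x)" if "0 < t" "t < X x"
          unfolding y_def using that ab lam by (intro powr_mono2) (auto simp: divide_right_mono)
        then show "ennreal (y t) * indicator {(x, t). 0 < t \<and> t < X x} (x, t) \<le> ennreal (y (X x)) * indicator {0<..<X x} t"
          by (auto split: split_indicator intro: ennreal_leI)
      qed
      also have "\<dots> = ennreal (y (X x)) * ennreal (X x)"
        using X0 by (simp add: nn_integral_cmult)
      also have "\<dots> = ennreal (y (X x) * X x)"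
        by (rule ennreal_mult[symmetric]) (use X0 in \<open>auto simp: y_def\<close>)
      also have "y (X x) * X x = lam powr (1 - b) * X x powr b"
        using X0[of x] lam by (cases "X x = 0") (auto simp: y_def powr_diff powr_divide)
      also have "ennreal (lam powr (1 - b) * X x powr b) = ennreal (lam powr (1 - b)) * ennreal (X x powr b)"
        by (rule ennreal_mult) auto
      finally show "(\<integral>\<^sup>+ t. ennreal (y t) * indicator {(x, t). 0 < t \<and> t < X x} (x, t) \<partial>lborel) \<le> ennreal (lam powr (1 - b)) * ennreal (X x powr b)" .
    qed
    also have "\<dots> = ennreal (lam powr (1 - b)) * (\<integral>\<^sup>+ x. ennreal (X x powr b) \<partial>M)"
      by (simp add: nn_integral_cmult)
    finally show ?thesis .
  qed
  have "(\<integral>\<^sup>+ t. indicator {0<..} t * e t \<partial>lborel) = ennreal \<phi> * (\<integral>\<^sup>+ t. e1 t \<partial>lborel) + (\<integral>\<^sup>+ t. e2 t \<partial>lborel)"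
    unfolding e by (simp add: nn_integral_add nn_integral_cmult)
  also have "\<dots> \<le> ennreal \<phi> * (ennreal lam * (\<integral>\<^sup>+ x. ennreal (Y x powr a) \<partial>M)) + ennreal (lam powr (1 - b)) * (\<integral>\<^sup>+ x. ennreal (X x powr b) \<partial>M)"
    by (intro add_mono mult_left_mono I1 I2) auto
  also have "ennreal \<phi> * (ennreal lam * (\<integral>\<^sup>+ x. ennreal (Y x powr a) \<partial>M)) = ennreal (\<phi> * lam) * (\<integral>\<^sup>+ x. ennreal (Y x powr a) \<partial>M)"
    using \<phi>_pos lam by (simp add: ennreal_mult mult.assoc)
  finally show ?thesis .
qed

text \<open>The event bounds are integrated over the level sets of \<open>X\<close>. The power of
  \<open>\<phi>\<close> is the reciprocal of the exponent \<open>a\<close> of the past variable, so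
  a larger exponent there weakens the gain from mixing. Working with nonnegative extended integrals
  defers all integrability questions.\<close>

lemma mixing_covariance_nonneg:
  fixes Y X :: "'a \<Rightarrow> real" and a b U V :: real
  assumes Y: "Y \<in> borel_measurable F" and X: "X \<in> borel_measurable G"
    and Y0: "\<And>x. 0 \<le> Y x" and X0: "\<And>x. 0 \<le> X x"
    and ab: "a > 1" "b > 1" "1 / a + 1 / b = 1" and UV: "V > 0" "U > 0"
    and YV: "(\<integral>\<^sup>+ x. ennreal (Y x powr a) \<partial>M) \<le> ennreal (V powr a)"
    and XU: "(\<integral>\<^sup>+ x. ennreal (X x powr b) \<partial>M) \<le> ennreal (U powr b)"
  defines "R \<equiv> ennreal (2 * \<phi> powr (1 / a) * V * U)"
  shows "(\<integral>\<^sup>+ x. ennreal (Y x) * ennreal (X x) \<partial>M) \<le> (\<integral>\<^sup>+ x. ennreal (X x) \<partial>M) * (\<integral>\<^sup>+ x. ennreal (Y x) \<partial>M) + R"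
    and "(\<integral>\<^sup>+ x. ennreal (X x) \<partial>M) * (\<integral>\<^sup>+ x. ennreal (Y x) \<partial>M) \<le> (\<integral>\<^sup>+ x. ennreal (Y x) * ennreal (X x) \<partial>M) + R"
proof -
  have [measurable]: "Y \<in> borel_measurable M" "X \<in> borel_measurable M"
    using Y X measurable_F measurable_G by blast+
  have b: "b = a / (a - 1)" using ab by (simp add: field_simps)
  \<comment> \<open>The value at which the two error terms coincide; \<open>q1\<close> and
    \<open>q2\<close> show that both become \<open>\<phi> powr (1 / a) * V * U\<close>.\<close>
  define lam where "lam = \<phi> powr (- 1 / b) * U * V powr (1 - a)"
  have lam: "lam > 0" using \<phi>_pos UV by (simp add: lam_def)
  have q1: "\<phi> * lam * V powr a = \<phi> powr (1 / a) * V * U"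
  proof -
    have "\<phi> * \<phi> powr (- 1 / b) = \<phi> powr (1 / a)"
      using powr_add[of \<phi> 1 "- 1 / b"] \<phi>_pos ab(3) by (simp flip: eq_diff_eq)
    moreover have "V powr (1 - a) * V powr a = V"
      using powr_add[of V "1 - a" a] UV by simp
    ultimately show ?thesis unfolding lam_def by (metis mult.assoc mult.commute)
  qed
  have q2: "lam powr (1 - b) * U powr b = \<phi> powr (1 / a) * V * U"
  proof -
    have "- 1 / b * (1 - b) = 1 / a" using ab by (simp add: b field_simps)
    moreover have "(1 - a) * (1 - b) = 1" using ab by (simp add: b field_simps)
    moreover have "U powr (1 - b) * U powr b = U" using powr_add[of U "1 - b" b] UV by simp
    ultimately show ?thesis
      using \<phi>_pos UV by (simp add: lam_def powr_mult powr_powr)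
  qed
  define y where "y t = (t / lam) powr (b - 1)" for t
  define B where "B t = {x \<in> space M. t < X x}" for t
  have B [measurable]: "B t \<in> sets G" "B t \<in> sets M" for t
  proof -
    have "{x \<in> space G. t < X x} \<in> sets G" using X by measurable
    then show "B t \<in> sets G" "B t \<in> sets M" using sub_G by (auto simp: B_def subalgebra_def)
  qed
  define e where "e t = ennreal \<phi> * (\<integral>\<^sup>+ x. ennreal (Y x) * indicator {y t<..} (Y x) \<partial>M)
      + ennreal (y t) * ennreal (prob (B t))" for t
  have E: "(\<integral>\<^sup>+ t. indicator {0<..} t * e t \<partial>lborel) \<le> R"
  proof -
    have "(\<integral>\<^sup>+ t. indicator {0<..} t * e t \<partial>lborel)
      \<le> ennreal (\<phi> * lam) * (\<integral>\<^sup>+ x. ennreal (Y x powr a) \<partial>M) + ennreal (lam powr (1 - b)) * (\<integral>\<^sup>+ x. ennreal (X x powr b) \<partial>M)"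
      unfolding e_def y_def B_def by (rule nn_integral_mixing_error[OF Y X Y0 X0 ab lam])
    also have "\<dots> \<le> ennreal (\<phi> * lam) * ennreal (V powr a) + ennreal (lam powr (1 - b)) * ennreal (U powr b)"
      by (intro add_mono mult_left_mono YV XU) auto
    also have "\<dots> = ennreal (\<phi> * lam * V powr a + lam powr (1 - b) * U powr b)"
      using \<phi>_pos lam by (simp add: ennreal_mult)
    also have "\<dots> = R" unfolding q1 q2 R_def by (simp add: ac_simps)
    finally show ?thesis .
  qed
  interpret L: pair_sigma_finite M "lborel :: real measure" ..
  have mB [measurable]: "(\<lambda>p. indicator (B (snd p)) (fst p) :: ennreal) \<in> borel_measurable (M \<Otimes>\<^sub>M lborel)"
  proof -
    have "indicator {q \<in> space (M \<Otimes>\<^sub>M lborel). snd q < X (fst q)} \<in> borel_measurable (M \<Otimes>\<^sub>M lborel)"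
      by measurable
    then show ?thesis
      by (rule measurable_cong[THEN iffD1, rotated]) (auto simp: space_pair_measure B_def split: split_indicator)
  qed
  have mP [measurable]: "(\<lambda>t. ennreal (prob (B t))) \<in> borel_measurable lborel"
  proof -
    have "(\<lambda>t. \<integral>\<^sup>+ x. (\<lambda>p. indicator (B (snd p)) (fst p)) (x, t) \<partial>M) \<in> borel_measurable lborel"
      by (rule borel_measurable_nn_integral_snd) (rule mB)
    then show ?thesis by (simp add: emeasure_eq_measure)
  qed
  have mYB: "(\<lambda>t. \<integral>\<^sup>+ x. ennreal (Y x) * indicator (B t) x \<partial>M) \<in> borel_measurable lborel"
  proof -
    have "(\<lambda>t. \<integral>\<^sup>+ x. (\<lambda>p. ennreal (Y (fst p)) * indicator (B (snd p)) (fst p)) (x, t) \<partial>M) \<in> borel_measurable lborel"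
      by (rule borel_measurable_nn_integral_snd) measurable
    then show ?thesis by simp
  qed
  have me: "e \<in> borel_measurable lborel"
  proof -
    have "(\<lambda>p. ennreal (Y (fst p)) * indicator {q \<in> space (M \<Otimes>\<^sub>M lborel). y (snd q) < Y (fst q)} p)
        \<in> borel_measurable (M \<Otimes>\<^sub>M lborel)"
      unfolding y_def by measurable
    then have "(\<lambda>p. ennreal (Y (fst p)) * indicator {y (snd p)<..} (Y (fst p))) \<in> borel_measurable (M \<Otimes>\<^sub>M lborel)"
      by (rule measurable_cong[THEN iffD1, rotated]) (auto simp: space_pair_measure split: split_indicator)
    then have "(\<lambda>t. \<integral>\<^sup>+ x. (\<lambda>p. ennreal (Y (fst p)) * indicator {y (snd p)<..} (Y (fst p))) (x, t) \<partial>M) \<in> borel_measurable lborel"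
      by (rule borel_measurable_nn_integral_snd)
    then have "(\<lambda>t. \<integral>\<^sup>+ x. ennreal (Y x) * indicator {y t<..} (Y x) \<partial>M) \<in> borel_measurable lborel"
      by simp
    moreover have "(\<lambda>t. ennreal (y t)) \<in> borel_measurable lborel" unfolding y_def by measurable
    ultimately show ?thesis unfolding e_def by measurable
  qed
  have YX: "(\<integral>\<^sup>+ x. ennreal (Y x) * ennreal (X x) \<partial>M)
      = (\<integral>\<^sup>+ t. indicator {0<..} t * (\<integral>\<^sup>+ x. ennreal (Y x) * indicator (B t) x \<partial>M) \<partial>lborel)"
    unfolding B_def by (rule nn_integral_layer_cake) (use X0 in auto)
  have X1: "(\<integral>\<^sup>+ x. ennreal (X x) \<partial>M) = (\<integral>\<^sup>+ t. indicator {0<..} t * ennreal (prob (B t)) \<partial>lborel)"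
    using nn_integral_layer_cake[of "\<lambda>_. 1" X] X0 unfolding B_def[symmetric]
    by (simp add: emeasure_eq_measure)
  define EY where "EY = (\<integral>\<^sup>+ x. ennreal (Y x) \<partial>M)"
  have X2: "(\<integral>\<^sup>+ x. ennreal (X x) \<partial>M) * EY = (\<integral>\<^sup>+ t. indicator {0<..} t * (ennreal (prob (B t)) * EY) \<partial>lborel)"
    unfolding X1 using mP by (subst nn_integral_multc[symmetric]) (auto simp: mult.assoc)
  have split: "(\<integral>\<^sup>+ x. ennreal (Y x) * indicator (B t) x \<partial>M) \<le> ennreal (prob (B t)) * EY + e t"
     "ennreal (prob (B t)) * EY \<le> (\<integral>\<^sup>+ x. ennreal (Y x) * indicator (B t) x \<partial>M) + e t" for t
    unfolding e_def EY_def by (intro nn_integral_mixing_split Y B Y0; simp add: y_def)+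
  have "(\<integral>\<^sup>+ x. ennreal (Y x) * ennreal (X x) \<partial>M)
    \<le> (\<integral>\<^sup>+ t. indicator {0<..} t * (ennreal (prob (B t)) * EY) + indicator {0<..} t * e t \<partial>lborel)"
    unfolding YX distrib_left[symmetric] by (intro nn_integral_mono mult_left_mono split) auto
  also have "\<dots> = (\<integral>\<^sup>+ x. ennreal (X x) \<partial>M) * EY + (\<integral>\<^sup>+ t. indicator {0<..} t * e t \<partial>lborel)"
    unfolding X2 using mP me by (intro nn_integral_add) auto
  also have "\<dots> \<le> (\<integral>\<^sup>+ x. ennreal (X x) \<partial>M) * EY + R" by (intro add_left_mono E)
  finally show "(\<integral>\<^sup>+ x. ennreal (Y x) * ennreal (X x) \<partial>M) \<le> (\<integral>\<^sup>+ x. ennreal (X x) \<partial>M) * (\<integral>\<^sup>+ x. ennreal (Y x) \<partial>M) + R"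
    by (simp add: EY_def)
  have "(\<integral>\<^sup>+ x. ennreal (X x) \<partial>M) * EY
    \<le> (\<integral>\<^sup>+ t. indicator {0<..} t * (\<integral>\<^sup>+ x. ennreal (Y x) * indicator (B t) x \<partial>M) + indicator {0<..} t * e t \<partial>lborel)"
    unfolding X2 distrib_left[symmetric] by (intro nn_integral_mono mult_left_mono split) auto
  also have "\<dots> = (\<integral>\<^sup>+ x. ennreal (Y x) * ennreal (X x) \<partial>M) + (\<integral>\<^sup>+ t. indicator {0<..} t * e t \<partial>lborel)"
    unfolding YX using mYB me by (intro nn_integral_add) auto
  also have "\<dots> \<le> (\<integral>\<^sup>+ x. ennreal (Y x) * ennreal (X x) \<partial>M) + R" by (intro add_left_mono E)
  finally show "(\<integral>\<^sup>+ x. ennreal (X x) \<partial>M) * (\<integral>\<^sup>+ x. ennreal (Y x) \<partial>M) \<le> (\<integral>\<^sup>+ x. ennreal (Y x) * ennreal (X x) \<partial>M) + R"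
    by (simp add: EY_def)
qed

end

text \<open>Comparing \<open>u\<close> with \<open>v powr (b - 1)\<close> decides which of the two
  powers dominates the product. The sharp weights of Young's inequality are dropped, as only
  integrability of products is drawn from it.\<close>

lemma Young_powr_bound:
  fixes u v a b :: real
  assumes "0 \<le> u" "0 \<le> v" and ab: "a > 1" "b > 1" "1 / a + 1 / b = 1"
  shows "u * v \<le> u powr a + v powr b"
proof (cases "u = 0 \<or> v = 0")
  case False
  then have uv: "u > 0" "v > 0" using assms by auto
  have ba: "(b - 1) * (a - 1) = 1" using ab by (simp add: field_simps)
  show ?thesis
  proof (cases "u \<le> v powr (b - 1)")
    case True
    then have "u * v \<le> v powr (b - 1) * v" using uv by (intro mult_right_mono) auto
    also have "\<dots> = v powr b" using uv by (simp add: powr_diff)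
    finally show ?thesis using powr_ge_zero[of u a] by linarith
  next
    case False
    then have "(v powr (b - 1)) powr (a - 1) \<le> u powr (a - 1)"
      using ab by (intro powr_mono2) auto
    then have "v \<le> u powr (a - 1)" using uv by (simp add: powr_powr ba)
    then have "u * v \<le> u * u powr (a - 1)" using uv by (intro mult_left_mono) auto
    also have "\<dots> = u powr a" using uv by (simp add: powr_diff)
    finally show ?thesis using powr_ge_zero[of v b] by linarith
  qed
qed (use assms in auto)

lemma abs_le_1_plus_powr:
  fixes x p :: real
  assumes "p \<ge> 1"
  shows "\<bar>x\<bar> \<le> 1 + \<bar>x\<bar> powr p"
proof (cases "\<bar>x\<bar> \<le> 1")
  case False
  then have "\<bar>x\<bar> powr 1 \<le> \<bar>x\<bar> powr p" using assms by (intro powr_mono) auto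
  then show ?thesis using False by simp
qed (simp add: add_increasing2)

lemma (in prob_space) integrable_of_powr_integrable:
  fixes f :: "'a \<Rightarrow> real"
  assumes [measurable]: "f \<in> borel_measurable M" and "integrable M (\<lambda>x. \<bar>f x\<bar> powr p)" "p \<ge> 1"
  shows "integrable M f"
  by (rule Bochner_Integration.integrable_bound[of _ "\<lambda>x. 1 + \<bar>f x\<bar> powr p"])
    (use assms abs_le_1_plus_powr in \<open>auto intro!: AE_I2 order_trans[OF abs_le_1_plus_powr]\<close>)

lemma (in prob_space) integrable_mult_of_powr:
  fixes f h :: "'a \<Rightarrow> real"
  assumes [measurable]: "f \<in> borel_measurable M" "h \<in> borel_measurable M"
    and "integrable M (\<lambda>x. \<bar>f x\<bar> powr a)" "integrable M (\<lambda>x. \<bar>h x\<bar> powr b)"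
    and "a > 1" "b > 1" "1 / a + 1 / b = 1"
  shows "integrable M (\<lambda>x. f x * h x)"
proof (rule Bochner_Integration.integrable_bound[of _ "\<lambda>x. \<bar>f x\<bar> powr a + \<bar>h x\<bar> powr b"])
  show "AE x in M. norm (f x * h x) \<le> norm (\<bar>f x\<bar> powr a + \<bar>h x\<bar> powr b)"
    using Young_powr_bound[OF _ _ assms(5-7)] by (intro AE_I2) (auto simp: abs_mult)
qed (use assms in auto)

context mixing_algebras
begin

lemma mixing_covariance_nonneg_real:
  fixes Y X :: "'a \<Rightarrow> real" and a b U V :: real
  assumes Y: "Y \<in> borel_measurable F" and X: "X \<in> borel_measurable G"
    and Y0: "\<And>x. 0 \<le> Y x" and X0: "\<And>x. 0 \<le> X x"
    and ab: "a > 1" "b > 1" "1 / a + 1 / b = 1" and UV: "V > 0" "U > 0"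
    and Yi: "integrable M (\<lambda>x. Y x powr a)" and YV: "expectation (\<lambda>x. Y x powr a) \<le> V powr a"
    and Xi: "integrable M (\<lambda>x. X x powr b)" and XU: "expectation (\<lambda>x. X x powr b) \<le> U powr b"
  shows "\<bar>expectation (\<lambda>x. Y x * X x) - expectation Y * expectation X\<bar> \<le> 2 * \<phi> powr (1 / a) * V * U"
proof -
  have [measurable]: "Y \<in> borel_measurable M" "X \<in> borel_measurable M"
    using Y X measurable_F measurable_G by blast+
  have Yi': "integrable M (\<lambda>x. \<bar>Y x\<bar> powr a)" and Xi': "integrable M (\<lambda>x. \<bar>X x\<bar> powr b)"
    using Yi Xi Y0 X0 by simp_all
  have iY: "integrable M Y" by (rule integrable_of_powr_integrable[of _ a]) (use ab Yi' in auto)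
  have iX: "integrable M X" by (rule integrable_of_powr_integrable[of _ b]) (use ab Xi' in auto)
  have iYX: "integrable M (\<lambda>x. Y x * X x)"
    by (rule integrable_mult_of_powr[of _ _ a b]) (use ab Yi' Xi' in auto)
  define R where "R = 2 * \<phi> powr (1 / a) * V * U"
  have R: "R \<ge> 0" using UV by (simp add: R_def)
  have eYX: "(\<integral>\<^sup>+ x. ennreal (Y x) * ennreal (X x) \<partial>M) = ennreal (expectation (\<lambda>x. Y x * X x))"
    using nn_integral_eq_integral[OF iYX] Y0 X0 by (simp add: ennreal_mult)
  have eY: "(\<integral>\<^sup>+ x. ennreal (Y x) \<partial>M) = ennreal (expectation Y)"
    using nn_integral_eq_integral[OF iY] Y0 by simp
  have eX: "(\<integral>\<^sup>+ x. ennreal (X x) \<partial>M) = ennreal (expectation X)"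
    using nn_integral_eq_integral[OF iX] X0 by simp
  have p: "(\<integral>\<^sup>+ x. ennreal (Y x powr a) \<partial>M) \<le> ennreal (V powr a)"
    "(\<integral>\<^sup>+ x. ennreal (X x powr b) \<partial>M) \<le> ennreal (U powr b)"
    using nn_integral_eq_integral[OF Yi] nn_integral_eq_integral[OF Xi] YV XU by (simp_all add: ennreal_leI)
  have pos: "expectation Y \<ge> 0" "expectation X \<ge> 0" "expectation (\<lambda>x. Y x * X x) \<ge> 0"
    using Y0 X0 by (auto intro!: integral_nonneg)
  note main = mixing_covariance_nonneg[OF Y X Y0 X0 ab UV p]
  have "ennreal (expectation (\<lambda>x. Y x * X x)) \<le> ennreal (expectation X * expectation Y + R)"
    using main(1) pos R by (simp add: eYX eY eX R_def[symmetric] ennreal_mult)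
  moreover have "ennreal (expectation X * expectation Y) \<le> ennreal (expectation (\<lambda>x. Y x * X x) + R)"
    using main(2) pos R by (simp add: eYX eY eX R_def[symmetric] ennreal_mult)
  ultimately have "expectation (\<lambda>x. Y x * X x) \<le> expectation X * expectation Y + R"
    "expectation X * expectation Y \<le> expectation (\<lambda>x. Y x * X x) + R"
    using pos R by (simp_all del: ennreal_plus)
  then show ?thesis by (simp add: R_def abs_le_iff mult.commute)
qed

text \<open>This is Ibragimov's covariance inequality up to the constant: positive and negative
  parts give four covariances, each bounded with the factor 2.\<close>

lemma mixing_covariance:
  fixes Y X :: "'a \<Rightarrow> real" and a b U V :: real
  assumes Y: "Y \<in> borel_measurable F" and X: "X \<in> borel_measurable G"
    and ab: "a > 1" "b > 1" "1 / a + 1 / b = 1" and UV: "V > 0" "U > 0"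
    and Yi: "integrable M (\<lambda>x. \<bar>Y x\<bar> powr a)" and YV: "expectation (\<lambda>x. \<bar>Y x\<bar> powr a) \<le> V powr a"
    and Xi: "integrable M (\<lambda>x. \<bar>X x\<bar> powr b)" and XU: "expectation (\<lambda>x. \<bar>X x\<bar> powr b) \<le> U powr b"
  shows "\<bar>expectation (\<lambda>x. Y x * X x) - expectation Y * expectation X\<bar> \<le> 8 * \<phi> powr (1 / a) * V * U"
proof -
  have Ym: "Y \<in> borel_measurable M" and Xm: "X \<in> borel_measurable M"
    using Y X measurable_F measurable_G by blast+
  define R where "R = 2 * \<phi> powr (1 / a) * V * U"
  define yp yn xp xn where "yp x = max 0 (Y x)" and "yn x = max 0 (- Y x)"
    and "xp x = max 0 (X x)" and "xn x = max 0 (- X x)" for x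
  have le: "yp x \<le> \<bar>Y x\<bar>" "yn x \<le> \<bar>Y x\<bar>" "xp x \<le> \<bar>X x\<bar>" "xn x \<le> \<bar>X x\<bar>"
     and ge: "yp x \<ge> 0" "yn x \<ge> 0" "xp x \<ge> 0" "xn x \<ge> 0" for x
    by (auto simp: yp_def yn_def xp_def xn_def)
  have meas: "yp \<in> borel_measurable F" "yn \<in> borel_measurable F" "xp \<in> borel_measurable G" "xn \<in> borel_measurable G"
    using Y X unfolding yp_def yn_def xp_def xn_def by measurable
  have part: "integrable M (\<lambda>x. z x powr s)" "expectation (\<lambda>x. z x powr s) \<le> W powr s"
    if "z \<in> borel_measurable M" "\<And>x. 0 \<le> z x" "\<And>x. z x \<le> \<bar>w x\<bar>"
      "integrable M (\<lambda>x. \<bar>w x\<bar> powr s)" "expectation (\<lambda>x. \<bar>w x\<bar> powr s) \<le> W powr s" "s > 1"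
    for z w :: "'a \<Rightarrow> real" and s W :: real
  proof -
    have le: "z x powr s \<le> \<bar>w x\<bar> powr s" for x using that(2,3)[of x] that(6) by (intro powr_mono2) auto
    show i: "integrable M (\<lambda>x. z x powr s)"
      by (rule Bochner_Integration.integrable_bound[OF that(4)])
        (use that(1) le in auto)
    have "expectation (\<lambda>x. z x powr s) \<le> expectation (\<lambda>x. \<bar>w x\<bar> powr s)"
      by (rule integral_mono[OF i that(4) le])
    then show "expectation (\<lambda>x. z x powr s) \<le> W powr s" using that by simp
  qed
  note mM = meas(1,2)[THEN measurable_F] meas(3,4)[THEN measurable_G]
  note P = part[OF mM(1) ge(1) le(1) Yi YV ab(1)] part[OF mM(2) ge(2) le(2) Yi YV ab(1)]
    part[OF mM(3) ge(3) le(3) Xi XU ab(2)] part[OF mM(4) ge(4) le(4) Xi XU ab(2)]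
  note C = mixing_covariance_nonneg_real[OF meas(1) meas(3) ge(1) ge(3) ab UV P(1,2) P(5,6)]
    mixing_covariance_nonneg_real[OF meas(1) meas(4) ge(1) ge(4) ab UV P(1,2) P(7,8)]
    mixing_covariance_nonneg_real[OF meas(2) meas(3) ge(2) ge(3) ab UV P(3,4) P(5,6)]
    mixing_covariance_nonneg_real[OF meas(2) meas(4) ge(2) ge(4) ab UV P(3,4) P(7,8)]
  have absi: "integrable M (\<lambda>x. \<bar>yp x\<bar> powr a)" "integrable M (\<lambda>x. \<bar>yn x\<bar> powr a)"
    "integrable M (\<lambda>x. \<bar>xp x\<bar> powr b)" "integrable M (\<lambda>x. \<bar>xn x\<bar> powr b)"
    using P ge by simp_all
  have i: "integrable M yp" "integrable M yn" "integrable M xp" "integrable M xn"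
    using integrable_of_powr_integrable[OF mM(1) absi(1)] integrable_of_powr_integrable[OF mM(2) absi(2)]
      integrable_of_powr_integrable[OF mM(3) absi(3)] integrable_of_powr_integrable[OF mM(4) absi(4)] ab
    by simp_all
  have ii: "integrable M (\<lambda>x. yp x * xp x)" "integrable M (\<lambda>x. yp x * xn x)"
    "integrable M (\<lambda>x. yn x * xp x)" "integrable M (\<lambda>x. yn x * xn x)"
    using integrable_mult_of_powr[OF mM(1,3) absi(1,3) ab] integrable_mult_of_powr[OF mM(1,4) absi(1,4) ab]
     integrable_mult_of_powr[OF mM(2,3) absi(2,3) ab] integrable_mult_of_powr[OF mM(2,4) absi(2,4) ab]
    by simp_all
  have YX: "Y x = yp x - yn x" "X x = xp x - xn x" for x
    by (auto simp: yp_def yn_def xp_def xn_def)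
  have e: "expectation Y = expectation yp - expectation yn" "expectation X = expectation xp - expectation xn"
    using i by (simp_all add: YX[abs_def])
  have e': "expectation (\<lambda>x. Y x * X x) = expectation (\<lambda>x. yp x * xp x) - expectation (\<lambda>x. yp x * xn x)
      - (expectation (\<lambda>x. yn x * xp x) - expectation (\<lambda>x. yn x * xn x))"
    using ii by (simp add: YX left_diff_distrib right_diff_distrib)
  have "expectation (\<lambda>x. Y x * X x) - expectation Y * expectation X
     = (expectation (\<lambda>x. yp x * xp x) - expectation yp * expectation xp)
     - (expectation (\<lambda>x. yp x * xn x) - expectation yp * expectation xn)
     - (expectation (\<lambda>x. yn x * xp x) - expectation yn * expectation xp)
     + (expectation (\<lambda>x. yn x * xn x) - expectation yn * expectation xn)"
    unfolding e e' by (simp add: algebra_simps)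
  then have "\<bar>expectation (\<lambda>x. Y x * X x) - expectation Y * expectation X\<bar> \<le> R + R + R + R"
    using C unfolding R_def[symmetric] by linarith
  then show ?thesis by (simp add: R_def ac_simps)
qed

end

text \<open>The event family \<open>gen_events\<close> in the form of a measure space, so that
  measurability of functions with respect to it can be expressed.\<close>

definition gen_algebra :: "'a measure \<Rightarrow> (nat \<Rightarrow> 'a \<Rightarrow> real) \<Rightarrow> nat set \<Rightarrow> 'a measure" where
  "gen_algebra M X V = sigma (space M) (\<Union>a\<in>V. {X a -` S \<inter> space M | S. S \<in> sets borel})"

lemma space_gen_algebra [simp]: "space (gen_algebra M X V) = space M"
  unfolding gen_algebra_def by (rule space_measure_of) auto

lemma sets_gen_algebra: "sets (gen_algebra M X V) = gen_events M X V"
  unfolding gen_algebra_def gen_events_def by (rule sets_measure_of) auto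

lemma sets_gen_algebra_mono: "V \<subseteq> W \<Longrightarrow> sets (gen_algebra M X V) \<subseteq> sets (gen_algebra M X W)"
  unfolding sets_gen_algebra gen_events_def by (rule sigma_sets_mono') blast

lemma measurable_gen_algebra_mono:
  "f \<in> measurable (gen_algebra M X V) N \<Longrightarrow> V \<subseteq> W \<Longrightarrow> f \<in> measurable (gen_algebra M X W) N"
  using sets_gen_algebra_mono[of V W M X] by (auto simp: measurable_def)

lemma measurable_gen_algebra:
  assumes "a \<in> V"
  shows "X a \<in> borel_measurable (gen_algebra M X V)"
proof (rule measurableI)
  fix S :: "real set" assume "S \<in> sets borel"
  then show "X a -` S \<inter> space (gen_algebra M X V) \<in> sets (gen_algebra M X V)"
    unfolding sets_gen_algebra gen_events_def space_gen_algebra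
    using assms by (intro sigma_sets.Basic) auto
qed simp

lemma subalgebra_gen_algebra:
  assumes "\<And>k. X k \<in> borel_measurable M"
  shows "subalgebra M (gen_algebra M X V)"
proof -
  have "gen_events M X V \<subseteq> sets M"
    unfolding gen_events_def
    by (rule sets.sigma_sets_subset) (use assms in \<open>auto intro: measurable_sets\<close>)
  then show ?thesis by (simp add: subalgebra_def sets_gen_algebra)
qed

text \<open>Past and future are the index sets \<open>{..<n}\<close> and \<open>{n + g..}\<close>; so \<open>g\<close> is one less than the
  lag in the definition of the mixing coefficients, and an empty past is allowed.\<close>

locale mixing_sequence = prob_space M for M :: "'a measure" +
  fixes X :: "nat \<Rightarrow> 'a \<Rightarrow> real" and \<delta> \<theta> c\<^sub>\<phi> c\<^sub>X :: real
  assumes X_meas [measurable]: "\<And>k. X k \<in> borel_measurable M"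
    and \<delta>_pos: "\<delta> > 0" and \<theta>_pos: "\<theta> > 0" and c\<phi>_pos: "c\<^sub>\<phi> > 0" and cX_ge1: "c\<^sub>X \<ge> 1"
    and mixing: "\<And>n g l A B. A \<in> gen_events M X {..<n} \<Longrightarrow> B \<in> gen_events M X {n + g..n + g + l} \<Longrightarrow>
      \<bar>prob (A \<inter> B) - prob A * prob B\<bar> \<le> c\<^sub>\<phi> * (real g + 1) powr (- \<theta>) * prob A"
    and moment_int: "\<And>k. integrable M (\<lambda>\<omega>. \<bar>X k \<omega>\<bar> powr (2 + \<delta>))"
    and moment: "\<And>k. expectation (\<lambda>\<omega>. \<bar>X k \<omega>\<bar> powr (2 + \<delta>)) \<le> c\<^sub>X powr (2 + \<delta>)"
    and centered: "\<And>k. expectation (X k) = 0"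
    and stationary: "\<And>k j. expectation (\<lambda>\<omega>. X k \<omega> * X (k + j) \<omega>) = autocov M X j"
begin

abbreviation past :: "nat \<Rightarrow> 'a measure" where
  "past n \<equiv> gen_algebra M X {..<n}"

abbreviation phi_rate :: "nat \<Rightarrow> real" where
  "phi_rate g \<equiv> c\<^sub>\<phi> * (real g + 1) powr (- \<theta>)"

lemma past_subalgebra: "subalgebra M (past n)"
  by (rule subalgebra_gen_algebra) simp

lemma past_measurable: "f \<in> measurable (past n) N \<Longrightarrow> f \<in> measurable M N"
  using past_subalgebra measurable_from_subalg by blast

lemma past_mono: "f \<in> measurable (past n) N \<Longrightarrow> n \<le> m \<Longrightarrow> f \<in> measurable (past m) N"
  by (rule measurable_gen_algebra_mono) auto

lemma X_past: "k < n \<Longrightarrow> X k \<in> borel_measurable (past n)"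
  by (rule measurable_gen_algebra) simp

text \<open>Futures are finite windows, as in the definition of the coefficients; every future
  variable met below depends on finitely many indices.\<close>

lemma mixing_algebras_past:
  "mixing_algebras M (past n) (gen_algebra M X {n + g..n + g + l}) (phi_rate g)"
  by unfold_locales
    (use c\<phi>_pos in \<open>auto simp: sets_gen_algebra intro: mixing subalgebra_gen_algebra[OF X_meas] mult_pos_pos\<close>)

lemma X_int: "integrable M (X k)"
  by (rule integrable_of_powr_integrable[of _ "2 + \<delta>"]) (use moment_int \<delta>_pos in auto)

lemma past_covariance:
  fixes Y Z :: "'a \<Rightarrow> real" and a b U V :: real
  assumes "Y \<in> borel_measurable (past n)" and "Z \<in> borel_measurable (gen_algebra M X {n + g..n + g + l})"
    and "a > 1" "b > 1" "1 / a + 1 / b = 1" and "V > 0" "U > 0"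
    and "integrable M (\<lambda>x. \<bar>Y x\<bar> powr a)" and "expectation (\<lambda>x. \<bar>Y x\<bar> powr a) \<le> V powr a"
    and "integrable M (\<lambda>x. \<bar>Z x\<bar> powr b)" and "expectation (\<lambda>x. \<bar>Z x\<bar> powr b) \<le> U powr b"
  shows "\<bar>expectation (\<lambda>x. Y x * Z x) - expectation Y * expectation Z\<bar>
    \<le> 8 * c\<^sub>\<phi> powr (1 / a) * (real g + 1) powr (- \<theta> / a) * V * U"
proof -
  interpret A: mixing_algebras M "past n" "gen_algebra M X {n + g..n + g + l}" "phi_rate g"
    by (rule mixing_algebras_past)
  have "phi_rate g powr (1 / a) = c\<^sub>\<phi> powr (1 / a) * (real g + 1) powr (- \<theta> / a)"
    using c\<phi>_pos by (simp add: powr_mult powr_powr)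
  then show ?thesis using A.mixing_covariance[OF assms] by (simp add: mult.assoc)
qed

text \<open>This is the product of \<open>\<rho>\<close> and \<open>\<theta>\<close>: when a past
  factor is paired with a single variable of order \<open>2 + \<delta>\<close>, the conjugate
  exponent turns the mixing rate \<open>\<theta>\<close> into this one.\<close>

abbreviation rate :: real where "rate \<equiv> \<theta> * ((1 + \<delta>) / (2 + \<delta>))"

text \<open>The exponent \<open>(2 + \<delta>) / (1 + \<delta>)\<close> is conjugate to the moment order \<open>2 + \<delta>\<close>.\<close>

lemma past_times_X:
  fixes V :: real
  assumes Y: "Y \<in> borel_measurable (past n)" and "V > 0"
    and "integrable M (\<lambda>x. \<bar>Y x\<bar> powr ((2 + \<delta>) / (1 + \<delta>)))"
    and "expectation (\<lambda>x. \<bar>Y x\<bar> powr ((2 + \<delta>) / (1 + \<delta>))) \<le> V powr ((2 + \<delta>) / (1 + \<delta>))"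
  shows "integrable M (\<lambda>x. Y x * X (n + g) x)"
    and "\<bar>expectation (\<lambda>x. Y x * X (n + g) x)\<bar>
      \<le> 8 * c\<^sub>\<phi> powr ((1 + \<delta>) / (2 + \<delta>)) * c\<^sub>X * (real g + 1) powr (- rate) * V"
proof -
  let ?a = "(2 + \<delta>) / (1 + \<delta>)"
  have ab: "?a > 1" "2 + \<delta> > 1" "1 / ?a + 1 / (2 + \<delta>) = 1" using \<delta>_pos by (auto simp: field_simps)
  show "integrable M (\<lambda>x. Y x * X (n + g) x)"
    by (rule integrable_mult_of_powr[of _ _ ?a "2 + \<delta>"])
      (use ab assms moment_int past_measurable in auto)
  have "\<bar>expectation (\<lambda>x. Y x * X (n + g) x) - expectation Y * expectation (X (n + g))\<bar>
    \<le> 8 * c\<^sub>\<phi> powr (1 / ?a) * (real g + 1) powr (- \<theta> / ?a) * V * c\<^sub>X"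
    by (rule past_covariance[where l = 0]) (use ab assms moment_int moment cX_ge1 in \<open>auto intro: measurable_gen_algebra\<close>)
  then show "\<bar>expectation (\<lambda>x. Y x * X (n + g) x)\<bar>
      \<le> 8 * c\<^sub>\<phi> powr ((1 + \<delta>) / (2 + \<delta>)) * c\<^sub>X * (real g + 1) powr (- rate) * V"
    by (simp add: centered ac_simps)
qed

end

text \<open>\<open>Sup\<close> of a set of reals is a true supremum only if the set is nonempty and
  bounded above. Here all elements lie between 0 and 1, and \<open>A = B = space M\<close>
  contributes the element 0.\<close>

lemma varphi_mix_bounds:
  assumes "prob_space M" "\<And>k. X k \<in> borel_measurable M"
  shows "0 \<le> varphi_mix M X V W" "varphi_mix M X V W \<le> 1"
    and "\<And>A B. A \<in> gen_events M X V \<Longrightarrow> B \<in> gen_events M X W \<Longrightarrow> measure M A > 0 \<Longrightarrow>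
      \<bar>measure M (B \<inter> A) / measure M A - measure M B\<bar> \<le> varphi_mix M X V W"
proof -
  interpret prob_space M by fact
  let ?S = "{\<bar>measure M (B \<inter> A) / measure M A - measure M B\<bar> | A B.
            A \<in> gen_events M X V \<and> B \<in> gen_events M X W \<and> measure M A > 0}"
  have ev: "A \<in> sets M" if "A \<in> gen_events M X U" for A U
    using that subalgebra_gen_algebra[where X = X and M = M, OF assms(2), of U] by (auto simp: subalgebra_def sets_gen_algebra)
  have le1: "x \<le> 1" if "x \<in> ?S" for x
  proof -
    obtain A B where x: "x = \<bar>prob (B \<inter> A) / prob A - prob B\<bar>" and A: "A \<in> sets M" "prob A > 0"
      using \<open>x \<in> ?S\<close> ev by blast
    have "prob (B \<inter> A) \<le> prob A" using A by (intro finite_measure_mono) auto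
    then have "prob (B \<inter> A) / prob A \<le> 1" "0 \<le> prob (B \<inter> A) / prob A" using A by auto
    moreover have "0 \<le> prob B" "prob B \<le> 1" by simp_all
    ultimately show ?thesis unfolding x by linarith
  qed
  then have bdd: "bdd_above ?S" by (rule bdd_aboveI)
  have sp: "space M \<in> gen_events M X U" for U
    unfolding gen_events_def by (rule sigma_sets_top)
  then have in0: "\<bar>prob (space M \<inter> space M) / prob (space M) - prob (space M)\<bar> \<in> ?S"
    by (intro CollectI exI[of _ "space M"]) (simp add: prob_space)
  show "varphi_mix M X V W \<le> 1" unfolding varphi_mix_def
    by (rule cSup_least) (use in0 le1 in auto)
  show "0 \<le> varphi_mix M X V W" unfolding varphi_mix_def
    by (rule order_trans[OF abs_ge_zero cSup_upper[OF in0 bdd]])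
  show "\<bar>prob (B \<inter> A) / prob A - prob B\<bar> \<le> varphi_mix M X V W"
    if "A \<in> gen_events M X V" "B \<in> gen_events M X W" "prob A > 0" for A B
    unfolding varphi_mix_def by (rule cSup_upper[OF _ bdd]) (use that in auto)
qed

text \<open>Both nested suprema run over families bounded by 1, so each is an upper bound of its
  members.\<close>

lemma varphi_mix_le_phi_coeff:
  assumes "prob_space M" "\<And>k. X k \<in> borel_measurable M" "k \<ge> 1"
  shows "varphi_mix M X {0..k} {k + n..k + n + l} \<le> phi_coeff M X n"
proof -
  note b = varphi_mix_bounds[OF assms(1,2)]
  have bdd: "bdd_above (range (\<lambda>l. varphi_mix M X {0..k} {k + n..k + n + l}))" for k
    by (rule bdd_aboveI2[of _ _ 1]) (rule b)
  have "varphi_mix M X {0..k} {k + n..k + n + l} \<le> (SUP l. varphi_mix M X {0..k} {k + n..k + n + l})"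
    by (rule cSUP_upper[OF _ bdd]) simp
  also have "\<dots> \<le> phi_coeff M X n"
    unfolding phi_coeff_def
  proof (rule cSUP_upper)
    show "bdd_above ((\<lambda>k. SUP l. varphi_mix M X {0..k} {k + n..k + n + l}) ` {1..})"
      by (rule bdd_aboveI2[of _ _ 1]) (rule cSUP_least, use b in auto)
  qed (use assms in auto)
  finally show ?thesis .
qed

text \<open>A gap \<open>g\<close> corresponds to the lag \<open>g + 1\<close>. This is direct for a
  past of at least two indices. The definition does not contain the past \<open>{0}\<close>, which
  is therefore enlarged to \<open>{0..1}\<close> at the price of one unit of lag. As
  \<open>g \<ge> (g + 1) / 2\<close> for \<open>g \<ge> 1\<close>, the factor
  \<open>2 powr \<theta>\<close> pays for it, and for \<open>g = 0\<close> that factor is at least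
  the trivial bound 1.\<close>

lemma mixing_sequence_of_W_class:
  assumes "prob_space M" "\<delta> > 0" "\<theta> > 0" "X \<in> W_phi_theta_class M \<delta> \<theta>"
  obtains c\<^sub>X where "mixing_sequence M X \<delta> \<theta> (2 powr \<theta>) c\<^sub>X"
proof -
  interpret prob_space M by fact
  have W: "X \<in> W_class M \<delta>" and phi: "phi_coeff M X n \<le> real n powr (- \<theta>)" if "n \<ge> 1" for n
    using assms(4) that by (auto simp: W_phi_theta_class_def W_phi_class_def)
  then have W: "X \<in> W_class M \<delta>" by blast
  then have meas: "X k \<in> borel_measurable M" and cent: "expectation (X k) = 0"
    and stat: "expectation (\<lambda>\<omega>. X k \<omega> * X (k + j) \<omega>) = autocov M X j"
    and int: "integrable M (\<lambda>\<omega>. \<bar>X k \<omega>\<bar> powr (2 + \<delta>))" for k j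
    by (auto simp: W_class_def autocov_def)
  note [measurable] = meas
  obtain c where c: "\<And>k. (expectation (\<lambda>\<omega>. \<bar>X k \<omega>\<bar> powr (2 + \<delta>))) powr (1 / (2 + \<delta>)) \<le> c"
    using W by (auto simp: W_class_def bdd_above_def)
  have mom: "expectation (\<lambda>\<omega>. \<bar>X k \<omega>\<bar> powr (2 + \<delta>)) \<le> (max c 1) powr (2 + \<delta>)" for k
  proof -
    let ?e = "expectation (\<lambda>\<omega>. \<bar>X k \<omega>\<bar> powr (2 + \<delta>))"
    have e: "?e \<ge> 0" by simp
    have "(?e powr (1 / (2 + \<delta>))) powr (2 + \<delta>) \<le> (max c 1) powr (2 + \<delta>)"
      using c[of k] assms by (intro powr_mono2) auto
    then show ?thesis using e assms by (simp add: powr_powr)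
  qed
  have ev: "A \<in> sets M" if "A \<in> gen_events M X U" for A U
    using that subalgebra_gen_algebra[where X = X and M = M, OF meas, of U] by (auto simp: subalgebra_def sets_gen_algebra)
  have mx: "\<bar>prob (A \<inter> B) - prob A * prob B\<bar> \<le> 2 powr \<theta> * (real g + 1) powr (- \<theta>) * prob A"
    if A: "A \<in> gen_events M X {..<n}" and B: "B \<in> gen_events M X {n + g..n + g + l}" for n g l A B
  proof (cases "prob A = 0 \<or> n = 0")
    case True
    have *: "prob (A \<inter> B) \<le> prob A" using ev[OF A] by (intro finite_measure_mono) auto
    show ?thesis
    proof (cases "prob A = 0")
      case True
      then have "prob (A \<inter> B) = 0" using * measure_nonneg[of M "A \<inter> B"] by linarith
      with True show ?thesis by simp
    next
      case False
      with True A have "A \<in> sigma_sets (space M) {}" by (simp add: gen_events_def)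
      \<comment> \<open>An empty past generates only the trivial events, and these are independent
        of everything.\<close>
      then have "A = {} \<or> A = space M" using sigma_sets_empty_eq[of "space M"] by auto
      moreover have "space M \<inter> B = B" using sets.sets_into_space[OF ev[OF B]] by blast
      ultimately show ?thesis by (auto simp: prob_space)
    qed
  next
    case False
    then have A0: "prob A > 0" using measure_nonneg[of M A] by linarith
    have key: "\<bar>prob (A \<inter> B) - prob A * prob B\<bar> \<le> t * prob A"
      if "\<bar>prob (B \<inter> A) / prob A - prob B\<bar> \<le> t" for t
    proof -
      have "prob (A \<inter> B) - prob A * prob B = (prob (B \<inter> A) / prob A - prob B) * prob A"
        using A0 by (simp add: Int_commute field_simps)
      then show ?thesis using that A0 by (simp add: abs_mult mult_right_mono)
    qed
    define v where "v = varphi_mix M X {..<n} {n + g..n + g + l}"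
    have v: "\<bar>prob (B \<inter> A) / prob A - prob B\<bar> \<le> v"
      unfolding v_def by (rule varphi_mix_bounds(3)) (use assms meas A B A0 in auto)
    have v1: "v \<le> 1" unfolding v_def by (rule varphi_mix_bounds) (use assms meas in auto)
    consider "n \<ge> 2" | "n = 1" "g = 0" | "n = 1" "g \<ge> 1" using False by force
    then have "\<bar>prob (B \<inter> A) / prob A - prob B\<bar> \<le> 2 powr \<theta> * (real g + 1) powr (- \<theta>)"
    proof cases
      case 1
      have eq: "{..<n} = {0..n - 1}" "n + g = (n - 1) + (g + 1)" using 1 by auto
      have "v \<le> phi_coeff M X (g + 1)"
        unfolding v_def eq by (rule varphi_mix_le_phi_coeff) (use assms meas 1 in auto)
      also have "\<dots> \<le> 1 * (real g + 1) powr (- \<theta>)" using phi[of "g + 1"] by (simp add: add.commute)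
      also have "\<dots> \<le> 2 powr \<theta> * (real g + 1) powr (- \<theta>)"
        by (intro mult_right_mono) (use assms in \<open>auto intro: ge_one_powr_ge_zero\<close>)
      finally show ?thesis using v by linarith
    next
      case 2
      have "1 \<le> 2 powr \<theta>" using assms by (auto intro: ge_one_powr_ge_zero)
      then show ?thesis using v v1 2 by simp
    next
      case 3
      have A': "A \<in> gen_events M X {0..1}"
      proof -
        have "{..<n} \<subseteq> {0..1}" using 3 by auto
        from sets_gen_algebra_mono[OF this, of M X] A show ?thesis by (auto simp: sets_gen_algebra)
      qed
      have "\<bar>prob (B \<inter> A) / prob A - prob B\<bar> \<le> varphi_mix M X {0..1} {1 + g..1 + g + l}"
        by (rule varphi_mix_bounds(3)) (use assms meas A' B A0 3 in auto)
      also have "\<dots> \<le> phi_coeff M X g"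
        by (rule varphi_mix_le_phi_coeff) (use assms meas in auto)
      also have "\<dots> \<le> real g powr (- \<theta>)" using phi[of g] 3 by simp
      also have "\<dots> \<le> ((real g + 1) / 2) powr (- \<theta>)"
        using 3 assms by (intro powr_mono2') auto
      also have "\<dots> = 2 powr \<theta> * (real g + 1) powr (- \<theta>)"
        by (simp add: powr_divide powr_minus field_simps)
      finally show ?thesis .
    qed
    then show ?thesis by (rule key)
  qed
  have "mixing_sequence M X \<delta> \<theta> (2 powr \<theta>) (max c 1)"
    by unfold_locales (use meas assms mx mom int cent stat in auto)
  then show ?thesis by (rule that)
qed

section \<open>Moments of block sums\<close>

lemma integrable_nonneg_bound:
  fixes f g :: "'a \<Rightarrow> real"
  assumes "integrable M g" "f \<in> borel_measurable M" "\<And>x. 0 \<le> f x" "\<And>x. f x \<le> g x"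
  shows "integrable M f"
proof (rule Bochner_Integration.integrable_bound[OF assms(1,2)], rule AE_I2)
  show "norm (f x) \<le> norm (g x)" for x using assms(3,4)[of x] by simp
qed

lemma convex_on_powr_nonneg:
  fixes p :: real
  assumes "p \<ge> 1"
  shows "convex_on {0..} (\<lambda>x. x powr p)"
proof (rule convex_onI)
  fix t x y :: real
  assume t: "0 < t" "t < 1" and xy: "x \<in> {0..}" "y \<in> {0..}"
  have scale: "(u * z) powr p \<le> u * z powr p" if "0 < u" "u < 1" "0 \<le> z" for u z :: real
  proof -
    have "u powr p \<le> u" using powr_mono'[of 1 p u] that assms by simp
    then show ?thesis using that by (simp add: powr_mult mult_right_mono)
  qed
  show "((1 - t) *\<^sub>R x + t *\<^sub>R y) powr p \<le> (1 - t) * x powr p + t * y powr p"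
  proof (cases "x = 0 \<or> y = 0")
    case True
    then show ?thesis using scale[of t y] scale[of "1 - t" x] t xy assms by auto
  next
    case False
    then show ?thesis using convex_onD[OF powr_convex[OF assms], of t x y] t xy by simp
  qed
qed simp

lemma sum_powr_le:
  fixes x :: "'b \<Rightarrow> real"
  assumes "finite A" "p \<ge> 1" "\<And>i. i \<in> A \<Longrightarrow> 0 \<le> x i"
  shows "(\<Sum>i\<in>A. x i) powr p \<le> real (card A) powr (p - 1) * (\<Sum>i\<in>A. x i powr p)"
proof (cases "A = {}")
  case False
  define n where "n = real (card A)"
  have n: "n > 0" using False assms by (simp add: n_def card_gt_0_iff)
  have "((\<Sum>i\<in>A. (1 / n) *\<^sub>R x i)) powr p \<le> (\<Sum>i\<in>A. (1 / n) * (x i powr p))"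
    by (rule convex_on_sum[OF assms(1) False convex_on_powr_nonneg[OF assms(2)]]) (use n assms in \<open>auto simp: n_def\<close>)
  then have "((\<Sum>i\<in>A. x i) / n) powr p \<le> (\<Sum>i\<in>A. x i powr p) / n"
    by (simp add: sum_divide_distrib)
  then have "(\<Sum>i\<in>A. x i) powr p / n powr p \<le> (\<Sum>i\<in>A. x i powr p) / n"
    using n assms by (simp add: powr_divide sum_nonneg)
  then have "(\<Sum>i\<in>A. x i) powr p \<le> (\<Sum>i\<in>A. x i powr p) / n * n powr p"
    using n by (simp add: pos_divide_le_eq)
  also have "\<dots> = n powr (p - 1) * (\<Sum>i\<in>A. x i powr p)"
    using n by (simp add: powr_diff)
  finally show ?thesis by (simp add: n_def)
qed simp

text \<open>By the mean value theorem between the larger variable and the sum. The pure powers have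
  coefficient exactly 1, and each cross term contains one variable only to the first power: after
  decoupling, first moments enter there.\<close>

lemma add_powr_le:
  fixes x y p :: real
  assumes "x \<ge> 0" "y \<ge> 0" "p \<ge> 1"
  shows "(x + y) powr p \<le> x powr p + y powr p + p * 2 powr p * (x powr (p - 1) * y + x * y powr (p - 1))"
proof -
  have key: "(x + y) powr p \<le> x powr p + p * 2 powr p * (x powr (p - 1) * y)"
    if "y \<le> x" "0 < y" for x y :: real
  proof -
    have "\<exists>z. x < z \<and> z < x + y \<and> (x + y) powr p - x powr p = (x + y - x) * (p * z powr (p - 1))"
      by (rule MVT2) (use that in \<open>auto intro!: has_real_derivative_powr\<close>)
    then obtain z where z: "x < z" "z < x + y" "(x + y) powr p - x powr p = y * (p * z powr (p - 1))"
      by auto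
    have "z powr (p - 1) \<le> (2 * x) powr (p - 1)"
      using z that assms by (intro powr_mono2) auto
    also have "\<dots> = 2 powr (p - 1) * x powr (p - 1)" using that by (simp add: powr_mult)
    also have "\<dots> \<le> 2 powr p * x powr (p - 1)" by (intro mult_right_mono powr_mono) auto
    finally have "y * (p * z powr (p - 1)) \<le> y * (p * (2 powr p * x powr (p - 1)))"
      using that assms by (intro mult_left_mono) auto
    then show ?thesis using z by (simp add: ac_simps)
  qed
  show ?thesis
  proof (cases "x = 0 \<or> y = 0")
    case False
    then have xy: "x > 0" "y > 0" using assms by auto
    then have pos: "0 \<le> p * 2 powr p * (x * y powr (p - 1))" "0 \<le> p * 2 powr p * (x powr (p - 1) * y)"
      "0 \<le> x powr p" "0 \<le> y powr p"
      using assms by simp_all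
    show ?thesis
    proof (cases "y \<le> x")
      case True
      then show ?thesis unfolding distrib_left using key[OF True xy(2)] pos by linarith
    next
      case False
      then have "(x + y) powr p \<le> y powr p + p * 2 powr p * (x * y powr (p - 1))"
        using key[of x y] xy by (simp add: ac_simps)
      then show ?thesis unfolding distrib_left using pos by linarith
    qed
  qed (use assms in auto)
qed

text \<open>Convexity at the points \<open>x / w\<close> and \<open>y / (1 - w)\<close>. For
  \<open>w\<close> near 1 the coefficient of \<open>x powr p\<close> is near 1; the large
  coefficient falls on \<open>y\<close>, which will be a remainder of bounded length.\<close>

lemma add_powr_le_weighted:
  fixes x y p w :: real
  assumes "x \<ge> 0" "y \<ge> 0" "p \<ge> 1" "0 < w" "w < 1"
  shows "(x + y) powr p \<le> w powr (1 - p) * x powr p + (1 - w) powr (1 - p) * y powr p"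
proof -
  have "((1 - (1 - w)) *\<^sub>R (x / w) + (1 - w) *\<^sub>R (y / (1 - w))) powr p
     \<le> (1 - (1 - w)) * (x / w) powr p + (1 - w) * (y / (1 - w)) powr p"
    by (rule convex_onD[OF convex_on_powr_nonneg[OF assms(3)]]) (use assms in auto)
  then have "(x + y) powr p \<le> w * (x / w) powr p + (1 - w) * (y / (1 - w)) powr p"
    using assms by simp
  also have "w * (x / w) powr p = w powr (1 - p) * x powr p"
    using assms by (simp add: powr_divide powr_diff)
  also have "(1 - w) * (y / (1 - w)) powr p = (1 - w) powr (1 - p) * y powr p"
    using assms by (simp add: powr_divide powr_diff)
  finally show ?thesis .
qed

section \<open>Block sums, moments of single variables, and autocovariances\<close>

context mixing_sequence
begin

abbreviation mord :: real where "mord \<equiv> 2 + \<delta>"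

definition block_sum :: "nat \<Rightarrow> nat \<Rightarrow> 'a \<Rightarrow> real" where
  "block_sum q m \<omega> = (\<Sum>i<m. X (q + i) \<omega>)"

lemma block_sum_measurable: "(\<And>i. i < m \<Longrightarrow> q + i \<in> V) \<Longrightarrow> block_sum q m \<in> borel_measurable (gen_algebra M X V)"
  unfolding block_sum_def by (intro borel_measurable_sum measurable_gen_algebra) auto

lemma block_sum_meas [measurable]: "block_sum q m \<in> borel_measurable M"
  unfolding block_sum_def by measurable

lemma block_sum_past: "q + m \<le> n \<Longrightarrow> block_sum q m \<in> borel_measurable (past n)"
  by (rule block_sum_measurable) auto

lemma block_sum_add: "block_sum q (m + k) \<omega> = block_sum q m \<omega> + block_sum (q + m) k \<omega>"
  unfolding block_sum_def by (induction k) (simp_all add: add.assoc)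

lemma abs_sum_moment:
  shows "integrable M (\<lambda>\<omega>. (\<Sum>i<m. \<bar>X (q + i) \<omega>\<bar>) powr mord)"
    and "expectation (\<lambda>\<omega>. (\<Sum>i<m. \<bar>X (q + i) \<omega>\<bar>) powr mord) \<le> (real m * c\<^sub>X) powr mord"
proof -
  have le: "(\<Sum>i<m. \<bar>X (q + i) \<omega>\<bar>) powr mord \<le> real m powr (mord - 1) * (\<Sum>i<m. \<bar>X (q + i) \<omega>\<bar> powr mord)" for \<omega>
    using sum_powr_le[of "{..<m}" mord "\<lambda>i. \<bar>X (q + i) \<omega>\<bar>"] \<delta>_pos by simp
  have i: "integrable M (\<lambda>\<omega>. real m powr (mord - 1) * (\<Sum>i<m. \<bar>X (q + i) \<omega>\<bar> powr mord))"
    using moment_int by simp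
  show i': "integrable M (\<lambda>\<omega>. (\<Sum>i<m. \<bar>X (q + i) \<omega>\<bar>) powr mord)"
    by (rule Bochner_Integration.integrable_bound[OF i])
      (use le in \<open>auto intro!: AE_I2 order_trans[OF le]\<close>)
  have "expectation (\<lambda>\<omega>. (\<Sum>i<m. \<bar>X (q + i) \<omega>\<bar>) powr mord)
     \<le> expectation (\<lambda>\<omega>. real m powr (mord - 1) * (\<Sum>i<m. \<bar>X (q + i) \<omega>\<bar> powr mord))"
    by (rule integral_mono[OF i' i le])
  also have "\<dots> = real m powr (mord - 1) * (\<Sum>i<m. expectation (\<lambda>\<omega>. \<bar>X (q + i) \<omega>\<bar> powr mord))"
    using moment_int by simp
  also have "\<dots> \<le> real m powr (mord - 1) * (\<Sum>i<m. c\<^sub>X powr mord)"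
    by (intro mult_left_mono sum_mono moment) auto
  also have "\<dots> = (real m * c\<^sub>X) powr mord"
    using \<delta>_pos cX_ge1 powr_mult_base[of "real m" "1 + \<delta>"] by (cases "m = 0") (auto simp: powr_mult ac_simps)
  finally show "expectation (\<lambda>\<omega>. (\<Sum>i<m. \<bar>X (q + i) \<omega>\<bar>) powr mord) \<le> (real m * c\<^sub>X) powr mord" .
qed

text \<open>No cancellation is used, so the order is \<open>m\<close> and not its square root. This
  serves for integrability and for sums of bounded length.\<close>

lemma block_sum_moment_trivial:
  shows "integrable M (\<lambda>\<omega>. \<bar>block_sum q m \<omega>\<bar> powr mord)"
    and "expectation (\<lambda>\<omega>. \<bar>block_sum q m \<omega>\<bar> powr mord) \<le> (real m * c\<^sub>X) powr mord"
proof -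
  have le: "\<bar>block_sum q m \<omega>\<bar> powr mord \<le> (\<Sum>i<m. \<bar>X (q + i) \<omega>\<bar>) powr mord" for \<omega>
    unfolding block_sum_def using \<delta>_pos by (intro powr_mono2 sum_abs) auto
  show i: "integrable M (\<lambda>\<omega>. \<bar>block_sum q m \<omega>\<bar> powr mord)"
    by (rule Bochner_Integration.integrable_bound[OF abs_sum_moment(1)[where q = q and m = m]]) (use le in auto)
  show "expectation (\<lambda>\<omega>. \<bar>block_sum q m \<omega>\<bar> powr mord) \<le> (real m * c\<^sub>X) powr mord"
    by (rule order_trans[OF integral_mono[OF i abs_sum_moment(1) le] abs_sum_moment(2)])
qed

lemma block_sum_int: "integrable M (block_sum q m)"
  unfolding block_sum_def using X_int by simp

lemma X_mult_int: "integrable M (\<lambda>\<omega>. X i \<omega> * X j \<omega>)"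
proof (rule Bochner_Integration.integrable_bound)
  show "integrable M (\<lambda>\<omega>. 2 + \<bar>X i \<omega>\<bar> powr mord + \<bar>X j \<omega>\<bar> powr mord)" using moment_int by simp
  show "AE \<omega> in M. norm (X i \<omega> * X j \<omega>) \<le> norm (2 + \<bar>X i \<omega>\<bar> powr mord + \<bar>X j \<omega>\<bar> powr mord)"
  proof (rule AE_I2)
    fix \<omega>
    have sq: "x\<^sup>2 \<le> 1 + \<bar>x\<bar> powr mord" for x :: real
    proof -
      have "x\<^sup>2 = \<bar>x\<bar> powr 2" by (cases "x = 0") auto
      moreover have "\<bar>x\<bar> powr 2 \<le> \<bar>x\<bar> powr mord" if "\<bar>x\<bar> > 1" using that \<delta>_pos by (intro powr_mono) auto
      moreover have "\<bar>x\<bar> powr 2 \<le> 1" if "\<bar>x\<bar> \<le> 1" using that powr_mono2[of 2 "\<bar>x\<bar>" 1] by simp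
      ultimately show ?thesis using powr_ge_zero[of "\<bar>x\<bar>" mord] by (cases "\<bar>x\<bar> \<le> 1") (auto intro: add_increasing2)
    qed
    have "2 * \<bar>X i \<omega> * X j \<omega>\<bar> \<le> (X i \<omega>)\<^sup>2 + (X j \<omega>)\<^sup>2"
      using sum_squares_bound[of "\<bar>X i \<omega>\<bar>" "\<bar>X j \<omega>\<bar>"] by (simp add: abs_mult)
    moreover have "0 \<le> (X i \<omega>)\<^sup>2 + (X j \<omega>)\<^sup>2" by simp
    ultimately have "\<bar>X i \<omega> * X j \<omega>\<bar> \<le> (X i \<omega>)\<^sup>2 + (X j \<omega>)\<^sup>2" by linarith
    then show "norm (X i \<omega> * X j \<omega>) \<le> norm (2 + \<bar>X i \<omega>\<bar> powr mord + \<bar>X j \<omega>\<bar> powr mord)"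
      using sq[of "X i \<omega>"] sq[of "X j \<omega>"] by simp
  qed
qed measurable

definition cov_const :: real where
  "cov_const = 8 * c\<^sub>\<phi> powr ((1 + \<delta>) / (2 + \<delta>)) * c\<^sub>X"

lemma cov_const_pos: "cov_const > 0"
  using c\<phi>_pos cX_ge1 by (simp add: cov_const_def)

text \<open>The scale \<open>c\<close> is kept apart from \<open>W\<close> because it will be a
  factor of Taylor remainders that depends on the smoothing, and it enters linearly. With
  \<open>V \<ge> 1\<close> a bound on the moment of \<open>W\<close> may be used in place of its
  root.\<close>

lemma past_times_X_dominated:
  assumes Y: "Y \<in> borel_measurable (past n)" and W: "W \<in> borel_measurable M"
    and le: "\<And>\<omega>. \<bar>Y \<omega>\<bar> \<le> c * W \<omega>" and c: "c > 0"
    and Wi: "integrable M (\<lambda>\<omega>. \<bar>W \<omega>\<bar> powr ((2 + \<delta>) / (1 + \<delta>)))"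
    and WV: "expectation (\<lambda>\<omega>. \<bar>W \<omega>\<bar> powr ((2 + \<delta>) / (1 + \<delta>))) \<le> V" and V: "V \<ge> 1"
  shows "integrable M (\<lambda>\<omega>. Y \<omega> * X (n + g) \<omega>)"
    and "\<bar>expectation (\<lambda>\<omega>. Y \<omega> * X (n + g) \<omega>)\<bar> \<le> cov_const * (real g + 1) powr (- rate) * (c * V)"
proof -
  let ?a = "(2 + \<delta>) / (1 + \<delta>)"
  have a: "?a > 1" using \<delta>_pos by simp
  have [measurable]: "Y \<in> borel_measurable M" using Y by (rule past_measurable)
  have W0: "W \<omega> \<ge> 0" for \<omega>
  proof -
    have "0 \<le> c * W \<omega>" using le[of \<omega>] abs_ge_zero[of "Y \<omega>"] by linarith
    then show ?thesis using c by (simp add: zero_le_mult_iff)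
  qed
  have le': "\<bar>Y \<omega>\<bar> powr ?a \<le> c powr ?a * \<bar>W \<omega>\<bar> powr ?a" for \<omega>
  proof -
    have "\<bar>Y \<omega>\<bar> powr ?a \<le> (c * W \<omega>) powr ?a" using le a by (intro powr_mono2) auto
    then show ?thesis using c W0[of \<omega>] by (simp add: powr_mult)
  qed
  have i: "integrable M (\<lambda>\<omega>. c powr ?a * \<bar>W \<omega>\<bar> powr ?a)" using Wi by simp
  have Yi: "integrable M (\<lambda>\<omega>. \<bar>Y \<omega>\<bar> powr ?a)"
    by (rule Bochner_Integration.integrable_bound[OF i]) (use le' in auto)
  have "expectation (\<lambda>\<omega>. \<bar>Y \<omega>\<bar> powr ?a) \<le> c powr ?a * expectation (\<lambda>\<omega>. \<bar>W \<omega>\<bar> powr ?a)"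
    using integral_mono[OF Yi i le'] by simp
  also have "\<dots> \<le> c powr ?a * V" by (intro mult_left_mono WV) auto
  also have "\<dots> \<le> c powr ?a * V powr ?a"
    using V a powr_mono[of 1 ?a V] by (intro mult_left_mono) auto
  also have "\<dots> = (c * V) powr ?a" using c V by (simp add: powr_mult)
  finally have YV: "expectation (\<lambda>\<omega>. \<bar>Y \<omega>\<bar> powr ?a) \<le> (c * V) powr ?a" .
  have cV: "c * V > 0" using c V by simp
  show "integrable M (\<lambda>\<omega>. Y \<omega> * X (n + g) \<omega>)"
    by (rule past_times_X(1)[OF Y cV Yi YV])
  show "\<bar>expectation (\<lambda>\<omega>. Y \<omega> * X (n + g) \<omega>)\<bar> \<le> cov_const * (real g + 1) powr (- rate) * (c * V)"
    using past_times_X(2)[OF Y cV Yi YV, of g] by (simp add: cov_const_def)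
qed

text \<open>A common bound for the moments of a variable of every order in \<open>(0, mord]\<close>,
  since such a power is at most 1 plus the power of order \<open>mord\<close>.\<close>

definition mom_const :: real where "mom_const = 1 + c\<^sub>X powr mord"

lemma mom_const_ge1: "mom_const \<ge> 1" by (simp add: mom_const_def)

lemma powr_le_1_plus_powr:
  fixes x s t :: real
  assumes "0 \<le> x" "0 < s" "s \<le> t"
  shows "x powr s \<le> 1 + x powr t"
proof (cases "x \<le> 1")
  case True
  then have "x powr s \<le> 1" using assms powr_mono2[of s x 1] by simp
  then show ?thesis using powr_ge_zero[of x t] by linarith
next
  case False
  then have "x powr s \<le> x powr t" using assms by (intro powr_mono) auto
  then show ?thesis by simp
qed

lemma X_lower_moment:
  assumes "0 < s" "s \<le> mord"
  shows "integrable M (\<lambda>\<omega>. \<bar>X k \<omega>\<bar> powr s)" "expectation (\<lambda>\<omega>. \<bar>X k \<omega>\<bar> powr s) \<le> mom_const"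
proof -
  have i: "integrable M (\<lambda>\<omega>. 1 + \<bar>X k \<omega>\<bar> powr mord)" using moment_int by simp
  have le: "\<bar>X k \<omega>\<bar> powr s \<le> 1 + \<bar>X k \<omega>\<bar> powr mord" for \<omega>
    by (rule powr_le_1_plus_powr) (use assms in auto)
  show i': "integrable M (\<lambda>\<omega>. \<bar>X k \<omega>\<bar> powr s)"
    by (rule Bochner_Integration.integrable_bound[OF i]) (auto intro!: AE_I2 order_trans[OF le])
  have "expectation (\<lambda>\<omega>. \<bar>X k \<omega>\<bar> powr s) \<le> expectation (\<lambda>\<omega>. 1 + \<bar>X k \<omega>\<bar> powr mord)"
    by (rule integral_mono[OF i' i le])
  also have "\<dots> \<le> mom_const" using moment_int moment[of k] by (simp add: mom_const_def prob_space)
  finally show "expectation (\<lambda>\<omega>. \<bar>X k \<omega>\<bar> powr s) \<le> mom_const" .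
qed

definition gamma_const :: real where
  "gamma_const = \<bar>autocov M X 0\<bar> + 2 powr rate * cov_const * mom_const"

lemma gamma_const_pos: "gamma_const > 0"
proof -
  have "2 powr rate * cov_const * mom_const > 0" using cov_const_pos mom_const_ge1 by simp
  then show ?thesis by (simp add: gamma_const_def add_nonneg_pos)
qed

text \<open>The variables with indices 0 and \<open>j\<close> have gap \<open>j - 1\<close>. The
  factor \<open>2 powr rate\<close> inside \<open>gamma_const\<close> replaces \<open>j\<close> by
  \<open>j + 1\<close>, a form that also covers \<open>j = 0\<close>.\<close>

lemma autocov_le: "\<bar>autocov M X j\<bar> \<le> gamma_const * (real j + 1) powr (- rate)"
proof (cases j)
  case 0
  have "2 powr rate * cov_const * mom_const > 0" using cov_const_pos mom_const_ge1 by simp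
  then show ?thesis using 0 by (simp add: gamma_const_def)
next
  case (Suc g)
  have a: "(2 + \<delta>) / (1 + \<delta>) \<le> mord" "0 < (2 + \<delta>) / (1 + \<delta>)" using \<delta>_pos by (auto simp: field_simps)
  have "autocov M X j = expectation (\<lambda>\<omega>. X 0 \<omega> * X (1 + g) \<omega>)" using stationary[of 0 j] Suc by simp
  also have "\<bar>\<dots>\<bar> \<le> cov_const * (real g + 1) powr (- rate) * (1 * mom_const)"
    by (rule past_times_X_dominated[where W = "\<lambda>\<omega>. \<bar>X 0 \<omega>\<bar>"])
      (use X_past mom_const_ge1 X_lower_moment[OF a(2,1)] in auto)
  also have "\<dots> \<le> cov_const * (2 powr rate * (real j + 1) powr (- rate)) * (1 * mom_const)"
  proof -
    have "(real g + 1) powr (- rate) \<le> ((real j + 1) / 2) powr (- rate)"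
      using Suc \<theta>_pos \<delta>_pos by (intro powr_mono2') auto
    also have "\<dots> = 2 powr rate * (real j + 1) powr (- rate)"
      by (simp add: powr_divide powr_minus field_simps)
    finally show ?thesis using cov_const_pos mom_const_ge1 by (intro mult_right_mono mult_left_mono) auto
  qed
  also have "\<dots> = (2 powr rate * cov_const * mom_const) * (real j + 1) powr (- rate)" by simp
  also have "\<dots> \<le> gamma_const * (real j + 1) powr (- rate)"
    by (intro mult_right_mono) (auto simp: gamma_const_def)
  finally show ?thesis .
qed

end

lemma summable_shift_powr: "s > 1 \<Longrightarrow> summable (\<lambda>j. (real j + 1) powr (- s))"
  using summable_real_powr_iff[of "- s"] summable_Suc_iff[of "\<lambda>n. real n powr (- s)"] by (simp add: add.commute)

lemma sum_shift_powr_le: "s > 1 \<Longrightarrow> finite A \<Longrightarrow> (\<Sum>j\<in>A. (real j + 1) powr (- s)) \<le> (\<Sum>j. (real j + 1) powr (- s))"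
  by (rule sum_le_suminf[OF summable_shift_powr]) auto

context mixing_sequence
begin

text \<open>The covariances decay like a summable power of the lag, so each row of the covariance
  matrix of a block has a sum bounded independently of \<open>m\<close>.\<close>

lemma block_sum_second_moment:
  assumes "rate > 1"
  shows "\<exists>c>0. \<forall>q m. integrable M (\<lambda>\<omega>. (block_sum q m \<omega>)\<^sup>2) \<and> expectation (\<lambda>\<omega>. (block_sum q m \<omega>)\<^sup>2) \<le> c * real m"
proof -
  obtain c where c: "c > 0" "\<And>j. \<bar>autocov M X j\<bar> \<le> c * (real j + 1) powr (- rate)"
    using gamma_const_pos autocov_le by blast
  define z where "z = (\<Sum>j. (real j + 1) powr (- rate))"
  have zpos: "z > 0"
  proof -
    have "(\<Sum>j\<in>{0}. (real j + 1) powr (- rate)) \<le> z"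
      unfolding z_def using assms by (intro sum_shift_powr_le) auto
    then show ?thesis by simp
  qed
  have cov: "expectation (\<lambda>\<omega>. X (q + i) \<omega> * X (q + j) \<omega>) = autocov M X (if i \<le> j then j - i else i - j)" for q i j
    using stationary[of "q + i" "j - i"] stationary[of "q + j" "i - j"] by (auto simp: mult.commute)
  have "integrable M (\<lambda>\<omega>. (block_sum q m \<omega>)\<^sup>2) \<and> expectation (\<lambda>\<omega>. (block_sum q m \<omega>)\<^sup>2) \<le> (2 * c * z) * real m" for q m
  proof
    have sq: "(block_sum q m \<omega>)\<^sup>2 = (\<Sum>i<m. \<Sum>j<m. X (q + i) \<omega> * X (q + j) \<omega>)" for \<omega>
      by (simp add: block_sum_def power2_eq_square sum_product)
    show "integrable M (\<lambda>\<omega>. (block_sum q m \<omega>)\<^sup>2)" unfolding sq using X_mult_int by simp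
    have "expectation (\<lambda>\<omega>. (block_sum q m \<omega>)\<^sup>2) = (\<Sum>i<m. \<Sum>j<m. expectation (\<lambda>\<omega>. X (q + i) \<omega> * X (q + j) \<omega>))"
      unfolding sq using X_mult_int by simp
    also have "\<dots> \<le> (\<Sum>i<m. 2 * c * z)"
    proof (rule sum_mono)
      fix i assume i: "i \<in> {..<m}"
      let ?r = "\<lambda>j. (real j + 1) powr (- rate)"
      have "(\<Sum>j<m. expectation (\<lambda>\<omega>. X (q + i) \<omega> * X (q + j) \<omega>)) \<le> (\<Sum>j<m. c * ?r (if i \<le> j then j - i else i - j))"
        unfolding cov by (intro sum_mono order_trans[OF abs_ge_self c(2)])
      also have "\<dots> \<le> (\<Sum>j<m. c * (if i \<le> j then ?r (j - i) else 0) + c * (if j \<le> i then ?r (i - j) else 0))"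
        using c(1) by (intro sum_mono) auto
      also have "\<dots> = c * ((\<Sum>j<m. if i \<le> j then ?r (j - i) else 0) + (\<Sum>j<m. if j \<le> i then ?r (i - j) else 0))"
        by (simp only: sum.distrib sum_distrib_left distrib_left)
      also have "\<dots> \<le> c * (z + z)"
      proof (intro mult_left_mono add_mono)
        have "(\<Sum>j<m. if i \<le> j then ?r (j - i) else 0) = (\<Sum>j\<in>{i..<m}. ?r (j - i))"
          by (subst sum.If_cases) (auto intro!: sum.cong)
        also have "\<dots> = (\<Sum>k\<in>(\<lambda>j. j - i) ` {i..<m}. ?r k)"
          by (subst sum.reindex) (auto intro!: inj_onI)
        also have "\<dots> \<le> z" unfolding z_def using assms by (intro sum_shift_powr_le) auto
        finally show "(\<Sum>j<m. if i \<le> j then ?r (j - i) else 0) \<le> z" .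
        have "(\<Sum>j<m. if j \<le> i then ?r (i - j) else 0) = (\<Sum>j\<in>{..i}. ?r (i - j))"
          using i by (subst sum.If_cases) (auto intro!: sum.cong)
        also have "\<dots> = (\<Sum>k\<in>(\<lambda>j. i - j) ` {..i}. ?r k)"
          by (subst sum.reindex) (auto intro!: inj_onI)
        also have "\<dots> \<le> z" unfolding z_def using assms by (intro sum_shift_powr_le) auto
        finally show "(\<Sum>j<m. if j \<le> i then ?r (i - j) else 0) \<le> z" .
      qed (use c in auto)
      finally show "(\<Sum>j<m. expectation (\<lambda>\<omega>. X (q + i) \<omega> * X (q + j) \<omega>)) \<le> 2 * c * z" by simp
    qed
    also have "\<dots> = (2 * c * z) * real m" by simp
    finally show "expectation (\<lambda>\<omega>. (block_sum q m \<omega>)\<^sup>2) \<le> (2 * c * z) * real m" .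
  qed
  moreover have "2 * c * z > 0" using c zpos by simp
  ultimately show ?thesis by blast
qed

lemma block_sum_first_moment:
  assumes "rate > 1"
  shows "\<exists>c>0. \<forall>q m. expectation (\<lambda>\<omega>. \<bar>block_sum q m \<omega>\<bar>) \<le> c * sqrt (real m)"
proof -
  obtain c where c: "c > 0" "\<And>q m. integrable M (\<lambda>\<omega>. (block_sum q m \<omega>)\<^sup>2)"
    "\<And>q m. expectation (\<lambda>\<omega>. (block_sum q m \<omega>)\<^sup>2) \<le> c * real m"
    using block_sum_second_moment[OF assms] by blast
  have "expectation (\<lambda>\<omega>. \<bar>block_sum q m \<omega>\<bar>) \<le> (1 + c) * sqrt (real m)" for q m
  proof (cases "m = 0")
    case True
    then show ?thesis by (simp add: block_sum_def)
  next
    case False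
    define u where "u = sqrt (real m)"
    have u: "u > 0" "u\<^sup>2 = real m" using False by (auto simp: u_def)
    \<comment> \<open>A pointwise substitute for the Cauchy--Schwarz inequality: with
      \<open>u = sqrt (real m)\<close> both terms have mean of the order \<open>u\<close>.\<close>
    have le: "\<bar>block_sum q m \<omega>\<bar> \<le> u + (block_sum q m \<omega>)\<^sup>2 / u" for \<omega>
    proof -
      let ?b = "\<bar>block_sum q m \<omega>\<bar>"
      have "?b * u \<le> u\<^sup>2 + ?b\<^sup>2"
        using sum_squares_bound[of ?b u] u zero_le_power2[of ?b] zero_le_power2[of u] by linarith
      then have "?b \<le> (u\<^sup>2 + ?b\<^sup>2) / u" using u by (simp add: pos_le_divide_eq)
      also have "\<dots> = u + (block_sum q m \<omega>)\<^sup>2 / u" using u(1) by (simp add: add_divide_distrib power2_eq_square)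
      finally show ?thesis .
    qed
    have "expectation (\<lambda>\<omega>. \<bar>block_sum q m \<omega>\<bar>) \<le> expectation (\<lambda>\<omega>. u + (block_sum q m \<omega>)\<^sup>2 / u)"
      by (rule integral_mono[OF _ _ le]) (use c(2) block_sum_int in auto)
    also have "\<dots> = u + expectation (\<lambda>\<omega>. (block_sum q m \<omega>)\<^sup>2) / u"
      using c(2) by (simp add: prob_space)
    also have "\<dots> \<le> u + c * u\<^sup>2 / u"
      using c(3)[of q m] u by (intro add_left_mono divide_right_mono) auto
    also have "\<dots> = (1 + c) * u" using u(1) by (simp add: power2_eq_square field_simps)
    finally show ?thesis by (simp add: u_def)
  qed
  moreover have "1 + c > 0" using c by simp
  ultimately show ?thesis by blast
qed

text \<open>The gap \<open>g\<close> between the two blocks makes the cross terms factorize up to a small multiple of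
  the \<open>p\<close>-th moments; this is what allows the moment bound to be doubled.\<close>

lemma two_block_moment:
  fixes K c :: real
  assumes c: "expectation (\<lambda>\<omega>. \<bar>block_sum q m \<omega>\<bar>) \<le> c * u" "expectation (\<lambda>\<omega>. \<bar>block_sum (q + m + g) m \<omega>\<bar>) \<le> c * u"
    and u: "u > 0" and c0: "c > 0" and K: "K > 0"
    and m1: "expectation (\<lambda>\<omega>. \<bar>block_sum q m \<omega>\<bar> powr mord) \<le> (K * u) powr mord"
    and m2: "expectation (\<lambda>\<omega>. \<bar>block_sum (q + m + g) m \<omega>\<bar> powr mord) \<le> (K * u) powr mord"
    and phi: "phi_rate g \<le> 1"
  shows "expectation (\<lambda>\<omega>. (\<bar>block_sum q m \<omega>\<bar> + \<bar>block_sum (q + m + g) m \<omega>\<bar>) powr mord)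
    \<le> (K * u) powr mord * (2 + mord * 2 powr mord * (16 * phi_rate g powr (1 / mord) + 4 * c / K))"
proof -
  let ?S = "\<lambda>\<omega>. \<bar>block_sum q m \<omega>\<bar>" and ?T = "\<lambda>\<omega>. \<bar>block_sum (q + m + g) m \<omega>\<bar>" and ?p = mord
  define V where "V = K * u"
  have V: "V > 0" using K u by (simp add: V_def)
  have p: "?p > 2" using \<delta>_pos by simp
  interpret A: mixing_algebras M "past (q + m)" "gen_algebra M X {q + m + g..q + m + g + m}" "phi_rate g"
    by (rule mixing_algebras_past)
  have meas: "?S \<in> borel_measurable (past (q + m))" "?T \<in> borel_measurable (gen_algebra M X {q + m + g..q + m + g + m})"
    by (intro borel_measurable_abs block_sum_past block_sum_measurable; auto)+
  note int = block_sum_moment_trivial(1)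
  \<comment> \<open>Moments of order \<open>?p - 1\<close> are read off from those of order
    \<open>?p\<close> by scaling with \<open>V\<close> and comparing with
    \<open>1 + x powr ?p\<close>; this costs a factor 2.\<close>
  have low: "expectation (\<lambda>\<omega>. \<bar>block_sum a b \<omega>\<bar> powr (?p - 1)) \<le> 2 * V powr (?p - 1)"
     "integrable M (\<lambda>\<omega>. \<bar>block_sum a b \<omega>\<bar> powr (?p - 1))"
    if "expectation (\<lambda>\<omega>. \<bar>block_sum a b \<omega>\<bar> powr ?p) \<le> V powr ?p" for a b
  proof -
    let ?f = "\<lambda>\<omega>. \<bar>block_sum a b \<omega>\<bar>"
    have le: "?f \<omega> powr (?p - 1) \<le> V powr (?p - 1) * (1 + ?f \<omega> powr ?p / V powr ?p)" for \<omega>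
    proof -
      have "(?f \<omega> / V) powr (?p - 1) \<le> 1 + (?f \<omega> / V) powr ?p"
        by (rule powr_le_1_plus_powr) (use V p in auto)
      then show ?thesis using V by (simp add: powr_divide field_simps)
    qed
    have i: "integrable M (\<lambda>\<omega>. V powr (?p - 1) * (1 + ?f \<omega> powr ?p / V powr ?p))" using int by simp
    show i': "integrable M (\<lambda>\<omega>. ?f \<omega> powr (?p - 1))"
      by (rule integrable_nonneg_bound[OF i _ _ le]) auto
    have "expectation (\<lambda>\<omega>. ?f \<omega> powr (?p - 1)) \<le> expectation (\<lambda>\<omega>. V powr (?p - 1) * (1 + ?f \<omega> powr ?p / V powr ?p))"
      by (rule integral_mono[OF i' i le])
    also have "\<dots> = V powr (?p - 1) * (1 + expectation (\<lambda>\<omega>. ?f \<omega> powr ?p) / V powr ?p)"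
      using int by (simp add: prob_space)
    also have "\<dots> \<le> V powr (?p - 1) * (1 + 1)"
      using that V by (intro mult_left_mono add_left_mono) (auto simp: divide_le_eq)
    finally show "expectation (\<lambda>\<omega>. ?f \<omega> powr (?p - 1)) \<le> 2 * V powr (?p - 1)" by simp
  qed
  have V1: "V powr (?p - 1) * V = V powr ?p" using V powr_mult_base[of V "?p - 1"] by (simp add: mult.commute)
  \<comment> \<open>The cross term with power \<open>?p - 1\<close> on the past block has the better
    mixing exponent \<open>(?p - 1) / ?p\<close>. It is reduced to \<open>1 / ?p\<close>, the
    exponent of the other cross term.\<close>
  have ph: "phi_rate g powr ((?p - 1) / ?p) \<le> phi_rate g powr (1 / ?p)"
    using phi c\<phi>_pos p by (intro powr_mono') (auto simp: divide_right_mono)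
  have pw: "(x powr (?p - 1)) powr (?p / (?p - 1)) = x powr ?p" for x :: real
    using p by (simp add: powr_powr)
  have 1: "\<bar>expectation (\<lambda>\<omega>. ?S \<omega> powr (?p - 1) * ?T \<omega>) - expectation (\<lambda>\<omega>. ?S \<omega> powr (?p - 1)) * expectation ?T\<bar>
      \<le> 8 * phi_rate g powr (1 / (?p / (?p - 1))) * V powr (?p - 1) * V"
  proof (rule A.mixing_covariance[where b = ?p])
    show "(\<lambda>\<omega>. ?S \<omega> powr (?p - 1)) \<in> borel_measurable (past (q + m))" using meas(1) by measurable
    show "integrable M (\<lambda>x. \<bar>?S x powr (?p - 1)\<bar> powr (?p / (?p - 1)))" using int pw by simp
    show "expectation (\<lambda>x. \<bar>?S x powr (?p - 1)\<bar> powr (?p / (?p - 1))) \<le> (V powr (?p - 1)) powr (?p / (?p - 1))"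
      using m1 V by (simp only: pw abs_of_nonneg powr_ge_zero) (simp add: V_def)
  qed (use meas V p int m2 in \<open>auto simp: V_def field_simps\<close>)
  have 2: "\<bar>expectation (\<lambda>\<omega>. ?S \<omega> * ?T \<omega> powr (?p - 1)) - expectation ?S * expectation (\<lambda>\<omega>. ?T \<omega> powr (?p - 1))\<bar>
      \<le> 8 * phi_rate g powr (1 / ?p) * V * V powr (?p - 1)"
  proof (rule A.mixing_covariance[where b = "?p / (?p - 1)"])
    show "(\<lambda>\<omega>. ?T \<omega> powr (?p - 1)) \<in> borel_measurable (gen_algebra M X {q + m + g..q + m + g + m})" using meas(2) by measurable
    show "integrable M (\<lambda>x. \<bar>?T x powr (?p - 1)\<bar> powr (?p / (?p - 1)))" using int pw by simp
    show "expectation (\<lambda>x. \<bar>?T x powr (?p - 1)\<bar> powr (?p / (?p - 1))) \<le> (V powr (?p - 1)) powr (?p / (?p - 1))"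
      using m2 V by (simp only: pw abs_of_nonneg powr_ge_zero) (simp add: V_def)
  qed (use meas V p int m1 in \<open>auto simp: V_def field_simps\<close>)
  have V': "V powr (?p - 1) * u = V powr ?p / K"
    using V1 K by (simp add: V_def field_simps)
  have e1: "expectation (\<lambda>\<omega>. ?S \<omega> powr (?p - 1) * ?T \<omega>) \<le> V powr ?p * (8 * phi_rate g powr (1 / ?p) + 2 * c / K)"
  proof -
    have "expectation (\<lambda>\<omega>. ?S \<omega> powr (?p - 1)) * expectation ?T \<le> (2 * V powr (?p - 1)) * (c * u)"
      using low(1)[of q m] m1 by (intro mult_mono c) (auto simp: V_def)
    also have "\<dots> = 2 * c * (V powr (?p - 1) * u)" by (simp only: ac_simps)
    also have "\<dots> = V powr ?p * (2 * c / K)" unfolding V' by simp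
    finally have "expectation (\<lambda>\<omega>. ?S \<omega> powr (?p - 1) * ?T \<omega>)
      \<le> V powr ?p * (2 * c / K) + 8 * phi_rate g powr ((?p - 1) / ?p) * (V powr (?p - 1) * V)"
      using 1 by (simp add: mult.assoc)
    also have "\<dots> \<le> V powr ?p * (2 * c / K) + 8 * phi_rate g powr (1 / ?p) * V powr ?p"
      unfolding V1 by (intro add_left_mono mult_right_mono mult_left_mono ph) auto
    finally show ?thesis by (simp add: algebra_simps)
  qed
  have e2: "expectation (\<lambda>\<omega>. ?S \<omega> * ?T \<omega> powr (?p - 1)) \<le> V powr ?p * (8 * phi_rate g powr (1 / ?p) + 2 * c / K)"
  proof -
    have "expectation ?S * expectation (\<lambda>\<omega>. ?T \<omega> powr (?p - 1)) \<le> (c * u) * (2 * V powr (?p - 1))"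
      using low(1)[of "q + m + g" m] m2 c0 u by (intro mult_mono c) (auto simp: V_def)
    also have "\<dots> = 2 * c * (V powr (?p - 1) * u)" by (simp only: ac_simps)
    also have "\<dots> = V powr ?p * (2 * c / K)" unfolding V' by simp
    finally have "expectation (\<lambda>\<omega>. ?S \<omega> * ?T \<omega> powr (?p - 1))
      \<le> V powr ?p * (2 * c / K) + 8 * phi_rate g powr (1 / ?p) * (V powr (?p - 1) * V)"
      using 2 by (simp add: ac_simps)
    then show ?thesis unfolding V1 by (simp add: algebra_simps)
  qed
  have i1: "integrable M (\<lambda>\<omega>. ?S \<omega> powr (?p - 1) * ?T \<omega>)"
    by (rule integrable_mult_of_powr[of _ _ "?p / (?p - 1)" ?p])
      (use p int pw in \<open>auto simp: field_simps\<close>)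
  have i2: "integrable M (\<lambda>\<omega>. ?S \<omega> * ?T \<omega> powr (?p - 1))"
    by (rule integrable_mult_of_powr[of _ _ ?p "?p / (?p - 1)"])
      (use p int pw in \<open>auto simp: field_simps\<close>)
  let ?R = "\<lambda>\<omega>. ?S \<omega> powr ?p + ?T \<omega> powr ?p + ?p * 2 powr ?p * (?S \<omega> powr (?p - 1) * ?T \<omega> + ?S \<omega> * ?T \<omega> powr (?p - 1))"
  have iR: "integrable M ?R" using int i1 i2 by simp
  have le: "(?S \<omega> + ?T \<omega>) powr ?p \<le> ?R \<omega>" for \<omega> by (rule add_powr_le) (use p in auto)
  have i: "integrable M (\<lambda>\<omega>. (?S \<omega> + ?T \<omega>) powr ?p)"
    by (rule integrable_nonneg_bound[OF iR _ _ le]) auto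
  have "expectation (\<lambda>\<omega>. (?S \<omega> + ?T \<omega>) powr ?p) \<le> expectation ?R" by (rule integral_mono[OF i iR le])
  also have "\<dots> = expectation (\<lambda>\<omega>. ?S \<omega> powr ?p) + expectation (\<lambda>\<omega>. ?T \<omega> powr ?p)
     + ?p * 2 powr ?p * (expectation (\<lambda>\<omega>. ?S \<omega> powr (?p - 1) * ?T \<omega>) + expectation (\<lambda>\<omega>. ?S \<omega> * ?T \<omega> powr (?p - 1)))"
    using int i1 i2 by simp
  also have "\<dots> \<le> V powr ?p + V powr ?p + ?p * 2 powr ?p *
     (V powr ?p * (8 * phi_rate g powr (1 / ?p) + 2 * c / K) + V powr ?p * (8 * phi_rate g powr (1 / ?p) + 2 * c / K))"
    using m1 m2 p by (intro add_mono mult_left_mono e1 e2) (auto simp: V_def)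
  finally show ?thesis by (simp add: V_def algebra_simps)
qed

end

context mixing_sequence
begin

lemma phi_rate_tendsto: "phi_rate \<longlonglongrightarrow> 0"
proof -
  have "(\<lambda>g. (real g + 1) powr (- \<theta>)) \<longlonglongrightarrow> 0"
    by (rule tendsto_neg_powr) (use \<theta>_pos in \<open>auto intro: filterlim_tendsto_add_at_top filterlim_real_sequentially
        simp: add.commute[of _ "1::real"]\<close>)
  from tendsto_mult_left[OF this, of c\<^sub>\<phi>] show ?thesis by simp
qed

text \<open>A gap is made by shifting the second half of a doubled block by \<open>g\<close>, which
  changes the block by two sums of length \<open>g\<close>. As \<open>g\<close> will stay fixed, the
  trivial moment bound is enough.\<close>

lemma double_block_remainder:
  "expectation (\<lambda>\<omega>. \<bar>block_sum a g \<omega> - block_sum b g \<omega>\<bar> powr mord) \<le> (4 * real g * c\<^sub>X) powr mord"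
  "integrable M (\<lambda>\<omega>. \<bar>block_sum a g \<omega> - block_sum b g \<omega>\<bar> powr mord)"
proof -
  let ?f = "\<lambda>\<omega>. \<bar>block_sum a g \<omega>\<bar>" and ?h = "\<lambda>\<omega>. \<bar>block_sum b g \<omega>\<bar>"
  have le: "\<bar>block_sum a g \<omega> - block_sum b g \<omega>\<bar> powr mord \<le> 2 powr mord * (?f \<omega> powr mord + ?h \<omega> powr mord)" for \<omega>
  proof -
    have "\<bar>block_sum a g \<omega> - block_sum b g \<omega>\<bar> powr mord \<le> (2 * max (?f \<omega>) (?h \<omega>)) powr mord"
      using \<delta>_pos by (intro powr_mono2) auto
    also have "\<dots> = 2 powr mord * max (?f \<omega>) (?h \<omega>) powr mord"
      by (subst powr_mult) (auto simp: le_max_iff_disj)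
    also have "max (?f \<omega>) (?h \<omega>) powr mord \<le> ?f \<omega> powr mord + ?h \<omega> powr mord"
      by (cases "?f \<omega> \<le> ?h \<omega>") (auto simp: max_def)
    finally show ?thesis by simp
  qed
  have i: "integrable M (\<lambda>\<omega>. 2 powr mord * (?f \<omega> powr mord + ?h \<omega> powr mord))"
    using block_sum_moment_trivial(1) by simp
  show i': "integrable M (\<lambda>\<omega>. \<bar>block_sum a g \<omega> - block_sum b g \<omega>\<bar> powr mord)"
    by (rule integrable_nonneg_bound[OF i _ _ le]) auto
  have "expectation (\<lambda>\<omega>. \<bar>block_sum a g \<omega> - block_sum b g \<omega>\<bar> powr mord)
    \<le> expectation (\<lambda>\<omega>. 2 powr mord * (?f \<omega> powr mord + ?h \<omega> powr mord))"
    by (rule integral_mono[OF i' i le])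
  also have "\<dots> = 2 powr mord * (expectation (\<lambda>\<omega>. ?f \<omega> powr mord) + expectation (\<lambda>\<omega>. ?h \<omega> powr mord))"
    using block_sum_moment_trivial(1) by simp
  also have "\<dots> \<le> 2 powr mord * ((real g * c\<^sub>X) powr mord + (real g * c\<^sub>X) powr mord)"
    by (intro mult_left_mono add_mono block_sum_moment_trivial(2)) auto
  also have "\<dots> \<le> 2 powr mord * (2 powr mord * (real g * c\<^sub>X) powr mord)"
  proof -
    have "2 powr 1 \<le> 2 powr mord" using \<delta>_pos by (intro powr_mono) auto
    then have "2 * (real g * c\<^sub>X) powr mord \<le> 2 powr mord * (real g * c\<^sub>X) powr mord"
      by (intro mult_right_mono) auto
    then show ?thesis by (intro mult_left_mono) auto
  qed
  also have "\<dots> = (4 * real g * c\<^sub>X) powr mord"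
  proof -
    have "(4 * real g * c\<^sub>X) powr mord = (2 * 2) powr mord * (real g * c\<^sub>X) powr mord"
      using cX_ge1 by (simp add: powr_mult)
    also have "(2 * 2) powr mord = 2 powr mord * (2 powr mord :: real)" by (rule powr_mult)
    finally show ?thesis by (simp only: mult.assoc)
  qed
  finally show "expectation (\<lambda>\<omega>. \<bar>block_sum a g \<omega> - block_sum b g \<omega>\<bar> powr mord) \<le> (4 * real g * c\<^sub>X) powr mord" .
qed

text \<open>Induction over \<open>k\<close> by doubling. Since \<open>mord > 2\<close>, the allowed
  growth factor \<open>Q = sqrt 2 powr mord\<close> exceeds the factor 2 that two decoupled halves
  would need. The slack \<open>Q - 2 = 3 * e\<close> is spent in equal parts on the cross terms, the
  convexity weight and the remainder.\<close>

theorem dyadic_block_moment: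
  assumes "rate > 1"
  shows "\<exists>K>0. \<forall>q k. expectation (\<lambda>\<omega>. \<bar>block_sum q (2 ^ k) \<omega>\<bar> powr mord) \<le> (K * sqrt (2 ^ k)) powr mord"
proof -
  obtain c where c: "c > 0" "\<And>q m. expectation (\<lambda>\<omega>. \<bar>block_sum q m \<omega>\<bar>) \<le> c * sqrt (real m)"
    using block_sum_first_moment[OF assms] by blast
  define Q where "Q = sqrt 2 powr mord"
  have Q: "Q > 2"
  proof -
    have "sqrt 2 powr 2 < sqrt 2 powr mord" using \<delta>_pos by (intro powr_less_mono) auto
    then show ?thesis by (simp add: Q_def)
  qed
  define e where "e = (Q - 2) / 3"
  have e: "e > 0" using Q by (simp add: e_def)
  \<comment> \<open>The weight for which convexity raises the coefficient \<open>2 + e\<close> to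
    exactly \<open>2 + 2 * e\<close>.\<close>
  define w where "w = ((2 + e) / (2 + 2 * e)) powr (1 / (mord - 1))"
  have w: "0 < w" "w < 1"
    using e \<delta>_pos powr_less_mono2[of "1 / (mord - 1)" "(2 + e) / (2 + 2 * e)" 1] by (auto simp: w_def)
  have we: "w powr (1 - mord) * (2 + e) = 2 + 2 * e"
  proof -
    have "1 / (mord - 1) * (1 - mord) = - 1" using \<delta>_pos by (simp add: field_simps)
    then have "w powr (1 - mord) = ((2 + e) / (2 + 2 * e)) powr (- 1)" by (simp add: w_def powr_powr)
    also have "\<dots> = (2 + 2 * e) / (2 + e)" using e by (simp add: powr_minus_divide)
    finally show ?thesis using e by simp
  qed
  define D where "D = mord * 2 powr mord"
  have D: "D > 0" using \<delta>_pos by (simp add: D_def)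
  have "(\<lambda>g. D * (16 * phi_rate g powr (1 / mord))) \<longlonglongrightarrow> D * (16 * 0 powr (1 / mord))"
    by (intro tendsto_intros phi_rate_tendsto) (use \<delta>_pos c\<phi>_pos in \<open>auto intro!: always_eventually\<close>)
  then have ev1: "\<forall>\<^sub>F g in sequentially. D * (16 * phi_rate g powr (1 / mord)) < e / 2"
    using e by (intro order_tendstoD) auto
  have ev2: "\<forall>\<^sub>F g in sequentially. phi_rate g < 1"
    using phi_rate_tendsto by (rule order_tendstoD) simp
  obtain g where g: "D * (16 * phi_rate g powr (1 / mord)) < e / 2" "phi_rate g < 1"
    using eventually_conj[OF ev1 ev2] by (auto simp: eventually_sequentially)
  define R where "R = (1 - w) powr (1 - mord) * (4 * real g * c\<^sub>X) powr mord"
  \<comment> \<open>The gap \<open>g\<close> is fixed before \<open>K\<close>. The three lower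
    bounds serve the single variable at \<open>k = 0\<close>, the first moments in the cross terms,
    and the remainder \<open>R\<close>.\<close>
  define K where "K = Max {c\<^sub>X, D * 4 * c / (e / 2), (R / e) powr (1 / mord)}"
  have K1: "K \<ge> c\<^sub>X" "K \<ge> D * 4 * c / (e / 2)" "K \<ge> (R / e) powr (1 / mord)" unfolding K_def by auto
  have K: "K > 0" using K1(1) cX_ge1 by linarith
  have Kc: "D * (4 * c / K) \<le> e / 2" using K1(2) K e by (simp add: field_simps)
  have KR: "R \<le> e * K powr mord"
  proof -
    have "R / e \<ge> 0" using e by (simp add: R_def)
    then have "R / e = ((R / e) powr (1 / mord)) powr mord"
      using \<delta>_pos unfolding powr_powr by (simp del: abs_divide)
    also have "\<dots> \<le> K powr mord" using K1(3) \<delta>_pos by (intro powr_mono2) auto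
    finally show ?thesis using e by (simp add: field_simps)
  qed
  have "expectation (\<lambda>\<omega>. \<bar>block_sum q (2 ^ k) \<omega>\<bar> powr mord) \<le> (K * sqrt (2 ^ k)) powr mord" for q k
  proof (induction k arbitrary: q)
    case 0
    have "c\<^sub>X powr mord \<le> K powr mord" using K1(1) cX_ge1 \<delta>_pos by (intro powr_mono2) auto
    then show ?case using block_sum_moment_trivial(2)[of q 1] by simp
  next
    case (Suc k)
    define m u where "m = (2 ^ k :: nat)" and "u = sqrt (2 ^ k)"
    have u: "u \<ge> 1" by (simp add: u_def)
    have u0: "u > 0" using u by simp
    have mu: "sqrt (real m) = u" by (simp add: m_def u_def)
    let ?S = "\<lambda>\<omega>. \<bar>block_sum q m \<omega>\<bar>" and ?T = "\<lambda>\<omega>. \<bar>block_sum (q + m + g) m \<omega>\<bar>"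
      and ?R = "\<lambda>\<omega>. \<bar>block_sum (q + m) g \<omega> - block_sum (q + m + m) g \<omega>\<bar>"
    have two: "expectation (\<lambda>\<omega>. (?S \<omega> + ?T \<omega>) powr mord) \<le> (K * u) powr mord * (2 + e)"
    proof -
      have "expectation (\<lambda>\<omega>. (?S \<omega> + ?T \<omega>) powr mord)
        \<le> (K * u) powr mord * (2 + D * (16 * phi_rate g powr (1 / mord) + 4 * c / K))"
        unfolding D_def
        by (rule two_block_moment) (use c(1) c(2)[of q m] c(2)[of "q + m + g" m] mu u0 K Suc[of q] Suc[of "q + m + g"] g(2)
            in \<open>auto simp: m_def u_def\<close>)
      also have "\<dots> \<le> (K * u) powr mord * (2 + e)"
        using Kc g(1) by (intro mult_left_mono) (auto simp: distrib_left)
      finally show ?thesis .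
    qed
    have dec: "\<bar>block_sum q (2 ^ Suc k) \<omega>\<bar> \<le> (?S \<omega> + ?T \<omega>) + ?R \<omega>" for \<omega>
    proof -
      have "block_sum q (2 ^ Suc k) \<omega> = block_sum q m \<omega> + block_sum (q + m) m \<omega>"
        using block_sum_add[of q m m \<omega>] by (simp add: m_def mult_2)
      moreover have "block_sum (q + m) g \<omega> + block_sum (q + m + g) m \<omega> = block_sum (q + m) m \<omega> + block_sum (q + m + m) g \<omega>"
        using block_sum_add[of "q + m" m g \<omega>] block_sum_add[of "q + m" g m \<omega>] by (simp add: add.commute)
      ultimately have "block_sum q (2 ^ Suc k) \<omega> = block_sum q m \<omega> + block_sum (q + m + g) m \<omega>
          + (block_sum (q + m) g \<omega> - block_sum (q + m + m) g \<omega>)" by linarith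
      then show ?thesis by linarith
    qed
    have iST: "integrable M (\<lambda>\<omega>. (?S \<omega> + ?T \<omega>) powr mord)"
    proof (rule integrable_nonneg_bound)
      show "integrable M (\<lambda>\<omega>. (1/2) powr (1 - mord) * ?S \<omega> powr mord + (1 - 1/2) powr (1 - mord) * ?T \<omega> powr mord)"
        using block_sum_moment_trivial(1) by simp
      show "(?S \<omega> + ?T \<omega>) powr mord \<le> (1/2) powr (1 - mord) * ?S \<omega> powr mord + (1 - 1/2) powr (1 - mord) * ?T \<omega> powr mord" for \<omega>
        by (rule add_powr_le_weighted) (use \<delta>_pos in auto)
    qed auto
    have le: "\<bar>block_sum q (2 ^ Suc k) \<omega>\<bar> powr mord \<le> w powr (1 - mord) * (?S \<omega> + ?T \<omega>) powr mord + (1 - w) powr (1 - mord) * ?R \<omega> powr mord" for \<omega>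
    proof -
      have "\<bar>block_sum q (2 ^ Suc k) \<omega>\<bar> powr mord \<le> ((?S \<omega> + ?T \<omega>) + ?R \<omega>) powr mord"
        using dec[of \<omega>] \<delta>_pos by (intro powr_mono2) auto
      also have "\<dots> \<le> w powr (1 - mord) * (?S \<omega> + ?T \<omega>) powr mord + (1 - w) powr (1 - mord) * ?R \<omega> powr mord"
        by (rule add_powr_le_weighted) (use w \<delta>_pos in auto)
      finally show ?thesis .
    qed
    have iR: "integrable M (\<lambda>\<omega>. w powr (1 - mord) * (?S \<omega> + ?T \<omega>) powr mord + (1 - w) powr (1 - mord) * ?R \<omega> powr mord)"
      using iST double_block_remainder(2) by simp
    have "expectation (\<lambda>\<omega>. \<bar>block_sum q (2 ^ Suc k) \<omega>\<bar> powr mord)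
       \<le> expectation (\<lambda>\<omega>. w powr (1 - mord) * (?S \<omega> + ?T \<omega>) powr mord + (1 - w) powr (1 - mord) * ?R \<omega> powr mord)"
      by (rule integral_mono[OF block_sum_moment_trivial(1) iR le])
    also have "\<dots> = w powr (1 - mord) * expectation (\<lambda>\<omega>. (?S \<omega> + ?T \<omega>) powr mord) + (1 - w) powr (1 - mord) * expectation (\<lambda>\<omega>. ?R \<omega> powr mord)"
      using iST double_block_remainder(2) by simp
    also have "\<dots> \<le> w powr (1 - mord) * ((K * u) powr mord * (2 + e)) + R"
      unfolding R_def by (intro add_mono mult_left_mono two double_block_remainder(1)) auto
    also have "\<dots> = (K * u) powr mord * (2 + 2 * e) + R"
      using we by (simp add: ac_simps)
    also have "R \<le> e * (K * u) powr mord"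
    proof -
      have "K powr mord \<le> (K * u) powr mord" using K u \<delta>_pos by (intro powr_mono2) auto
      then have "e * K powr mord \<le> e * (K * u) powr mord" using e by (intro mult_left_mono) auto
      then show ?thesis using KR by linarith
    qed
    also have "(K * u) powr mord * (2 + 2 * e) + e * (K * u) powr mord = (K * u) powr mord * (2 + 3 * e)"
      by (simp add: algebra_simps)
    also have "2 + 3 * e = Q" by (simp add: e_def field_simps)
    also have "(K * u) powr mord * Q = (K * sqrt (2 ^ Suc k)) powr mord"
    proof -
      have "K * sqrt (2 ^ Suc k) = (K * u) * sqrt 2" by (simp add: u_def real_sqrt_mult)
      then show ?thesis by (simp only: Q_def powr_mult)
    qed
    finally show ?case by simp
  qed
  then show ?thesis using K by blast
qed

end

section \<open>Gaussian smoothing of Lipschitz functions\<close>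

lemma has_real_derivative_lebesgue_integral:
  fixes f f' :: "real \<Rightarrow> 'a \<Rightarrow> real"
  assumes int: "\<And>x. integrable M (f x)"
    and der: "\<And>x y. (( \<lambda>x. f x y) has_real_derivative f' x y) (at x)"
    and meas: "f' x0 \<in> borel_measurable M"
    and dom: "integrable M G" "\<And>x y. \<bar>x - x0\<bar> \<le> 1 \<Longrightarrow> \<bar>f' x y\<bar> \<le> G y"
  shows "((\<lambda>x. \<integral>y. f x y \<partial>M) has_real_derivative (\<integral>y. f' x0 y \<partial>M)) (at x0)"
  unfolding DERIV_def
proof (subst tendsto_at_iff_sequentially)
  show "\<forall>X. (\<forall>i. X i \<in> UNIV - {0}) \<longrightarrow> X \<longlonglongrightarrow> 0 \<longrightarrow>
    ((\<lambda>h. ((\<integral>y. f (x0 + h) y \<partial>M) - (\<integral>y. f x0 y \<partial>M)) / h) \<circ> X) \<longlonglongrightarrow> (\<integral>y. f' x0 y \<partial>M)"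
  proof (intro allI impI)
    fix H :: "nat \<Rightarrow> real" assume H: "\<forall>i. H i \<in> UNIV - {0}" "H \<longlonglongrightarrow> 0"
    obtain N where N: "\<And>n. n \<ge> N \<Longrightarrow> \<bar>H n\<bar> < 1"
      using LIMSEQ_D[OF H(2), of 1] by auto
    define q where "q n y = (f (x0 + H (n + N)) y - f x0 y) / H (n + N)" for n y
    have qint: "integrable M (q n)" for n unfolding q_def using int by simp
    have bound: "\<bar>q n y\<bar> \<le> G y" for n y
    proof -
      let ?h = "H (n + N)"
      have h: "?h \<noteq> 0" "\<bar>?h\<bar> < 1" using H(1) N[of "n + N"] by auto
      have "\<bar>f (x0 + ?h) y - f x0 y\<bar> \<le> G y * \<bar>?h\<bar>"
      proof -
        have "norm (f (x0 + ?h) y - f x0 y) \<le> G y * norm (x0 + ?h - x0)"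
        proof (rule field_differentiable_bound[of "{x0 - 1..x0 + 1}" _ "\<lambda>x. f' x y"])
          show "((\<lambda>x. f x y) has_field_derivative f' z y) (at z within {x0 - 1..x0 + 1})" for z
            using der by (rule has_field_derivative_at_within)
          show "norm (f' z y) \<le> G y" if "z \<in> {x0 - 1..x0 + 1}" for z
            using dom(2)[of z y] that by (auto simp: abs_le_iff)
        qed (use h in \<open>auto simp: abs_less_iff\<close>)
        then show ?thesis by simp
      qed
      then show ?thesis using h by (simp add: q_def abs_divide divide_le_eq)
    qed
    have lim: "(\<lambda>n. q n y) \<longlonglongrightarrow> f' x0 y" for y
    proof -
      have "((\<lambda>h. (f (x0 + h) y - f x0 y) / h) \<longlongrightarrow> f' x0 y) (at 0)"
        using der[of y x0] unfolding DERIV_def .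
      then have "((\<lambda>h. (f (x0 + h) y - f x0 y) / h) \<circ> H) \<longlonglongrightarrow> f' x0 y"
        using H unfolding tendsto_at_iff_sequentially by blast
      then show ?thesis unfolding q_def o_def by (rule LIMSEQ_ignore_initial_segment)
    qed
    have "(\<lambda>n. \<integral>y. q n y \<partial>M) \<longlonglongrightarrow> (\<integral>y. f' x0 y \<partial>M)"
      by (rule integral_dominated_convergence[of _ _ _ G])
        (use qint meas dom(1) lim bound in auto)
    moreover have "(\<integral>y. q n y \<partial>M) = ((\<integral>y. f (x0 + H (n + N)) y \<partial>M) - (\<integral>y. f x0 y \<partial>M)) / H (n + N)" for n
      unfolding q_def using int by simp
    ultimately show "((\<lambda>h. ((\<integral>y. f (x0 + h) y \<partial>M) - (\<integral>y. f x0 y \<partial>M)) / h) \<circ> H) \<longlonglongrightarrow> (\<integral>y. f' x0 y \<partial>M)"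
      by (subst LIMSEQ_offset[of _ N]) (simp_all add: o_def LIMSEQ_offset)
  qed
qed


text \<open>Only the polynomials up to degree three are needed; for \<open>n > 3\<close> the value is junk.\<close>

definition hermite :: "nat \<Rightarrow> real \<Rightarrow> real" where
  "hermite n z = (if n = 0 then 1 else if n = 1 then z else if n = 2 then z\<^sup>2 - 1 else z ^ 3 - 3 * z)"

lemma hermite_measurable [measurable]: "hermite n \<in> borel_measurable borel"
  unfolding hermite_def by measurable

lemma hermite_bound: "\<bar>hermite n z\<bar> \<le> (1 + \<bar>z\<bar>) ^ 3"
proof -
  have e: "(1 + \<bar>z\<bar>) ^ 3 = 1 + 3 * \<bar>z\<bar> + 3 * \<bar>z\<bar>\<^sup>2 + \<bar>z\<bar> ^ 3"
    by (simp add: power3_eq_cube power2_eq_square algebra_simps)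
  have p: "\<bar>z\<bar> \<ge> 0" "\<bar>z\<bar>\<^sup>2 \<ge> 0" "\<bar>z\<bar> ^ 3 \<ge> 0" by simp_all
  have "\<bar>z\<^sup>2 - 1\<bar> \<le> \<bar>z\<bar>\<^sup>2 + 1" using abs_triangle_ineq4[of "z\<^sup>2" 1] by simp
  moreover have "\<bar>z ^ 3 - 3 * z\<bar> \<le> \<bar>z\<bar> ^ 3 + 3 * \<bar>z\<bar>"
    using abs_triangle_ineq4[of "z ^ 3" "3 * z"] by (simp add: power_abs abs_mult)
  ultimately show ?thesis unfolding e hermite_def using p by (auto simp del: power2_abs)
qed

text \<open>The recursion of the Hermite polynomials: the next one is \<open>z\<close> times the
  current one minus its derivative. The sign is positive because the derivative is taken in the
  shift \<open>x\<close> and not in \<open>y\<close>.\<close>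

lemma hermite_density_deriv:
  assumes "n \<le> 2"
  shows "((\<lambda>x. hermite n (y - x) * std_normal_density (y - x)) has_real_derivative
    hermite (Suc n) (y - x) * std_normal_density (y - x)) (at x)"
proof -
  have dd: "((\<lambda>x. std_normal_density (y - x)) has_real_derivative (y - x) * std_normal_density (y - x)) (at x)"
  proof -
    have "((\<lambda>x. exp (- (y - x)\<^sup>2 / 2)) has_real_derivative (y - x) * exp (- (y - x)\<^sup>2 / 2)) (at x)"
      by (auto intro!: derivative_eq_intros simp: field_simps)
    from DERIV_cmult[OF this, of "1 / sqrt (2 * pi)"] show ?thesis
      by (simp add: std_normal_density_def)
  qed
  consider "n = 0" | "n = 1" | "n = 2" using assms by linarith
  then show ?thesis
  proof cases
    case 1
    then show ?thesis using dd by (simp add: hermite_def)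
  next
    case 2
    have "((\<lambda>x. y - x) has_real_derivative - 1) (at x)"
      by (auto intro!: derivative_eq_intros)
    from DERIV_mult[OF this dd] show ?thesis
      using 2 by (simp add: hermite_def power2_eq_square algebra_simps)
  next
    case 3
    have "((\<lambda>x. (y - x)\<^sup>2 - 1) has_real_derivative - 2 * (y - x)) (at x)"
      by (auto intro!: derivative_eq_intros)
    from DERIV_mult[OF this dd] show ?thesis
      using 3 by (simp add: hermite_def power2_eq_square power3_eq_cube algebra_simps)
  qed
qed

lemma power4_add_le: "(a + b) ^ 4 \<le> 16 * (a ^ 4 + b ^ 4)" if "a \<ge> 0" "b \<ge> 0" for a b :: real
proof -
  have "(a + b) ^ 4 \<le> (2 * max a b) ^ 4" using that by (intro power_mono) auto
  also have "\<dots> = 16 * max a b ^ 4" by (simp add: power_mult_distrib)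
  also have "max a b ^ 4 \<le> a ^ 4 + b ^ 4" using that by (auto simp: max_def)
  finally show ?thesis by simp
qed

text \<open>The degree 4 is one for the growth of a Lipschitz function plus three for the largest
  Hermite polynomial.\<close>

lemma integrable_normal_growth:
  fixes f :: "real \<Rightarrow> real"
  assumes [measurable]: "f \<in> borel_measurable borel" and f: "\<And>z. \<bar>f z\<bar> \<le> (c + \<bar>z\<bar>) ^ 4" and "c \<ge> 0" "s > 0"
  shows "integrable lborel (\<lambda>z. f z * normal_density 0 s z)"
proof (rule Bochner_Integration.integrable_bound)
  show "integrable lborel (\<lambda>z. 16 * (c ^ 4 * (normal_density 0 s z) + normal_density 0 s z * \<bar>z\<bar> ^ 4))"
    using integrable_normal_moment_abs[of s 0 4] \<open>s > 0\<close> by simp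
  show "AE z in lborel. norm (f z * normal_density 0 s z)
     \<le> norm (16 * (c ^ 4 * (normal_density 0 s z) + normal_density 0 s z * \<bar>z\<bar> ^ 4))"
  proof (rule AE_I2)
    fix z
    have "\<bar>f z\<bar> \<le> 16 * (c ^ 4 + \<bar>z\<bar> ^ 4)"
      by (rule order_trans[OF f power4_add_le]) (use assms in auto)
    then have "\<bar>f z\<bar> * normal_density 0 s z \<le> 16 * (c ^ 4 + \<bar>z\<bar> ^ 4) * normal_density 0 s z"
      by (intro mult_right_mono) auto
    moreover have "0 \<le> 16 * (c ^ 4 * (normal_density 0 s z) + normal_density 0 s z * \<bar>z\<bar> ^ 4)"
      using \<open>c \<ge> 0\<close> by (intro mult_nonneg_nonneg add_nonneg_nonneg) auto
    ultimately show "norm (f z * normal_density 0 s z)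
     \<le> norm (16 * (c ^ 4 * (normal_density 0 s z) + normal_density 0 s z * \<bar>z\<bar> ^ 4))"
      by (simp add: abs_mult algebra_simps)
  qed
qed measurable

text \<open>For \<open>n \<le> 3\<close> this is the \<open>n\<close>-th derivative of the average
  of \<open>h\<close> over a standard normal shift; \<open>smooth1_deriv\<close> is the inductive
  step.\<close>

definition smooth1 :: "nat \<Rightarrow> (real \<Rightarrow> real) \<Rightarrow> real \<Rightarrow> real" where
  "smooth1 n h x = (\<integral>z. h (x + z) * hermite n z * std_normal_density z \<partial>lborel)"

context
  fixes h :: "real \<Rightarrow> real"
  assumes lip: "\<And>x y. \<bar>h x - h y\<bar> \<le> \<bar>x - y\<bar>"
begin

lemma lip_measurable: "h \<in> borel_measurable borel"
proof -
  have "1-lipschitz_on UNIV h" using lip by (intro lipschitz_onI) (auto simp: dist_real_def)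
  then show ?thesis by (intro borel_measurable_continuous_onI lipschitz_on_continuous_on)
qed

lemma lip_growth: "\<bar>h (x + z)\<bar> \<le> \<bar>h x\<bar> + \<bar>z\<bar>"
  using lip[of "x + z" x] by simp

lemma smooth1_shift: "smooth1 n h x = (\<integral>y. h y * (hermite n (y - x) * std_normal_density (y - x)) \<partial>lborel)"
  unfolding smooth1_def
  by (subst lborel_integral_real_affine[where c = 1 and t = "- x"]) (simp_all add: mult.assoc)

lemma smooth1_integrable: "integrable lborel (\<lambda>z. h (x + z) * hermite n z * std_normal_density z)"
proof (rule integrable_normal_growth[where c = "\<bar>h x\<bar> + 1"])
  show "(\<lambda>z. h (x + z) * hermite n z) \<in> borel_measurable borel" using lip_measurable by measurable
  show "\<bar>h (x + z) * hermite n z\<bar> \<le> (\<bar>h x\<bar> + 1 + \<bar>z\<bar>) ^ 4" for z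
  proof -
    have "\<bar>h (x + z) * hermite n z\<bar> \<le> (\<bar>h x\<bar> + 1 + \<bar>z\<bar>) * (\<bar>h x\<bar> + 1 + \<bar>z\<bar>) ^ 3"
      unfolding abs_mult
      by (intro mult_mono order_trans[OF lip_growth] order_trans[OF hermite_bound] power_mono) auto
    then show ?thesis by (simp add: power4_eq_xxxx power3_eq_cube mult.assoc)
  qed
qed auto

lemma smooth1_shift_integrable:
  "integrable lborel (\<lambda>y. h y * (hermite n (y - x) * std_normal_density (y - x)))"
proof -
  have "integrable lborel (\<lambda>y. h (x + (- x + 1 * y)) * hermite n (- x + 1 * y) * std_normal_density (- x + 1 * y))"
    by (rule lborel_integrable_real_affine[OF smooth1_integrable]) simp
  then show ?thesis by (simp add: mult.assoc)
qed

text \<open>A normal density of variance 2 dominates every translate of the standard one by at most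
  1, because \<open>v\<^sup>2 \<le> 2 * z\<^sup>2 + 2 * (v - z)\<^sup>2\<close>. This supplies the
  integrable majorant for differentiation under the integral.\<close>

lemma std_normal_density_shift_le:
  assumes "\<bar>z - v\<bar> \<le> 1"
  shows "std_normal_density z \<le> 3 * normal_density 0 (sqrt 2) v"
proof -
  have "v\<^sup>2 \<le> 2 * z\<^sup>2 + 2 * (v - z)\<^sup>2"
    using zero_le_power2[of "z - (v - z)"] by (simp add: power2_eq_square algebra_simps)
  moreover have "(v - z)\<^sup>2 \<le> 1" using assms by (simp add: abs_square_le_1 abs_minus_commute)
  ultimately have "- z\<^sup>2 / 2 \<le> 1 / 2 + - v\<^sup>2 / 4" by (simp add: field_simps)
  then have "exp (- z\<^sup>2 / 2) \<le> exp (1 / 2) * exp (- v\<^sup>2 / 4)"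
    by (subst exp_add[symmetric]) simp
  also have "exp (1 / 2) * sqrt 2 \<le> (3 :: real)"
  proof -
    have "(exp (1 / 2) * sqrt 2)\<^sup>2 = exp 1 * (2 :: real)"
      by (simp add: power_mult_distrib flip: exp_of_nat_mult)
    also have "\<dots> \<le> 3\<^sup>2" using exp_le by simp
    finally show ?thesis by (rule power2_le_imp_le) simp
  qed
  then have "exp (1 / 2) \<le> 3 / sqrt (2 :: real)" by (simp add: field_simps)
  then have "exp (1 / 2) * exp (- v\<^sup>2 / 4) \<le> 3 / sqrt 2 * exp (- v\<^sup>2 / 4)" by (rule mult_right_mono) simp
  finally have "exp (- z\<^sup>2 / 2) / sqrt (2 * pi) \<le> 3 / sqrt 2 * exp (- v\<^sup>2 / 4) / sqrt (2 * pi)"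
    by (rule divide_right_mono) simp
  moreover have "sqrt 2 * sqrt (2 * pi) = sqrt (2 * pi * 2)" by (simp add: real_sqrt_mult)
  ultimately show ?thesis by (simp add: std_normal_density_def normal_density_def)
qed

lemma smooth1_deriv:
  assumes "n \<le> 2"
  shows "(smooth1 n h has_real_derivative smooth1 (Suc n) h x) (at x)"
proof -
  define G where "G y = (\<bar>h x\<bar> + \<bar>y - x\<bar>) * (2 + \<bar>y - x\<bar>) ^ 3 * (3 * normal_density 0 (sqrt 2) (y - x))" for y
  have "integrable lborel (\<lambda>z. (\<bar>h x\<bar> + \<bar>z\<bar>) * (2 + \<bar>z\<bar>) ^ 3 * normal_density 0 (sqrt 2) z)"
  proof (rule integrable_normal_growth[where c = "\<bar>h x\<bar> + 2"])
    show "\<bar>(\<bar>h x\<bar> + \<bar>z\<bar>) * (2 + \<bar>z\<bar>) ^ 3\<bar> \<le> (\<bar>h x\<bar> + 2 + \<bar>z\<bar>) ^ 4" for z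
    proof -
      have "(\<bar>h x\<bar> + \<bar>z\<bar>) * (2 + \<bar>z\<bar>) ^ 3 \<le> (\<bar>h x\<bar> + 2 + \<bar>z\<bar>) * (\<bar>h x\<bar> + 2 + \<bar>z\<bar>) ^ 3"
        by (intro mult_mono power_mono) auto
      then show ?thesis by (simp add: power4_eq_xxxx power3_eq_cube mult.assoc)
    qed
  qed auto
  then have "integrable lborel (\<lambda>z. 3 * ((\<bar>h x\<bar> + \<bar>z\<bar>) * (2 + \<bar>z\<bar>) ^ 3 * normal_density 0 (sqrt 2) z))" by simp
  from lborel_integrable_real_affine[OF this, of 1 "- x"] have G: "integrable lborel G"
    unfolding G_def by (simp add: ac_simps)
  have "((\<lambda>x. \<integral>y. h y * (hermite n (y - x) * std_normal_density (y - x)) \<partial>lborel) has_real_derivative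
     (\<integral>y. h y * (hermite (Suc n) (y - x) * std_normal_density (y - x)) \<partial>lborel)) (at x)"
  proof (rule has_real_derivative_lebesgue_integral[OF smooth1_shift_integrable _ _ G])
    show "((\<lambda>x. h y * (hermite n (y - x) * std_normal_density (y - x))) has_real_derivative
      h y * (hermite (Suc n) (y - x') * std_normal_density (y - x'))) (at x')" for x' y
      by (rule DERIV_cmult[OF hermite_density_deriv[OF assms]])
    show "(\<lambda>y. h y * (hermite (Suc n) (y - x) * std_normal_density (y - x))) \<in> borel_measurable lborel"
      using lip_measurable by measurable
    show "\<bar>h y * (hermite (Suc n) (y - x') * std_normal_density (y - x'))\<bar> \<le> G y"
      if "\<bar>x' - x\<bar> \<le> 1" for x' y
    proof -
      have "\<bar>h y\<bar> \<le> \<bar>h x\<bar> + \<bar>y - x\<bar>" using lip_growth[of x "y - x"] by simp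
      moreover have "\<bar>hermite (Suc n) (y - x')\<bar> \<le> (2 + \<bar>y - x\<bar>) ^ 3"
        using that by (intro order_trans[OF hermite_bound] power_mono) auto
      moreover have "std_normal_density (y - x') \<le> 3 * normal_density 0 (sqrt 2) (y - x)"
        by (rule std_normal_density_shift_le) (use that in auto)
      ultimately have "\<bar>h y\<bar> * (\<bar>hermite (Suc n) (y - x')\<bar> * std_normal_density (y - x'))
         \<le> (\<bar>h x\<bar> + \<bar>y - x\<bar>) * ((2 + \<bar>y - x\<bar>) ^ 3 * (3 * normal_density 0 (sqrt 2) (y - x)))"
        by (intro mult_mono) auto
      then show ?thesis by (simp add: G_def abs_mult mult.assoc)
    qed
  qed
  then show ?thesis by (simp add: smooth1_shift[abs_def])
qed

end

text \<open>The factor \<open>\<bar>z\<bar>\<close> is the Lipschitz bound for an increment of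
  \<open>h\<close> over \<open>z\<close>. Summing over the orders up to three gives one constant for
  all derivatives and for the smoothing error.\<close>

definition hermite_const :: real where
  "hermite_const = (\<Sum>n\<le>3. \<integral>z. \<bar>z\<bar> * \<bar>hermite n z\<bar> * std_normal_density z \<partial>lborel)"

lemma hermite_abs_integrable: "integrable lborel (\<lambda>z. \<bar>z\<bar> * \<bar>hermite n z\<bar> * std_normal_density z)"
proof (rule integrable_normal_growth[where c = 1])
  show "\<bar>\<bar>z\<bar> * \<bar>hermite n z\<bar>\<bar> \<le> (1 + \<bar>z\<bar>) ^ 4" for z
  proof -
    have "\<bar>z\<bar> * \<bar>hermite n z\<bar> \<le> (1 + \<bar>z\<bar>) * (1 + \<bar>z\<bar>) ^ 3"
      by (intro mult_mono hermite_bound) auto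
    then show ?thesis by (simp add: power4_eq_xxxx power3_eq_cube mult.assoc)
  qed
qed auto

lemma hermite_const_ge:
  assumes "n \<le> 3"
  shows "(\<integral>z. \<bar>z\<bar> * \<bar>hermite n z\<bar> * std_normal_density z \<partial>lborel) \<le> hermite_const"
  unfolding hermite_const_def using assms by (intro member_le_sum) (auto intro!: integral_nonneg)

lemma hermite_const_nonneg: "0 \<le> hermite_const"
  unfolding hermite_const_def by (intro sum_nonneg integral_nonneg) auto

text \<open>Hermite polynomials of positive degree have mean zero under the normal law;
  differentiating a constant function shows this without computing moments.\<close>

lemma smooth1_const:
  assumes "n \<le> 2"
  shows "smooth1 (Suc n) (\<lambda>_. c) x = 0"
proof -
  have "smooth1 n (\<lambda>_. c) = (\<lambda>_. smooth1 n (\<lambda>_. c) 0)" by (simp add: smooth1_def fun_eq_iff)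
  moreover have "(smooth1 n (\<lambda>_. c) has_real_derivative smooth1 (Suc n) (\<lambda>_. c) x) (at x)"
    by (rule smooth1_deriv) (use assms in auto)
  ultimately have "((\<lambda>_. smooth1 n (\<lambda>_. c) 0) has_real_derivative smooth1 (Suc n) (\<lambda>_. c) x) (at x)" by simp
  then show ?thesis by (rule DERIV_unique) simp
qed

context
  fixes h :: "real \<Rightarrow> real"
  assumes lip: "\<And>x y. \<bar>h x - h y\<bar> \<le> \<bar>x - y\<bar>"
begin

text \<open>Only increments of \<open>h\<close> are seen, so the bound is independent of the size of
  \<open>h\<close>. For \<open>n\<close> from 1 to 3 the subtracted term vanishes; for
  \<open>n = 0\<close> the difference is the smoothing error.\<close>

lemma smooth1_bound_aux:
  "\<bar>smooth1 n h x - smooth1 n (\<lambda>_. h x) x\<bar> \<le> (\<integral>z. \<bar>z\<bar> * \<bar>hermite n z\<bar> * std_normal_density z \<partial>lborel)"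
proof -
  have 1: "integrable lborel (\<lambda>z. h (x + z) * hermite n z * std_normal_density z)"
    by (rule smooth1_integrable[OF lip])
  have 2: "integrable lborel (\<lambda>z. h x * hermite n z * std_normal_density z)"
    using smooth1_integrable[of "\<lambda>_. h x" x n] by simp
  have "smooth1 n h x - smooth1 n (\<lambda>_. h x) x
     = (\<integral>z. h (x + z) * hermite n z * std_normal_density z - h x * hermite n z * std_normal_density z \<partial>lborel)"
    unfolding smooth1_def using 1 2 by simp
  also have "\<bar>\<dots>\<bar> \<le> (\<integral>z. \<bar>z\<bar> * \<bar>hermite n z\<bar> * std_normal_density z \<partial>lborel)"
  proof (rule integral_abs_bound[THEN order_trans], rule integral_mono)
    fix z
    have "\<bar>h (x + z) - h x\<bar> * (\<bar>hermite n z\<bar> * std_normal_density z) \<le> \<bar>z\<bar> * (\<bar>hermite n z\<bar> * std_normal_density z)"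
      using lip[of "x + z" x] by (intro mult_right_mono) auto
    then show "\<bar>h (x + z) * hermite n z * std_normal_density z - h x * hermite n z * std_normal_density z\<bar>
      \<le> \<bar>z\<bar> * \<bar>hermite n z\<bar> * std_normal_density z"
      by (simp add: abs_mult mult.assoc flip: left_diff_distrib)
  qed (use 1 2 hermite_abs_integrable in auto)
  finally show ?thesis .
qed

lemma smooth1_bound:
  assumes "1 \<le> n" "n \<le> 3"
  shows "\<bar>smooth1 n h x\<bar> \<le> hermite_const"
  using smooth1_bound_aux[of n x] smooth1_const[of "n - 1" "h x" x] hermite_const_ge[of n] assms by simp

text \<open>Interpolation: through the third derivative for \<open>\<bar>a\<bar> \<le> 1\<close>,
  through the bound on the second derivative for larger \<open>a\<close>. In this way every Hoelder
  exponent up to 1 is available.\<close>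

lemma smooth1_2_hoelder:
  assumes "0 < d" "d \<le> 1"
  shows "\<bar>smooth1 2 h (x + a) - smooth1 2 h x\<bar> \<le> 2 * hermite_const * \<bar>a\<bar> powr d"
proof (cases "a = 0")
  case False
  have mv: "\<bar>smooth1 2 h (x + a) - smooth1 2 h x\<bar> \<le> hermite_const * \<bar>a\<bar>"
  proof -
    have "norm (smooth1 2 h (x + a) - smooth1 2 h x) \<le> hermite_const * norm (x + a - x)"
    proof (rule field_differentiable_bound[of UNIV "smooth1 2 h" "smooth1 3 h"])
      show "(smooth1 2 h has_field_derivative smooth1 3 h z) (at z within UNIV)" for z
        using smooth1_deriv[OF lip, of 2 z] by simp
      show "norm (smooth1 3 h z) \<le> hermite_const" for z using smooth1_bound[of 3 z] by simp
    qed auto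
    then show ?thesis by simp
  qed
  show ?thesis
  proof (cases "\<bar>a\<bar> \<le> 1")
    case True
    have "\<bar>a\<bar> powr 1 \<le> \<bar>a\<bar> powr d" using True False assms by (intro powr_mono') auto
    then have "hermite_const * \<bar>a\<bar> \<le> hermite_const * \<bar>a\<bar> powr d"
      using False hermite_const_nonneg by (intro mult_left_mono) auto
    moreover have "0 \<le> hermite_const * \<bar>a\<bar> powr d" using hermite_const_nonneg by simp
    ultimately show ?thesis using mv by linarith
  next
    case big: False
    have "1 \<le> \<bar>a\<bar> powr d" using big assms by (intro ge_one_powr_ge_zero) auto
    then have "2 * hermite_const * 1 \<le> 2 * hermite_const * \<bar>a\<bar> powr d"
      using hermite_const_nonneg by (intro mult_left_mono) auto
    then show ?thesis using smooth1_bound[of 2 "x + a"] smooth1_bound[of 2 x] by simp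
  qed
qed simp

text \<open>The mean value inequality applied to the Hoelder bound along the segment to
  \<open>a\<close>. The Taylor constant is not improved by the integration, so one constant serves
  all orders.\<close>

lemma smooth1_1_taylor:
  assumes "0 < d" "d \<le> 1"
  shows "\<bar>smooth1 1 h (x + a) - smooth1 1 h x - a * smooth1 2 h x\<bar> \<le> 2 * hermite_const * \<bar>a\<bar> powr (1 + d)"
proof -
  define f where "f z = smooth1 1 h (x + z) - z * smooth1 2 h x" for z
  have "norm (f a - f 0) \<le> (2 * hermite_const * \<bar>a\<bar> powr d) * norm (a - 0)"
  proof (rule field_differentiable_bound[of "{- \<bar>a\<bar>..\<bar>a\<bar>}" f "\<lambda>z. smooth1 2 h (x + z) - smooth1 2 h x"])
    fix z assume z: "z \<in> {- \<bar>a\<bar>..\<bar>a\<bar>}"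
    have "((\<lambda>z. smooth1 1 h (z + x)) has_real_derivative smooth1 2 h (z + x)) (at z)"
      by (rule DERIV_shift[THEN iffD1]) (use smooth1_deriv[OF lip, of 1 "z + x"] in \<open>simp add: numeral_2_eq_2\<close>)
    then have 1: "((\<lambda>z. smooth1 1 h (x + z)) has_real_derivative smooth1 2 h (x + z)) (at z)"
      by (simp only: add.commute)
    have 2: "((\<lambda>z. z * smooth1 2 h x) has_real_derivative smooth1 2 h x) (at z)"
      by (auto intro!: derivative_eq_intros)
    show "(f has_field_derivative (smooth1 2 h (x + z) - smooth1 2 h x)) (at z within {- \<bar>a\<bar>..\<bar>a\<bar>})"
      unfolding f_def by (rule has_field_derivative_at_within[OF DERIV_diff[OF 1 2]])
    have "\<bar>z\<bar> powr d \<le> \<bar>a\<bar> powr d" using z assms by (intro powr_mono2) auto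
    then have "2 * hermite_const * \<bar>z\<bar> powr d \<le> 2 * hermite_const * \<bar>a\<bar> powr d"
      using hermite_const_nonneg by (intro mult_left_mono) auto
    then show "norm (smooth1 2 h (x + z) - smooth1 2 h x) \<le> 2 * hermite_const * \<bar>a\<bar> powr d"
      using smooth1_2_hoelder[OF assms, of x z] by simp
  qed auto
  moreover have "\<bar>a\<bar> powr d * \<bar>a\<bar> = \<bar>a\<bar> powr (1 + d)"
    by (cases "a = 0") (auto simp: powr_add)
  ultimately show ?thesis by (simp add: f_def mult.assoc)
qed

lemma smooth1_0_taylor:
  assumes "0 < d" "d \<le> 1"
  shows "\<bar>smooth1 0 h (x + a) - smooth1 0 h x - a * smooth1 1 h x - a\<^sup>2 / 2 * smooth1 2 h x\<bar>
    \<le> 2 * hermite_const * \<bar>a\<bar> powr (2 + d)"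
proof -
  define f where "f z = smooth1 0 h (x + z) - z * smooth1 1 h x - z\<^sup>2 / 2 * smooth1 2 h x" for z
  have "norm (f a - f 0) \<le> (2 * hermite_const * \<bar>a\<bar> powr (1 + d)) * norm (a - 0)"
  proof (rule field_differentiable_bound[of "{- \<bar>a\<bar>..\<bar>a\<bar>}" f "\<lambda>z. smooth1 1 h (x + z) - smooth1 1 h x - z * smooth1 2 h x"])
    fix z assume z: "z \<in> {- \<bar>a\<bar>..\<bar>a\<bar>}"
    have "((\<lambda>z. smooth1 0 h (z + x)) has_real_derivative smooth1 1 h (z + x)) (at z)"
      by (rule DERIV_shift[THEN iffD1]) (use smooth1_deriv[OF lip, of 0 "z + x"] in simp)
    then have 1: "((\<lambda>z. smooth1 0 h (x + z)) has_real_derivative smooth1 1 h (x + z)) (at z)"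
      by (simp only: add.commute)
    have 2: "((\<lambda>z. z * smooth1 1 h x) has_real_derivative smooth1 1 h x) (at z)"
      by (auto intro!: derivative_eq_intros)
    have "((\<lambda>z. z\<^sup>2 / 2) has_real_derivative z) (at z)"
      by (auto intro!: derivative_eq_intros)
    then have 3: "((\<lambda>z. z\<^sup>2 / 2 * smooth1 2 h x) has_real_derivative z * smooth1 2 h x) (at z)"
      using DERIV_mult[of "\<lambda>z. z\<^sup>2 / 2" z z UNIV "\<lambda>_. smooth1 2 h x" 0] by simp
    show "(f has_field_derivative (smooth1 1 h (x + z) - smooth1 1 h x - z * smooth1 2 h x)) (at z within {- \<bar>a\<bar>..\<bar>a\<bar>})"
      unfolding f_def by (rule has_field_derivative_at_within[OF DERIV_diff[OF DERIV_diff[OF 1 2] 3]])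
    have "\<bar>z\<bar> powr (1 + d) \<le> \<bar>a\<bar> powr (1 + d)" using z assms by (intro powr_mono2) auto
    then have "2 * hermite_const * \<bar>z\<bar> powr (1 + d) \<le> 2 * hermite_const * \<bar>a\<bar> powr (1 + d)"
      using hermite_const_nonneg by (intro mult_left_mono) auto
    then show "norm (smooth1 1 h (x + z) - smooth1 1 h x - z * smooth1 2 h x) \<le> 2 * hermite_const * \<bar>a\<bar> powr (1 + d)"
      using smooth1_1_taylor[OF assms, of x z] by simp
  qed auto
  moreover have "\<bar>a\<bar> powr (1 + d) * \<bar>a\<bar> = \<bar>a\<bar> powr (2 + d)"
    by (cases "a = 0") (auto simp: powr_add power2_eq_square)
  ultimately show ?thesis by (simp add: f_def mult.assoc)
qed

end

text \<open>For \<open>n \<le> 3\<close> the \<open>n\<close>-th derivative of the average of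
  \<open>h\<close> over a centered normal shift of standard deviation \<open>s\<close>; each
  differentiation contributes a factor \<open>1 / s\<close>.\<close>

definition gsmooth :: "nat \<Rightarrow> real \<Rightarrow> (real \<Rightarrow> real) \<Rightarrow> real \<Rightarrow> real" where
  "gsmooth n s h x = (\<integral>z. h (x + s * z) * hermite n z * std_normal_density z \<partial>lborel) / s ^ n"

context
  fixes h :: "real \<Rightarrow> real" and s :: real
  assumes lip: "\<And>x y. \<bar>h x - h y\<bar> \<le> \<bar>x - y\<bar>" and s: "s > 0"
begin

private lemma powr_scale: "s powr (- 1 - d) = 1 / (s * s powr d)"
  using s powr_add[of s 1 d] powr_minus_divide[of s "1 + d"] by (simp add: algebra_simps)

text \<open>Rescaling argument and value by \<open>s\<close> preserves the Lipschitz constant 1 and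
  reduces every scale to \<open>s = 1\<close>. The power \<open>- 1 - d\<close> of \<open>s\<close>
  in the bounds below arises in undoing it.\<close>

private definition "hs y = h (s * y) / s"

private lemma hs_lip: "\<bar>hs x - hs y\<bar> \<le> \<bar>x - y\<bar>"
proof -
  have "\<bar>hs x - hs y\<bar> = \<bar>h (s * x) - h (s * y)\<bar> / s"
    using s by (simp add: hs_def flip: diff_divide_distrib)
  also have "\<dots> \<le> \<bar>s * x - s * y\<bar> / s" using s by (intro divide_right_mono lip) auto
  also have "\<dots> = \<bar>x - y\<bar>" using s by (simp add: abs_mult flip: right_diff_distrib)
  finally show ?thesis .
qed

private lemma gsmooth_eq: "gsmooth n s h x = s * smooth1 n hs (x / s) / s ^ n"
proof -
  have "h (x + s * z) = s * hs (x / s + z)" for z using s by (simp add: hs_def distrib_left)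
  then show ?thesis by (simp add: gsmooth_def smooth1_def mult.assoc)
qed

lemma gsmooth_integrable: "integrable lborel (\<lambda>z. h (x + s * z) * hermite n z * std_normal_density z)"
proof -
  have "h (x + s * z) = s * hs (x / s + z)" for z using s by (simp add: hs_def distrib_left)
  then show ?thesis using smooth1_integrable[OF hs_lip, of "x / s" n] by (simp add: mult.assoc)
qed

lemma gsmooth_1_bound: "\<bar>gsmooth 1 s h x\<bar> \<le> hermite_const"
  using smooth1_bound[OF hs_lip, of 1 "x / s"] s by (simp add: gsmooth_eq)

lemma gsmooth_2_bound: "\<bar>gsmooth 2 s h x\<bar> \<le> hermite_const / s"
  using smooth1_bound[OF hs_lip, of 2 "x / s"] s
  by (simp add: gsmooth_eq power2_eq_square divide_right_mono)

lemma gsmooth_2_hoelder: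
  assumes d: "0 < d" "d \<le> 1"
  shows "\<bar>gsmooth 2 s h (x + a) - gsmooth 2 s h x\<bar> \<le> 2 * hermite_const * s powr (- 1 - d) * \<bar>a\<bar> powr d"
proof -
  have "gsmooth 2 s h (x + a) - gsmooth 2 s h x = (smooth1 2 hs (x / s + a / s) - smooth1 2 hs (x / s)) / s"
    using s by (simp add: gsmooth_eq power2_eq_square add_divide_distrib diff_divide_distrib)
  also have "\<bar>\<dots>\<bar> \<le> 2 * hermite_const * \<bar>a / s\<bar> powr d / s"
    using smooth1_2_hoelder[OF hs_lip d, of "x / s" "a / s"] s by (simp add: divide_right_mono)
  also have "\<dots> = 2 * hermite_const * s powr (- 1 - d) * \<bar>a\<bar> powr d"
    using s by (simp add: powr_divide powr_scale)
  finally show ?thesis .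
qed

lemma gsmooth_1_taylor:
  assumes d: "0 < d" "d \<le> 1"
  shows "\<bar>gsmooth 1 s h (x + a) - gsmooth 1 s h x - a * gsmooth 2 s h x\<bar>
    \<le> 2 * hermite_const * s powr (- 1 - d) * \<bar>a\<bar> powr (1 + d)"
proof -
  have "gsmooth 1 s h (x + a) - gsmooth 1 s h x - a * gsmooth 2 s h x
    = smooth1 1 hs (x / s + a / s) - smooth1 1 hs (x / s) - a / s * smooth1 2 hs (x / s)"
    using s by (simp add: gsmooth_eq power2_eq_square add_divide_distrib)
  also have "\<bar>\<dots>\<bar> \<le> 2 * hermite_const * \<bar>a / s\<bar> powr (1 + d)"
    by (rule smooth1_1_taylor[OF hs_lip d])
  also have "\<dots> = 2 * hermite_const * s powr (- 1 - d) * \<bar>a\<bar> powr (1 + d)"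
    using s by (simp add: powr_divide powr_scale powr_add)
  finally show ?thesis .
qed

lemma gsmooth_0_taylor:
  assumes d: "0 < d" "d \<le> 1"
  shows "\<bar>gsmooth 0 s h (x + a) - gsmooth 0 s h x - a * gsmooth 1 s h x - a\<^sup>2 / 2 * gsmooth 2 s h x\<bar>
    \<le> 2 * hermite_const * s powr (- 1 - d) * \<bar>a\<bar> powr (2 + d)"
proof -
  have "gsmooth 0 s h (x + a) - gsmooth 0 s h x - a * gsmooth 1 s h x - a\<^sup>2 / 2 * gsmooth 2 s h x
    = s * (smooth1 0 hs (x / s + a / s) - smooth1 0 hs (x / s) - a / s * smooth1 1 hs (x / s)
       - (a / s)\<^sup>2 / 2 * smooth1 2 hs (x / s))"
    using s by (simp add: gsmooth_eq power2_eq_square add_divide_distrib right_diff_distrib)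
  also have "\<bar>\<dots>\<bar> \<le> s * (2 * hermite_const * \<bar>a / s\<bar> powr (2 + d))"
    using s smooth1_0_taylor[OF hs_lip d, of "x / s" "a / s"] by (simp add: abs_mult)
  also have "\<dots> = 2 * hermite_const * s powr (- 1 - d) * \<bar>a\<bar> powr (2 + d)"
    using s by (simp add: powr_divide powr_scale powr_add power2_eq_square)
  finally show ?thesis .
qed

lemma gsmooth_0_lip: "\<bar>gsmooth 0 s h x - gsmooth 0 s h y\<bar> \<le> \<bar>x - y\<bar>"
proof -
  let ?f = "\<lambda>x z. h (x + s * z) * hermite 0 z * std_normal_density z"
  have "\<bar>\<integral>z. ?f x z - ?f y z \<partial>lborel\<bar> \<le> (\<integral>z. \<bar>x - y\<bar> * std_normal_density z \<partial>lborel)"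
  proof (rule integral_abs_bound[THEN order_trans], rule integral_mono)
    fix z
    have "\<bar>h (x + s * z) - h (y + s * z)\<bar> * std_normal_density z \<le> \<bar>x - y\<bar> * std_normal_density z"
      using lip[of "x + s * z" "y + s * z"] by (intro mult_right_mono) auto
    then show "\<bar>?f x z - ?f y z\<bar> \<le> \<bar>x - y\<bar> * std_normal_density z"
      by (simp add: abs_mult hermite_def flip: left_diff_distrib)
  qed (intro integrable_abs Bochner_Integration.integrable_diff gsmooth_integrable, simp)
  moreover have "(\<integral>z. \<bar>x - y\<bar> * std_normal_density z \<partial>lborel) = \<bar>x - y\<bar>" by simp
  moreover have "gsmooth 0 s h x - gsmooth 0 s h y = (\<integral>z. ?f x z - ?f y z \<partial>lborel)"
    unfolding gsmooth_def by (subst Bochner_Integration.integral_diff[OF gsmooth_integrable gsmooth_integrable]) simp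
  ultimately show ?thesis by linarith
qed

lemma gsmooth_0_near: "\<bar>gsmooth 0 s h x - h x\<bar> \<le> hermite_const * s"
proof -
  have "gsmooth 0 s h x - h x = s * (smooth1 0 hs (x / s) - smooth1 0 (\<lambda>_. hs (x / s)) (x / s))"
    using s by (simp add: gsmooth_eq smooth1_def hermite_def hs_def right_diff_distrib)
  also have "\<bar>\<dots>\<bar> \<le> s * hermite_const"
    using s smooth1_bound_aux[OF hs_lip, of 0 "x / s"] hermite_const_ge[of 0] by (simp add: abs_mult)
  finally show ?thesis by (simp add: mult.commute)
qed

end

section \<open>Scaling and convolution of normal laws\<close>

lemma integral_normal_density_scale:
  fixes f :: "real \<Rightarrow> real"
  assumes "s > 0"
  shows "(\<integral>z. f (s * z) * std_normal_density z \<partial>lborel) = (\<integral>y. f y * normal_density 0 s y \<partial>lborel)"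
proof -
  have "std_normal_density z = s * normal_density 0 s (s * z)" for z
    using assms by (simp add: normal_density_def power_mult_distrib real_sqrt_mult)
  then show ?thesis
    using assms by (subst lborel_integral_real_affine[where c = s and t = 0 and f = "\<lambda>y. f y * normal_density 0 s y"])
      (simp_all add: ac_simps)
qed

lemma integral_normal_density_sum:
  fixes f :: "real \<Rightarrow> real"
  assumes s: "s > 0" "t > 0" and [measurable]: "f \<in> borel_measurable borel"
    and int: "integrable lborel (\<lambda>y. f y * normal_density 0 (sqrt (s\<^sup>2 + t\<^sup>2)) y)"
  shows "(\<integral>x. (\<integral>y. f (x + y) * normal_density 0 s y \<partial>lborel) * normal_density 0 t x \<partial>lborel)
     = (\<integral>y. f y * normal_density 0 (sqrt (s\<^sup>2 + t\<^sup>2)) y \<partial>lborel)"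
proof -
  define N where "N u = density lborel (\<lambda>x. ennreal (normal_density 0 u x))" for u
  have prob: "prob_space (N u)" if "u > 0" for u
    unfolding N_def by (rule prob_space_normal_density) (rule that)
  interpret S: prob_space "N s" by (rule prob) (rule s)
  interpret T: prob_space "N t" by (rule prob) (rule s)
  interpret P: pair_prob_space "N t" "N s" ..
  have intN: "(\<integral>x. g x \<partial>N u) = (\<integral>x. g x * normal_density 0 u x \<partial>lborel)"
    if [measurable]: "g \<in> borel_measurable borel" for g :: "real \<Rightarrow> real" and u
    unfolding N_def by (subst integral_real_density) (auto simp: mult.commute)
  have [measurable_cong]: "sets (N u) = sets borel" for u by (simp add: N_def)
  have conv: "convolution (N t) (N s) = N (sqrt (s\<^sup>2 + t\<^sup>2))"
  proof -
    have "convolution (N t) (N s) = density lborel (\<lambda>x. \<integral>\<^sup>+y. ennreal (normal_density 0 t (x - y)) * ennreal (normal_density 0 s y) \<partial>lborel)"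
      unfolding N_def
      by (rule convolution_density) (use prob s in \<open>auto simp: N_def prob_space_def\<close>)
    also have "\<dots> = density lborel (\<lambda>x. ennreal (normal_density 0 (sqrt (t\<^sup>2 + s\<^sup>2)) x))"
      using fun_cong[OF conv_normal_density_zero_mean[OF s(2,1)]]
      by (intro density_cong) (auto simp: ennreal_mult[symmetric])
    finally show ?thesis by (simp add: N_def add.commute)
  qed
  have i: "integrable (N (sqrt (s\<^sup>2 + t\<^sup>2))) f"
    unfolding N_def using int by (subst integrable_real_density) (auto simp: mult.commute)
  have "(\<integral>y. f y * normal_density 0 (sqrt (s\<^sup>2 + t\<^sup>2)) y \<partial>lborel) = (\<integral>x. f x \<partial>convolution (N t) (N s))"
    unfolding conv by (rule intN[symmetric]) simp
  also have "\<dots> = (\<integral>p. f (fst p + snd p) \<partial>(N t \<Otimes>\<^sub>M N s))"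
    unfolding convolution_def by (subst integral_distr) (auto simp: case_prod_unfold)
  also have "\<dots> = (\<integral>x. (\<integral>y. f (x + y) \<partial>N s) \<partial>N t)"
  proof -
    have "integrable (distr (N t \<Otimes>\<^sub>M N s) borel (\<lambda>(x, y). x + y)) f"
      using i unfolding conv[symmetric] convolution_def .
    then have "integrable (N t \<Otimes>\<^sub>M N s) (\<lambda>p. f (case p of (x, y) \<Rightarrow> x + y))"
      by (subst (asm) integrable_distr_eq) auto
    then have "integrable (N t \<Otimes>\<^sub>M N s) (\<lambda>(x, y). f (x + y))" by (simp add: case_prod_unfold)
    from P.integral_fst'[OF this] show ?thesis by (simp add: case_prod_unfold)
  qed
  also have "\<dots> = (\<integral>x. (\<integral>y. f (x + y) * normal_density 0 s y \<partial>lborel) * normal_density 0 t x \<partial>lborel)"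
    by (subst intN, measurable, subst intN, measurable)
  finally show ?thesis by simp
qed

text \<open>Variances of independent normal variables add. Additional smoothing thus becomes an
  average over shifts, to which a Taylor expansion applies.\<close>

lemma gsmooth_semigroup:
  fixes h :: "real \<Rightarrow> real"
  assumes lip: "\<And>x y. \<bar>h x - h y\<bar> \<le> \<bar>x - y\<bar>" and s: "s > 0" "t > 0"
  shows "(\<integral>z. gsmooth 0 s h (x + t * z) * std_normal_density z \<partial>lborel) = gsmooth 0 (sqrt (s\<^sup>2 + t\<^sup>2)) h x"
proof -
  have [measurable]: "h \<in> borel_measurable borel" by (rule lip_measurable[OF lip])
  have g: "gsmooth 0 u h y = (\<integral>v. h (y + v) * normal_density 0 u v \<partial>lborel)" if "u > 0" for u y
    using integral_normal_density_scale[OF that, of "\<lambda>v. h (y + v)"] by (simp add: gsmooth_def hermite_def)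
  have pos: "sqrt (s\<^sup>2 + t\<^sup>2) > 0" using s by (simp add: add_pos_pos)
  have int: "integrable lborel (\<lambda>y. h (x + y) * normal_density 0 (sqrt (s\<^sup>2 + t\<^sup>2)) y)"
  proof (rule integrable_normal_growth[where c = "\<bar>h x\<bar> + 1"])
    show "\<bar>h (x + z)\<bar> \<le> (\<bar>h x\<bar> + 1 + \<bar>z\<bar>) ^ 4" for z
    proof -
      have "\<bar>h x\<bar> + 1 + \<bar>z\<bar> \<le> (\<bar>h x\<bar> + 1 + \<bar>z\<bar>) ^ 4"
        using power_increasing[of 1 4 "\<bar>h x\<bar> + 1 + \<bar>z\<bar>"] by simp
      then show ?thesis using lip_growth[OF lip, of x z] by linarith
    qed
  qed (use pos in auto)
  have "(\<integral>z. gsmooth 0 s h (x + t * z) * std_normal_density z \<partial>lborel)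
     = (\<integral>z. gsmooth 0 s h (x + z) * normal_density 0 t z \<partial>lborel)"
    by (rule integral_normal_density_scale[OF s(2)])
  also have "\<dots> = (\<integral>z. (\<integral>v. h (x + (z + v)) * normal_density 0 s v \<partial>lborel) * normal_density 0 t z \<partial>lborel)"
    by (simp add: g[OF s(1)] add.assoc)
  also have "\<dots> = gsmooth 0 (sqrt (s\<^sup>2 + t\<^sup>2)) h x"
    unfolding g[OF pos] by (rule integral_normal_density_sum[OF s _ int]) simp
  finally show ?thesis .
qed

section \<open>Gaussian approximation of one block\<close>

lemma (in prob_space) integrable_bounded_mult:
  fixes f g :: "'a \<Rightarrow> real"
  assumes "integrable M g" "f \<in> borel_measurable M" "\<And>x. \<bar>f x\<bar> \<le> c"
  shows "integrable M (\<lambda>x. f x * g x)"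
proof (rule Bochner_Integration.integrable_bound)
  show "integrable M (\<lambda>x. c * \<bar>g x\<bar>)" using assms by simp
  show "AE x in M. norm (f x * g x) \<le> norm (c * \<bar>g x\<bar>)"
  proof (rule AE_I2)
    fix x
    have "\<bar>f x\<bar> * \<bar>g x\<bar> \<le> c * \<bar>g x\<bar>" by (intro mult_right_mono assms) auto
    moreover have "c \<ge> 0" using assms(3)[of x] by linarith
    ultimately show "norm (f x * g x) \<le> norm (c * \<bar>g x\<bar>)" by (simp add: abs_mult)
  qed
qed (use assms in auto)

lemma (in prob_space) abs_expectation_le:
  fixes f g :: "'a \<Rightarrow> real"
  assumes "integrable M g" "f \<in> borel_measurable M" "\<And>x. \<bar>f x\<bar> \<le> g x"
  shows "integrable M f" "\<bar>expectation f\<bar> \<le> expectation g"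
proof -
  show i: "integrable M f"
    by (rule Bochner_Integration.integrable_bound[OF assms(1,2)])
      (use assms(3) in \<open>auto intro!: AE_I2 order_trans[OF assms(3)]\<close>)
  show "\<bar>expectation f\<bar> \<le> expectation g"
    by (rule order_trans[OF integral_abs_bound]) (use i assms in \<open>auto intro!: integral_mono\<close>)
qed

lemma powr_product_le:
  fixes A x e1 e2 t :: real
  assumes "0 \<le> A" "0 \<le> x" "0 \<le> e1" "0 \<le> e2" "0 < e1 + e2" "e1 + e2 \<le> t"
  shows "A powr e1 * x powr e2 \<le> 1 + A powr t + x powr t"
proof -
  let ?z = "max A x"
  have "A powr e1 * x powr e2 \<le> ?z powr e1 * ?z powr e2"
    using assms by (intro mult_mono powr_mono2) auto
  also have "\<dots> = ?z powr (e1 + e2)" by (simp add: powr_add)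
  also have "\<dots> \<le> 1 + ?z powr t"
  proof (cases "?z \<le> 1")
    case True
    then have "?z powr (e1 + e2) \<le> 1" using assms powr_mono2[of "e1 + e2" ?z 1] by simp
    then show ?thesis using powr_ge_zero[of ?z t] by linarith
  next
    case False
    then have "?z powr (e1 + e2) \<le> ?z powr t" using assms by (intro powr_mono) auto
    then show ?thesis by simp
  qed
  also have "?z powr t \<le> A powr t + x powr t"
    by (cases "A \<le> x") (auto simp: max_def)
  finally show ?thesis by simp
qed

lemma powr_shift_le:
  assumes "j \<ge> 1" "s \<ge> 0"
  shows "real j powr (- s) \<le> 2 powr s * (real j + 1) powr (- s)"
proof -
  have "real j powr (- s) \<le> ((real j + 1) / 2) powr (- s)"
    using assms by (intro powr_mono2') auto
  also have "\<dots> = 2 powr s * (real j + 1) powr (- s)"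
    by (simp add: powr_divide powr_minus field_simps)
  finally show ?thesis .
qed

context mixing_sequence
begin

text \<open>The rate for a bounded past factor against a product of two variables: such a product
  has moments of order \<open>(2 + \<delta>) / 2\<close>, and
  \<open>\<delta> / (2 + \<delta>)\<close> is the reciprocal of the conjugate exponent.\<close>

abbreviation arate :: real where "arate \<equiv> \<theta> * (\<delta> / (2 + \<delta>))"

text \<open>Controls how far the partial sum moves over at most \<open>L\<close> indices. Divided by
  \<open>L\<close>, it has moments bounded independently of \<open>L\<close> without any use of
  cancellation.\<close>

definition abs_block :: "nat \<Rightarrow> nat \<Rightarrow> 'a \<Rightarrow> real" where
  "abs_block q l \<omega> = (\<Sum>i<l. \<bar>X (q + i) \<omega>\<bar>)"

lemma abs_block_meas [measurable]: "abs_block q l \<in> borel_measurable M"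
  unfolding abs_block_def by measurable

lemma abs_block_nonneg: "abs_block q l \<omega> \<ge> 0"
  unfolding abs_block_def by (rule sum_nonneg) simp

lemma abs_block_sum_le: "\<bar>block_sum q l \<omega>\<bar> \<le> abs_block q l \<omega>"
  unfolding block_sum_def abs_block_def by (rule sum_abs)

lemma rate_pos: "rate > 0" using \<theta>_pos \<delta>_pos by simp

lemma abs_block_mean_moment:
  assumes "1 \<le> L" "l \<le> L"
  shows "integrable M (\<lambda>\<omega>. (abs_block q l \<omega> / real L) powr mord)"
    and "expectation (\<lambda>\<omega>. (abs_block q l \<omega> / real L) powr mord) \<le> c\<^sub>X powr mord"
proof -
  have e: "(abs_block q l \<omega> / real L) powr mord = abs_block q l \<omega> powr mord / real L powr mord" for \<omega>
    by (simp add: powr_divide abs_block_nonneg)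
  note m = abs_sum_moment[of q l, folded abs_block_def]
  show "integrable M (\<lambda>\<omega>. (abs_block q l \<omega> / real L) powr mord)"
    unfolding e using m(1) by simp
  have "expectation (\<lambda>\<omega>. (abs_block q l \<omega> / real L) powr mord) = expectation (\<lambda>\<omega>. abs_block q l \<omega> powr mord) / real L powr mord"
    unfolding e by simp
  also have "\<dots> \<le> (real l * c\<^sub>X) powr mord / real L powr mord"
    by (intro divide_right_mono m(2)) auto
  also have "\<dots> \<le> (real L * c\<^sub>X) powr mord / real L powr mord"
    using assms cX_ge1 \<delta>_pos by (intro divide_right_mono powr_mono2 mult_right_mono) auto
  also have "\<dots> = c\<^sub>X powr mord" using assms cX_ge1 by (simp add: powr_mult)
  finally show "expectation (\<lambda>\<omega>. (abs_block q l \<omega> / real L) powr mord) \<le> c\<^sub>X powr mord" .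
qed

lemma abs_block_mixed_moment:
  assumes "1 \<le> L" "l \<le> L" "0 \<le> e1" "0 \<le> e2" "0 < e1 + e2" "e1 + e2 \<le> mord"
  shows "integrable M (\<lambda>\<omega>. (abs_block q l \<omega> / real L) powr e1 * \<bar>X k \<omega>\<bar> powr e2)"
    and "expectation (\<lambda>\<omega>. (abs_block q l \<omega> / real L) powr e1 * \<bar>X k \<omega>\<bar> powr e2) \<le> 2 * mom_const"
proof -
  let ?A = "\<lambda>\<omega>. abs_block q l \<omega> / real L"
  have le: "?A \<omega> powr e1 * \<bar>X k \<omega>\<bar> powr e2 \<le> 1 + ?A \<omega> powr mord + \<bar>X k \<omega>\<bar> powr mord" for \<omega>
    by (rule powr_product_le) (use assms abs_block_nonneg in auto)
  note m = abs_block_mean_moment[OF assms(1,2), of q]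
  have i: "integrable M (\<lambda>\<omega>. 1 + ?A \<omega> powr mord + \<bar>X k \<omega>\<bar> powr mord)" using m(1) moment_int by simp
  show i': "integrable M (\<lambda>\<omega>. ?A \<omega> powr e1 * \<bar>X k \<omega>\<bar> powr e2)"
    by (rule integrable_nonneg_bound[OF i _ _ le]) auto
  have "expectation (\<lambda>\<omega>. ?A \<omega> powr e1 * \<bar>X k \<omega>\<bar> powr e2) \<le> expectation (\<lambda>\<omega>. 1 + ?A \<omega> powr mord + \<bar>X k \<omega>\<bar> powr mord)"
    by (rule integral_mono[OF i' i le])
  also have "\<dots> = 1 + expectation (\<lambda>\<omega>. ?A \<omega> powr mord) + expectation (\<lambda>\<omega>. \<bar>X k \<omega>\<bar> powr mord)"
    using m(1) moment_int by (simp add: prob_space)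
  also have "\<dots> \<le> 2 * mom_const" using m(2) moment[of k] by (simp add: mom_const_def)
  finally show "expectation (\<lambda>\<omega>. ?A \<omega> powr e1 * \<bar>X k \<omega>\<bar> powr e2) \<le> 2 * mom_const" .
qed

lemma abs_block_lower_moment:
  assumes "1 \<le> L" "l \<le> L" "0 < e" "e \<le> mord"
  shows "integrable M (\<lambda>\<omega>. (abs_block q l \<omega> / real L) powr e)"
    and "expectation (\<lambda>\<omega>. (abs_block q l \<omega> / real L) powr e) \<le> mom_const"
proof -
  let ?A = "\<lambda>\<omega>. abs_block q l \<omega> / real L"
  have le: "?A \<omega> powr e \<le> 1 + ?A \<omega> powr mord" for \<omega>
    by (rule powr_le_1_plus_powr) (use assms abs_block_nonneg in auto)
  note m = abs_block_mean_moment[OF assms(1,2), of q]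
  have i: "integrable M (\<lambda>\<omega>. 1 + ?A \<omega> powr mord)" using m(1) by simp
  show i': "integrable M (\<lambda>\<omega>. ?A \<omega> powr e)"
    by (rule integrable_nonneg_bound[OF i _ _ le]) auto
  have "expectation (\<lambda>\<omega>. ?A \<omega> powr e) \<le> expectation (\<lambda>\<omega>. 1 + ?A \<omega> powr mord)"
    by (rule integral_mono[OF i' i le])
  also have "\<dots> \<le> mom_const" using m by (simp add: prob_space mom_const_def)
  finally show "expectation (\<lambda>\<omega>. ?A \<omega> powr e) \<le> mom_const" .
qed

lemma X_square_moment: "expectation (\<lambda>\<omega>. (X k \<omega>)\<^sup>2) \<le> mom_const"
proof -
  have "(X k \<omega>)\<^sup>2 = \<bar>X k \<omega>\<bar> powr 2" for \<omega> by (cases "X k \<omega> = 0") auto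
  then show ?thesis using X_lower_moment(2)[of 2 k] \<delta>_pos by simp
qed

text \<open>Together with \<open>xx_mix\<close>, the constants of the two bounds that
  \<open>XX_covariance\<close> interpolates: decay in the lag between two variables, and mixing
  across the gap before them.\<close>

definition xx_decay :: real where
  "xx_decay = 2 powr rate * cov_const * mom_const + mom_const + gamma_const"

definition xx_mix :: real where
  "xx_mix = 16 * c\<^sub>\<phi> powr (\<delta> / (2 + \<delta>)) * mom_const"

text \<open>Two estimates are combined. Splitting off the later variable \<open>X k\<close> gives
  decay in the lag \<open>k - i\<close>. Treating the product as one future variable, whose mean is
  the autocovariance, gives decay in the gap \<open>g\<close>. Their geometric mean decays in both
  at half the rates, and it is summable in the lag when \<open>rate > 2\<close>.\<close>

lemma XX_covariance:
  assumes Y: "Y \<in> borel_measurable (past n)" and Yc: "\<And>\<omega>. \<bar>Y \<omega>\<bar> \<le> c" and c: "c > 0"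
    and i: "i = n + g" and ik: "i \<le> k"
  shows "\<bar>expectation (\<lambda>\<omega>. Y \<omega> * (X i \<omega> * X k \<omega> - autocov M X (k - i)))\<bar>
    \<le> c * sqrt (xx_decay * xx_mix) * ((real (k - i) + 1) powr (- rate / 2) * (real g + 1) powr (- arate / 2))"
proof -
  have [measurable]: "Y \<in> borel_measurable M" using Y by (rule past_measurable)
  let ?Z = "\<lambda>\<omega>. X i \<omega> * X k \<omega>" and ?G = "autocov M X (k - i)"
  define v where "v = expectation (\<lambda>\<omega>. Y \<omega> * (?Z \<omega> - ?G))"
  have Yi: "integrable M Y"
    using integrable_bounded_mult[of "\<lambda>_. 1" Y c] Yc by simp
  have YZi: "integrable M (\<lambda>\<omega>. Y \<omega> * ?Z \<omega>)"
    by (rule integrable_bounded_mult[OF X_mult_int]) (use Yc in auto)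
  have EY: "\<bar>expectation Y\<bar> \<le> c"
    using abs_expectation_le(2)[of "\<lambda>_. c" Y] Yc by (simp add: prob_space)
  have v: "v = expectation (\<lambda>\<omega>. Y \<omega> * ?Z \<omega>) - ?G * expectation Y"
    unfolding v_def using Yi YZi by (simp add: right_diff_distrib mult.commute)
  \<comment> \<open>For \<open>i < k\<close> the product \<open>Y * X i\<close> is the past factor
    of \<open>X k\<close>. For \<open>i = k\<close> the lag is 0, and a bound by the second moment
    is enough.\<close>
  have A: "\<bar>v\<bar> \<le> c * (xx_decay * (real (k - i) + 1) powr (- rate))"
  proof -
    have G: "\<bar>?G * expectation Y\<bar> \<le> (gamma_const * (real (k - i) + 1) powr (- rate)) * c"
      unfolding abs_mult by (intro mult_mono autocov_le EY) (use gamma_const_pos in auto)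
    have "\<bar>expectation (\<lambda>\<omega>. Y \<omega> * ?Z \<omega>)\<bar> \<le> (2 powr rate * cov_const * mom_const + mom_const) * (real (k - i) + 1) powr (- rate) * c"
    proof (cases "i = k")
      case True
      have sq: "integrable M (\<lambda>\<omega>. (X k \<omega>)\<^sup>2)" using X_mult_int[of k k] by (simp add: power2_eq_square)
      have "\<bar>expectation (\<lambda>\<omega>. Y \<omega> * ?Z \<omega>)\<bar> \<le> expectation (\<lambda>\<omega>. c * (X k \<omega>)\<^sup>2)"
        using Yc True sq by (intro abs_expectation_le(2)) (auto simp: abs_mult power2_eq_square intro!: mult_right_mono)
      also have "\<dots> \<le> c * mom_const" using X_square_moment[of k] c by simp
      also have "\<dots> \<le> (2 powr rate * cov_const * mom_const + mom_const) * c"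
        using cov_const_pos mom_const_ge1 c by simp
      finally show ?thesis using True by simp
    next
      case False
      then have lt: "i < k" using ik by simp
      have YX: "(\<lambda>\<omega>. Y \<omega> * X i \<omega>) \<in> borel_measurable (past (Suc i))"
        using past_mono[OF Y, of "Suc i"] X_past[of i "Suc i"] i by simp
      have a: "0 < (2 + \<delta>) / (1 + \<delta>)" "(2 + \<delta>) / (1 + \<delta>) \<le> mord" using \<delta>_pos by (auto simp: field_simps)
      have "\<bar>expectation (\<lambda>\<omega>. Y \<omega> * X i \<omega> * X (Suc i + (k - i - 1)) \<omega>)\<bar>
          \<le> cov_const * (real (k - i - 1) + 1) powr (- rate) * (c * mom_const)"
        by (rule past_times_X_dominated(2)[OF YX, where W = "\<lambda>\<omega>. \<bar>X i \<omega>\<bar>"])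
          (use Yc c mom_const_ge1 X_lower_moment[OF a] in \<open>auto simp: abs_mult intro!: mult_right_mono\<close>)
      moreover have "Suc i + (k - i - 1) = k" "real (k - i - 1) + 1 = real (k - i)" using lt by auto
      ultimately have "\<bar>expectation (\<lambda>\<omega>. Y \<omega> * ?Z \<omega>)\<bar> \<le> cov_const * real (k - i) powr (- rate) * (c * mom_const)"
        by (simp add: mult.assoc)
      also have "\<dots> \<le> cov_const * (2 powr rate * (real (k - i) + 1) powr (- rate)) * (c * mom_const)"
        using lt cov_const_pos c mom_const_ge1 rate_pos
        by (intro mult_right_mono mult_left_mono powr_shift_le) auto
      also have "\<dots> = (2 powr rate * cov_const * mom_const) * (real (k - i) + 1) powr (- rate) * c" by simp
      also have "\<dots> \<le> (2 powr rate * cov_const * mom_const + mom_const) * (real (k - i) + 1) powr (- rate) * c"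
        using c mom_const_ge1 by (intro mult_right_mono) auto
      finally show ?thesis .
    qed
    with G have "\<bar>v\<bar> \<le> (2 powr rate * cov_const * mom_const + mom_const) * (real (k - i) + 1) powr (- rate) * c
      + (gamma_const * (real (k - i) + 1) powr (- rate)) * c" unfolding v by linarith
    then show ?thesis by (simp add: xx_decay_def algebra_simps)
  qed
  \<comment> \<open>\<open>Y\<close> is bounded, so it has moments of every order, in particular of
    the order conjugate to the integrability of the product.\<close>
  have B: "\<bar>v\<bar> \<le> c * (xx_mix * (real g + 1) powr (- arate))"
  proof -
    let ?a = "(2 + \<delta>) / \<delta>" and ?b = "(2 + \<delta>) / 2" and ?U = "2 * mom_const"
    have "1 / ?a + 1 / ?b = \<delta> / (2 + \<delta>) + 2 / (2 + \<delta>)"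
      by (simp only: divide_divide_eq_right mult_1_left)
    also have "\<dots> = (\<delta> + 2) / (2 + \<delta>)" by (rule add_divide_distrib[symmetric])
    also have "\<dots> = 1" using \<delta>_pos by simp
    finally have "1 / ?a + 1 / ?b = 1" .
    then have ab: "?a > 1" "?b > 1" "1 / ?a + 1 / ?b = 1" using \<delta>_pos by (auto simp: less_divide_eq)
    have Yle: "\<bar>Y \<omega>\<bar> powr ?a \<le> c powr ?a" for \<omega> using Yc ab by (intro powr_mono2) auto
    have Ya: "integrable M (\<lambda>x. \<bar>Y x\<bar> powr ?a)"
      by (rule integrable_nonneg_bound[OF _ _ _ Yle]) auto
    have YV: "expectation (\<lambda>x. \<bar>Y x\<bar> powr ?a) \<le> c powr ?a"
      using integral_mono[OF Ya _ Yle] by (simp add: prob_space)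
    have Zle: "\<bar>?Z \<omega>\<bar> powr ?b \<le> 1 + \<bar>X i \<omega>\<bar> powr mord + \<bar>X k \<omega>\<bar> powr mord" for \<omega>
    proof -
      have "\<bar>?Z \<omega>\<bar> powr ?b = \<bar>X i \<omega>\<bar> powr ?b * \<bar>X k \<omega>\<bar> powr ?b" by (simp add: abs_mult powr_mult)
      also have "\<dots> \<le> 1 + \<bar>X i \<omega>\<bar> powr mord + \<bar>X k \<omega>\<bar> powr mord"
        by (rule powr_product_le) (use \<delta>_pos in auto)
      finally show ?thesis .
    qed
    have Zi: "integrable M (\<lambda>\<omega>. 1 + \<bar>X i \<omega>\<bar> powr mord + \<bar>X k \<omega>\<bar> powr mord)" using moment_int by simp
    have Zb: "integrable M (\<lambda>\<omega>. \<bar>?Z \<omega>\<bar> powr ?b)"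
      by (rule integrable_nonneg_bound[OF Zi _ _ Zle]) auto
    have "expectation (\<lambda>\<omega>. \<bar>?Z \<omega>\<bar> powr ?b) \<le> 1 + expectation (\<lambda>\<omega>. \<bar>X i \<omega>\<bar> powr mord) + expectation (\<lambda>\<omega>. \<bar>X k \<omega>\<bar> powr mord)"
      using integral_mono[OF Zb Zi Zle] moment_int by (simp add: prob_space)
    also have "\<dots> \<le> ?U" using moment[of i] moment[of k] by (simp add: mom_const_def)
    also have "?U \<le> ?U powr ?b" using powr_mono[of 1 ?b ?U] ab mom_const_ge1 by simp
    finally have ZU: "expectation (\<lambda>\<omega>. \<bar>?Z \<omega>\<bar> powr ?b) \<le> ?U powr ?b" .
    have "\<bar>expectation (\<lambda>x. Y x * ?Z x) - expectation Y * expectation ?Z\<bar>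
       \<le> 8 * c\<^sub>\<phi> powr (1 / ?a) * (real g + 1) powr (- \<theta> / ?a) * c * ?U"
    proof (rule past_covariance[OF Y _ ab c _ Ya YV Zb ZU])
      have "X i \<in> borel_measurable (gen_algebra M X {n + g..n + g + (k - i)})"
        "X k \<in> borel_measurable (gen_algebra M X {n + g..n + g + (k - i)})"
        using i ik by (auto intro!: measurable_gen_algebra)
      then show "?Z \<in> borel_measurable (gen_algebra M X {n + g..n + g + (k - i)})" by measurable
    qed (use mom_const_ge1 in auto)
    moreover have "expectation ?Z = ?G" using stationary[of i "k - i"] ik by simp
    moreover have "- \<theta> / ?a = - arate" by simp
    moreover have "1 / ?a = \<delta> / (2 + \<delta>)" by simp
    ultimately have "\<bar>v\<bar> \<le> 8 * c\<^sub>\<phi> powr (\<delta> / (2 + \<delta>)) * (real g + 1) powr (- arate) * c * ?U"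
      unfolding v by (simp only: mult.commute[of ?G])
    also have "\<dots> = c * (xx_mix * (real g + 1) powr (- arate))" by (simp add: xx_mix_def)
    finally show ?thesis .
  qed
  let ?x = "(real (k - i) + 1) powr (- rate)" and ?y = "(real g + 1) powr (- arate)"
  have "\<bar>v\<bar> * \<bar>v\<bar> \<le> (c * (xx_decay * ?x)) * (c * (xx_mix * ?y))"
    by (intro mult_mono A B order_trans[OF abs_ge_zero A]) auto
  then have "v\<^sup>2 \<le> (c * c) * ((xx_decay * xx_mix) * (?x * ?y))"
    by (simp add: power2_eq_square ac_simps)
  then have "\<bar>v\<bar> \<le> sqrt ((c * c) * ((xx_decay * xx_mix) * (?x * ?y)))"
    by (intro real_le_rsqrt) simp
  also have "\<dots> = c * sqrt (xx_decay * xx_mix) * (sqrt ?x * sqrt ?y)"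
    using c by (simp add: real_sqrt_mult)
  also have "sqrt ?x = (real (k - i) + 1) powr (- rate / 2)"
    by (simp add: powr_half_sqrt[symmetric] powr_powr)
  also have "sqrt ?y = (real g + 1) powr (- arate / 2)"
    by (simp add: powr_half_sqrt[symmetric] powr_powr)
  finally show ?thesis by (simp add: v_def)
qed

end

lemma gauss_powr_integrable:
  assumes "0 < e"
  shows "integrable lborel (\<lambda>z. \<bar>z\<bar> powr e * std_normal_density z)"
proof (rule Bochner_Integration.integrable_bound)
  let ?k = "nat \<lceil>e\<rceil>"
  show "integrable lborel (\<lambda>z. std_normal_density z + std_normal_density z * \<bar>z\<bar> ^ ?k)"
    using integrable_std_normal_moment_abs[of ?k] by simp
  show "AE z in lborel. norm (\<bar>z\<bar> powr e * std_normal_density z) \<le> norm (std_normal_density z + std_normal_density z * \<bar>z\<bar> ^ ?k)"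
  proof (rule AE_I2)
    fix z :: real
    have "\<bar>z\<bar> powr e \<le> 1 + \<bar>z\<bar> ^ ?k"
    proof (cases "\<bar>z\<bar> \<le> 1")
      case True
      then have "\<bar>z\<bar> powr e \<le> 1" using assms powr_mono2[of e "\<bar>z\<bar>" 1] by simp
      then show ?thesis using zero_le_power_abs[of z ?k] by linarith
    next
      case False
      then have "\<bar>z\<bar> powr e \<le> \<bar>z\<bar> powr real ?k" using assms by (intro powr_mono) auto
      then show ?thesis using False by (simp add: powr_realpow)
    qed
    then have "\<bar>z\<bar> powr e * std_normal_density z \<le> (1 + \<bar>z\<bar> ^ ?k) * std_normal_density z"
      by (rule mult_right_mono) simp
    then show "norm (\<bar>z\<bar> powr e * std_normal_density z) \<le> norm (std_normal_density z + std_normal_density z * \<bar>z\<bar> ^ ?k)"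
      by (simp add: algebra_simps)
  qed
qed measurable

definition gauss_moment :: "real \<Rightarrow> real" where
  "gauss_moment e = (\<integral>z. \<bar>z\<bar> powr e * std_normal_density z \<partial>lborel)"

lemma gauss_moment_nonneg: "gauss_moment e \<ge> 0"
  unfolding gauss_moment_def by (rule integral_nonneg_AE) simp

text \<open>A Taylor expansion averaged over a normal shift of standard deviation \<open>t\<close>:
  the linear term has mean zero, the square contributes \<open>t\<^sup>2 / 2\<close>. The semigroup
  property identifies the average itself.\<close>

lemma gsmooth_gauss_step:
  fixes h :: "real \<Rightarrow> real"
  assumes lip: "\<And>x y. \<bar>h x - h y\<bar> \<le> \<bar>x - y\<bar>" and s: "s > 0" "t > 0" and d: "0 < d" "d \<le> 1"
  shows "\<bar>gsmooth 0 (sqrt (s\<^sup>2 + t\<^sup>2)) h x - gsmooth 0 s h x - t\<^sup>2 / 2 * gsmooth 2 s h x\<bar>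
    \<le> 2 * hermite_const * s powr (- 1 - d) * (t powr (2 + d) * gauss_moment (2 + d))"
proof -
  let ?g = "\<lambda>n. gsmooth n s h x" and ?C = "2 * hermite_const * s powr (- 1 - d)"
  have lip0: "\<bar>gsmooth 0 s h a - gsmooth 0 s h b\<bar> \<le> \<bar>a - b\<bar>" for a b by (rule gsmooth_0_lip[OF lip s(1)])
  have i0: "integrable lborel (\<lambda>z. gsmooth 0 s h (x + t * z) * std_normal_density z)"
    using gsmooth_integrable[OF lip0 s(2), of x 0] by (simp add: hermite_def)
  have z1: "integrable lborel (\<lambda>z. z * std_normal_density z)" "(\<integral>z. z * std_normal_density z \<partial>lborel) = 0"
    using integrable_std_normal_moment[of 1] integral_std_normal_moment_odd[of 0] by (simp_all add: mult.commute)
  have z2: "integrable lborel (\<lambda>z. z\<^sup>2 * std_normal_density z)" "(\<integral>z. z\<^sup>2 * std_normal_density z \<partial>lborel) = 1"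
    using integrable_std_normal_moment[of 2] integral_std_normal_moment_even[of 1] by (simp_all add: mult.commute)
  let ?p = "\<lambda>z. ?g 0 * std_normal_density z + t * ?g 1 * (z * std_normal_density z) + t\<^sup>2 / 2 * ?g 2 * (z\<^sup>2 * std_normal_density z)"
  have ip: "integrable lborel ?p" using z1(1) z2(1) by simp
  have "(\<integral>z. ?p z \<partial>lborel) = ?g 0 + t\<^sup>2 / 2 * ?g 2"
    using z1 z2 by simp
  moreover have "(\<integral>z. gsmooth 0 s h (x + t * z) * std_normal_density z \<partial>lborel) = gsmooth 0 (sqrt (s\<^sup>2 + t\<^sup>2)) h x"
    by (rule gsmooth_semigroup[OF lip s])
  ultimately have eq: "gsmooth 0 (sqrt (s\<^sup>2 + t\<^sup>2)) h x - gsmooth 0 s h x - t\<^sup>2 / 2 * gsmooth 2 s h x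
     = (\<integral>z. gsmooth 0 s h (x + t * z) * std_normal_density z - ?p z \<partial>lborel)"
    using i0 ip by simp
  have ib: "integrable lborel (\<lambda>z. ?C * t powr (2 + d) * (\<bar>z\<bar> powr (2 + d) * std_normal_density z))"
    using gauss_powr_integrable[of "2 + d"] d by simp
  have "\<bar>\<integral>z. gsmooth 0 s h (x + t * z) * std_normal_density z - ?p z \<partial>lborel\<bar>
    \<le> (\<integral>z. ?C * t powr (2 + d) * (\<bar>z\<bar> powr (2 + d) * std_normal_density z) \<partial>lborel)"
  proof (rule integral_abs_bound[THEN order_trans], rule integral_mono)
    fix z
    have "\<bar>gsmooth 0 s h (x + t * z) - ?g 0 - t * z * ?g 1 - (t * z)\<^sup>2 / 2 * ?g 2\<bar> * std_normal_density z
       \<le> (?C * \<bar>t * z\<bar> powr (2 + d)) * std_normal_density z"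
      by (intro mult_right_mono gsmooth_0_taylor[OF lip s(1) d]) auto
    also have "\<dots> = ?C * t powr (2 + d) * (\<bar>z\<bar> powr (2 + d) * std_normal_density z)"
      using s by (simp add: abs_mult powr_mult)
    also have "gsmooth 0 s h (x + t * z) * std_normal_density z - ?p z
      = (gsmooth 0 s h (x + t * z) - ?g 0 - t * z * ?g 1 - (t * z)\<^sup>2 / 2 * ?g 2) * std_normal_density z"
      by (simp add: power_mult_distrib algebra_simps)
    then have "\<bar>gsmooth 0 s h (x + t * z) - ?g 0 - t * z * ?g 1 - (t * z)\<^sup>2 / 2 * ?g 2\<bar> * std_normal_density z
       = \<bar>gsmooth 0 s h (x + t * z) * std_normal_density z - ?p z\<bar>"
      by (simp add: abs_mult)
    finally show "\<bar>gsmooth 0 s h (x + t * z) * std_normal_density z - ?p z\<bar>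
      \<le> ?C * t powr (2 + d) * (\<bar>z\<bar> powr (2 + d) * std_normal_density z)" .
  qed (rule integrable_abs, rule Bochner_Integration.integrable_diff[OF i0 ip], rule ib)
  also have "\<dots> = ?C * (t powr (2 + d) * gauss_moment (2 + d))"
    unfolding gauss_moment_def by (simp add: mult.assoc)
  finally show ?thesis unfolding eq .
qed

text \<open>Smoothing acts on the real argument only; \<open>\<omega>\<close> selects both the
  function and the point of evaluation.\<close>

definition gs_at :: "nat \<Rightarrow> real \<Rightarrow> ('a \<Rightarrow> real \<Rightarrow> real) \<Rightarrow> ('a \<Rightarrow> real) \<Rightarrow> 'a \<Rightarrow> real" where
  "gs_at n s H Z \<omega> = gsmooth n s (H \<omega>) (Z \<omega>)"

context mixing_sequence
begin

text \<open>The Lipschitz bound holds for every \<open>\<omega>\<close>, so the deterministic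
  smoothing bounds apply pointwise. Together with the integrability at 0 it makes the composition
  with an integrable variable integrable.\<close>

definition past_lipschitz :: "nat \<Rightarrow> ('a \<Rightarrow> real \<Rightarrow> real) \<Rightarrow> bool" where
  "past_lipschitz q H \<longleftrightarrow> case_prod H \<in> borel_measurable (past q \<Otimes>\<^sub>M borel)
     \<and> (\<forall>\<omega> x y. \<bar>H \<omega> x - H \<omega> y\<bar> \<le> \<bar>x - y\<bar>) \<and> integrable M (\<lambda>\<omega>. H \<omega> 0)"

end

text \<open>The added 1 makes the constant strictly positive, as the scale \<open>c\<close> in
  \<open>past_times_X_dominated\<close> has to be.\<close>

definition hc :: real where "hc = hermite_const + 1"

lemma hc_pos: "hc > 0" "hc \<ge> hermite_const" using hermite_const_nonneg by (auto simp: hc_def)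

section \<open>Terms of the Lindeberg expansion within one block\<close>

locale lindeberg_block = mixing_sequence M X \<delta> \<theta> c\<^sub>\<phi> c\<^sub>X
  for M :: "'a measure" and X \<delta> \<theta> c\<^sub>\<phi> c\<^sub>X +
  fixes q :: nat and H :: "'a \<Rightarrow> real \<Rightarrow> real" and s d :: real
  assumes H: "past_lipschitz q H" and s: "s > 0" and d: "0 < d" "d \<le> 1" "d \<le> \<delta>"
begin

lemma H_lip: "\<bar>H \<omega> x - H \<omega> y\<bar> \<le> \<bar>x - y\<bar>"
  using H by (auto simp: past_lipschitz_def)

lemma gs_at_measurable:
  assumes Z [measurable]: "Z \<in> borel_measurable (past N)" and "q \<le> N"
  shows "gs_at n s H Z \<in> borel_measurable (past N)"
proof -
  have id [measurable]: "(\<lambda>\<omega>. \<omega>) \<in> measurable (past N) (past q)"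
  proof (rule measurableI)
    fix A assume A: "A \<in> sets (past q)"
    then have "A \<in> sets (past N)" using sets_gen_algebra_mono[of "{..<q}" "{..<N}" M X] assms by auto
    then show "(\<lambda>\<omega>. \<omega>) -` A \<inter> space (past N) \<in> sets (past N)"
      using sets.Int_space_eq2[of A "past N"] by simp
  qed simp
  have Hm: "case_prod H \<in> borel_measurable (past q \<Otimes>\<^sub>M borel)" using H by (simp add: past_lipschitz_def)
  have "(\<lambda>p. case_prod H (fst p, Z (fst p) + s * snd p)) \<in> borel_measurable (past N \<Otimes>\<^sub>M lborel)"
    by (rule measurable_compose[OF _ Hm]) measurable
  then have [measurable]: "(\<lambda>p. H (fst p) (Z (fst p) + s * snd p)) \<in> borel_measurable (past N \<Otimes>\<^sub>M lborel)" by simp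
  have "(\<lambda>\<omega>. \<integral>z. H \<omega> (Z \<omega> + s * z) * hermite n z * std_normal_density z \<partial>lborel) \<in> borel_measurable (past N)"
    by (rule lborel.borel_measurable_lebesgue_integral) (simp add: case_prod_unfold)
  then show ?thesis unfolding gs_at_def gsmooth_def by measurable
qed

abbreviation S :: "nat \<Rightarrow> 'a \<Rightarrow> real" where "S k \<equiv> block_sum q k"

abbreviation G :: "nat \<Rightarrow> nat \<Rightarrow> 'a \<Rightarrow> real" where "G n k \<equiv> gs_at n s H (S k)"

text \<open>The common factor of all Taylor remainders at smoothing scale \<open>s\<close>.\<close>

definition eps :: real where "eps = 2 * hc * s powr (- 1 - d)"

lemma eps_pos: "eps > 0" using hc_pos s by (simp add: eps_def)

lemma eps_ge: "2 * hermite_const * s powr (- 1 - d) \<le> eps"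
  unfolding eps_def using hc_pos by (intro mult_right_mono) auto

lemma G_past: "q + k \<le> N \<Longrightarrow> G n k \<in> borel_measurable (past N)"
  by (rule gs_at_measurable[OF block_sum_past]) auto

lemma G_meas [measurable]: "G n k \<in> borel_measurable M"
  by (rule past_measurable[OF G_past[OF order_refl]])

lemma G1_bound: "\<bar>G 1 k \<omega>\<bar> \<le> hc"
  unfolding gs_at_def by (rule order_trans[OF gsmooth_1_bound[OF H_lip s] hc_pos(2)])

lemma G2_bound: "\<bar>G 2 k \<omega>\<bar> \<le> hc / s"
  unfolding gs_at_def
  by (rule order_trans[OF gsmooth_2_bound[OF H_lip s]]) (use s hc_pos in \<open>auto intro: divide_right_mono\<close>)

lemma S_Suc: "S (Suc i) \<omega> = S i \<omega> + X (q + i) \<omega>"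
  by (simp add: block_sum_def)

lemma S_diff: "j \<le> i \<Longrightarrow> S i \<omega> = S j \<omega> + block_sum (q + j) (i - j) \<omega>"
  using block_sum_add[of q j "i - j" \<omega>] by simp

lemma G2_diff:
  assumes "j \<le> i" "i - j \<le> L" "1 \<le> L"
  shows "\<bar>G 2 i \<omega> - G 2 j \<omega>\<bar> \<le> eps * real L powr d * (abs_block (q + j) (i - j) \<omega> / real L) powr d"
proof -
  have "\<bar>G 2 i \<omega> - G 2 j \<omega>\<bar> \<le> 2 * hermite_const * s powr (- 1 - d) * \<bar>block_sum (q + j) (i - j) \<omega>\<bar> powr d"
    unfolding gs_at_def S_diff[OF assms(1)] by (rule gsmooth_2_hoelder[OF H_lip s d(1,2)])
  also have "\<dots> \<le> eps * abs_block (q + j) (i - j) \<omega> powr d"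
    using d abs_block_sum_le eps_pos by (intro mult_mono eps_ge powr_mono2) auto
  also have "abs_block (q + j) (i - j) \<omega> powr d = real L powr d * (abs_block (q + j) (i - j) \<omega> / real L) powr d"
    using assms by (simp add: powr_divide abs_block_nonneg)
  finally show ?thesis by (simp add: mult.assoc)
qed

text \<open>The remainder of the first derivative has the order \<open>1 + d\<close> in one
  variable, and its moment of the conjugate order must exist; this is one of the uses of
  \<open>d \<le> \<delta>\<close>.\<close>

lemma conj_exp: "0 < (2 + \<delta>) / (1 + \<delta>)" "(1 + d) * ((2 + \<delta>) / (1 + \<delta>)) \<le> mord"
proof -
  have "(1 + d) * (2 + \<delta>) \<le> (1 + \<delta>) * (2 + \<delta>)" using d \<delta>_pos by (intro mult_right_mono) auto
  then show "(1 + d) * ((2 + \<delta>) / (1 + \<delta>)) \<le> mord"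
    using \<delta>_pos by (simp add: pos_divide_le_eq mult.commute)
qed (use \<delta>_pos in simp)

text \<open>The first derivative at the start of the block is bounded and known before the block, so
  the gap before \<open>X (q + k)\<close> is the full \<open>k\<close>.\<close>

lemma term_first:
  "integrable M (\<lambda>\<omega>. G 1 0 \<omega> * X (q + k) \<omega>)"
  "\<bar>expectation (\<lambda>\<omega>. G 1 0 \<omega> * X (q + k) \<omega>)\<bar> \<le> cov_const * (real k + 1) powr (- rate) * hc"
proof -
  have "G 1 0 \<in> borel_measurable (past q)" by (rule G_past) simp
  note * = past_times_X_dominated[OF this, where W = "\<lambda>_. 1" and c = hc and V = 1]
  show "integrable M (\<lambda>\<omega>. G 1 0 \<omega> * X (q + k) \<omega>)"
    "\<bar>expectation (\<lambda>\<omega>. G 1 0 \<omega> * X (q + k) \<omega>)\<bar> \<le> cov_const * (real k + 1) powr (- rate) * hc"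
    using *(1)[of k] *(2)[of k] G1_bound hc_pos by (auto simp: prob_space)
qed

text \<open>The remainder depends on indices up to \<open>q + i\<close>, which leaves a gap of
  \<open>k - i - 1\<close> before \<open>X (q + k)\<close>; mixing therefore adds a factor that is
  summable over \<open>i\<close> once \<open>rate > 1\<close>.\<close>

lemma term_remainder:
  assumes "i < k"
  defines "R \<equiv> \<lambda>\<omega>. G 1 (Suc i) \<omega> - G 1 i \<omega> - X (q + i) \<omega> * G 2 i \<omega>"
  shows "integrable M (\<lambda>\<omega>. R \<omega> * X (q + k) \<omega>)"
    and "\<bar>expectation (\<lambda>\<omega>. R \<omega> * X (q + k) \<omega>)\<bar> \<le> eps * (2 powr rate * cov_const * mom_const) * (real (k - i) + 1) powr (- rate)"
proof -
  have R: "R \<in> borel_measurable (past (q + Suc i))"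
    unfolding R_def using G_past[of "Suc i" "q + Suc i" 1] G_past[of i "q + Suc i" 1] G_past[of i "q + Suc i" 2] X_past[of "q + i" "q + Suc i"]
    by measurable
  have le: "\<bar>R \<omega>\<bar> \<le> eps * \<bar>X (q + i) \<omega>\<bar> powr (1 + d)" for \<omega>
  proof -
    have "\<bar>R \<omega>\<bar> \<le> 2 * hermite_const * s powr (- 1 - d) * \<bar>X (q + i) \<omega>\<bar> powr (1 + d)"
      unfolding R_def gs_at_def S_Suc by (rule gsmooth_1_taylor[OF H_lip s d(1,2)])
    then show ?thesis using mult_right_mono[OF eps_ge, of "\<bar>X (q + i) \<omega>\<bar> powr (1 + d)"] by simp
  qed
  have m: "integrable M (\<lambda>\<omega>. \<bar>\<bar>X (q + i) \<omega>\<bar> powr (1 + d)\<bar> powr ((2 + \<delta>) / (1 + \<delta>)))"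
     "expectation (\<lambda>\<omega>. \<bar>\<bar>X (q + i) \<omega>\<bar> powr (1 + d)\<bar> powr ((2 + \<delta>) / (1 + \<delta>))) \<le> mom_const"
    using X_lower_moment[of "(1 + d) * ((2 + \<delta>) / (1 + \<delta>))" "q + i"] conj_exp d \<delta>_pos
    by (simp_all add: powr_powr)
  note * = past_times_X_dominated[OF R _ le eps_pos m mom_const_ge1, of "k - i - 1"]
  have k: "q + Suc i + (k - i - 1) = q + k" "real (k - i - 1) + 1 = real (k - i)" using assms(1) by auto
  show "integrable M (\<lambda>\<omega>. R \<omega> * X (q + k) \<omega>)" using *(1) unfolding k by simp
  have "\<bar>expectation (\<lambda>\<omega>. R \<omega> * X (q + k) \<omega>)\<bar> \<le> cov_const * real (k - i) powr (- rate) * (eps * mom_const)"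
    using *(2) unfolding k by simp
  also have "\<dots> \<le> cov_const * (2 powr rate * (real (k - i) + 1) powr (- rate)) * (eps * mom_const)"
    using assms(1) cov_const_pos eps_pos mom_const_ge1 rate_pos
    by (intro mult_right_mono mult_left_mono powr_shift_le) auto
  finally show "\<bar>expectation (\<lambda>\<omega>. R \<omega> * X (q + k) \<omega>)\<bar> \<le> eps * (2 powr rate * cov_const * mom_const) * (real (k - i) + 1) powr (- rate)"
    by (simp add: ac_simps)
qed

lemma G2_XX_int: "integrable M (\<lambda>\<omega>. G 2 i \<omega> * (X a \<omega> * X b \<omega> - c))"
  by (rule integrable_bounded_mult[OF _ _ G2_bound]) (use X_mult_int in auto)

text \<open>The second derivative is frozen \<open>L\<close> indices before \<open>i\<close>.
  Subtraction of naturals stops at the start of the block, so for \<open>i < L\<close> the gap is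
  only \<open>i\<close>; hence \<open>min i L\<close>.\<close>

lemma term_far:
  assumes "i \<le> k"
  shows "\<bar>expectation (\<lambda>\<omega>. G 2 (i - L) \<omega> * (X (q + i) \<omega> * X (q + k) \<omega> - autocov M X (k - i)))\<bar>
    \<le> hc / s * sqrt (xx_decay * xx_mix) * ((real (k - i) + 1) powr (- rate / 2) * (real (min i L) + 1) powr (- arate / 2))"
proof -
  have "G 2 (i - L) \<in> borel_measurable (past (q + (i - L)))" by (rule G_past) simp
  from XX_covariance[OF this G2_bound, of "q + i" "min i L" "q + k"]
  show ?thesis using assms hc_pos s by simp
qed

text \<open>The price of freezing. The second derivative moves by at most a multiple of
  \<open>real L powr d\<close> in mean, and the decay in the lag \<open>k - i\<close> is retained
  because \<open>X (q + k)\<close> is still split off by mixing.\<close>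

lemma term_near:
  assumes "i \<le> k" "1 \<le> L"
  shows "\<bar>expectation (\<lambda>\<omega>. (G 2 i \<omega> - G 2 (i - L) \<omega>) * (X (q + i) \<omega> * X (q + k) \<omega> - autocov M X (k - i)))\<bar>
    \<le> eps * real L powr d * (2 * mom_const * (2 powr rate * cov_const + 1 + gamma_const)) * (real (k - i) + 1) powr (- rate)"
proof -
  define Y where "Y \<omega> = G 2 i \<omega> - G 2 (i - L) \<omega>" for \<omega>
  define c where "c = eps * real L powr d"
  define A where "A \<omega> = abs_block (q + (i - L)) (i - (i - L)) \<omega> / real L" for \<omega>
  have [measurable]: "Y \<in> borel_measurable M" "A \<in> borel_measurable M" unfolding Y_def A_def by measurable
  have c: "c > 0" using eps_pos assms by (simp add: c_def)
  have l: "i - (i - L) \<le> L" by simp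
  have A0: "A \<omega> \<ge> 0" for \<omega> by (simp add: A_def abs_block_nonneg)
  have Y: "\<bar>Y \<omega>\<bar> \<le> c * A \<omega> powr d" for \<omega>
    unfolding Y_def c_def A_def by (rule G2_diff[OF _ l assms(2)]) simp
  have Ybd: "\<bar>Y \<omega>\<bar> \<le> hc / s + hc / s" for \<omega>
    using G2_bound[of i \<omega>] G2_bound[of "i - L" \<omega>] unfolding Y_def by linarith
  let ?w = "(real (k - i) + 1) powr (- rate)" and ?Z = "\<lambda>\<omega>. X (q + i) \<omega> * X (q + k) \<omega>"
  have Yi: "integrable M Y" using integrable_bounded_mult[of "\<lambda>_. 1" Y, OF _ _ Ybd] by simp
  have YZi: "integrable M (\<lambda>\<omega>. Y \<omega> * ?Z \<omega>)" by (rule integrable_bounded_mult[OF X_mult_int _ Ybd]) simp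
  have EY: "\<bar>expectation Y\<bar> \<le> c * (2 * mom_const)"
  proof -
    have m: "integrable M (\<lambda>\<omega>. A \<omega> powr d)" "expectation (\<lambda>\<omega>. A \<omega> powr d) \<le> mom_const"
      unfolding A_def using abs_block_lower_moment[OF assms(2) l, of d] d \<delta>_pos by auto
    have "\<bar>expectation Y\<bar> \<le> expectation (\<lambda>\<omega>. c * A \<omega> powr d)"
      by (rule abs_expectation_le(2)) (use m Y in auto)
    also have "\<dots> \<le> c * mom_const" using m c by simp
    also have "\<dots> \<le> c * (2 * mom_const)" using c mom_const_ge1 by simp
    finally show ?thesis .
  qed
  have G: "\<bar>autocov M X (k - i) * expectation Y\<bar> \<le> (gamma_const * ?w) * (c * (2 * mom_const))"
    unfolding abs_mult by (intro mult_mono autocov_le EY) (use gamma_const_pos in auto)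
  have YZ: "\<bar>expectation (\<lambda>\<omega>. Y \<omega> * ?Z \<omega>)\<bar> \<le> (2 powr rate * cov_const + 1) * ?w * (c * (2 * mom_const))"
  proof (cases "i = k")
    case True
    have e: "0 \<le> d" "0 \<le> (2::real)" "0 < d + 2" "d + 2 \<le> mord" using d by auto
    note m = abs_block_mixed_moment[OF assms(2) l e, of "q + (i - L)" "q + k", folded A_def]
    have sq: "\<bar>x\<bar> powr 2 = x\<^sup>2" for x :: real by (cases "x = 0") auto
    have "\<bar>expectation (\<lambda>\<omega>. Y \<omega> * ?Z \<omega>)\<bar> \<le> expectation (\<lambda>\<omega>. c * (A \<omega> powr d * \<bar>X (q + k) \<omega>\<bar> powr 2))"
    proof (rule abs_expectation_le(2))
      show "\<bar>Y \<omega> * ?Z \<omega>\<bar> \<le> c * (A \<omega> powr d * \<bar>X (q + k) \<omega>\<bar> powr 2)" for \<omega>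
        using mult_right_mono[OF Y, of "(X (q + k) \<omega>)\<^sup>2" \<omega>] True by (simp add: sq abs_mult power2_eq_square mult.assoc)
    qed (use m in auto)
    also have "\<dots> \<le> c * (2 * mom_const)" using m(2) c by simp
    also have "\<dots> \<le> (2 powr rate * cov_const + 1) * ?w * (c * (2 * mom_const))"
      using True cov_const_pos c mom_const_ge1 by (simp add: distrib_right)
    finally show ?thesis .
  next
    case False
    then have lt: "i < k" using assms by simp
    have YX: "(\<lambda>\<omega>. Y \<omega> * X (q + i) \<omega>) \<in> borel_measurable (past (q + Suc i))"
      unfolding Y_def using G_past[of i "q + Suc i" 2] G_past[of "i - L" "q + Suc i" 2] X_past[of "q + i" "q + Suc i"]
      by measurable
    let ?a = "(2 + \<delta>) / (1 + \<delta>)"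
    let ?W = "\<lambda>\<omega>. A \<omega> powr d * \<bar>X (q + i) \<omega>\<bar>"
    have W: "\<bar>?W \<omega>\<bar> powr ?a = A \<omega> powr (d * ?a) * \<bar>X (q + i) \<omega>\<bar> powr ?a" for \<omega>
      by (simp add: abs_mult powr_mult powr_powr)
    have "d * ?a + ?a = (1 + d) * ?a" by (simp only: distrib_right mult_1_left add.commute)
    moreover have "0 < d * ?a" using d conj_exp(1) by (rule_tac mult_pos_pos) auto
    ultimately have e: "0 \<le> d * ?a" "0 \<le> ?a" "0 < d * ?a + ?a" "d * ?a + ?a \<le> mord"
      using conj_exp by linarith+
    note m = abs_block_mixed_moment[OF assms(2) l e, of "q + (i - L)" "q + i", folded A_def, folded W]
    have le: "\<bar>Y \<omega> * X (q + i) \<omega>\<bar> \<le> c * ?W \<omega>" for \<omega>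
      using mult_right_mono[OF Y, of "\<bar>X (q + i) \<omega>\<bar>" \<omega>] by (simp add: abs_mult mult.assoc)
    have k: "q + Suc i + (k - i - 1) = q + k" "real (k - i - 1) + 1 = real (k - i)" using lt by auto
    have "\<bar>expectation (\<lambda>\<omega>. Y \<omega> * X (q + i) \<omega> * X (q + Suc i + (k - i - 1)) \<omega>)\<bar>
       \<le> cov_const * (real (k - i - 1) + 1) powr (- rate) * (c * (2 * mom_const))"
      by (rule past_times_X_dominated(2)[OF YX _ le c m]) (use mom_const_ge1 in auto)
    then have "\<bar>expectation (\<lambda>\<omega>. Y \<omega> * ?Z \<omega>)\<bar> \<le> cov_const * real (k - i) powr (- rate) * (c * (2 * mom_const))"
      unfolding k by (simp add: mult.assoc)
    also have "\<dots> \<le> cov_const * (2 powr rate * ?w) * (c * (2 * mom_const))"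
      using lt cov_const_pos c mom_const_ge1 rate_pos
      by (intro mult_right_mono mult_left_mono powr_shift_le) auto
    also have "\<dots> = (2 powr rate * cov_const) * ?w * (c * (2 * mom_const))" by simp
    also have "\<dots> \<le> (2 powr rate * cov_const + 1) * ?w * (c * (2 * mom_const))"
      using c mom_const_ge1 by (intro mult_right_mono) auto
    finally show ?thesis .
  qed
  have "expectation (\<lambda>\<omega>. Y \<omega> * (?Z \<omega> - autocov M X (k - i))) = expectation (\<lambda>\<omega>. Y \<omega> * ?Z \<omega>) - autocov M X (k - i) * expectation Y"
    using Yi YZi by (simp add: right_diff_distrib mult.commute)
  then have "\<bar>expectation (\<lambda>\<omega>. Y \<omega> * (?Z \<omega> - autocov M X (k - i)))\<bar>
    \<le> (2 powr rate * cov_const + 1) * ?w * (c * (2 * mom_const)) + (gamma_const * ?w) * (c * (2 * mom_const))"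
    using YZ G by linarith
  also have "\<dots> = c * (2 * mom_const * (2 powr rate * cov_const + 1 + gamma_const)) * ?w"
    by (simp add: algebra_simps)
  finally show ?thesis by (simp add: Y_def c_def)
qed

lemma G2_int: "integrable M (G 2 i)"
  using integrable_bounded_mult[of "\<lambda>_. 1" "G 2 i", OF _ _ G2_bound] by simp

text \<open>Linear growth in the lag is crude, but for \<open>rate > 2\<close> it remains summable
  against the autocovariances.\<close>

lemma term_variance:
  assumes "i < k"
  shows "\<bar>expectation (G 2 i) - expectation (G 2 k)\<bar> \<le> eps * mom_const * (real (k - i) + 1)"
proof -
  let ?L = "k - i"
  have L: "1 \<le> ?L" using assms by simp
  have m: "integrable M (\<lambda>\<omega>. (abs_block (q + i) ?L \<omega> / real ?L) powr d)"
    "expectation (\<lambda>\<omega>. (abs_block (q + i) ?L \<omega> / real ?L) powr d) \<le> mom_const"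
    using abs_block_lower_moment[OF L order_refl, of d] d \<delta>_pos by auto
  have "expectation (G 2 k) - expectation (G 2 i) = expectation (\<lambda>\<omega>. G 2 k \<omega> - G 2 i \<omega>)" using G2_int by simp
  also have "\<bar>\<dots>\<bar> \<le> expectation (\<lambda>\<omega>. eps * real ?L powr d * (abs_block (q + i) ?L \<omega> / real ?L) powr d)"
    by (rule abs_expectation_le(2)) (use m(1) assms G2_diff[of i k ?L] in auto)
  also have "\<dots> = eps * real ?L powr d * expectation (\<lambda>\<omega>. (abs_block (q + i) ?L \<omega> / real ?L) powr d)" by simp
  also have "\<dots> \<le> eps * real ?L powr d * mom_const" using m(2) eps_pos by (intro mult_left_mono) auto
  also have "\<dots> \<le> eps * (real ?L + 1) * mom_const"
  proof -
    have "real ?L powr d \<le> real ?L powr 1" using L d by (intro powr_mono) auto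
    then show ?thesis using eps_pos mom_const_ge1 L by (intro mult_right_mono mult_left_mono) auto
  qed
  finally show ?thesis by (simp add: ac_simps abs_minus_commute)
qed

end

definition zeta_sum :: "real \<Rightarrow> real" where
  "zeta_sum s = (\<Sum>j. (real j + 1) powr (- s))"

lemma zeta_sum_ge: "s > 1 \<Longrightarrow> finite A \<Longrightarrow> (\<Sum>j\<in>A. (real j + 1) powr (- s)) \<le> zeta_sum s"
  unfolding zeta_sum_def by (rule sum_shift_powr_le)

lemma zeta_sum_nonneg: "s > 1 \<Longrightarrow> zeta_sum s \<ge> 0"
  using zeta_sum_ge[of s "{}"] by simp

lemma zeta_sum_rev:
  assumes "s > 1"
  shows "(\<Sum>i\<le>k. (real (k - i) + 1) powr (- s)) \<le> zeta_sum s" "(\<Sum>i<k. (real (k - i) + 1) powr (- s)) \<le> zeta_sum s"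
proof -
  have *: "(\<Sum>i\<in>A. (real (k - i) + 1) powr (- s)) \<le> zeta_sum s" if "A \<subseteq> {..k}" for A
  proof -
    have "inj_on (\<lambda>i. k - i) A" using that by (intro inj_onI) (metis atMost_iff diff_diff_cancel subsetD)
    then have "(\<Sum>i\<in>A. (real (k - i) + 1) powr (- s)) = (\<Sum>j\<in>(\<lambda>i. k - i) ` A. (real j + 1) powr (- s))"
      by (simp add: sum.reindex)
    also have "\<dots> \<le> zeta_sum s" using that finite_subset[OF that] assms by (intro zeta_sum_ge) auto
    finally show ?thesis .
  qed
  show "(\<Sum>i\<le>k. (real (k - i) + 1) powr (- s)) \<le> zeta_sum s" by (rule *) simp
  show "(\<Sum>i<k. (real (k - i) + 1) powr (- s)) \<le> zeta_sum s" by (rule *) auto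
qed

context mixing_sequence
begin

lemma autocov_summable: "rate > 1 \<Longrightarrow> summable (\<lambda>j. \<bar>autocov M X (j + k)\<bar>)"
proof (rule summable_comparison_test')
  assume "rate > 1"
  then show "summable (\<lambda>j. gamma_const * (real j + 1) powr (- rate))"
    by (intro summable_mult summable_shift_powr)
  show "norm \<bar>autocov M X (j + k)\<bar> \<le> gamma_const * (real j + 1) powr (- rate)" if "j \<ge> 0" for j
  proof -
    have "\<bar>autocov M X (j + k)\<bar> \<le> gamma_const * (real (j + k) + 1) powr (- rate)" by (rule autocov_le)
    also have "\<dots> \<le> gamma_const * (real j + 1) powr (- rate)"
      using gamma_const_pos rate_pos by (intro mult_left_mono powr_mono2') auto
    finally show ?thesis by simp
  qed
qed

text \<open>The decay is cut into two halves: one is extracted at lag \<open>k\<close>, the other is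
  summed, which takes \<open>rate / 2 > 1\<close>.\<close>

lemma autocov_tail:
  assumes "rate > 2"
  shows "\<bar>\<Sum>j. autocov M X (j + Suc k)\<bar> \<le> gamma_const * zeta_sum (rate / 2) * (real k + 1) powr (- rate / 2)"
proof -
  have "x / 2 > 1" if "x > 2" for x :: real using that by simp
  then have r2: "rate / 2 > 1" using assms by blast
  have le: "\<bar>autocov M X (j + Suc k)\<bar> \<le> gamma_const * (real k + 1) powr (- rate / 2) * (real j + 1) powr (- (rate / 2))" for j
  proof -
    have "\<bar>autocov M X (j + Suc k)\<bar> \<le> gamma_const * (real (j + Suc k) + 1) powr (- rate)" by (rule autocov_le)
    also have "(real (j + Suc k) + 1) powr (- rate) = (real (j + Suc k) + 1) powr (- rate / 2) * (real (j + Suc k) + 1) powr (- (rate / 2))"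
    proof -
      have "- r / 2 + - (r / 2) = - r" for r :: real by simp
      then show ?thesis by (metis powr_add)
    qed
    also have "\<dots> \<le> (real k + 1) powr (- rate / 2) * (real j + 1) powr (- (rate / 2))"
      using \<theta>_pos \<delta>_pos by (intro mult_mono powr_mono2') auto
    finally show ?thesis using gamma_const_pos by (simp add: mult.assoc)
  qed
  have sm: "summable (\<lambda>j. gamma_const * (real k + 1) powr (- rate / 2) * (real j + 1) powr (- (rate / 2)))"
    by (intro summable_mult summable_shift_powr r2)
  have "\<bar>\<Sum>j. autocov M X (j + Suc k)\<bar> \<le> (\<Sum>j. \<bar>autocov M X (j + Suc k)\<bar>)"
    using assms by (intro summable_rabs autocov_summable) simp
  also have "\<dots> \<le> (\<Sum>j. gamma_const * (real k + 1) powr (- rate / 2) * (real j + 1) powr (- (rate / 2)))"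
    by (intro suminf_le le autocov_summable sm) (use assms in simp)
  also have "\<dots> = gamma_const * (real k + 1) powr (- rate / 2) * zeta_sum (rate / 2)"
    unfolding zeta_sum_def by (intro suminf_mult summable_shift_powr r2)
  finally show ?thesis by (simp add: ac_simps)
qed

text \<open>The coefficients of \<open>eps\<close> in one exchange: Taylor remainder of the
  variable, Taylor remainder of its Gaussian substitute, remainders of the first derivative, cost of
  freezing, and variation of the second derivative along the block.\<close>

definition step_const :: "real \<Rightarrow> real \<Rightarrow> real" where
  "step_const \<sigma> d = mom_const + \<sigma> powr (2 + d) * gauss_moment (2 + d)
     + 2 powr rate * cov_const * mom_const * zeta_sum rate
     + 2 * mom_const * (2 powr rate * cov_const + 1 + gamma_const) * zeta_sum rate
     + gamma_const * mom_const * zeta_sum (rate - 1)"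

end

context lindeberg_block
begin

lemma G0_int:
  assumes "integrable M Z" "Z \<in> borel_measurable (past N)" "q \<le> N"
  shows "integrable M (gs_at 0 s H Z)"
proof (rule Bochner_Integration.integrable_bound)
  have H0: "integrable M (\<lambda>\<omega>. H \<omega> 0)" using H by (simp add: past_lipschitz_def)
  then show "integrable M (\<lambda>\<omega>. \<bar>H \<omega> 0\<bar> + \<bar>Z \<omega>\<bar> + hermite_const * s)" using assms by simp
  show "gs_at 0 s H Z \<in> borel_measurable M" by (rule past_measurable[OF gs_at_measurable[OF assms(2,3)]])
  show "AE \<omega> in M. norm (gs_at 0 s H Z \<omega>) \<le> norm (\<bar>H \<omega> 0\<bar> + \<bar>Z \<omega>\<bar> + hermite_const * s)"
  proof (rule AE_I2)
    fix \<omega>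
    have "\<bar>gsmooth 0 s (H \<omega>) (Z \<omega>) - H \<omega> (Z \<omega>)\<bar> \<le> hermite_const * s" by (rule gsmooth_0_near[OF H_lip s])
    moreover have "\<bar>H \<omega> (Z \<omega>) - H \<omega> 0\<bar> \<le> \<bar>Z \<omega>\<bar>" using H_lip[of \<omega> "Z \<omega>" 0] by simp
    ultimately show "norm (gs_at 0 s H Z \<omega>) \<le> norm (\<bar>H \<omega> 0\<bar> + \<bar>Z \<omega>\<bar> + hermite_const * s)"
      unfolding gs_at_def real_norm_def by linarith
  qed
qed

text \<open>\<open>X (q + k)\<close> is not centered given the past, so the first-order term
  survives. Telescoping the first derivative back to the start of the block and expanding each
  increment turns it into products of two variables weighted by second derivatives; the value at the
  start contributes a mixing error.\<close>

lemma G1_times_X: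
  "integrable M (\<lambda>\<omega>. G 1 k \<omega> * X (q + k) \<omega>)"
  "\<bar>expectation (\<lambda>\<omega>. G 1 k \<omega> * X (q + k) \<omega>) - (\<Sum>i<k. expectation (\<lambda>\<omega>. G 2 i \<omega> * (X (q + i) \<omega> * X (q + k) \<omega>)))\<bar>
   \<le> cov_const * (real k + 1) powr (- rate) * hc
     + eps * (2 powr rate * cov_const * mom_const) * (\<Sum>i<k. (real (k - i) + 1) powr (- rate))"
proof -
  define R where "R i \<omega> = G 1 (Suc i) \<omega> - G 1 i \<omega> - X (q + i) \<omega> * G 2 i \<omega>" for i \<omega>
  have tele: "G 1 k \<omega> = G 1 0 \<omega> + (\<Sum>i<k. R i \<omega> + X (q + i) \<omega> * G 2 i \<omega>)" for \<omega>
    by (induction k) (simp_all add: R_def)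
  have i2: "integrable M (\<lambda>\<omega>. G 2 i \<omega> * (X (q + i) \<omega> * X (q + k) \<omega>))" for i
    using G2_XX_int[of i "q + i" "q + k" 0] by simp
  note R = term_remainder[folded R_def]
  have eq: "G 1 k \<omega> * X (q + k) \<omega> = G 1 0 \<omega> * X (q + k) \<omega> + (\<Sum>i<k. R i \<omega> * X (q + k) \<omega>)
      + (\<Sum>i<k. G 2 i \<omega> * (X (q + i) \<omega> * X (q + k) \<omega>))" for \<omega>
    unfolding tele[of \<omega>] distrib_right sum.distrib sum_distrib_right by (simp add: ac_simps)
  show "integrable M (\<lambda>\<omega>. G 1 k \<omega> * X (q + k) \<omega>)"
    by (rule integrable_bounded_mult[OF X_int _ G1_bound]) simp
  have iR: "integrable M (\<lambda>\<omega>. \<Sum>i<k. R i \<omega> * X (q + k) \<omega>)" using R(1) by (intro Bochner_Integration.integrable_sum) auto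
  have iG: "integrable M (\<lambda>\<omega>. \<Sum>i<k. G 2 i \<omega> * (X (q + i) \<omega> * X (q + k) \<omega>))" using i2 by simp
  have "expectation (\<lambda>\<omega>. G 1 k \<omega> * X (q + k) \<omega>) = expectation (\<lambda>\<omega>. G 1 0 \<omega> * X (q + k) \<omega>)
     + (\<Sum>i<k. expectation (\<lambda>\<omega>. R i \<omega> * X (q + k) \<omega>)) + (\<Sum>i<k. expectation (\<lambda>\<omega>. G 2 i \<omega> * (X (q + i) \<omega> * X (q + k) \<omega>)))"
    unfolding eq using term_first(1) iR iG R(1) i2 by (simp add: Bochner_Integration.integral_sum)
  moreover have "\<bar>\<Sum>i<k. expectation (\<lambda>\<omega>. R i \<omega> * X (q + k) \<omega>)\<bar>
     \<le> (\<Sum>i<k. eps * (2 powr rate * cov_const * mom_const) * (real (k - i) + 1) powr (- rate))"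
    by (rule order_trans[OF sum_abs sum_mono]) (use R(2) in auto)
  ultimately show "\<bar>expectation (\<lambda>\<omega>. G 1 k \<omega> * X (q + k) \<omega>) - (\<Sum>i<k. expectation (\<lambda>\<omega>. G 2 i \<omega> * (X (q + i) \<omega> * X (q + k) \<omega>)))\<bar>
   \<le> cov_const * (real k + 1) powr (- rate) * hc
     + eps * (2 powr rate * cov_const * mom_const) * (\<Sum>i<k. (real (k - i) + 1) powr (- rate))"
    using term_first(2)[of k] by (simp add: sum_distrib_left)
qed

text \<open>With the second derivative frozen \<open>L\<close> indices earlier, mixing replaces the
  product of the two variables by its mean, and undoing the freezing is a separate error.\<close>

lemma G2_times_XX:
  assumes "i \<le> k" "1 \<le> L"
  shows "\<bar>expectation (\<lambda>\<omega>. G 2 i \<omega> * (X (q + i) \<omega> * X (q + k) \<omega>)) - autocov M X (k - i) * expectation (G 2 i)\<bar>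
    \<le> eps * real L powr d * (2 * mom_const * (2 powr rate * cov_const + 1 + gamma_const)) * (real (k - i) + 1) powr (- rate)
     + hc / s * sqrt (xx_decay * xx_mix) * ((real (k - i) + 1) powr (- rate / 2) * (real (min i L) + 1) powr (- arate / 2))"
proof -
  let ?Z = "\<lambda>\<omega>. X (q + i) \<omega> * X (q + k) \<omega> - autocov M X (k - i)"
  have i2: "integrable M (\<lambda>\<omega>. G 2 i \<omega> * (X (q + i) \<omega> * X (q + k) \<omega>))"
    using G2_XX_int[of i "q + i" "q + k" 0] by simp
  have "expectation (\<lambda>\<omega>. G 2 i \<omega> * (X (q + i) \<omega> * X (q + k) \<omega>)) - autocov M X (k - i) * expectation (G 2 i)
     = expectation (\<lambda>\<omega>. G 2 i \<omega> * ?Z \<omega>)"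
    using i2 G2_int[of i] by (simp add: right_diff_distrib mult.commute)
  also have "\<dots> = expectation (\<lambda>\<omega>. (G 2 i \<omega> - G 2 (i - L) \<omega>) * ?Z \<omega>) + expectation (\<lambda>\<omega>. G 2 (i - L) \<omega> * ?Z \<omega>)"
    using G2_XX_int by (simp add: left_diff_distrib)
  finally show ?thesis using term_near[OF assms] term_far[OF assms(1), of L] by linarith
qed

end

context lindeberg_block
begin

text \<open>The Gaussian substitute has the full variance \<open>\<sigma>\<^sup>2\<close> and not
  that of a single variable. The quadratic term yields half of the autocovariance at lag 0, the
  first-order term yields the autocovariances at lags 1 to \<open>k\<close>, and the missing tail of
  the series is an error that decays in \<open>k\<close>.\<close>

lemma lindeberg_step:
  fixes \<sigma> :: real
  assumes \<sigma>: "\<sigma> > 0" and var: "\<sigma>\<^sup>2 = autocov M X 0 + 2 * (\<Sum>j. autocov M X (Suc j))"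
    and r: "rate > 2" and L: "1 \<le> L"
  shows "\<bar>expectation (G 0 (Suc k)) - expectation (gs_at 0 (sqrt (s\<^sup>2 + \<sigma>\<^sup>2)) H (S k))\<bar>
    \<le> step_const \<sigma> d * eps * real L powr d + cov_const * hc * (real k + 1) powr (- rate)
      + hc / s * (gamma_const * zeta_sum (rate / 2) * (real k + 1) powr (- rate / 2))
      + hc / s * sqrt (xx_decay * xx_mix) * (\<Sum>i\<le>k. (real (k - i) + 1) powr (- rate / 2) * (real (min i L) + 1) powr (- arate / 2))"
proof -
  define A where "A i = expectation (G 2 i)" for i
  define P where "P i = expectation (\<lambda>\<omega>. G 2 i \<omega> * (X (q + i) \<omega> * X (q + k) \<omega>))" for i
  define Q where "Q = expectation (\<lambda>\<omega>. G 1 k \<omega> * X (q + k) \<omega>)"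
  define u where "u = expectation (G 0 k)"
  define u1 where "u1 = expectation (G 0 (Suc k))"
  define u' where "u' = expectation (gs_at 0 (sqrt (s\<^sup>2 + \<sigma>\<^sup>2)) H (S k))"
  define c where "c j = autocov M X j" for j
  define w where "w i = (real (k - i) + 1) powr (- rate)" for i
  define fw where "fw i = (real (k - i) + 1) powr (- rate / 2) * (real (min i L) + 1) powr (- arate / 2)" for i
  define tail where "tail = (\<Sum>j. c (j + Suc k))"
  define Ld where "Ld = real L powr d"
  have Ld: "Ld \<ge> 1" using L d by (simp add: Ld_def ge_one_powr_ge_zero)
  have s': "sqrt (s\<^sup>2 + \<sigma>\<^sup>2) > 0" using s by (simp add: add_pos_nonneg)
  interpret S': lindeberg_block M X \<delta> \<theta> c\<^sub>\<phi> c\<^sub>X q H "sqrt (s\<^sup>2 + \<sigma>\<^sup>2)" d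
    by unfold_locales (use H s' d in auto)
  have iG0: "integrable M (G 0 j)" for j
    by (rule G0_int[OF block_sum_int block_sum_past[OF order_refl]]) simp
  have iG0': "integrable M (gs_at 0 (sqrt (s\<^sup>2 + \<sigma>\<^sup>2)) H (S k))"
    by (rule S'.G0_int[OF block_sum_int block_sum_past[OF order_refl]]) simp
  have i2: "integrable M (\<lambda>\<omega>. G 2 i \<omega> * (X (q + i) \<omega> * X (q + k) \<omega>))" for i
    using G2_XX_int[of i "q + i" "q + k" 0] by simp
  have iX: "integrable M (\<lambda>\<omega>. \<bar>X (q + k) \<omega>\<bar> powr (2 + d))" "expectation (\<lambda>\<omega>. \<bar>X (q + k) \<omega>\<bar> powr (2 + d)) \<le> mom_const"
    using X_lower_moment[of "2 + d" "q + k"] d by auto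
  have e1: "\<bar>u1 - u - Q - P k / 2\<bar> \<le> eps * mom_const"
  proof -
    have "\<bar>u1 - u - Q - P k / 2\<bar>
        = \<bar>expectation (\<lambda>\<omega>. G 0 (Suc k) \<omega> - G 0 k \<omega> - G 1 k \<omega> * X (q + k) \<omega> - G 2 k \<omega> * (X (q + k) \<omega> * X (q + k) \<omega>) / 2)\<bar>"
      unfolding u1_def u_def Q_def P_def using iG0 G1_times_X(1) i2[of k] by simp
    also have "\<dots> \<le> expectation (\<lambda>\<omega>. eps * \<bar>X (q + k) \<omega>\<bar> powr (2 + d))"
    proof (rule abs_expectation_le(2))
      fix \<omega>
      have "\<bar>gsmooth 0 s (H \<omega>) (S k \<omega> + X (q + k) \<omega>) - gsmooth 0 s (H \<omega>) (S k \<omega>) - X (q + k) \<omega> * gsmooth 1 s (H \<omega>) (S k \<omega>)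
          - (X (q + k) \<omega>)\<^sup>2 / 2 * gsmooth 2 s (H \<omega>) (S k \<omega>)\<bar> \<le> 2 * hermite_const * s powr (- 1 - d) * \<bar>X (q + k) \<omega>\<bar> powr (2 + d)"
        by (rule gsmooth_0_taylor[OF H_lip s d(1,2)])
      also have "\<dots> \<le> eps * \<bar>X (q + k) \<omega>\<bar> powr (2 + d)" by (intro mult_right_mono eps_ge) auto
      finally show "\<bar>G 0 (Suc k) \<omega> - G 0 k \<omega> - G 1 k \<omega> * X (q + k) \<omega> - G 2 k \<omega> * (X (q + k) \<omega> * X (q + k) \<omega>) / 2\<bar>
          \<le> eps * \<bar>X (q + k) \<omega>\<bar> powr (2 + d)"
        unfolding gs_at_def S_Suc by (simp add: power2_eq_square ac_simps)
    qed (use iX in auto)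
    also have "\<dots> = eps * expectation (\<lambda>\<omega>. \<bar>X (q + k) \<omega>\<bar> powr (2 + d))" by simp
    also have "\<dots> \<le> eps * mom_const" using iX(2) eps_pos by (intro mult_left_mono) auto
    finally show ?thesis .
  qed
  have e2: "\<bar>u' - u - \<sigma>\<^sup>2 / 2 * A k\<bar> \<le> eps * (\<sigma> powr (2 + d) * gauss_moment (2 + d))"
  proof -
    have "\<bar>u' - u - \<sigma>\<^sup>2 / 2 * A k\<bar> = \<bar>expectation (\<lambda>\<omega>. gs_at 0 (sqrt (s\<^sup>2 + \<sigma>\<^sup>2)) H (S k) \<omega> - G 0 k \<omega> - \<sigma>\<^sup>2 / 2 * G 2 k \<omega>)\<bar>"
      unfolding u'_def u_def A_def using iG0 iG0' G2_int by simp
    also have "\<dots> \<le> expectation (\<lambda>\<omega>. eps * (\<sigma> powr (2 + d) * gauss_moment (2 + d)))"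
    proof (rule abs_expectation_le(2))
      fix \<omega>
      have "\<bar>gs_at 0 (sqrt (s\<^sup>2 + \<sigma>\<^sup>2)) H (S k) \<omega> - G 0 k \<omega> - \<sigma>\<^sup>2 / 2 * G 2 k \<omega>\<bar>
        \<le> 2 * hermite_const * s powr (- 1 - d) * (\<sigma> powr (2 + d) * gauss_moment (2 + d))"
        unfolding gs_at_def by (rule gsmooth_gauss_step[OF H_lip s \<sigma> d(1,2)])
      also have "\<dots> \<le> eps * (\<sigma> powr (2 + d) * gauss_moment (2 + d))"
        using gauss_moment_nonneg by (intro mult_right_mono eps_ge) auto
      finally show "\<bar>gs_at 0 (sqrt (s\<^sup>2 + \<sigma>\<^sup>2)) H (S k) \<omega> - G 0 k \<omega> - \<sigma>\<^sup>2 / 2 * G 2 k \<omega>\<bar>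
        \<le> eps * (\<sigma> powr (2 + d) * gauss_moment (2 + d))" .
    qed (use iG0 iG0' G2_int in \<open>auto intro!: Bochner_Integration.integrable_diff borel_measurable_integrable\<close>)
    finally show ?thesis by (simp add: prob_space)
  qed
  have e3: "\<bar>Q - (\<Sum>i<k. P i)\<bar> \<le> cov_const * (real k + 1) powr (- rate) * hc
     + eps * (2 powr rate * cov_const * mom_const) * zeta_sum rate"
  proof -
    have "eps * (2 powr rate * cov_const * mom_const) * (\<Sum>i<k. w i) \<le> eps * (2 powr rate * cov_const * mom_const) * zeta_sum rate"
      unfolding w_def using r eps_pos cov_const_pos mom_const_ge1 by (intro mult_left_mono zeta_sum_rev) auto
    then show ?thesis using G1_times_X(2)[of k, folded Q_def P_def w_def] by linarith
  qed
  define N where "N = 2 * mom_const * (2 powr rate * cov_const + 1 + gamma_const)"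
  have N: "N > 0" unfolding N_def using mom_const_ge1 cov_const_pos gamma_const_pos
    by (intro mult_pos_pos add_pos_pos) auto
  define F where "F = hc / s * sqrt (xx_decay * xx_mix)"
  have xx: "xx_decay \<ge> 0" "xx_mix \<ge> 0"
    using mom_const_ge1 cov_const_pos gamma_const_pos by (auto simp: xx_decay_def xx_mix_def)
  then have F: "F \<ge> 0" using hc_pos s by (simp add: F_def)
  define b where "b i = eps * Ld * N * w i + F * fw i" for i
  have b0: "b i \<ge> 0" for i
    unfolding b_def w_def fw_def using eps_pos Ld N F by simp
  have PA: "\<bar>P i - c (k - i) * A i\<bar> \<le> b i" if "i \<le> k" for i
    using G2_times_XX[OF that L] by (simp add: P_def c_def A_def b_def N_def F_def Ld_def w_def fw_def)
  have e4: "\<bar>(\<Sum>i<k. P i - c (k - i) * A i) + (P k - c 0 * A k) / 2\<bar> \<le> eps * Ld * N * zeta_sum rate + F * (\<Sum>i\<le>k. fw i)"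
  proof -
    have "\<bar>\<Sum>i<k. P i - c (k - i) * A i\<bar> \<le> (\<Sum>i<k. b i)"
      by (rule order_trans[OF sum_abs sum_mono]) (use PA in auto)
    moreover have "\<bar>P k - c 0 * A k\<bar> \<le> b k" using PA[of k] by simp
    ultimately have "\<bar>(\<Sum>i<k. P i - c (k - i) * A i) + (P k - c 0 * A k) / 2\<bar> \<le> (\<Sum>i<k. b i) + b k"
    proof -
      have "\<bar>x + y / 2\<bar> \<le> B + C" if "\<bar>x\<bar> \<le> B" "\<bar>y\<bar> \<le> C" for x y B C :: real
        using that by linarith
      then show ?thesis using \<open>\<bar>P k - c 0 * A k\<bar> \<le> b k\<close> \<open>\<bar>\<Sum>i<k. P i - c (k - i) * A i\<bar> \<le> (\<Sum>i<k. b i)\<close> by blast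
    qed
    also have "\<dots> = (\<Sum>i\<le>k. b i)" by (simp add: lessThan_Suc_atMost[symmetric])
    also have "\<dots> = eps * Ld * N * (\<Sum>i\<le>k. w i) + F * (\<Sum>i\<le>k. fw i)"
      by (simp add: b_def sum.distrib sum_distrib_left)
    also have "\<dots> \<le> eps * Ld * N * zeta_sum rate + F * (\<Sum>i\<le>k. fw i)"
      unfolding w_def using r eps_pos Ld N by (intro add_right_mono mult_left_mono zeta_sum_rev) auto
    finally show ?thesis .
  qed
  have e5: "\<bar>\<Sum>i<k. c (k - i) * (A i - A k)\<bar> \<le> eps * (gamma_const * mom_const * zeta_sum (rate - 1))"
  proof -
    have "\<bar>\<Sum>i<k. c (k - i) * (A i - A k)\<bar> \<le> (\<Sum>i<k. eps * (gamma_const * mom_const) * (real (k - i) + 1) powr (- (rate - 1)))"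
    proof (rule order_trans[OF sum_abs sum_mono])
      fix i assume i: "i \<in> {..<k}"
      have "\<bar>c (k - i) * (A i - A k)\<bar> \<le> (gamma_const * (real (k - i) + 1) powr (- rate)) * (eps * mom_const * (real (k - i) + 1))"
        unfolding abs_mult c_def A_def using i gamma_const_pos by (intro mult_mono autocov_le term_variance) auto
      also have "\<dots> = eps * (gamma_const * mom_const) * ((real (k - i) + 1) powr (- rate) * (real (k - i) + 1))"
        by (simp only: ac_simps)
      also have "(real (k - i) + 1) powr (- rate) * (real (k - i) + 1) = (real (k - i) + 1) powr (- (rate - 1))"
        using powr_mult_base[of "real (k - i) + 1" "- rate"] by (simp add: mult.commute)
      finally show "\<bar>c (k - i) * (A i - A k)\<bar> \<le> eps * (gamma_const * mom_const) * (real (k - i) + 1) powr (- (rate - 1))" .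
    qed
    also have "\<dots> = eps * (gamma_const * mom_const) * (\<Sum>i<k. (real (k - i) + 1) powr (- (rate - 1)))"
      by (simp add: sum_distrib_left)
    also have "\<dots> \<le> eps * (gamma_const * mom_const) * zeta_sum (rate - 1)"
      using r eps_pos gamma_const_pos mom_const_ge1 by (intro mult_left_mono zeta_sum_rev) auto
    finally show ?thesis by (simp add: mult.assoc)
  qed
  have e6: "\<bar>tail * A k\<bar> \<le> (gamma_const * zeta_sum (rate / 2) * (real k + 1) powr (- rate / 2)) * (hc / s)"
    unfolding abs_mult
  proof (intro mult_mono)
    show "\<bar>tail\<bar> \<le> gamma_const * zeta_sum (rate / 2) * (real k + 1) powr (- rate / 2)"
      unfolding tail_def c_def by (rule autocov_tail[OF r])
    have "\<bar>A k\<bar> \<le> expectation (\<lambda>_. hc / s)"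
      unfolding A_def by (rule abs_expectation_le(2)) (use G2_bound in auto)
    then show "\<bar>A k\<bar> \<le> hc / s" by (simp add: prob_space)
    show "0 \<le> gamma_const * zeta_sum (rate / 2) * (real k + 1) powr (- rate / 2)"
    proof -
      have "x / 2 > 1" if "x > 2" for x :: real using that by simp
      then have "rate / 2 > 1" using r by blast
      from zeta_sum_nonneg[OF this] show ?thesis using gamma_const_pos by simp
    qed
  qed simp
  have "(\<Sum>j. c (Suc j)) = (\<Sum>i<k. c (k - i)) + tail"
  proof -
    have sm: "summable (\<lambda>j. c (Suc j))"
      using summable_rabs_cancel[OF autocov_summable[of 1]] r by (simp add: c_def)
    have "(\<Sum>j. c (Suc j)) = (\<Sum>j. c (Suc (j + k))) + (\<Sum>j<k. c (Suc j))"
      by (rule suminf_split_initial_segment[OF sm])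
    moreover have "(\<Sum>j<k. c (Suc j)) = (\<Sum>i<k. c (Suc (k - Suc i)))"
      by (rule sum.nat_diff_reindex[symmetric])
    moreover have "\<dots> = (\<Sum>i<k. c (k - i))" by (intro sum.cong) (auto simp: Suc_diff_Suc)
    ultimately show ?thesis by (simp add: tail_def)
  qed
  then have v: "\<sigma>\<^sup>2 / 2 = c 0 / 2 + (\<Sum>i<k. c (k - i)) + tail" using var by (simp add: c_def)
  \<comment> \<open>An exact decomposition into six errors. The means \<open>A i\<close> of the
    second derivatives are all moved to the index \<open>k\<close>, so that the autocovariances
    acquire one common coefficient.\<close>
  have "u1 - u' = (u1 - u - Q - P k / 2) - (u' - u - \<sigma>\<^sup>2 / 2 * A k) + (Q - (\<Sum>i<k. P i))
     + ((\<Sum>i<k. P i - c (k - i) * A i) + (P k - c 0 * A k) / 2) + (\<Sum>i<k. c (k - i) * (A i - A k)) - tail * A k"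
  proof -
    have "(\<Sum>i<k. P i - c (k - i) * A i) = (\<Sum>i<k. P i) - (\<Sum>i<k. c (k - i) * A i)"
      by (rule sum_subtractf)
    moreover have "(\<Sum>i<k. c (k - i) * (A i - A k)) = (\<Sum>i<k. c (k - i) * A i) - (\<Sum>i<k. c (k - i)) * A k"
      by (simp add: right_diff_distrib sum_subtractf sum_distrib_right)
    ultimately show ?thesis unfolding v by (simp add: algebra_simps diff_divide_distrib)
  qed
  then have "\<bar>u1 - u'\<bar> \<le> eps * mom_const + eps * (\<sigma> powr (2 + d) * gauss_moment (2 + d))
      + (cov_const * (real k + 1) powr (- rate) * hc + eps * (2 powr rate * cov_const * mom_const) * zeta_sum rate)
      + (eps * Ld * N * zeta_sum rate + F * (\<Sum>i\<le>k. fw i)) + eps * (gamma_const * mom_const * zeta_sum (rate - 1))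
      + (gamma_const * zeta_sum (rate / 2) * (real k + 1) powr (- rate / 2)) * (hc / s)"
    using e1 e2 e3 e4 e5 e6 by linarith
  also have "\<dots> = eps * (mom_const + \<sigma> powr (2 + d) * gauss_moment (2 + d) + 2 powr rate * cov_const * mom_const * zeta_sum rate
        + gamma_const * mom_const * zeta_sum (rate - 1)) + eps * Ld * (N * zeta_sum rate)
      + cov_const * hc * (real k + 1) powr (- rate) + hc / s * (gamma_const * zeta_sum (rate / 2) * (real k + 1) powr (- rate / 2))
      + F * (\<Sum>i\<le>k. fw i)"
    by (simp add: algebra_simps)
  also have "\<dots> \<le> eps * Ld * (mom_const + \<sigma> powr (2 + d) * gauss_moment (2 + d) + 2 powr rate * cov_const * mom_const * zeta_sum rate
        + gamma_const * mom_const * zeta_sum (rate - 1)) + eps * Ld * (N * zeta_sum rate)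
      + cov_const * hc * (real k + 1) powr (- rate) + hc / s * (gamma_const * zeta_sum (rate / 2) * (real k + 1) powr (- rate / 2))
      + F * (\<Sum>i\<le>k. fw i)"
    using eps_pos Ld mom_const_ge1 gauss_moment_nonneg cov_const_pos gamma_const_pos zeta_sum_nonneg[of rate] zeta_sum_nonneg[of "rate - 1"] r
    by (intro add_right_mono mult_right_mono add_nonneg_nonneg mult_nonneg_nonneg) auto
  also have "\<dots> = step_const \<sigma> d * eps * Ld
      + cov_const * hc * (real k + 1) powr (- rate) + hc / s * (gamma_const * zeta_sum (rate / 2) * (real k + 1) powr (- rate / 2))
      + F * (\<Sum>i\<le>k. fw i)"
    by (simp add: step_const_def N_def algebra_simps)
  finally show ?thesis by (simp add: u1_def u'_def F_def Ld_def fw_def)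
qed

end

section \<open>Summation of the exchange errors over a block\<close>

lemma sum_inverse_le: "(\<Sum>t=1..n. 1 / real t) \<le> 1 + ln (real (max 1 n))"
proof (induction n)
  case (Suc n)
  show ?case
  proof (cases "n = 0")
    case False
    then have n: "n \<ge> 1" by simp
    have "ln (real n / real (Suc n)) \<le> real n / real (Suc n) - 1"
      using n by (intro ln_le_minus_one) auto
    also have "\<dots> = - (1 / real (Suc n))" by (simp add: field_simps)
    finally have "1 / real (Suc n) \<le> ln (real (Suc n)) - ln (real n)" using n by (simp add: ln_div)
    then show ?thesis using Suc n by simp
  qed simp
qed simp

lemma sum_inverse_sqrt_le: "(\<Sum>t=1..n. 1 / sqrt (real t)) \<le> 2 * sqrt (real n)"
proof (induction n)
  case (Suc n)
  let ?a = "sqrt (real n)" and ?b = "sqrt (real (Suc n))"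
  have b: "?b > 0" by simp
  have "2 * ?a * ?b \<le> ?a\<^sup>2 + ?b\<^sup>2" by (rule sum_squares_bound)
  also have "\<dots> = 2 * (?b * ?b) - 1" by simp
  finally have "1 \<le> (2 * ?b - 2 * ?a) * ?b" by (simp add: algebra_simps)
  then have "1 / ?b \<le> 2 * ?b - 2 * ?a" using b by (simp add: pos_divide_le_eq)
  then show ?case using Suc by simp
qed simp

lemma sum_reverse_index:
  fixes f :: "nat \<Rightarrow> real"
  shows "(\<Sum>k<n. f (n - k)) = (\<Sum>t=1..n. f t)"
  by (rule sum.reindex_bij_witness[of _ "\<lambda>t. n - t" "\<lambda>k. n - k"]) auto

context mixing_sequence
begin

text \<open>\<open>U t k\<close> keeps \<open>k\<close> variables of the block and smooths with
  variance \<open>t * \<sigma>\<^sup>2\<close>; each exchange removes the last variable and adds one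
  unit of variance. The path starts at \<open>t = 1\<close> instead of 0, since the derivatives blow
  up without smoothing; the one variable left out is replaced beforehand at a bounded cost.\<close>

theorem block_gaussian_approximation:
  fixes \<sigma> d :: real
  assumes \<sigma>: "\<sigma> > 0" and var: "\<sigma>\<^sup>2 = autocov M X 0 + 2 * (\<Sum>j. autocov M X (Suc j))"
    and r: "rate > 2" and d: "0 < d" "d \<le> 1" "d \<le> \<delta>"
  shows "\<exists>C>0. \<forall>q m L H. 1 \<le> m \<longrightarrow> 1 \<le> L \<longrightarrow> past_lipschitz q H \<longrightarrow>
     \<bar>expectation (\<lambda>\<omega>. H \<omega> (block_sum q m \<omega>)) - expectation (\<lambda>\<omega>. gsmooth 0 (\<sigma> * sqrt (real m)) (H \<omega>) 0)\<bar>
      \<le> C * ((1 + ln (real m)) * real m powr ((1 - d) / 2) * real L powr d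
          + sqrt (real m) * real L powr (- arate / 2) + real L)"
proof -
  have half: "x / 2 > 1" if "x > 2" for x :: real using that by simp
  have r2: "rate / 2 > 1" using r half by blast
  have r1: "rate > 1" using r by simp
  define c1 where "c1 = step_const \<sigma> d * (2 * hc * \<sigma> powr (- 1 - d))"
  define c2 where "c2 = cov_const * hc * zeta_sum rate + hc / \<sigma> * gamma_const * zeta_sum (rate / 2) * zeta_sum (rate / 2)"
  define c3 where "c3 = hc / \<sigma> * sqrt (xx_decay * xx_mix) * zeta_sum (rate / 2)"
  define c4 where "c4 = mom_const + hc * \<sigma>"
  have xx: "xx_decay \<ge> 0" "xx_mix \<ge> 0"
    using mom_const_ge1 cov_const_pos gamma_const_pos by (auto simp: xx_decay_def xx_mix_def)
  note z = zeta_sum_nonneg[OF r1] zeta_sum_nonneg[OF r2]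
  have z1: "zeta_sum (rate - 1) \<ge> 0" using r by (intro zeta_sum_nonneg) simp
  have "step_const \<sigma> d \<ge> 0"
    unfolding step_const_def using z z1 mom_const_ge1 cov_const_pos gamma_const_pos gauss_moment_nonneg
    by (intro add_nonneg_nonneg mult_nonneg_nonneg) auto
  then have c: "c1 \<ge> 0" "c2 \<ge> 0" "c3 \<ge> 0" "c4 > 0"
    unfolding c1_def c2_def c3_def c4_def using hc_pos \<sigma> z xx mom_const_ge1 cov_const_pos gamma_const_pos
    by (auto intro!: add_nonneg_nonneg mult_nonneg_nonneg divide_nonneg_pos add_pos_pos mult_pos_pos)
  define C where "C = c1 + c2 + 2 * c3 + c4"
  have "\<bar>expectation (\<lambda>\<omega>. H \<omega> (block_sum q m \<omega>)) - expectation (\<lambda>\<omega>. gsmooth 0 (\<sigma> * sqrt (real m)) (H \<omega>) 0)\<bar>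
      \<le> C * ((1 + ln (real m)) * real m powr ((1 - d) / 2) * real L powr d
          + sqrt (real m) * real L powr (- arate / 2) + real L)"
    if m: "1 \<le> m" and L: "1 \<le> L" and H: "past_lipschitz q H" for q m L H
  proof -
    define n where "n = m - 1"
    have mn: "m = Suc n" using m by (simp add: n_def)
    let ?S = "block_sum q"
    define s where "s t = \<sigma> * sqrt (real t)" for t :: nat
    define U where "U t k = expectation (gs_at 0 (s t) H (?S k))" for t k
    have sp: "s t > 0" if "t \<ge> 1" for t using that \<sigma> by (simp add: s_def)
    have lb: "lindeberg_block M X \<delta> \<theta> c\<^sub>\<phi> c\<^sub>X q H (s t) d" if "t \<ge> 1" for t
      by unfold_locales (use H sp[OF that] d in auto)
    have ss: "sqrt ((s t)\<^sup>2 + \<sigma>\<^sup>2) = s (Suc t)" for t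
    proof -
      have "(s t)\<^sup>2 + \<sigma>\<^sup>2 = (\<sigma> * sqrt (real (Suc t)))\<^sup>2" by (simp add: s_def power_mult_distrib algebra_simps)
      then show ?thesis using \<sigma> by (simp add: s_def)
    qed
    define w where "w k i = (real (k - i) + 1) powr (- rate / 2) * (real (min i L) + 1) powr (- arate / 2)" for k i
    have step: "\<bar>U (n - k) (Suc k) - U (Suc (n - k)) k\<bar>
      \<le> c1 * real L powr d * (real (n - k) powr ((- 1 - d) / 2)) + cov_const * hc * (real k + 1) powr (- rate)
       + hc / \<sigma> * (gamma_const * zeta_sum (rate / 2) * (real k + 1) powr (- rate / 2))
       + hc / \<sigma> * sqrt (xx_decay * xx_mix) * (1 / sqrt (real (n - k)) * (\<Sum>i\<le>k. w k i))" if k: "k < n" for k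
    proof -
      have t: "n - k \<ge> 1" using k by simp
      interpret B: lindeberg_block M X \<delta> \<theta> c\<^sub>\<phi> c\<^sub>X q H "s (n - k)" d by (rule lb[OF t])
      have sk: "s (n - k) = \<sigma> * sqrt (real (n - k))" by (simp add: s_def)
      have e: "B.eps = 2 * hc * \<sigma> powr (- 1 - d) * real (n - k) powr ((- 1 - d) / 2)"
      proof -
        have "sqrt (real (n - k)) powr (- 1 - d) = real (n - k) powr ((- 1 - d) / 2)"
          by (simp add: powr_half_sqrt[symmetric] powr_powr)
        moreover have "B.eps = 2 * hc * s (n - k) powr (- 1 - d)" by (rule B.eps_def)
        ultimately show ?thesis by (simp add: sk powr_mult)
      qed
      have le: "hc / s (n - k) \<le> hc / \<sigma>"
        using hc_pos \<sigma> t unfolding sk by (intro divide_left_mono) (auto simp: real_sqrt_ge_1_iff)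
      have "\<bar>U (n - k) (Suc k) - U (Suc (n - k)) k\<bar> \<le> step_const \<sigma> d * B.eps * real L powr d + cov_const * hc * (real k + 1) powr (- rate)
       + hc / s (n - k) * (gamma_const * zeta_sum (rate / 2) * (real k + 1) powr (- rate / 2))
       + hc / s (n - k) * sqrt (xx_decay * xx_mix) * (\<Sum>i\<le>k. w k i)"
        using B.lindeberg_step[OF \<sigma> var r L, of k] unfolding ss U_def w_def .
      also have "\<dots> \<le> step_const \<sigma> d * B.eps * real L powr d + cov_const * hc * (real k + 1) powr (- rate)
       + hc / \<sigma> * (gamma_const * zeta_sum (rate / 2) * (real k + 1) powr (- rate / 2))
       + hc / s (n - k) * sqrt (xx_decay * xx_mix) * (\<Sum>i\<le>k. w k i)"
        using le gamma_const_pos z by (intro add_right_mono add_left_mono mult_right_mono) auto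
      also have "hc / s (n - k) * sqrt (xx_decay * xx_mix) * (\<Sum>i\<le>k. w k i)
        = hc / \<sigma> * sqrt (xx_decay * xx_mix) * (1 / sqrt (real (n - k)) * (\<Sum>i\<le>k. w k i))"
        unfolding sk by simp
      also have "step_const \<sigma> d * B.eps * real L powr d = c1 * real L powr d * (real (n - k) powr ((- 1 - d) / 2))"
        unfolding e c1_def by simp
      finally show ?thesis .
    qed
    have tele: "U 1 n - U (Suc n) 0 = (\<Sum>k<n. U (n - k) (Suc k) - U (Suc (n - k)) k)"
    proof -
      have "(\<Sum>k<n. U (Suc n - Suc k) (Suc k) - U (Suc n - k) k) = U (Suc n - n) n - U (Suc n - 0) 0"
        by (rule sum_lessThan_telescope[of "\<lambda>k. U (Suc n - k) k"])
      moreover have "(\<Sum>k<n. U (Suc n - Suc k) (Suc k) - U (Suc n - k) k) = (\<Sum>k<n. U (n - k) (Suc k) - U (Suc (n - k)) k)"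
        by (intro sum.cong) (auto simp: Suc_diff_le)
      ultimately show ?thesis by simp
    qed
    let ?lnm = "1 + ln (real m)" and ?P = "real m powr ((1 - d) / 2)" and ?La = "real L powr (- arate / 2)"
    \<comment> \<open>Bounding \<open>real t powr ((1 - d) / 2)\<close> by its value at
      \<open>m\<close> leaves a harmonic sum, which treats \<open>d < 1\<close> and
      \<open>d = 1\<close> alike.\<close>
    have s1: "(\<Sum>k<n. real (n - k) powr ((- 1 - d) / 2)) \<le> ?lnm * ?P"
    proof -
      have "(\<Sum>k<n. real (n - k) powr ((- 1 - d) / 2)) = (\<Sum>t=1..n. real t powr ((- 1 - d) / 2))"
        by (rule sum_reverse_index)
      also have "\<dots> \<le> (\<Sum>t=1..n. ?P * (1 / real t))"
      proof (rule sum_mono)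
        fix t assume t: "t \<in> {1..n}"
        have "(1 - d) / 2 + - 1 = (- 1 - d) / 2" by (simp add: field_simps)
        then have "real t powr ((- 1 - d) / 2) = real t powr ((1 - d) / 2) * real t powr (- 1)"
          by (metis powr_add)
        also have "\<dots> \<le> ?P * (1 / real t)"
          using t mn d by (intro mult_mono powr_mono2) (auto simp: powr_minus_divide)
        finally show "real t powr ((- 1 - d) / 2) \<le> ?P * (1 / real t)" .
      qed
      also have "\<dots> = ?P * (\<Sum>t=1..n. 1 / real t)" by (simp add: sum_distrib_left)
      also have "\<dots> \<le> ?P * ?lnm"
        using sum_inverse_le[of n] mn by (intro mult_left_mono order_trans[OF sum_inverse_le]) auto
      finally show ?thesis by (simp add: mult.commute)
    qed
    have s2: "(\<Sum>k<n. (real k + 1) powr (- rate)) \<le> zeta_sum rate" using r1 by (intro zeta_sum_ge) auto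
    have s3: "(\<Sum>k<n. (real k + 1) powr (- rate / 2)) \<le> zeta_sum (rate / 2)"
      using zeta_sum_ge[OF r2, of "{..<n}"] by simp
    have wle: "w k i \<le> (real (k - i) + 1) powr (- rate / 2) * (?La + (if i < L then 1 else 0))" for k i
    proof -
      have a: "- arate / 2 \<le> 0" using \<theta>_pos \<delta>_pos by simp
      have "(real (min i L) + 1) powr (- arate / 2) \<le> ?La + (if i < L then 1 else 0)"
      proof (cases "i < L")
        case True
        have "(real (min i L) + 1) powr (- arate / 2) \<le> 1 powr (- arate / 2)"
          using a by (intro powr_mono2') auto
        then show ?thesis using True by (simp add: add_increasing)
      next
        case False
        then have "(real (min i L) + 1) powr (- arate / 2) \<le> ?La"
          using a L by (intro powr_mono2') auto
        then show ?thesis using False by simp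
      qed
      then show ?thesis unfolding w_def by (intro mult_left_mono) auto
    qed
    have wle': "w k i \<le> (real (k - i) + 1) powr (- (rate / 2)) * ?La + (if i < L then (real (k - i) + 1) powr (- (rate / 2)) else 0)" for k i
      using wle[of k i] by (cases "i < L") (simp_all add: distrib_left)
    \<comment> \<open>Indices \<open>i \<ge> L\<close> have the full gap and give \<open>?La\<close>
      times a sum of inverse square roots. Indices \<open>i < L\<close> get no such gain, but after
      exchanging the sums each of them costs at most one zeta sum; this is the source of the term
      \<open>real L\<close>.\<close>
    have s4: "(\<Sum>k<n. 1 / sqrt (real (n - k)) * (\<Sum>i\<le>k. w k i)) \<le> zeta_sum (rate / 2) * (2 * (sqrt (real m) * ?La) + real L)"
    proof -
      have "(\<Sum>k<n. 1 / sqrt (real (n - k)) * (\<Sum>i\<le>k. w k i))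
        \<le> (\<Sum>k<n. zeta_sum (rate / 2) * ?La * (1 / sqrt (real (n - k))) + (\<Sum>i\<in>{..k} \<inter> {..<L}. (real (k - i) + 1) powr (- (rate / 2))))"
      proof (rule sum_mono)
        fix k assume k: "k \<in> {..<n}"
        have "(\<Sum>i\<le>k. w k i) \<le> (\<Sum>i\<le>k. (real (k - i) + 1) powr (- (rate / 2)) * ?La + (if i < L then (real (k - i) + 1) powr (- (rate / 2)) else 0))"
          by (intro sum_mono wle')
        also have "\<dots> = (\<Sum>i\<le>k. (real (k - i) + 1) powr (- (rate / 2))) * ?La + (\<Sum>i\<in>{..k} \<inter> {..<L}. (real (k - i) + 1) powr (- (rate / 2)))"
          by (simp add: sum.distrib sum_distrib_right sum.If_cases lessThan_def)
        also have "\<dots> \<le> zeta_sum (rate / 2) * ?La + (\<Sum>i\<in>{..k} \<inter> {..<L}. (real (k - i) + 1) powr (- (rate / 2)))"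
          by (intro add_right_mono mult_right_mono zeta_sum_rev r2) auto
        finally have "1 / sqrt (real (n - k)) * (\<Sum>i\<le>k. w k i)
          \<le> 1 / sqrt (real (n - k)) * (zeta_sum (rate / 2) * ?La + (\<Sum>i\<in>{..k} \<inter> {..<L}. (real (k - i) + 1) powr (- (rate / 2))))"
          by (intro mult_left_mono) auto
        also have "\<dots> \<le> zeta_sum (rate / 2) * ?La * (1 / sqrt (real (n - k))) + 1 * (\<Sum>i\<in>{..k} \<inter> {..<L}. (real (k - i) + 1) powr (- (rate / 2)))"
        proof -
          have "1 / sqrt (real (n - k)) \<le> 1" using k by (auto simp: divide_le_eq real_sqrt_ge_1_iff)
          then have "1 / sqrt (real (n - k)) * (\<Sum>i\<in>{..k} \<inter> {..<L}. (real (k - i) + 1) powr (- (rate / 2)))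
            \<le> 1 * (\<Sum>i\<in>{..k} \<inter> {..<L}. (real (k - i) + 1) powr (- (rate / 2)))"
            by (intro mult_right_mono sum_nonneg) auto
          then show ?thesis by (simp add: distrib_left mult.commute)
        qed
        finally show "1 / sqrt (real (n - k)) * (\<Sum>i\<le>k. w k i)
          \<le> zeta_sum (rate / 2) * ?La * (1 / sqrt (real (n - k))) + (\<Sum>i\<in>{..k} \<inter> {..<L}. (real (k - i) + 1) powr (- (rate / 2)))"
          by simp
      qed
      also have "\<dots> = zeta_sum (rate / 2) * ?La * (\<Sum>k<n. 1 / sqrt (real (n - k)))
         + (\<Sum>k<n. \<Sum>i\<in>{..k} \<inter> {..<L}. (real (k - i) + 1) powr (- (rate / 2)))"
        by (simp add: sum.distrib sum_distrib_left)
      also have "(\<Sum>k<n. 1 / sqrt (real (n - k))) = (\<Sum>t=1..n. 1 / sqrt (real t))" by (rule sum_reverse_index)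
      also have "(\<Sum>k<n. \<Sum>i\<in>{..k} \<inter> {..<L}. (real (k - i) + 1) powr (- (rate / 2)))
         = (\<Sum>i<L. \<Sum>k\<in>{k. k < n \<and> i \<le> k}. (real (k - i) + 1) powr (- (rate / 2)))"
      proof -
        have "(\<Sum>k<n. \<Sum>i\<in>{..k} \<inter> {..<L}. (real (k - i) + 1) powr (- (rate / 2)))
           = (\<Sum>k\<in>{..<n}. \<Sum>i | i \<in> {..<L} \<and> i \<le> k. (real (k - i) + 1) powr (- (rate / 2)))"
          by (intro sum.cong) auto
        also have "\<dots> = (\<Sum>i\<in>{..<L}. \<Sum>k | k \<in> {..<n} \<and> i \<le> k. (real (k - i) + 1) powr (- (rate / 2)))"
          by (rule sum.swap_restrict) auto
        finally show ?thesis by simp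
      qed
      also have "\<dots> \<le> (\<Sum>i<L. zeta_sum (rate / 2))"
      proof (rule sum_mono)
        fix i
        let ?A = "{k. k < n \<and> i \<le> k}"
        have "(\<Sum>k\<in>?A. (real (k - i) + 1) powr (- (rate / 2))) = (\<Sum>j\<in>(\<lambda>k. k - i) ` ?A. (real j + 1) powr (- (rate / 2)))"
          by (subst sum.reindex) (auto intro!: inj_onI)
        also have "\<dots> \<le> zeta_sum (rate / 2)" by (intro zeta_sum_ge r2) auto
        finally show "(\<Sum>k\<in>?A. (real (k - i) + 1) powr (- (rate / 2))) \<le> zeta_sum (rate / 2)" .
      qed
      finally have "(\<Sum>k<n. 1 / sqrt (real (n - k)) * (\<Sum>i\<le>k. w k i))
        \<le> zeta_sum (rate / 2) * ?La * (\<Sum>t=1..n. 1 / sqrt (real t)) + (\<Sum>i<L. zeta_sum (rate / 2))" by simp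
      also have "\<dots> \<le> zeta_sum (rate / 2) * ?La * (2 * sqrt (real m)) + real L * zeta_sum (rate / 2)"
      proof (intro add_mono mult_left_mono)
        show "(\<Sum>t=1..n. 1 / sqrt (real t)) \<le> 2 * sqrt (real m)"
          by (rule order_trans[OF sum_inverse_sqrt_le]) (simp add: mn)
      qed (use z in auto)
      also have "\<dots> = zeta_sum (rate / 2) * (2 * (sqrt (real m) * ?La) + real L)"
        by (simp only: distrib_left ac_simps)
      finally show ?thesis .
    qed
    have main: "\<bar>U 1 n - U (Suc n) 0\<bar> \<le> c1 * real L powr d * (?lnm * ?P) + c2 + c3 * (2 * (sqrt (real m) * ?La) + real L)"
    proof -
      have "\<bar>U 1 n - U (Suc n) 0\<bar> \<le> (\<Sum>k<n. c1 * real L powr d * (real (n - k) powr ((- 1 - d) / 2)) + cov_const * hc * (real k + 1) powr (- rate)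
       + hc / \<sigma> * (gamma_const * zeta_sum (rate / 2) * (real k + 1) powr (- rate / 2))
       + hc / \<sigma> * sqrt (xx_decay * xx_mix) * (1 / sqrt (real (n - k)) * (\<Sum>i\<le>k. w k i)))"
        unfolding tele by (rule order_trans[OF sum_abs sum_mono]) (use step in auto)
      also have "\<dots> = c1 * real L powr d * (\<Sum>k<n. real (n - k) powr ((- 1 - d) / 2)) + cov_const * hc * (\<Sum>k<n. (real k + 1) powr (- rate))
       + hc / \<sigma> * (gamma_const * zeta_sum (rate / 2)) * (\<Sum>k<n. (real k + 1) powr (- rate / 2))
       + hc / \<sigma> * sqrt (xx_decay * xx_mix) * (\<Sum>k<n. 1 / sqrt (real (n - k)) * (\<Sum>i\<le>k. w k i))"
        by (simp add: sum.distrib sum_distrib_left mult.assoc)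
      also have "\<dots> \<le> c1 * real L powr d * (?lnm * ?P) + cov_const * hc * zeta_sum rate
       + hc / \<sigma> * (gamma_const * zeta_sum (rate / 2)) * zeta_sum (rate / 2)
       + hc / \<sigma> * sqrt (xx_decay * xx_mix) * (zeta_sum (rate / 2) * (2 * (sqrt (real m) * ?La) + real L))"
        using c hc_pos \<sigma> z xx cov_const_pos gamma_const_pos
        by (intro add_mono mult_left_mono s1 s2 s3 s4) auto
      also have "\<dots> = c1 * real L powr d * (?lnm * ?P) + c2 + c3 * (2 * (sqrt (real m) * ?La) + real L)"
        by (simp add: c2_def c3_def mult.assoc)
      finally show ?thesis .
    qed
    \<comment> \<open>Removing one variable and one unit of smoothing changes a Lipschitz function
      by a bounded amount in mean.\<close>
    have last: "\<bar>expectation (\<lambda>\<omega>. H \<omega> (?S m \<omega>)) - U 1 n\<bar> \<le> c4"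
    proof -
      interpret B: lindeberg_block M X \<delta> \<theta> c\<^sub>\<phi> c\<^sub>X q H "s 1" d by (rule lb) simp
      have s1: "s 1 = \<sigma>" by (simp add: s_def)
      have ig: "integrable M (gs_at 0 (s 1) H (?S n))"
        by (rule B.G0_int[OF block_sum_int block_sum_past[OF order_refl]]) simp
      have le: "\<bar>H \<omega> (?S m \<omega>) - gs_at 0 (s 1) H (?S n) \<omega>\<bar> \<le> \<bar>X (q + n) \<omega>\<bar> powr 1 + hc * \<sigma>" for \<omega>
      proof -
        have "\<bar>gsmooth 0 (s 1) (H \<omega>) (?S n \<omega>) - H \<omega> (?S n \<omega>)\<bar> \<le> hermite_const * s 1"
          by (rule gsmooth_0_near[OF B.H_lip B.s])
        also have "\<dots> \<le> hc * \<sigma>" unfolding s1 using hc_pos \<sigma> by (intro mult_right_mono) auto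
        finally have 1: "\<bar>gsmooth 0 (s 1) (H \<omega>) (?S n \<omega>) - H \<omega> (?S n \<omega>)\<bar> \<le> hc * \<sigma>" .
        have "\<bar>H \<omega> (?S m \<omega>) - H \<omega> (?S n \<omega>)\<bar> \<le> \<bar>X (q + n) \<omega>\<bar>"
          using B.H_lip[of \<omega> "?S m \<omega>" "?S n \<omega>"] unfolding mn B.S_Suc by simp
        then show ?thesis using 1 unfolding gs_at_def by simp
      qed
      have iH: "integrable M (\<lambda>\<omega>. H \<omega> (?S m \<omega>))"
      proof (rule abs_expectation_le(1))
        show "integrable M (\<lambda>\<omega>. \<bar>H \<omega> 0\<bar> + \<bar>?S m \<omega>\<bar>)"
          using H block_sum_int by (simp add: past_lipschitz_def)
        show "\<bar>H \<omega> (?S m \<omega>)\<bar> \<le> \<bar>H \<omega> 0\<bar> + \<bar>?S m \<omega>\<bar>" for \<omega> using B.H_lip[of \<omega> "?S m \<omega>" 0] by simp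
        have "(\<lambda>\<omega>. (\<omega>, ?S m \<omega>)) \<in> measurable M (past q \<Otimes>\<^sub>M borel)"
          using past_measurable[OF measurable_ident_sets[OF refl], of q] by (intro measurable_Pair) (simp_all add: id_def)
        moreover have "case_prod H \<in> borel_measurable (past q \<Otimes>\<^sub>M borel)" using H by (simp add: past_lipschitz_def)
        ultimately show "(\<lambda>\<omega>. H \<omega> (?S m \<omega>)) \<in> borel_measurable M"
          using measurable_compose by fastforce
      qed
      have iX: "integrable M (\<lambda>\<omega>. \<bar>X (q + n) \<omega>\<bar> powr 1)" "expectation (\<lambda>\<omega>. \<bar>X (q + n) \<omega>\<bar> powr 1) \<le> mom_const"
        using X_lower_moment[of 1 "q + n"] \<delta>_pos by auto
      have "\<bar>expectation (\<lambda>\<omega>. H \<omega> (?S m \<omega>)) - U 1 n\<bar> = \<bar>expectation (\<lambda>\<omega>. H \<omega> (?S m \<omega>) - gs_at 0 (s 1) H (?S n) \<omega>)\<bar>"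
        unfolding U_def using iH ig by simp
      also have "\<dots> \<le> expectation (\<lambda>\<omega>. \<bar>X (q + n) \<omega>\<bar> powr 1 + hc * \<sigma>)"
        by (rule abs_expectation_le(2)[OF _ _ le]) (use iX iH ig in \<open>auto intro!: borel_measurable_diff borel_measurable_integrable\<close>)
      also have "\<dots> = expectation (\<lambda>\<omega>. \<bar>X (q + n) \<omega>\<bar> powr 1) + hc * \<sigma>" using iX by (simp add: prob_space)
      also have "\<dots> \<le> c4" using iX(2) by (simp add: c4_def)
      finally show ?thesis .
    qed
    have U0: "U (Suc n) 0 = expectation (\<lambda>\<omega>. gsmooth 0 (\<sigma> * sqrt (real m)) (H \<omega>) 0)"
      unfolding U_def gs_at_def s_def mn by (simp add: block_sum_def)
    have nn: "real L \<ge> 1" "?lnm * ?P * real L powr d \<ge> 0" "sqrt (real m) * ?La \<ge> 0"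
      using L m by auto
    have "\<bar>expectation (\<lambda>\<omega>. H \<omega> (?S m \<omega>)) - U (Suc n) 0\<bar> \<le> c1 * (?lnm * ?P * real L powr d) + 2 * c3 * (sqrt (real m) * ?La) + c3 * real L + c2 + c4"
      using main last by (simp add: algebra_simps)
    also have "\<dots> \<le> C * (?lnm * ?P * real L powr d) + C * (sqrt (real m) * ?La) + (c3 + c2 + c4) * real L"
    proof -
      have "c2 * 1 \<le> c2 * real L" "c4 * 1 \<le> c4 * real L" using c nn by (intro mult_left_mono; simp)+
      moreover have "c1 * (?lnm * ?P * real L powr d) \<le> C * (?lnm * ?P * real L powr d)" "2 * c3 * (sqrt (real m) * ?La) \<le> C * (sqrt (real m) * ?La)"
        using c nn by (intro mult_right_mono; simp add: C_def)+
      ultimately show ?thesis by (simp add: distrib_right)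
    qed
    also have "\<dots> \<le> C * (?lnm * ?P * real L powr d) + C * (sqrt (real m) * ?La) + C * real L"
      using c by (intro add_left_mono mult_right_mono) (auto simp: C_def)
    finally show ?thesis unfolding U0 by (simp add: distrib_left)
  qed
  moreover have "C > 0" using c by (simp add: C_def add_nonneg_pos)
  ultimately show ?thesis by blast
qed

end

section \<open>Dyadic chaining in the path space\<close>

lemma dist_cadlag_le:
  assumes "\<And>t. t \<in> {0..1} \<Longrightarrow> \<bar>apply_cadlag x t - apply_cadlag y t\<bar> \<le> c"
  shows "dist x y \<le> c"
  unfolding dist_cadlag_def by (rule cSUP_least) (use assms in auto)

text \<open>The increment \<open>x k\<close> enters at time \<open>(k + 1) / J\<close>, so on the
  unit interval exactly the coordinates \<open>k < J\<close> matter, the last one at time 1.\<close>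

definition step_fun :: "nat \<Rightarrow> (nat \<Rightarrow> real) \<Rightarrow> real \<Rightarrow> real" where
  "step_fun J x t = (\<Sum>k<nat \<lfloor>real J * t\<rfloor>. x k)"

definition step_path :: "nat \<Rightarrow> (nat \<Rightarrow> real) \<Rightarrow> cadlag" where
  "step_path J x = to_cadlag (step_fun J x)"

lemma is_cadlag_step_fun:
  assumes "J \<ge> 1"
  shows "is_cadlag (step_fun J x)"
  unfolding is_cadlag_def
proof (intro conjI ballI)
  have J: "real J > 0" using assms by simp
  fix t :: real
  define v where "v = \<lfloor>real J * t\<rfloor>"
  have v: "of_int v \<le> real J * t" "real J * t < of_int v + 1" by (auto simp: v_def)
  have "\<forall>\<^sub>F s in at_right t. step_fun J x s = step_fun J x t"
  proof (rule eventually_at_rightI)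
    show "t < (of_int v + 1) / real J" using v J by (simp add: field_simps)
    show "step_fun J x s = step_fun J x t" if "s \<in> {t<..<(of_int v + 1) / real J}" for s
    proof -
      have "real J * t \<le> real J * s" "real J * s < of_int v + 1" using that J by (auto simp: field_simps)
      then have "\<lfloor>real J * s\<rfloor> = v" using v by (intro floor_unique) auto
      then show ?thesis by (simp add: step_fun_def v_def)
    qed
  qed
  then show "(step_fun J x \<longlongrightarrow> step_fun J x t) (at_right t)" by (rule tendsto_eventually)
next
  have J: "real J > 0" using assms by simp
  fix t :: real
  define v where "v = \<lceil>real J * t\<rceil> - 1"
  have v: "of_int v < real J * t" "real J * t \<le> of_int v + 1" by (auto simp: v_def) linarith+
  have "\<forall>\<^sub>F s in at_left t. step_fun J x s = (\<Sum>k<nat v. x k)"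
  proof (rule eventually_at_leftI)
    show "of_int v / real J < t" using v J by (simp add: field_simps)
    show "step_fun J x s = (\<Sum>k<nat v. x k)" if "s \<in> {of_int v / real J<..<t}" for s
    proof -
      have "of_int v \<le> real J * s" "real J * s < real J * t" using that J by (auto simp: field_simps)
      then have "\<lfloor>real J * s\<rfloor> = v" using v by (intro floor_unique) auto
      then show ?thesis by (simp add: step_fun_def)
    qed
  qed
  then show "\<exists>l. (step_fun J x \<longlongrightarrow> l) (at_left t)" using tendsto_eventually by blast
qed

lemma apply_step_path: "J \<ge> 1 \<Longrightarrow> t \<in> {0..1} \<Longrightarrow> apply_cadlag (step_path J x) t = step_fun J x t"
  unfolding step_path_def by (rule apply_to_cadlag[OF is_cadlag_step_fun])

lemma step_index_le:
  assumes "t \<in> {0..1 :: real}"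
  shows "nat \<lfloor>real J * t\<rfloor> \<le> J"
proof -
  have "real J * t \<le> real J * 1" using assms by (intro mult_left_mono) auto
  then have "\<lfloor>real J * t\<rfloor> \<le> int J" by (simp add: floor_le_iff)
  then show ?thesis by simp
qed

lemma step_path_dist:
  assumes "J \<ge> 1"
  shows "dist (step_path J x) (step_path J y) \<le> (\<Sum>k<J. \<bar>x k - y k\<bar>)"
proof (rule dist_cadlag_le)
  fix t :: real assume t: "t \<in> {0..1}"
  let ?n = "nat \<lfloor>real J * t\<rfloor>"
  have "\<bar>step_fun J x t - step_fun J y t\<bar> = \<bar>\<Sum>k<?n. x k - y k\<bar>"
    by (simp add: step_fun_def sum_subtractf)
  also have "\<dots> \<le> (\<Sum>k<?n. \<bar>x k - y k\<bar>)" by (rule sum_abs)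
  also have "\<dots> \<le> (\<Sum>k<J. \<bar>x k - y k\<bar>)" using step_index_le[OF t, of J] by (intro sum_mono2) auto
  finally show "\<bar>apply_cadlag (step_path J x) t - apply_cadlag (step_path J y) t\<bar> \<le> (\<Sum>k<J. \<bar>x k - y k\<bar>)"
    using assms t by (simp add: apply_step_path)
qed

lemma step_path_cong: "(\<And>k. k < J \<Longrightarrow> x k = y k) \<Longrightarrow> J \<ge> 1 \<Longrightarrow> step_path J x = step_path J y"
  using step_path_dist[of J x y] by simp

text \<open>In the uniform metric the path space is not separable and its Borel sets are not
  generated by the values at fixed times. Measurability is therefore drawn from continuity: a map
  that is Lipschitz in finitely many coordinates is continuous for the product topology.\<close>

lemma coordinate_lipschitz_measurable:
  fixes f :: "(nat \<Rightarrow> real) \<Rightarrow> 'b :: metric_space"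
  assumes "\<And>x y. dist (f x) (f y) \<le> c * (\<Sum>k<J. \<bar>x k - y k\<bar>)"
  shows "f \<in> borel_measurable borel"
proof (rule borel_measurable_continuous_onI)
  have "(f \<longlongrightarrow> f x) (at x)" for x
  proof (rule metric_tendsto_imp_tendsto[where f = "\<lambda>y. c * (\<Sum>k<J. \<bar>y k - x k\<bar>)" and a = 0])
    have "((\<lambda>y. y k) \<longlongrightarrow> x k) (at x)" for k :: nat
    proof -
      have "continuous_on UNIV (\<lambda>y :: nat \<Rightarrow> real. y k)" by simp
      then show ?thesis unfolding continuous_on_def by blast
    qed
    then have "((\<lambda>y. c * (\<Sum>k<J. \<bar>y k - x k\<bar>)) \<longlongrightarrow> c * (\<Sum>k<J. \<bar>x k - x k\<bar>)) (at x)"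
      by (intro tendsto_intros)
    then show "((\<lambda>y. c * (\<Sum>k<J. \<bar>y k - x k\<bar>)) \<longlongrightarrow> 0) (at x)" by simp
    show "\<forall>\<^sub>F y in at x. dist (f y) (f x) \<le> dist (c * (\<Sum>k<J. \<bar>y k - x k\<bar>)) 0"
    proof (rule always_eventually, rule allI)
      fix y
      show "dist (f y) (f x) \<le> dist (c * (\<Sum>k<J. \<bar>y k - x k\<bar>)) 0"
        using assms[of y x] by (simp add: dist_real_def)
    qed
  qed
  then show "continuous_on UNIV f" by (simp add: continuous_on_def)
qed

lemma step_path_measurable [measurable]:
  assumes "J \<ge> 1"
  shows "step_path J \<in> borel_measurable borel"
  by (rule coordinate_lipschitz_measurable[of _ 1 J]) (use step_path_dist[OF assms] in simp)

lemma measurable_sequence: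
  fixes f :: "nat \<Rightarrow> 'a \<Rightarrow> real"
  assumes "\<And>k. f k \<in> borel_measurable M"
  shows "(\<lambda>\<omega> k. f k \<omega>) \<in> borel_measurable M"
proof -
  have "(\<lambda>\<omega> k. f k \<omega>) \<in> measurable M (PiM UNIV (\<lambda>_. borel))"
    by (rule measurable_PiM_single') (use assms in auto)
  moreover have "sets (PiM UNIV (\<lambda>_ :: nat. borel :: real measure)) = sets borel" by (rule sets_PiM_equal_borel)
  ultimately show ?thesis using measurable_cong_sets by blast
qed

definition pair_sum :: "(nat \<Rightarrow> real) \<Rightarrow> nat \<Rightarrow> real" where
  "pair_sum x k = x (2 * k) + x (2 * k + 1)"

lemma sum_pair_sum: "(\<Sum>k<2 * n. x k) = (\<Sum>k<n. pair_sum x k)"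
  by (induction n) (simp_all add: pair_sum_def)

text \<open>The coarse path is the fine one sampled at even steps, so at any time at most one fine
  increment is missing.\<close>

lemma step_path_refine:
  assumes J: "J \<ge> 1" and c: "\<And>k. k < 2 * J \<Longrightarrow> \<bar>x k\<bar> \<le> c"
  shows "dist (step_path (2 * J) x) (step_path J (pair_sum x)) \<le> c"
proof (rule dist_cadlag_le)
  fix t :: real assume t: "t \<in> {0..1}"
  let ?n = "nat \<lfloor>real J * t\<rfloor>" and ?m = "nat \<lfloor>real (2 * J) * t\<rfloor>"
  have nn: "0 \<le> \<lfloor>real J * t\<rfloor>" "0 \<le> \<lfloor>real (2 * J) * t\<rfloor>" using t by auto
  have "\<lfloor>real (2 * J) * t\<rfloor> = 2 * \<lfloor>real J * t\<rfloor> \<or> \<lfloor>real (2 * J) * t\<rfloor> = 2 * \<lfloor>real J * t\<rfloor> + 1"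
    by (simp add: mult.assoc) linarith
  then have m: "?m = 2 * ?n \<or> ?m = Suc (2 * ?n)" using nn by linarith
  have "\<bar>step_fun (2 * J) x t - step_fun J (pair_sum x) t\<bar> \<le> c"
  proof (cases "?m = 2 * ?n")
    case True
    have "0 \<le> \<bar>x 0\<bar>" by simp
    also have "\<dots> \<le> c" using c[of 0] J by simp
    finally show ?thesis using True by (simp add: step_fun_def sum_pair_sum[symmetric])
  next
    case False
    then have mm: "?m = Suc (2 * ?n)" using m by simp
    have "2 * ?n < 2 * J" using step_index_le[OF t, of "2 * J"] mm by linarith
    then have "\<bar>x (2 * ?n)\<bar> \<le> c" by (rule c)
    then show ?thesis unfolding step_fun_def mm by (simp add: sum_pair_sum)
  qed
  then show "\<bar>apply_cadlag (step_path (2 * J) x) t - apply_cadlag (step_path J (pair_sum x)) t\<bar> \<le> c"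
    using J t by (simp add: apply_step_path)
qed

text \<open>The largest increment is bounded by a sum of \<open>p\<close>-th powers, in a form
  linear in these powers so that expectations can be taken without roots. The scale \<open>u\<close>
  is free.\<close>

lemma step_path_refine_powr:
  assumes J: "J \<ge> 1" and p: "p \<ge> 1" and u: "u > 0"
  shows "dist (step_path (2 * J) x) (step_path J (pair_sum x)) \<le> u + u powr (1 - p) * (\<Sum>k<2 * J. \<bar>x k\<bar> powr p)"
proof (rule step_path_refine[OF J])
  fix k assume k: "k < 2 * J"
  have "\<bar>x k\<bar> \<le> u + u powr (1 - p) * \<bar>x k\<bar> powr p"
  proof (cases "\<bar>x k\<bar> \<le> u")
    case False
    then have x: "\<bar>x k\<bar> > 0" using u by linarith
    have "\<bar>x k\<bar> powr (1 - p) \<le> u powr (1 - p)" using False u p by (intro powr_mono2') auto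
    then have "\<bar>x k\<bar> powr (1 - p) * \<bar>x k\<bar> powr p \<le> u powr (1 - p) * \<bar>x k\<bar> powr p"
      by (intro mult_right_mono) auto
    then show ?thesis using u x by (simp flip: powr_add)
  qed (simp add: add_increasing2)
  also have "\<dots> \<le> u + u powr (1 - p) * (\<Sum>k<2 * J. \<bar>x k\<bar> powr p)"
    using k by (intro add_left_mono mult_left_mono member_le_sum) auto
  finally show "\<bar>x k\<bar> \<le> u + u powr (1 - p) * (\<Sum>k<2 * J. \<bar>x k\<bar> powr p)" .
qed

lemma lipschitz_cadlag_measurable:
  fixes f :: "cadlag \<Rightarrow> real"
  assumes "1-lipschitz_on UNIV f"
  shows "f \<in> borel_measurable borel"
  by (intro borel_measurable_continuous_onI lipschitz_on_continuous_on[OF assms])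

lemma lipschitz_step_bound:
  fixes f :: "cadlag \<Rightarrow> real"
  assumes f: "1-lipschitz_on UNIV f" and J: "J \<ge> 1"
  shows "\<bar>f (step_path J x) - f (step_path J y)\<bar> \<le> (\<Sum>k<J. \<bar>x k - y k\<bar>)"
  using lipschitz_onD[OF f, of "step_path J x" "step_path J y"] step_path_dist[OF J, of x y]
  by (simp add: dist_real_def)

text \<open>Twice the sum of the geometric series with ratio
  \<open>2 powr (- (1 / 2 - 1 / p))\<close>, which is below 1 for \<open>p > 2\<close>.\<close>

definition chain_const :: "real \<Rightarrow> real" where
  "chain_const p = 2 / (1 - 2 powr (- (1 / 2 - 1 / p)))"

lemma chain_const_sum:
  assumes "p > 2"
  shows "(\<Sum>l\<in>{j<..n}. 2 * (2 powr (- real l * (1 / 2 - 1 / p)))) \<le> chain_const p * 2 powr (- real j * (1 / 2 - 1 / p))"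
proof -
  define x where "x = 2 powr (- (1 / 2 - 1 / p))"
  have a: "1 / 2 - 1 / p > 0" using assms by (simp add: field_simps)
  have x: "0 < x" "x < 1" using a by (auto simp: x_def powr_less_one)
  have e: "2 powr (- real l * (1 / 2 - 1 / p)) = x ^ l" for l
  proof -
    have "x ^ l = x powr real l" using x(1) by (simp add: powr_realpow)
    also have "\<dots> = 2 powr (- (1 / 2 - 1 / p) * real l)" by (simp only: x_def powr_powr)
    also have "- (1 / 2 - 1 / p) * real l = - real l * (1 / 2 - 1 / p)" by (simp add: algebra_simps)
    finally show ?thesis ..
  qed
  have "(\<Sum>l\<in>{j<..n}. x ^ l) \<le> x ^ j / (1 - x)"
  proof -
    have "(\<Sum>l\<in>{j<..n}. x ^ l) \<le> (\<Sum>l\<in>{j..<Suc n + j}. x ^ l)"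
      using x by (intro sum_mono2) auto
    also have "\<dots> = (\<Sum>i<Suc n. x ^ (i + j))"
      using sum.shift_bounds_nat_ivl[of "\<lambda>l. x ^ l" 0 j "Suc n"] by (simp add: lessThan_atLeast0)
    also have "\<dots> = x ^ j * (\<Sum>i<Suc n. x ^ i)" by (simp add: power_add sum_distrib_left mult.commute del: sum.lessThan_Suc)
    also have "\<dots> = x ^ j * ((1 - x ^ Suc n) / (1 - x))" using x by (subst sum_gp_strict) simp
    also have "\<dots> \<le> x ^ j * (1 / (1 - x))" using x by (intro mult_left_mono divide_right_mono) auto
    finally show ?thesis by simp
  qed
  then show ?thesis
    unfolding e chain_const_def x_def[symmetric] by (simp add: sum_distrib_left[symmetric])
qed

lemma lipschitz_step_measurable:
  fixes f :: "cadlag \<Rightarrow> real"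
  assumes "1-lipschitz_on UNIV f" "J \<ge> 1" "\<And>k. D k \<in> borel_measurable M"
  shows "(\<lambda>\<omega>. f (step_path J (\<lambda>k. D k \<omega>))) \<in> borel_measurable M"
proof (rule measurable_compose[OF _ lipschitz_cadlag_measurable[OF assms(1)]])
  show "(\<lambda>\<omega>. step_path J (\<lambda>k. D k \<omega>)) \<in> borel_measurable M"
    by (rule measurable_compose[OF measurable_sequence[OF assms(3)] step_path_measurable[OF assms(2)]])
qed

text \<open>Level \<open>l\<close> has \<open>2 ^ l\<close> increments, each of order
  \<open>2 powr (- real l / 2)\<close> in the \<open>p\<close>-th mean, so their maximum is of order
  \<open>2 powr (- real l * (1 / 2 - 1 / p))\<close>; the levels above \<open>j\<close> form a
  geometric series. A general array is used so that the walk and Brownian motion are both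
  covered.\<close>

lemma (in prob_space) dyadic_chain:
  fixes D :: "nat \<Rightarrow> nat \<Rightarrow> 'a \<Rightarrow> real" and f :: "cadlag \<Rightarrow> real"
  assumes f: "1-lipschitz_on UNIV f" and p: "p > 2" and K: "K > 0" and jn: "j \<le> n"
    and meas: "\<And>l k. D l k \<in> borel_measurable M"
    and refine: "\<And>l k \<omega>. j \<le> l \<Longrightarrow> l < n \<Longrightarrow> k < 2 ^ l \<Longrightarrow> \<omega> \<in> space M \<Longrightarrow>
      D l k \<omega> = D (Suc l) (2 * k) \<omega> + D (Suc l) (2 * k + 1) \<omega>"
    and int: "\<And>l k. j < l \<Longrightarrow> l \<le> n \<Longrightarrow> k < 2 ^ l \<Longrightarrow> integrable M (\<lambda>\<omega>. \<bar>D l k \<omega>\<bar> powr p)"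
    and mom: "\<And>l k. j < l \<Longrightarrow> l \<le> n \<Longrightarrow> k < 2 ^ l \<Longrightarrow>
      expectation (\<lambda>\<omega>. \<bar>D l k \<omega>\<bar> powr p) \<le> (K * 2 powr (- real l / 2)) powr p"
  defines "Y \<equiv> \<lambda>l \<omega>. f (step_path (2 ^ l) (\<lambda>k. D l k \<omega>))"
  shows "\<And>l. Y l \<in> borel_measurable M" and "integrable M (\<lambda>\<omega>. \<bar>Y n \<omega> - Y j \<omega>\<bar>)"
    and "expectation (\<lambda>\<omega>. \<bar>Y n \<omega> - Y j \<omega>\<bar>) \<le> chain_const p * K * 2 powr (- real j * (1 / 2 - 1 / p))"
proof -
  show [measurable]: "Y l \<in> borel_measurable M" for l
    unfolding Y_def by (rule lipschitz_step_measurable[OF f _ meas]) simp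
  let ?u = "\<lambda>l. K * 2 powr (- real l * (1 / 2 - 1 / p))"
  have step: "integrable M (\<lambda>\<omega>. \<bar>Y (Suc l) \<omega> - Y l \<omega>\<bar>) \<and> expectation (\<lambda>\<omega>. \<bar>Y (Suc l) \<omega> - Y l \<omega>\<bar>) \<le> 2 * ?u (Suc l)"
    if l: "j \<le> l" "l < n" for l
  proof -
    \<comment> \<open>At this scale the second term of \<open>step_path_refine_powr\<close> is also
      at most \<open>u\<close> in mean, so a level costs \<open>2 * u\<close>.\<close>
    define u where "u = ?u (Suc l)"
    have u: "u > 0" using K by (simp add: u_def)
    define R where "R \<omega> = u + u powr (1 - p) * (\<Sum>k<2 * 2 ^ l. \<bar>D (Suc l) k \<omega>\<bar> powr p)" for \<omega>
    have le: "\<bar>Y (Suc l) \<omega> - Y l \<omega>\<bar> \<le> R \<omega>" if \<omega>: "\<omega> \<in> space M" for \<omega>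
    proof -
      have "step_path (2 ^ l) (\<lambda>k. D l k \<omega>) = step_path (2 ^ l) (pair_sum (\<lambda>k. D (Suc l) k \<omega>))"
        using refine[OF l _ \<omega>] by (intro step_path_cong) (auto simp: pair_sum_def)
      then have "\<bar>Y (Suc l) \<omega> - Y l \<omega>\<bar> \<le> dist (step_path (2 * 2 ^ l) (\<lambda>k. D (Suc l) k \<omega>)) (step_path (2 ^ l) (pair_sum (\<lambda>k. D (Suc l) k \<omega>)))"
        using lipschitz_onD[OF f] by (simp add: Y_def dist_real_def)
      also have "\<dots> \<le> R \<omega>" unfolding R_def by (rule step_path_refine_powr) (use p u in auto)
      finally show ?thesis .
    qed
    have iR: "integrable M R"
      unfolding R_def using int[of "Suc l"] l
      by (intro Bochner_Integration.integrable_add integrable_const integrable_mult_right Bochner_Integration.integrable_sum) auto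
    have i: "integrable M (\<lambda>\<omega>. \<bar>Y (Suc l) \<omega> - Y l \<omega>\<bar>)"
    proof (rule Bochner_Integration.integrable_bound[OF iR])
      show "AE \<omega> in M. norm \<bar>Y (Suc l) \<omega> - Y l \<omega>\<bar> \<le> norm (R \<omega>)"
        using le by (intro AE_I2) (simp add: order_trans[OF _ abs_ge_self])
    qed measurable
    have "expectation (\<lambda>\<omega>. \<bar>Y (Suc l) \<omega> - Y l \<omega>\<bar>) \<le> expectation R"
      by (intro integral_mono_AE i iR AE_I2 le)
    also have "\<dots> = u + u powr (1 - p) * (\<Sum>k<2 * 2 ^ l. expectation (\<lambda>\<omega>. \<bar>D (Suc l) k \<omega>\<bar> powr p))"
    proof -
      have isum: "integrable M (\<lambda>\<omega>. \<Sum>k<2 * 2 ^ l. \<bar>D (Suc l) k \<omega>\<bar> powr p)"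
        using int[of "Suc l"] l by (intro Bochner_Integration.integrable_sum) auto
      have "expectation (\<lambda>\<omega>. \<Sum>k<2 * 2 ^ l. \<bar>D (Suc l) k \<omega>\<bar> powr p) = (\<Sum>k<2 * 2 ^ l. expectation (\<lambda>\<omega>. \<bar>D (Suc l) k \<omega>\<bar> powr p))"
        using int[of "Suc l"] l by (intro Bochner_Integration.integral_sum) auto
      then show ?thesis unfolding R_def using isum by (simp add: prob_space)
    qed
    also have "\<dots> \<le> u + u powr (1 - p) * (\<Sum>k\<in>{..<2 * 2 ^ l :: nat}. (K * 2 powr (- real (Suc l) / 2)) powr p)"
      using mom[of "Suc l"] l by (intro add_left_mono mult_left_mono sum_mono) auto
    also have "u powr (1 - p) * (\<Sum>k\<in>{..<2 * 2 ^ l :: nat}. (K * 2 powr (- real (Suc l) / 2)) powr p) = u"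
    proof -
      let ?L = "real (Suc l)"
      have two: "real (2 * 2 ^ l) = 2 powr ?L" by (subst powr_realpow) auto
      have "u powr (1 - p) = u * u powr (- p)" using u powr_mult_base[of u "- p"] by simp
      also have "u powr (- p) = K powr (- p) * 2 powr (?L * (1 / 2 - 1 / p) * p)"
      proof -
        have "- ?L * (1 / 2 - 1 / p) * (- p) = ?L * (1 / 2 - 1 / p) * p" by (simp only: minus_mult_minus minus_mult_left)
        then show ?thesis by (simp only: u_def powr_mult powr_powr)
      qed
      finally have "u powr (1 - p) * (2 powr ?L * (K * 2 powr (- ?L / 2)) powr p)
         = u * (K powr (- p) * K powr p) * (2 powr (?L * (1 / 2 - 1 / p) * p) * (2 powr ?L * 2 powr (- ?L / 2 * p)))"
        using K by (simp add: powr_mult powr_powr)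
      also have "K powr (- p) * K powr p = 1" using K by (simp flip: powr_add)
      also have "2 powr (?L * (1 / 2 - 1 / p) * p) * (2 powr ?L * 2 powr (- ?L / 2 * p)) = 2 powr 0"
      proof -
        have "?L * (1 / 2 - 1 / p) * p + (?L + - ?L / 2 * p) = 0" using p by (simp add: field_simps)
        then show ?thesis by (simp only: powr_add[symmetric])
      qed
      finally show ?thesis using two by simp
    qed
    finally show ?thesis using i by (simp add: u_def)
  qed
  have "n' \<le> n \<longrightarrow> integrable M (\<lambda>\<omega>. \<bar>Y n' \<omega> - Y j \<omega>\<bar>) \<and>
     expectation (\<lambda>\<omega>. \<bar>Y n' \<omega> - Y j \<omega>\<bar>) \<le> (\<Sum>l\<in>{j<..n'}. 2 * ?u l)" if "j \<le> n'" for n'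
    using that
  proof (induction n' rule: dec_induct)
    case base
    then show ?case by simp
  next
    case (step m)
    show ?case
    proof
      assume m: "Suc m \<le> n"
      then have IH: "integrable M (\<lambda>\<omega>. \<bar>Y m \<omega> - Y j \<omega>\<bar>)" "expectation (\<lambda>\<omega>. \<bar>Y m \<omega> - Y j \<omega>\<bar>) \<le> (\<Sum>l\<in>{j<..m}. 2 * ?u l)"
        using step by auto
      have S: "integrable M (\<lambda>\<omega>. \<bar>Y (Suc m) \<omega> - Y m \<omega>\<bar>)" "expectation (\<lambda>\<omega>. \<bar>Y (Suc m) \<omega> - Y m \<omega>\<bar>) \<le> 2 * ?u (Suc m)"
        using \<open>\<And>l. j \<le> l \<Longrightarrow> l < n \<Longrightarrow> _\<close>[of m] step m by auto
      have isum: "integrable M (\<lambda>\<omega>. \<bar>Y (Suc m) \<omega> - Y m \<omega>\<bar> + \<bar>Y m \<omega> - Y j \<omega>\<bar>)" using IH S by simp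
      have le: "\<bar>Y (Suc m) \<omega> - Y j \<omega>\<bar> \<le> \<bar>Y (Suc m) \<omega> - Y m \<omega>\<bar> + \<bar>Y m \<omega> - Y j \<omega>\<bar>" for \<omega> by simp
      have i: "integrable M (\<lambda>\<omega>. \<bar>Y (Suc m) \<omega> - Y j \<omega>\<bar>)"
        by (rule integrable_nonneg_bound[OF isum _ _ le]) auto
      have "expectation (\<lambda>\<omega>. \<bar>Y (Suc m) \<omega> - Y j \<omega>\<bar>) \<le> expectation (\<lambda>\<omega>. \<bar>Y (Suc m) \<omega> - Y m \<omega>\<bar> + \<bar>Y m \<omega> - Y j \<omega>\<bar>)"
        by (rule integral_mono[OF i isum le])
      also have "\<dots> \<le> 2 * ?u (Suc m) + (\<Sum>l\<in>{j<..m}. 2 * ?u l)" using IH S by simp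
      also have "\<dots> = (\<Sum>l\<in>{j<..Suc m}. 2 * ?u l)"
      proof -
        have "{j<..Suc m} = insert (Suc m) {j<..m}" using step by auto
        then show ?thesis by (simp del: of_nat_Suc)
      qed
      finally show "integrable M (\<lambda>\<omega>. \<bar>Y (Suc m) \<omega> - Y j \<omega>\<bar>) \<and>
        expectation (\<lambda>\<omega>. \<bar>Y (Suc m) \<omega> - Y j \<omega>\<bar>) \<le> (\<Sum>l\<in>{j<..Suc m}. 2 * ?u l)" using i by simp
    qed
  qed
  from this[OF jn] have *: "integrable M (\<lambda>\<omega>. \<bar>Y n \<omega> - Y j \<omega>\<bar>)"
     "expectation (\<lambda>\<omega>. \<bar>Y n \<omega> - Y j \<omega>\<bar>) \<le> (\<Sum>l\<in>{j<..n}. 2 * ?u l)" by auto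
  show "integrable M (\<lambda>\<omega>. \<bar>Y n \<omega> - Y j \<omega>\<bar>)" by (rule *)
  have "(\<Sum>l\<in>{j<..n}. 2 * ?u l) = K * (\<Sum>l\<in>{j<..n}. 2 * (2 powr (- real l * (1 / 2 - 1 / p))))"
    by (simp add: sum_distrib_left ac_simps)
  also have "\<dots> \<le> K * (chain_const p * 2 powr (- real j * (1 / 2 - 1 / p)))"
    using K by (intro mult_left_mono chain_const_sum[OF p]) auto
  finally show "expectation (\<lambda>\<omega>. \<bar>Y n \<omega> - Y j \<omega>\<bar>) \<le> chain_const p * K * 2 powr (- real j * (1 / 2 - 1 / p))"
    using *(2) by (simp add: ac_simps)
qed

text \<open>The value 0 beyond the last increment makes all coordinates measurable, as nothing is
  known about \<open>B\<close> at times outside the unit interval.\<close>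

definition bm_increment :: "(real \<Rightarrow> 'b \<Rightarrow> real) \<Rightarrow> real \<Rightarrow> nat \<Rightarrow> nat \<Rightarrow> 'b \<Rightarrow> real" where
  "bm_increment B \<sigma> l k \<omega> = (if k < 2 ^ l then \<sigma> * (B (real (Suc k) / 2 ^ l) \<omega> - B (real k / 2 ^ l) \<omega>) else 0)"

context
  fixes M' :: "'b measure" and B :: "real \<Rightarrow> 'b \<Rightarrow> real" and \<sigma> :: real
  assumes BM: "standard_BM01 M' B" and \<sigma>: "\<sigma> > 0"
begin

lemma bm_prob: "prob_space M'" using BM by (simp add: standard_BM01_def)

lemma bm_increment_meas [measurable]: "bm_increment B \<sigma> l k \<in> borel_measurable M'"
proof (cases "k < 2 ^ l")
  case True
  then have "real k < 2 ^ l" "real (Suc k) \<le> 2 ^ l"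
    by (metis of_nat_less_numeral_power_cancel_iff of_nat_numeral of_nat_power Suc_leI of_nat_le_iff)+
  then have "real (Suc k) / 2 ^ l \<in> {0..1}" "real k / 2 ^ l \<in> {0..1}" by (auto simp: divide_le_eq)
  then have [measurable]: "B (real (Suc k) / 2 ^ l) \<in> borel_measurable M'" "B (real k / 2 ^ l) \<in> borel_measurable M'"
    using BM unfolding standard_BM01_def by blast+
  have "bm_increment B \<sigma> l k = (\<lambda>\<omega>. \<sigma> * (B (real (Suc k) / 2 ^ l) \<omega> - B (real k / 2 ^ l) \<omega>))"
    using True by (simp add: bm_increment_def fun_eq_iff)
  moreover have "(\<lambda>\<omega>. \<sigma> * (B (real (Suc k) / 2 ^ l) \<omega> - B (real k / 2 ^ l) \<omega>)) \<in> borel_measurable M'"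
    by measurable
  ultimately show ?thesis by (simp only:)
next
  case False
  then have "bm_increment B \<sigma> l k = (\<lambda>_. 0)" by (simp add: bm_increment_def fun_eq_iff)
  then show ?thesis by simp
qed

lemma bm_increment_refine:
  assumes "k < 2 ^ l"
  shows "bm_increment B \<sigma> l k \<omega> = bm_increment B \<sigma> (Suc l) (2 * k) \<omega> + bm_increment B \<sigma> (Suc l) (2 * k + 1) \<omega>"
proof -
  have "real (Suc (2 * k + 1)) / 2 ^ Suc l = real (Suc k) / 2 ^ l" "real (2 * k) / 2 ^ Suc l = real k / 2 ^ l"
    by (simp_all add: field_simps)
  moreover have "2 * k < 2 ^ Suc l" "2 * k + 1 < 2 ^ Suc l" using assms by auto
  ultimately show ?thesis using assms by (simp add: bm_increment_def distrib_left[symmetric] del: power_Suc of_nat_Suc of_nat_mult of_nat_add)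
qed

lemma bm_increment_distributed:
  assumes "k < 2 ^ l"
  shows "distributed M' lborel (\<lambda>\<omega>. B (real (Suc k) / 2 ^ l) \<omega> - B (real k / 2 ^ l) \<omega>) (normal_density 0 (sqrt (1 / 2 ^ l)))"
proof -
  have "real (Suc k) \<le> real (2 ^ l)" using assms by (subst of_nat_le_iff) simp
  then have "real (Suc k) / 2 ^ l \<le> 1" by (simp add: divide_le_eq)
  moreover have "real k / 2 ^ l < real (Suc k) / 2 ^ l" by (intro divide_strict_right_mono) auto
  moreover have "0 \<le> real k / 2 ^ l" by simp
  ultimately have "distributed M' lborel (\<lambda>\<omega>. B (real (Suc k) / 2 ^ l) \<omega> - B (real k / 2 ^ l) \<omega>)
      (normal_density 0 (sqrt (real (Suc k) / 2 ^ l - real k / 2 ^ l)))"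
    using BM unfolding standard_BM01_def by blast
  moreover have "real (Suc k) / 2 ^ l - real k / 2 ^ l = 1 / 2 ^ l" by (simp add: field_simps)
  ultimately show ?thesis by simp
qed

lemma bm_increment_moment:
  assumes k: "k < 2 ^ l" and p: "p > 0"
  shows "integrable M' (\<lambda>\<omega>. \<bar>bm_increment B \<sigma> l k \<omega>\<bar> powr p)"
    and "(\<integral>\<omega>. \<bar>bm_increment B \<sigma> l k \<omega>\<bar> powr p \<partial>M') = (\<sigma> * 2 powr (- real l / 2)) powr p * gauss_moment p"
proof -
  let ?s = "sqrt (1 / 2 ^ l)" and ?Z = "\<lambda>\<omega>. B (real (Suc k) / 2 ^ l) \<omega> - B (real k / 2 ^ l) \<omega>"
  have s: "?s > 0" by simp
  have s': "?s = 2 powr (- real l / 2)"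
    by (simp add: real_sqrt_divide powr_half_sqrt[symmetric] powr_minus_divide powr_realpow[symmetric] powr_powr)
  have eq: "\<bar>bm_increment B \<sigma> l k \<omega>\<bar> powr p = \<bar>\<sigma> * ?Z \<omega>\<bar> powr p" for \<omega> using k by (simp add: bm_increment_def)
  note d = bm_increment_distributed[OF k]
  have nd: "normal_density 0 ?s (?s * z) * ?s = std_normal_density z" for z
    using s by (simp add: normal_density_def power_mult_distrib real_sqrt_mult real_sqrt_divide power_divide)
  have i: "integrable lborel (\<lambda>y. normal_density 0 ?s y * \<bar>\<sigma> * y\<bar> powr p)"
  proof -
    have "integrable lborel (\<lambda>z. (\<sigma> * ?s) powr p * (\<bar>z\<bar> powr p * std_normal_density z))"
      using gauss_powr_integrable[OF p] by simp
    then have "integrable lborel (\<lambda>z. ?s * (normal_density 0 ?s (0 + ?s * z) * \<bar>\<sigma> * (0 + ?s * z)\<bar> powr p))"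
      unfolding nd[symmetric] using \<sigma> s by (simp add: abs_mult powr_mult ac_simps)
    then have "integrable lborel (\<lambda>z. normal_density 0 ?s (0 + ?s * z) * \<bar>\<sigma> * (0 + ?s * z)\<bar> powr p)"
      using s by simp
    then show ?thesis using s by (subst (asm) lborel_integrable_real_affine_iff) auto
  qed
  show "integrable M' (\<lambda>\<omega>. \<bar>bm_increment B \<sigma> l k \<omega>\<bar> powr p)"
    unfolding eq using distributed_integrable[OF d, of "\<lambda>y. \<bar>\<sigma> * y\<bar> powr p"] i by simp
  have "(\<integral>\<omega>. \<bar>bm_increment B \<sigma> l k \<omega>\<bar> powr p \<partial>M') = (\<integral>y. \<bar>\<sigma> * y\<bar> powr p * normal_density 0 ?s y \<partial>lborel)"
    unfolding eq using distributed_integral[OF d, of "\<lambda>y. \<bar>\<sigma> * y\<bar> powr p"] by (simp add: mult.commute)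
  also have "\<dots> = (\<integral>z. \<bar>\<sigma> * (?s * z)\<bar> powr p * std_normal_density z \<partial>lborel)"
    by (rule integral_normal_density_scale[OF s, symmetric])
  also have "\<dots> = (\<integral>z. (\<sigma> * ?s) powr p * (\<bar>z\<bar> powr p * std_normal_density z) \<partial>lborel)"
    using \<sigma> s by (intro Bochner_Integration.integral_cong) (auto simp: abs_mult powr_mult)
  also have "\<dots> = (\<sigma> * ?s) powr p * gauss_moment p" by (simp add: gauss_moment_def)
  finally show "(\<integral>\<omega>. \<bar>bm_increment B \<sigma> l k \<omega>\<bar> powr p \<partial>M') = (\<sigma> * 2 powr (- real l / 2)) powr p * gauss_moment p"
    unfolding s' .
qed

lemma bm_step_fun:
  assumes \<omega>: "\<omega> \<in> space M'" and t: "t \<in> {0..1}"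
  shows "step_fun (2 ^ l) (\<lambda>k. bm_increment B \<sigma> l k \<omega>) t = \<sigma> * B (real (nat \<lfloor>2 ^ l * t\<rfloor>) / 2 ^ l) \<omega>"
proof -
  let ?n = "nat \<lfloor>2 ^ l * t\<rfloor>"
  have n: "?n \<le> 2 ^ l" using step_index_le[OF t, of "2 ^ l"] by simp
  have "step_fun (2 ^ l) (\<lambda>k. bm_increment B \<sigma> l k \<omega>) t = (\<Sum>k<?n. \<sigma> * B (real (Suc k) / 2 ^ l) \<omega> - \<sigma> * B (real k / 2 ^ l) \<omega>)"
    unfolding step_fun_def
  proof (intro sum.cong)
    fix k assume "k \<in> {..<?n}"
    then have "k < 2 ^ l" using n by (metis lessThan_iff order_less_le_trans)
    then show "bm_increment B \<sigma> l k \<omega> = \<sigma> * B (real (Suc k) / 2 ^ l) \<omega> - \<sigma> * B (real k / 2 ^ l) \<omega>"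
      by (simp add: bm_increment_def right_diff_distrib)
  qed simp
  also have "\<dots> = \<sigma> * B (real ?n / 2 ^ l) \<omega> - \<sigma> * B (real 0 / 2 ^ l) \<omega>"
    by (rule sum_lessThan_telescope)
  also have "B (real 0 / 2 ^ l) \<omega> = 0" using BM \<omega> by (simp add: standard_BM01_def)
  finally show ?thesis by simp
qed

text \<open>Uniform continuity of the path on the compact interval gives convergence in the uniform
  metric itself.\<close>

lemma bm_step_path_tendsto:
  assumes \<omega>: "\<omega> \<in> space M'"
  shows "(\<lambda>l. step_path (2 ^ l) (\<lambda>k. bm_increment B \<sigma> l k \<omega>)) \<longlonglongrightarrow> to_cadlag (\<lambda>t. \<sigma> * B t \<omega>)"
proof (rule metric_LIMSEQ_I)
  fix e :: real assume e: "e > 0"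
  have cont: "continuous_on {0..1} (\<lambda>t. \<sigma> * B t \<omega>)"
    using BM \<omega> by (auto simp: standard_BM01_def intro!: continuous_intros)
  have "uniformly_continuous_on {0..1} (\<lambda>t. \<sigma> * B t \<omega>)"
    by (rule compact_uniformly_continuous[OF cont]) simp
  then obtain r where r: "r > 0" "\<And>s t. s \<in> {0..1} \<Longrightarrow> t \<in> {0..1} \<Longrightarrow> dist s t < r \<Longrightarrow> dist (\<sigma> * B s \<omega>) (\<sigma> * B t \<omega>) < e / 2"
    using e unfolding uniformly_continuous_on_def by (metis half_gt_zero)
  obtain N where N: "(1 / 2 :: real) ^ N < r" using real_arch_pow_inv[OF r(1), of "1 / 2"] by auto
  show "\<exists>no. \<forall>l\<ge>no. dist (step_path (2 ^ l) (\<lambda>k. bm_increment B \<sigma> l k \<omega>)) (to_cadlag (\<lambda>t. \<sigma> * B t \<omega>)) < e"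
  proof (intro exI allI impI)
    fix l assume l: "l \<ge> N"
    have small: "1 / 2 ^ l < r"
    proof -
      have "(1 / 2 :: real) ^ l \<le> (1 / 2) ^ N" using l by (intro power_decreasing) auto
      then show ?thesis using N by (simp add: power_one_over)
    qed
    have "dist (step_path (2 ^ l) (\<lambda>k. bm_increment B \<sigma> l k \<omega>)) (to_cadlag (\<lambda>t. \<sigma> * B t \<omega>)) \<le> e / 2"
    proof (rule dist_cadlag_le)
      fix t :: real assume t: "t \<in> {0..1}"
      let ?s = "real (nat \<lfloor>2 ^ l * t\<rfloor>) / 2 ^ l"
      have nn: "0 \<le> \<lfloor>2 ^ l * t\<rfloor>" using t by simp
      have fl: "real (nat \<lfloor>2 ^ l * t\<rfloor>) \<le> 2 ^ l * t" "2 ^ l * t < real (nat \<lfloor>2 ^ l * t\<rfloor>) + 1"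
        using nn by (simp_all add: of_nat_nat)
      have "t < (real (nat \<lfloor>2 ^ l * t\<rfloor>) + 1) / 2 ^ l" using fl(2) by (simp add: pos_less_divide_eq mult.commute)
      then have s: "?s \<le> t" "t - ?s < 1 / 2 ^ l"
        using fl(1) by (simp_all add: pos_divide_le_eq mult.commute add_divide_distrib)
      have "0 \<le> ?s" by simp
      then have "?s \<in> {0..1}" using s(1) t unfolding atLeastAtMost_iff by linarith
      moreover have "dist ?s t < r" using s small unfolding dist_real_def by linarith
      ultimately have "dist (\<sigma> * B ?s \<omega>) (\<sigma> * B t \<omega>) < e / 2" using t by (intro r(2))
      then show "\<bar>apply_cadlag (step_path (2 ^ l) (\<lambda>k. bm_increment B \<sigma> l k \<omega>)) t - apply_cadlag (to_cadlag (\<lambda>t. \<sigma> * B t \<omega>)) t\<bar> \<le> e / 2"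
        using t by (simp add: apply_step_path bm_step_fun[OF \<omega> t] apply_to_cadlag[OF continuous_is_cadlag[OF cont] t] dist_real_def)
    qed
    then show "dist (step_path (2 ^ l) (\<lambda>k. bm_increment B \<sigma> l k \<omega>)) (to_cadlag (\<lambda>t. \<sigma> * B t \<omega>)) < e" using e by linarith
  qed
qed

text \<open>A pointwise limit of measurable step paths. Measurability of the values at fixed times
  alone would not reach the Borel sets of the uniform metric.\<close>

lemma bm_path_measurable: "(\<lambda>\<omega>. to_cadlag (\<lambda>t. \<sigma> * B t \<omega>)) \<in> borel_measurable M'"
proof (rule borel_measurable_LIMSEQ_metric)
  show "(\<lambda>\<omega>. step_path (2 ^ l) (\<lambda>k. bm_increment B \<sigma> l k \<omega>)) \<in> borel_measurable M'" for l
    by (rule measurable_compose[OF measurable_sequence step_path_measurable]) auto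
qed (rule bm_step_path_tendsto)

text \<open>The added 1 makes the second factor at least 1, so that for \<open>p \<ge> 1\<close> its
  \<open>p\<close>-th power dominates \<open>gauss_moment p\<close> and no root is taken.\<close>

definition bm_const :: "real \<Rightarrow> real" where "bm_const p = \<sigma> * (gauss_moment p + 1)"

text \<open>Chaining reaches every finite level \<open>l \<ge> j\<close> with one and the same
  bound; Fatou's lemma carries it over to the continuous path.\<close>

lemma bm_chain:
  fixes f :: "cadlag \<Rightarrow> real"
  assumes f: "1-lipschitz_on UNIV f" and p: "p > 2"
  defines "Y \<equiv> \<lambda>l \<omega>. f (step_path (2 ^ l) (\<lambda>k. bm_increment B \<sigma> l k \<omega>))"
    and "T \<equiv> \<lambda>\<omega>. f (to_cadlag (\<lambda>t. \<sigma> * B t \<omega>))"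
  shows "integrable M' (Y j)" "integrable M' T"
    and "\<bar>(\<integral>\<omega>. T \<omega> \<partial>M') - (\<integral>\<omega>. Y j \<omega> \<partial>M')\<bar> \<le> chain_const p * bm_const p * 2 powr (- real j * (1 / 2 - 1 / p))"
proof -
  interpret prob_space M' by (rule bm_prob)
  have K: "bm_const p > 0" using \<sigma> gauss_moment_nonneg[of p] by (simp add: bm_const_def add_nonneg_pos)
  define c where "c = chain_const p * bm_const p * 2 powr (- real j * (1 / 2 - 1 / p))"
  have mom: "(\<integral>\<omega>. \<bar>bm_increment B \<sigma> l k \<omega>\<bar> powr p \<partial>M') \<le> (bm_const p * 2 powr (- real l / 2)) powr p" if "k < 2 ^ l" for l k
  proof -
    have "gauss_moment p + 1 \<le> (gauss_moment p + 1) powr p"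
      using powr_mono[of 1 p "gauss_moment p + 1"] gauss_moment_nonneg[of p] p by simp
    then have "gauss_moment p \<le> (gauss_moment p + 1) powr p" by linarith
    then have "(\<sigma> * 2 powr (- real l / 2)) powr p * gauss_moment p \<le> (\<sigma> * 2 powr (- real l / 2)) powr p * (gauss_moment p + 1) powr p"
      by (intro mult_left_mono) auto
    also have "\<dots> = (bm_const p * 2 powr (- real l / 2)) powr p"
      by (simp add: bm_const_def powr_mult ac_simps)
    finally show ?thesis using bm_increment_moment(2)[OF that, of p] p by simp
  qed
  note ch = dyadic_chain[OF f p K _ bm_increment_meas bm_increment_refine bm_increment_moment(1) mom]
  have Ym [measurable]: "Y l \<in> borel_measurable M'" for l
    unfolding Y_def by (rule lipschitz_step_measurable[OF f]) auto
  have Yi: "integrable M' (\<lambda>\<omega>. \<bar>Y l \<omega> - Y j \<omega>\<bar>)" "expectation (\<lambda>\<omega>. \<bar>Y l \<omega> - Y j \<omega>\<bar>) \<le> c" if "j \<le> l" for l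
    using ch(2)[OF that] ch(3)[OF that] p by (auto simp: c_def Y_def)
  show iY: "integrable M' (Y j)"
  proof (rule Bochner_Integration.integrable_bound)
    show "integrable M' (\<lambda>\<omega>. \<bar>f (step_path (2 ^ j) (\<lambda>_. 0))\<bar> + (\<Sum>k<2 ^ j. \<bar>bm_increment B \<sigma> j k \<omega>\<bar>))"
      using integrable_of_powr_integrable[OF bm_increment_meas bm_increment_moment(1), of _ j p] p
      by (intro Bochner_Integration.integrable_add integrable_const Bochner_Integration.integrable_sum integrable_abs) auto
    show "AE \<omega> in M'. norm (Y j \<omega>) \<le> norm (\<bar>f (step_path (2 ^ j) (\<lambda>_. 0))\<bar> + (\<Sum>k<2 ^ j. \<bar>bm_increment B \<sigma> j k \<omega>\<bar>))"
    proof (rule AE_I2)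
      fix \<omega>
      have "\<bar>Y j \<omega> - f (step_path (2 ^ j) (\<lambda>_. 0))\<bar> \<le> (\<Sum>k<2 ^ j. \<bar>bm_increment B \<sigma> j k \<omega>\<bar>)"
        using lipschitz_step_bound[OF f, of "2 ^ j" "\<lambda>k. bm_increment B \<sigma> j k \<omega>" "\<lambda>_. 0"] by (simp add: Y_def)
      then show "norm (Y j \<omega>) \<le> norm (\<bar>f (step_path (2 ^ j) (\<lambda>_. 0))\<bar> + (\<Sum>k<2 ^ j. \<bar>bm_increment B \<sigma> j k \<omega>\<bar>))"
        by simp
    qed
  qed measurable
  have T_lim: "(\<lambda>l. Y l \<omega>) \<longlonglongrightarrow> T \<omega>" if "\<omega> \<in> space M'" for \<omega>
  proof -
    have "isCont f x" for x
      using lipschitz_on_continuous_on[OF f] by (simp add: continuous_on_eq_continuous_at)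
    from isCont_tendsto_compose[OF this bm_step_path_tendsto[OF that]] show ?thesis by (simp add: Y_def T_def)
  qed
  have Tm [measurable]: "T \<in> borel_measurable M'"
    by (rule borel_measurable_LIMSEQ_metric[OF Ym T_lim])
  have "(\<integral>\<^sup>+ \<omega>. ennreal \<bar>T \<omega> - Y j \<omega>\<bar> \<partial>M') = (\<integral>\<^sup>+ \<omega>. liminf (\<lambda>l. ennreal \<bar>Y l \<omega> - Y j \<omega>\<bar>) \<partial>M')"
  proof (rule nn_integral_cong)
    fix \<omega> assume "\<omega> \<in> space M'"
    then have "(\<lambda>l. ennreal \<bar>Y l \<omega> - Y j \<omega>\<bar>) \<longlonglongrightarrow> ennreal \<bar>T \<omega> - Y j \<omega>\<bar>"
      by (intro tendsto_ennrealI tendsto_intros T_lim)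
    then show "ennreal \<bar>T \<omega> - Y j \<omega>\<bar> = liminf (\<lambda>l. ennreal \<bar>Y l \<omega> - Y j \<omega>\<bar>)"
      by (intro lim_imp_Liminf[symmetric]) auto
  qed
  also have "\<dots> \<le> liminf (\<lambda>l. \<integral>\<^sup>+ \<omega>. ennreal \<bar>Y l \<omega> - Y j \<omega>\<bar> \<partial>M')"
    by (rule nn_integral_liminf) measurable
  also have "\<dots> \<le> ennreal c"
  proof (rule Liminf_le)
    show "\<forall>\<^sub>F l in sequentially. (\<integral>\<^sup>+ \<omega>. ennreal \<bar>Y l \<omega> - Y j \<omega>\<bar> \<partial>M') \<le> ennreal c"
      using eventually_ge_at_top[of j]
    proof eventually_elim
      case (elim l)
      then show ?case using nn_integral_eq_integral[OF Yi(1)[OF elim]] Yi(2)[OF elim] by (simp add: ennreal_leI)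
    qed
  qed simp
  finally have fin: "(\<integral>\<^sup>+ \<omega>. ennreal \<bar>T \<omega> - Y j \<omega>\<bar> \<partial>M') \<le> ennreal c" .
  have iD: "integrable M' (\<lambda>\<omega>. T \<omega> - Y j \<omega>)"
    by (rule integrableI_bounded) (use fin in \<open>auto intro: order.strict_trans1\<close>)
  have "integrable M' (\<lambda>\<omega>. (T \<omega> - Y j \<omega>) + Y j \<omega>)" using iD iY by (rule Bochner_Integration.integrable_add)
  then show iT: "integrable M' T" by simp
  have c0: "c \<ge> 0"
    using order_trans[OF _ Yi(2)[OF order_refl]] by simp
  have "\<bar>(\<integral>\<omega>. T \<omega> \<partial>M') - (\<integral>\<omega>. Y j \<omega> \<partial>M')\<bar> = \<bar>\<integral>\<omega>. T \<omega> - Y j \<omega> \<partial>M'\<bar>" using iT iY by simp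
  also have "\<dots> \<le> (\<integral>\<omega>. \<bar>T \<omega> - Y j \<omega>\<bar> \<partial>M')" by (rule integral_abs_bound)
  also have "\<dots> \<le> c"
  proof -
    have "ennreal (\<integral>\<omega>. \<bar>T \<omega> - Y j \<omega>\<bar> \<partial>M') = (\<integral>\<^sup>+ \<omega>. ennreal \<bar>T \<omega> - Y j \<omega>\<bar> \<partial>M')"
      by (rule nn_integral_eq_integral[symmetric]) (use iD in auto)
    then show ?thesis using fin c0 by (metis ennreal_le_iff)
  qed
  finally show "\<bar>(\<integral>\<omega>. T \<omega> \<partial>M') - (\<integral>\<omega>. Y j \<omega> \<partial>M')\<bar> \<le> chain_const p * bm_const p * 2 powr (- real j * (1 / 2 - 1 / p))"
    by (simp add: c_def)
qed

end

text \<open>One inequality encodes two facts: dependence on the first \<open>i\<close> coordinates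
  only, and Lipschitz constant 1 in each of them.\<close>

definition coord_lip :: "nat \<Rightarrow> ((nat \<Rightarrow> real) \<Rightarrow> real) \<Rightarrow> bool" where
  "coord_lip i \<Psi> \<longleftrightarrow> (\<forall>x y. \<bar>\<Psi> x - \<Psi> y\<bar> \<le> (\<Sum>k<i. \<bar>x k - y k\<bar>))"

lemma coord_lipD: "coord_lip i \<Psi> \<Longrightarrow> \<bar>\<Psi> x - \<Psi> y\<bar> \<le> (\<Sum>k<i. \<bar>x k - y k\<bar>)"
  by (auto simp: coord_lip_def)

lemma coord_lip_cong: "coord_lip i \<Psi> \<Longrightarrow> (\<And>k. k < i \<Longrightarrow> x k = y k) \<Longrightarrow> \<Psi> x = \<Psi> y"
  using coord_lipD[of i \<Psi> x y] by simp

lemma coord_lip_measurable: "coord_lip i \<Psi> \<Longrightarrow> \<Psi> \<in> borel_measurable borel"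
  by (rule coordinate_lipschitz_measurable[of _ 1 i]) (simp add: coord_lip_def dist_real_def)

lemma coord_lip_update:
  assumes "coord_lip (Suc i) \<Psi>"
  shows "\<bar>\<Psi> (x(i := u)) - \<Psi> (x(i := v))\<bar> \<le> \<bar>u - v\<bar>"
proof -
  have "\<bar>\<Psi> (x(i := u)) - \<Psi> (x(i := v))\<bar> \<le> (\<Sum>k<Suc i. \<bar>(x(i := u)) k - (x(i := v)) k\<bar>)"
    by (rule coord_lipD[OF assms])
  also have "\<dots> = \<bar>u - v\<bar>" by simp
  finally show ?thesis .
qed

lemma coord_lip_integrable:
  assumes "prob_space M" "coord_lip i \<Psi>" "\<And>k. k < i \<Longrightarrow> integrable M (G k)" "\<And>k. G k \<in> borel_measurable M"
  shows "integrable M (\<lambda>\<omega>. \<Psi> (\<lambda>k. G k \<omega>))"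
proof -
  interpret prob_space M by fact
  show ?thesis
  proof (rule abs_expectation_le(1))
    show "integrable M (\<lambda>\<omega>. \<bar>\<Psi> (\<lambda>_. 0)\<bar> + (\<Sum>k<i. \<bar>G k \<omega>\<bar>))"
      using assms(3) by (intro Bochner_Integration.integrable_add integrable_const Bochner_Integration.integrable_sum integrable_abs) auto
    show "(\<lambda>\<omega>. \<Psi> (\<lambda>k. G k \<omega>)) \<in> borel_measurable M"
      by (rule measurable_compose[OF measurable_sequence[OF assms(4)] coord_lip_measurable[OF assms(2)]])
    show "\<bar>\<Psi> (\<lambda>k. G k \<omega>)\<bar> \<le> \<bar>\<Psi> (\<lambda>_. 0)\<bar> + (\<Sum>k<i. \<bar>G k \<omega>\<bar>)" for \<omega>
      using coord_lipD[OF assms(2), of "\<lambda>k. G k \<omega>" "\<lambda>_. 0"] by simp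
  qed
qed

text \<open>Averages coordinate \<open>i\<close> over a centered normal variable of standard
  deviation \<open>s\<close>, which is what conditioning on the other coordinates does to an
  independent Gaussian coordinate.\<close>

definition gauss_out :: "nat \<Rightarrow> real \<Rightarrow> ((nat \<Rightarrow> real) \<Rightarrow> real) \<Rightarrow> (nat \<Rightarrow> real) \<Rightarrow> real" where
  "gauss_out i s \<Psi> x = gsmooth 0 s (\<lambda>y. \<Psi> (x(i := y))) 0"

lemma gauss_out_lip:
  assumes \<Psi>: "coord_lip (Suc i) \<Psi>" and s: "s > 0"
  shows "coord_lip i (gauss_out i s \<Psi>)"
  unfolding coord_lip_def
proof (intro allI)
  fix x y :: "nat \<Rightarrow> real"
  define c where "c = (\<Sum>k<i. \<bar>x k - y k\<bar>)"
  let ?f = "\<lambda>x z. \<Psi> (x(i := 0 + s * z)) * hermite 0 z * std_normal_density z"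
  have i: "integrable lborel (?f x)" for x
    using gsmooth_integrable[of "\<lambda>y. \<Psi> (x(i := y))" s 0 0] coord_lip_update[OF \<Psi>] s by blast
  have le: "\<bar>?f x z - ?f y z\<bar> \<le> c * std_normal_density z" for z
  proof -
    have "\<bar>\<Psi> (x(i := 0 + s * z)) - \<Psi> (y(i := 0 + s * z))\<bar> \<le> c"
      using coord_lipD[OF \<Psi>, of "x(i := 0 + s * z)" "y(i := 0 + s * z)"] by (simp add: c_def)
    then have "\<bar>\<Psi> (x(i := 0 + s * z)) - \<Psi> (y(i := 0 + s * z))\<bar> * std_normal_density z \<le> c * std_normal_density z"
      by (rule mult_right_mono) simp
    then show ?thesis by (simp add: hermite_def abs_mult flip: left_diff_distrib)
  qed
  have "\<bar>gauss_out i s \<Psi> x - gauss_out i s \<Psi> y\<bar> = \<bar>\<integral>z. ?f x z - ?f y z \<partial>lborel\<bar>"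
    unfolding gauss_out_def gsmooth_def by (subst Bochner_Integration.integral_diff[OF i i]) simp
  also have "\<dots> \<le> (\<integral>z. \<bar>?f x z - ?f y z\<bar> \<partial>lborel)" by (rule integral_abs_bound)
  also have "\<dots> \<le> (\<integral>z. c * std_normal_density z \<partial>lborel)"
    by (rule integral_mono[OF integrable_abs[OF Bochner_Integration.integrable_diff[OF i i]] _ le]) simp
  also have "\<dots> = c" by simp
  finally show "\<bar>gauss_out i s \<Psi> x - gauss_out i s \<Psi> y\<bar> \<le> (\<Sum>k<i. \<bar>x k - y k\<bar>)" by (simp add: c_def)
qed

text \<open>After \<open>r\<close> steps the coordinates from \<open>J - 1\<close> down to
  \<open>J - r\<close> are averaged out. In this order the remaining function depends on an initial
  segment of the coordinates, that is, on the past.\<close>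

primrec gauss_tail :: "real \<Rightarrow> nat \<Rightarrow> ((nat \<Rightarrow> real) \<Rightarrow> real) \<Rightarrow> nat \<Rightarrow> (nat \<Rightarrow> real) \<Rightarrow> real" where
  "gauss_tail s J \<Phi> 0 = \<Phi>"
| "gauss_tail s J \<Phi> (Suc r) = gauss_out (J - Suc r) s (gauss_tail s J \<Phi> r)"

lemma gauss_tail_lip:
  assumes "coord_lip J \<Phi>" "s > 0"
  shows "r \<le> J \<Longrightarrow> coord_lip (J - r) (gauss_tail s J \<Phi> r)"
proof (induction r)
  case (Suc r)
  then have "coord_lip (Suc (J - Suc r)) (gauss_tail s J \<Phi> r)" by (simp add: Suc_diff_Suc)
  then show ?case using gauss_out_lip[OF _ assms(2)] by simp
qed (use assms in simp)

section \<open>Exchange of the blocks\<close>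

context mixing_sequence
begin

text \<open>Seen from block \<open>i\<close>, the earlier block sums are coefficients known from the
  past and the later ones do not occur, so the estimate for a single block applies.\<close>

lemma replace_block:
  fixes m i :: nat and \<Psi> s
  assumes \<Psi>: "coord_lip (Suc i) \<Psi>" and s: "s > 0"
    and W: "\<And>H. past_lipschitz (i * m) H \<Longrightarrow>
       \<bar>expectation (\<lambda>\<omega>. H \<omega> (block_sum (i * m) m \<omega>)) - expectation (\<lambda>\<omega>. gsmooth 0 s (H \<omega>) 0)\<bar> \<le> W"
  shows "\<bar>expectation (\<lambda>\<omega>. \<Psi> (\<lambda>k. block_sum (k * m) m \<omega>)) - expectation (\<lambda>\<omega>. gauss_out i s \<Psi> (\<lambda>k. block_sum (k * m) m \<omega>))\<bar> \<le> W"
proof -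
  \<comment> \<open>Coordinates beyond \<open>i\<close> are set to \<open>y\<close> as well.
    \<open>\<Psi>\<close> ignores them, and \<open>H\<close> then involves no variable of the
    current or a later block.\<close>
  define H where "H \<omega> y = \<Psi> (\<lambda>k. if k < i then block_sum (k * m) m \<omega> else y)" for \<omega> y
  have upd: "H \<omega> y = \<Psi> ((\<lambda>k. block_sum (k * m) m \<omega>)(i := y))" for \<omega> y
    unfolding H_def by (rule coord_lip_cong[OF \<Psi>]) auto
  have "past_lipschitz (i * m) H"
    unfolding past_lipschitz_def
  proof (intro conjI allI)
    have comp: "(\<lambda>p. if k < i then block_sum (k * m) m (fst p) else snd p) \<in> borel_measurable (past (i * m) \<Otimes>\<^sub>M borel)" for k
    proof (cases "k < i")
      case True
      then have "Suc k * m \<le> i * m" by (intro mult_right_mono) auto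
      then have [measurable]: "block_sum (k * m) m \<in> borel_measurable (past (i * m))"
        by (intro block_sum_past) (simp add: add.commute)
      show ?thesis using True by simp
    qed simp
    have "(\<lambda>p. \<Psi> (\<lambda>k. if k < i then block_sum (k * m) m (fst p) else snd p)) \<in> borel_measurable (past (i * m) \<Otimes>\<^sub>M borel)"
      by (rule measurable_compose[OF measurable_sequence[OF comp] coord_lip_measurable[OF \<Psi>]])
    then show "case_prod H \<in> borel_measurable (past (i * m) \<Otimes>\<^sub>M borel)" by (simp add: H_def case_prod_unfold)
    show "\<bar>H \<omega> x - H \<omega> y\<bar> \<le> \<bar>x - y\<bar>" for \<omega> x y unfolding upd by (rule coord_lip_update[OF \<Psi>])
    show "integrable M (\<lambda>\<omega>. H \<omega> 0)"
      unfolding H_def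
    proof (rule coord_lip_integrable[OF prob_space_axioms \<Psi>, of "\<lambda>k \<omega>. if k < i then block_sum (k * m) m \<omega> else 0"])
      show "integrable M (\<lambda>\<omega>. if k < i then block_sum (k * m) m \<omega> else 0)" for k
        using block_sum_int by (cases "k < i") simp_all
    qed simp
  qed
  moreover have "H \<omega> = (\<lambda>y. \<Psi> ((\<lambda>k. block_sum (k * m) m \<omega>)(i := y)))" for \<omega>
    by (rule ext) (rule upd)
  ultimately show ?thesis using W[of H]
    by (simp add: gauss_out_def fun_upd_idem)
qed

text \<open>After \<open>J\<close> exchanges no coordinate is left, so the iterated average is a
  constant; \<open>bm_gauss_tail\<close> reaches the same constant from Brownian motion, without
  error.\<close>

lemma replace_all_blocks:
  fixes m J :: nat and \<Phi> s
  assumes \<Phi>: "coord_lip J \<Phi>" and s: "s > 0"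
    and W: "\<And>q H. past_lipschitz q H \<Longrightarrow>
       \<bar>expectation (\<lambda>\<omega>. H \<omega> (block_sum q m \<omega>)) - expectation (\<lambda>\<omega>. gsmooth 0 s (H \<omega>) 0)\<bar> \<le> W"
  shows "\<bar>expectation (\<lambda>\<omega>. \<Phi> (\<lambda>k. block_sum (k * m) m \<omega>)) - gauss_tail s J \<Phi> J (\<lambda>_. 0)\<bar> \<le> real J * W"
proof -
  let ?E = "\<lambda>r. expectation (\<lambda>\<omega>. gauss_tail s J \<Phi> r (\<lambda>k. block_sum (k * m) m \<omega>))"
  have "r \<le> J \<Longrightarrow> \<bar>?E 0 - ?E r\<bar> \<le> real r * W" for r
  proof (induction r)
    case (Suc r)
    have "coord_lip (Suc (J - Suc r)) (gauss_tail s J \<Phi> r)"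
      using gauss_tail_lip[OF \<Phi> s, of r] Suc.prems by (simp add: Suc_diff_Suc)
    then have "\<bar>?E r - ?E (Suc r)\<bar> \<le> W"
      unfolding gauss_tail.simps by (rule replace_block[OF _ s W])
    then show ?case using Suc by (simp add: distrib_right)
  qed simp
  from this[of J] have "\<bar>?E 0 - ?E J\<bar> \<le> real J * W" by simp
  moreover define t where "t = gauss_tail s J \<Phi> J (\<lambda>_. 0)"
  have const: "gauss_tail s J \<Phi> J x = t" for x
    using coord_lip_cong[of 0 "gauss_tail s (J) \<Phi> (J)" x "\<lambda>_. 0"] gauss_tail_lip[OF \<Phi> s, of "J"]
    by (simp add: t_def)
  have "?E (J) = t" unfolding const by (simp add: prob_space)
  ultimately show ?thesis by (simp add: t_def)
qed

end

section \<open>Exact integration over Brownian increments\<close>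

context
  fixes M' :: "'b measure" and B :: "real \<Rightarrow> 'b \<Rightarrow> real" and \<sigma> :: real
  assumes BM: "standard_BM01 M' B" and \<sigma>: "\<sigma> > 0"
begin

lemma bm_indep: "prob_space.indep_vars M' (\<lambda>_. borel) (\<lambda>k \<omega>. c * bm_increment B \<sigma> j k \<omega>) {..<2 ^ j}"
proof -
  interpret prob_space M' using BM by (rule bm_prob[OF _ \<sigma>])
  have "indep_vars (\<lambda>_. borel) (\<lambda>i \<omega>. B (real (Suc i) / 2 ^ j) \<omega> - B (real i / 2 ^ j) \<omega>) {..<2 ^ j}"
  proof -
    have "\<forall>(m::nat) \<tau>. 0 \<le> \<tau> 0 \<longrightarrow> \<tau> m \<le> 1 \<longrightarrow> (\<forall>i<m. \<tau> i < \<tau> (Suc i)) \<longrightarrow>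
        indep_vars (\<lambda>_. borel) (\<lambda>i \<omega>. B (\<tau> (Suc i)) \<omega> - B (\<tau> i) \<omega>) {..<m}"
      using BM by (simp add: standard_BM01_def)
    from this[rule_format, of "\<lambda>i. real i / 2 ^ j" "2 ^ j"] show ?thesis
      by (simp add: divide_strict_right_mono)
  qed
  from indep_vars_compose2[OF this, of "\<lambda>_ x. c * (\<sigma> * x)" "\<lambda>_. borel"]
  have "indep_vars (\<lambda>_. borel) (\<lambda>i \<omega>. c * (\<sigma> * (B (real (Suc i) / 2 ^ j) \<omega> - B (real i / 2 ^ j) \<omega>))) {..<2 ^ j}" by simp
  then show ?thesis
    by (rule indep_vars_cong[THEN iffD1, rotated -1]) (auto simp: bm_increment_def)
qed

text \<open>The joint law of the earlier increments and the current one is a product, so Fubini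
  integrates out the latter exactly. The factor \<open>c\<close> will undo the diffusive scaling, so
  that increments are comparable with unscaled block sums.\<close>

lemma bm_integrate_out:
  fixes c :: real
  assumes \<Psi>: "coord_lip (Suc i) \<Psi>" and i: "i < 2 ^ j" and c: "c > 0"
  defines "G \<equiv> \<lambda>k \<omega>. c * bm_increment B \<sigma> j k \<omega>" and "s \<equiv> c * \<sigma> * sqrt (1 / 2 ^ j)"
  shows "(\<integral>\<omega>. \<Psi> (\<lambda>k. G k \<omega>) \<partial>M') = (\<integral>\<omega>. gauss_out i s \<Psi> (\<lambda>k. G k \<omega>) \<partial>M')"
proof -
  interpret prob_space M' using BM by (rule bm_prob[OF _ \<sigma>])
  have Gm [measurable]: "G k \<in> borel_measurable M'" for k
    using bm_increment_meas[OF BM \<sigma>] unfolding G_def by measurable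
  have Gi: "integrable M' (G k)" if "k < 2 ^ j" for k
    unfolding G_def using integrable_of_powr_integrable[OF bm_increment_meas[OF BM \<sigma>] bm_increment_moment(1)[OF BM \<sigma> that], of 1] by simp
  let ?P = "PiM {..<i} (\<lambda>_. borel :: real measure)" and ?Q = "PiM {i} (\<lambda>_. borel :: real measure)"
  define past where "past \<omega> = (\<lambda>k\<in>{..<i}. G k \<omega>)" for \<omega>
  define cur where "cur \<omega> = (\<lambda>k\<in>{i}. G k \<omega>)" for \<omega>
  have ind: "indep_var ?P past ?Q cur"
    unfolding past_def cur_def by (rule indep_var_restrict[OF bm_indep[of c j, folded G_def]]) (use i in auto)
  define g where "g p = \<Psi> (\<lambda>k. if k < i then fst p k else snd p i)" for p :: "(nat \<Rightarrow> real) \<times> (nat \<Rightarrow> real)"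
  have gm [measurable]: "g \<in> borel_measurable (?P \<Otimes>\<^sub>M ?Q)"
    unfolding g_def
  proof (rule measurable_compose[OF measurable_sequence coord_lip_measurable[OF \<Psi>]])
    show "(\<lambda>p. if k < i then fst p k else snd p i) \<in> borel_measurable (?P \<Otimes>\<^sub>M ?Q)" for k
    proof (cases "k < i")
      case True
      then have "(\<lambda>x. x k) \<in> borel_measurable ?P" by (intro measurable_component_singleton) auto
      from measurable_compose[OF measurable_fst this] show ?thesis using True by simp
    next
      case False
      have "(\<lambda>x. x i) \<in> borel_measurable ?Q" by (intro measurable_component_singleton) auto
      from measurable_compose[OF measurable_snd this] show ?thesis using False by simp
    qed
  qed
  have gG: "\<Psi> (\<lambda>k. G k \<omega>) = g (past \<omega>, cur \<omega>)" for \<omega>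
    unfolding g_def past_def cur_def by (rule coord_lip_cong[OF \<Psi>]) (auto simp: less_Suc_eq)
  have intG: "integrable M' (\<lambda>\<omega>. \<Psi> (\<lambda>k. G k \<omega>))"
    by (rule coord_lip_integrable[OF prob_space_axioms \<Psi>]) (use Gi i in auto)
  have pm [measurable]: "past \<in> measurable M' ?P" using ind by (rule indep_var_rv1)
  have cm [measurable]: "cur \<in> measurable M' ?Q" using ind by (rule indep_var_rv2)
  let ?D1 = "distr M' ?P past" and ?D2 = "distr M' ?Q cur"
  interpret D1: prob_space ?D1 by (rule prob_space_distr) measurable
  interpret D2: prob_space ?D2 by (rule prob_space_distr) measurable
  interpret D: pair_prob_space ?D1 ?D2 ..
  have joint: "?D1 \<Otimes>\<^sub>M ?D2 = distr M' (?P \<Otimes>\<^sub>M ?Q) (\<lambda>\<omega>. (past \<omega>, cur \<omega>))"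
    using ind by (simp add: indep_var_distribution_eq)
  have "integrable (distr M' (?P \<Otimes>\<^sub>M ?Q) (\<lambda>\<omega>. (past \<omega>, cur \<omega>))) g"
    by (subst integrable_distr_eq) (use intG gG in auto)
  then have gi: "integrable (?D1 \<Otimes>\<^sub>M ?D2) g" by (simp add: joint)
  have "(\<integral>\<omega>. \<Psi> (\<lambda>k. G k \<omega>) \<partial>M') = (\<integral>p. g p \<partial>(?D1 \<Otimes>\<^sub>M ?D2))"
    unfolding joint gG by (subst integral_distr) auto
  also have "\<dots> = (\<integral>x. (\<integral>y. g (x, y) \<partial>?D2) \<partial>?D1)" by (rule D.integral_fst'[symmetric, OF gi])
  also have "\<dots> = (\<integral>\<omega>. (\<integral>y. g (past \<omega>, y) \<partial>?D2) \<partial>M')"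
    by (subst integral_distr) auto
  also have "\<dots> = (\<integral>\<omega>. gauss_out i s \<Psi> (\<lambda>k. G k \<omega>) \<partial>M')"
  proof (rule Bochner_Integration.integral_cong)
    fix \<omega> assume "\<omega> \<in> space M'"
    have gy: "g (past \<omega>, y) = \<Psi> ((\<lambda>k. G k \<omega>)(i := y i))" for y
      unfolding g_def past_def by (rule coord_lip_cong[OF \<Psi>]) (auto simp: less_Suc_eq)
    have hm: "(\<lambda>y. \<Psi> ((\<lambda>k. G k \<omega>)(i := y))) \<in> borel_measurable borel"
      by (rule lip_measurable) (rule coord_lip_update[OF \<Psi>])
    let ?h = "\<lambda>y. \<Psi> ((\<lambda>k. G k \<omega>)(i := y))" and ?t = "sqrt (1 / 2 ^ j)"
    let ?Z = "\<lambda>\<omega>. B (real (Suc i) / 2 ^ j) \<omega> - B (real i / 2 ^ j) \<omega>"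
    have Gz: "G i \<omega> = c * \<sigma> * ?Z \<omega>" for \<omega> using i by (simp add: G_def bm_increment_def)
    have "(\<integral>y. g (past \<omega>, y) \<partial>?D2) = (\<integral>\<omega>'. ?h (G i \<omega>') \<partial>M')"
    proof -
      have m: "(\<lambda>y. ?h (y i)) \<in> borel_measurable ?Q"
        by (rule measurable_compose[OF _ hm]) (auto intro: measurable_component_singleton)
      have "(\<integral>y. ?h (y i) \<partial>?D2) = (\<integral>\<omega>'. ?h (cur \<omega>' i) \<partial>M')" by (rule integral_distr[OF cm m])
      then show ?thesis unfolding gy by (simp add: cur_def)
    qed
    also have "\<dots> = (\<integral>\<omega>'. ?h (c * \<sigma> * ?Z \<omega>') \<partial>M')" by (simp only: Gz)
    also have "\<dots> = (\<integral>y. normal_density 0 ?t y * ?h (c * \<sigma> * y) \<partial>lborel)"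
      by (rule distributed_integral[OF bm_increment_distributed[OF BM \<sigma> i], symmetric]) (use hm in auto)
    also have "\<dots> = (\<integral>y. ?h (c * \<sigma> * y) * normal_density 0 ?t y \<partial>lborel)" by (simp add: mult.commute)
    also have "\<dots> = (\<integral>z. ?h (c * \<sigma> * (?t * z)) * std_normal_density z \<partial>lborel)"
      by (rule integral_normal_density_scale[symmetric]) simp
    also have "\<dots> = gauss_out i s \<Psi> (\<lambda>k. G k \<omega>)"
      by (simp add: gauss_out_def gsmooth_def hermite_def s_def mult.assoc)
    finally show "(\<integral>y. g (past \<omega>, y) \<partial>?D2) = gauss_out i s \<Psi> (\<lambda>k. G k \<omega>)" .
  qed simp
  finally show ?thesis .
qed

lemma bm_gauss_tail:
  fixes c :: real
  assumes \<Phi>: "coord_lip (2 ^ j) \<Phi>" and c: "c > 0"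
  shows "(\<integral>\<omega>. \<Phi> (\<lambda>k. c * bm_increment B \<sigma> j k \<omega>) \<partial>M') = gauss_tail (c * \<sigma> * sqrt (1 / 2 ^ j)) (2 ^ j) \<Phi> (2 ^ j) (\<lambda>_. 0)"
proof -
  interpret prob_space M' using BM by (rule bm_prob[OF _ \<sigma>])
  define s where "s = c * \<sigma> * sqrt (1 / 2 ^ j)"
  have s: "s > 0" using c \<sigma> by (simp add: s_def)
  let ?J = "2 ^ j :: nat"
  let ?E = "\<lambda>r. (\<integral>\<omega>. gauss_tail s ?J \<Phi> r (\<lambda>k. c * bm_increment B \<sigma> j k \<omega>) \<partial>M')"
  have "r \<le> ?J \<Longrightarrow> ?E 0 = ?E r" for r
  proof (induction r)
    case (Suc r)
    have "coord_lip (Suc (?J - Suc r)) (gauss_tail s ?J \<Phi> r)"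
      using gauss_tail_lip[OF \<Phi> s, of r] Suc.prems by (simp add: Suc_diff_Suc)
    then have "?E r = ?E (Suc r)"
      unfolding gauss_tail.simps s_def by (rule bm_integrate_out) (use c in auto)
    then show ?case using Suc by simp
  qed simp
  from this[of ?J] have "?E 0 = ?E ?J" by simp
  moreover define t where "t = gauss_tail s ?J \<Phi> ?J (\<lambda>_. 0)"
  have const: "gauss_tail s ?J \<Phi> ?J x = t" for x
    using coord_lip_cong[of 0 "gauss_tail s (?J) \<Phi> (?J)" x "\<lambda>_. 0"] gauss_tail_lip[OF \<Phi> s, of "?J"]
    by (simp add: t_def)
  have "?E (?J) = t" unfolding const by (simp add: prob_space)
  ultimately show ?thesis by (simp add: s_def t_def)
qed

end

section \<open>Balancing the errors and conclusion\<close>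

lemma random_walk_path:
  "to_cadlag (\<lambda>t. random_walk X n t \<omega>) = step_path (2 ^ n) (\<lambda>k. 2 powr (- real n / 2) * X k \<omega>)"
proof -
  have "(\<lambda>t. random_walk X n t \<omega>) = step_fun (2 ^ n) (\<lambda>k. 2 powr (- real n / 2) * X k \<omega>)"
    by (simp add: random_walk_def step_fun_def sum_distrib_left fun_eq_iff)
  then show ?thesis by (simp add: step_path_def)
qed

lemma KR_dist_le:
  assumes "\<And>f. 1-lipschitz_on UNIV f \<Longrightarrow> integral\<^sup>L \<mu> f - integral\<^sup>L \<nu> f \<le> c"
  shows "KR_dist \<mu> \<nu> \<le> ereal c"
  unfolding KR_dist_def by (rule SUP_least) (use assms in simp)

text \<open>The memory length \<open>L\<close> balances the smoothing error against the mixing error.\<close>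

lemma block_error_balance:
  fixes d a M :: real
  assumes d: "0 < d" "d \<le> 1" and a: "a > 0" and M: "M \<ge> 1"
  defines "x \<equiv> d / (2 * d + a)" and "\<kappa> \<equiv> d * a / (2 * (2 * d + a))"
  defines "L \<equiv> nat \<lceil>M powr x\<rceil>"
  shows "1 \<le> L" "(1 + ln M) * M powr ((1 - d) / 2) * real L powr d + sqrt M * real L powr (- a / 2) + real L
    \<le> 5 * ((1 + ln M) * M powr (1 / 2 - \<kappa>))"
proof -
  have x0: "x > 0" and x2: "x \<le> 1 / 2" using d a by (auto simp: x_def field_simps)
  \<comment> \<open>The two expressions are the exponents saved, relative to the square root of
    \<open>M\<close>, in the mixing error and in the smoothing error; \<open>x\<close> is chosen to
    make them equal.\<close>
  have k: "\<kappa> = x * a / 2" "\<kappa> = d / 2 - x * d"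
    using d a by (auto simp: x_def \<kappa>_def field_simps)
  have Mx: "M powr x \<ge> 1" using M x0 by (intro ge_one_powr_ge_zero) auto
  have Ll: "M powr x \<le> real L" unfolding L_def by linarith
  have Lu: "real L \<le> 2 * M powr x"
  proof -
    have "real L < M powr x + 1" unfolding L_def using Mx by linarith
    then show ?thesis using Mx by linarith
  qed
  show "1 \<le> L" using Ll Mx by linarith
  let ?R = "M powr (1 / 2 - \<kappa>)" and ?l = "1 + ln M"
  have l: "?l \<ge> 1" using M by simp
  have t1: "M powr ((1 - d) / 2) * real L powr d \<le> 2 * ?R"
  proof -
    have "real L powr d \<le> (2 * M powr x) powr d" using Lu d by (intro powr_mono2) auto
    also have "\<dots> = 2 powr d * M powr (x * d)" by (simp add: powr_mult powr_powr)
    also have "\<dots> \<le> 2 * M powr (x * d)" using powr_mono[of d 1 2] d by (intro mult_right_mono) auto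
    finally have "M powr ((1 - d) / 2) * real L powr d \<le> M powr ((1 - d) / 2) * (2 * M powr (x * d))"
      by (intro mult_left_mono) auto
    also have "\<dots> = 2 * M powr ((1 - d) / 2 + x * d)" by (simp add: powr_add)
    also have "(1 - d) / 2 + x * d = 1 / 2 - \<kappa>" unfolding k(2) by (simp add: field_simps)
    finally show ?thesis .
  qed
  have t2: "sqrt M * real L powr (- a / 2) \<le> ?R"
  proof -
    have "real L powr (- a / 2) \<le> (M powr x) powr (- a / 2)" using Ll Mx a by (intro powr_mono2') auto
    also have "\<dots> = M powr (- \<kappa>)" unfolding k(1) by (simp add: powr_powr)
    finally have "sqrt M * real L powr (- a / 2) \<le> M powr (1 / 2) * M powr (- \<kappa>)"
      using M by (simp add: powr_half_sqrt mult_left_mono)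
    also have "\<dots> = ?R" by (simp flip: powr_add)
    finally show ?thesis .
  qed
  \<comment> \<open>The term \<open>real L\<close> is not larger than the others: the exponents
    differ by \<open>(1 - d) * (1 / 2 - x)\<close>, which is nonnegative.\<close>
  have t3: "real L \<le> 2 * ?R"
  proof -
    have "(1 / 2 - \<kappa>) - x = (1 - d) * (1 / 2 - x)" unfolding k(2) by (simp add: field_simps)
    moreover have "(1 - d) * (1 / 2 - x) \<ge> 0" using d x2 by (intro mult_nonneg_nonneg) auto
    ultimately have "M powr x \<le> ?R" using M by (intro powr_mono) auto
    then show ?thesis using Lu by linarith
  qed
  have "(1 + ln M) * M powr ((1 - d) / 2) * real L powr d = ?l * (M powr ((1 - d) / 2) * real L powr d)" by simp
  also have "\<dots> \<le> ?l * (2 * ?R)" using l by (intro mult_left_mono t1) auto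
  finally have "(1 + ln M) * M powr ((1 - d) / 2) * real L powr d \<le> 2 * (?l * ?R)" by simp
  moreover have "?R \<le> ?l * ?R" using l mult_right_mono[of 1 ?l ?R] by simp
  ultimately show "(1 + ln M) * M powr ((1 - d) / 2) * real L powr d + sqrt M * real L powr (- a / 2) + real L
    \<le> 5 * (?l * ?R)" using t2 t3 by linarith
qed

text \<open>There are about \<open>N powr g\<close> blocks of length about
  \<open>N powr (1 - g)\<close>. Chaining costs \<open>N powr (- (g * \<alpha>))\<close>. The
  rescaled block errors add up to \<open>N powr (g / 2 - (1 - g) * \<kappa>)\<close> times a
  logarithm, and \<open>bal\<close> says that this power is not larger. Rounding \<open>j\<close>
  down loses at most a factor 2 in the first error and only helps in the second.\<close>

lemma dyadic_rate_balance:
  fixes g \<alpha> \<kappa> :: real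
  assumes n: "n \<ge> 1" and g: "0 < g" "g < 1" and \<alpha>: "0 \<le> \<alpha>" "\<alpha> \<le> 1" and \<kappa>: "\<kappa> \<ge> 0"
    and bal: "g * (1 / 2 + \<alpha>) \<le> (1 - g) * \<kappa>"
  defines "j \<equiv> nat \<lfloor>real n * g\<rfloor>"
  shows "j \<le> n" "2 powr (- real j * \<alpha>) \<le> 4 * ((2 ^ n) powr (- (g * \<alpha>)) * ln (2 ^ n))"
    and "2 powr (- real n / 2) * (2 ^ j * ((1 + ln (2 ^ (n - j))) * (2 ^ (n - j)) powr (1 / 2 - \<kappa>)))
      \<le> 3 * ((2 ^ n) powr (- (g * \<alpha>)) * ln (2 ^ n))"
proof -
  have ng: "real n * g > 0" "real n * g \<le> real n" using n g by auto
  have j: "real j \<le> real n * g" "real n * g < real j + 1" unfolding j_def using ng by linarith+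
  show jn: "j \<le> n" using j ng by linarith
  have ln2: "ln 2 \<ge> (1 / 2 :: real)" using ln2_ge_two_thirds by linarith
  have lnn: "ln (2 ^ n) = real n * ln (2 :: real)" by (simp add: ln_realpow)
  \<comment> \<open>A positive lower bound of the logarithm, by which it absorbs additive and
    multiplicative constants.\<close>
  have ln1: "1 / 2 \<le> ln (2 ^ n :: real)"
  proof -
    have "1 * (1 / 2) \<le> real n * ln (2 :: real)" using n ln2 by (intro mult_mono) auto
    then show ?thesis by (simp add: lnn)
  qed
  have P: "(2 ^ n) powr (- (g * \<alpha>)) = 2 powr (- (real n * g * \<alpha>))" for \<alpha> :: real
    by (simp add: powr_realpow[symmetric] powr_powr mult.assoc)
  have "- real j * \<alpha> \<le> 1 + - (real n * g * \<alpha>)"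
  proof -
    have "(real n * g) * \<alpha> \<le> (real j + 1) * \<alpha>" using j \<alpha> by (intro mult_right_mono) auto
    then show ?thesis using \<alpha> by (simp add: algebra_simps)
  qed
  then have "2 powr (- real j * \<alpha>) \<le> 2 powr (1 + - (real n * g * \<alpha>))" by (intro powr_mono) auto
  also have "\<dots> = 4 * (2 powr (- (real n * g * \<alpha>)) * (1 / 2))" unfolding powr_add by simp
  also have "\<dots> \<le> 4 * (2 powr (- (real n * g * \<alpha>)) * ln (2 ^ n))"
    using ln1 by (intro mult_left_mono) auto
  finally show "2 powr (- real j * \<alpha>) \<le> 4 * ((2 ^ n) powr (- (g * \<alpha>)) * ln (2 ^ n))" by (simp add: P)
  have l: "1 + ln (2 ^ (n - j)) \<le> 3 * ln (2 ^ n :: real)"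
  proof -
    have "ln (2 ^ (n - j)) \<le> ln (2 ^ n :: real)" by (simp add: power_increasing)
    then show ?thesis using ln1 by linarith
  qed
  have m: "(2 ^ (n - j)) powr (1 / 2 - \<kappa>) = 2 powr ((real n - real j) * (1 / 2 - \<kappa>))"
    using jn by (simp add: powr_realpow[symmetric] powr_powr of_nat_diff)
  have "2 powr (- real n / 2) * (2 ^ j * (2 ^ (n - j)) powr (1 / 2 - \<kappa>))
     = 2 powr (- real n / 2 + (real j + (real n - real j) * (1 / 2 - \<kappa>)))"
    unfolding m powr_add by (simp add: powr_realpow)
  also have "\<dots> \<le> 2 powr (- (real n * g * \<alpha>))"
  proof (rule powr_mono)
    have "- real n / 2 + (real j + (real n - real j) * (1 / 2 - \<kappa>)) = real j * (1 / 2 + \<kappa>) - real n * \<kappa>"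
      by (simp add: field_simps)
    also have "\<dots> \<le> (real n * g) * (1 / 2 + \<kappa>) - real n * \<kappa>" using j \<kappa> by (intro diff_right_mono mult_right_mono) auto
    also have "\<dots> = real n * (g * (1 / 2 + \<alpha>) - (1 - g) * \<kappa>) - real n * g * \<alpha>" by (simp add: algebra_simps)
    also have "\<dots> \<le> - (real n * g * \<alpha>)"
      using bal mult_left_mono[of "g * (1 / 2 + \<alpha>) - (1 - g) * \<kappa>" 0 "real n"] by simp
    finally show "- real n / 2 + (real j + (real n - real j) * (1 / 2 - \<kappa>)) \<le> - (real n * g * \<alpha>)" .
  qed simp
  finally have main: "2 powr (- real n / 2) * (2 ^ j * (2 ^ (n - j)) powr (1 / 2 - \<kappa>)) \<le> 2 powr (- (real n * g * \<alpha>))" .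
  have "2 powr (- real n / 2) * (2 ^ j * ((1 + ln (2 ^ (n - j))) * (2 ^ (n - j)) powr (1 / 2 - \<kappa>)))
     = (1 + ln (2 ^ (n - j))) * (2 powr (- real n / 2) * (2 ^ j * (2 ^ (n - j)) powr (1 / 2 - \<kappa>)))"
    by (simp only: ac_simps)
  also have "\<dots> \<le> (3 * ln (2 ^ n)) * 2 powr (- (real n * g * \<alpha>))"
    using ln1 by (intro mult_mono l main) auto
  finally show "2 powr (- real n / 2) * (2 ^ j * ((1 + ln (2 ^ (n - j))) * (2 ^ (n - j)) powr (1 / 2 - \<kappa>)))
      \<le> 3 * ((2 ^ n) powr (- (g * \<alpha>)) * ln (2 ^ n))" unfolding P by (simp add: ac_simps)
qed

context mixing_sequence
begin

text \<open>With the scaling fixed at level \<open>n\<close>, block sums form an array that refines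
  exactly, each block being the union of its halves. The constant comes from the block moments and
  is uniform in \<open>f\<close>, \<open>n\<close> and \<open>j\<close>.\<close>

lemma walk_chain:
  assumes "rate > 1"
  shows "\<exists>K>0. \<forall>f n j. 1-lipschitz_on UNIV f \<longrightarrow> j \<le> n \<longrightarrow>
    \<bar>expectation (\<lambda>\<omega>. f (step_path (2 ^ n) (\<lambda>k. 2 powr (- real n / 2) * X k \<omega>)))
     - expectation (\<lambda>\<omega>. f (step_path (2 ^ j) (\<lambda>k. 2 powr (- real n / 2) * block_sum (k * 2 ^ (n - j)) (2 ^ (n - j)) \<omega>)))\<bar>
    \<le> chain_const mord * K * 2 powr (- real j * (1 / 2 - 1 / mord))"
proof -
  obtain K where K: "K > 0" "\<And>q k. expectation (\<lambda>\<omega>. \<bar>block_sum q (2 ^ k) \<omega>\<bar> powr mord) \<le> (K * sqrt (2 ^ k)) powr mord"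
    using dyadic_block_moment[OF assms] by blast
  have "\<bar>expectation (\<lambda>\<omega>. f (step_path (2 ^ n) (\<lambda>k. 2 powr (- real n / 2) * X k \<omega>)))
     - expectation (\<lambda>\<omega>. f (step_path (2 ^ j) (\<lambda>k. 2 powr (- real n / 2) * block_sum (k * 2 ^ (n - j)) (2 ^ (n - j)) \<omega>)))\<bar>
    \<le> chain_const mord * K * 2 powr (- real j * (1 / 2 - 1 / mord))"
    if f: "1-lipschitz_on UNIV f" and jn: "j \<le> n" for f :: "cadlag \<Rightarrow> real" and n j
  proof -
    define c where "c = 2 powr (- real n / 2)"
    have c: "c > 0" by (simp add: c_def)
    define D where "D l k \<omega> = c * block_sum (k * 2 ^ (n - l)) (2 ^ (n - l)) \<omega>" for l k \<omega>
    have Dm: "D l k \<in> borel_measurable M" for l k unfolding D_def by measurable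
    have p: "mord > 2" using \<delta>_pos by simp
    have refine: "D l k \<omega> = D (Suc l) (2 * k) \<omega> + D (Suc l) (2 * k + 1) \<omega>" if "l < n" for l k \<omega>
    proof -
      let ?m = "2 ^ (n - Suc l) :: nat"
      have m: "2 ^ (n - l) = ?m + ?m" using that by (simp add: Suc_diff_Suc[symmetric] mult_2)
      have "block_sum (k * (?m + ?m)) (?m + ?m) \<omega> = block_sum (2 * k * ?m) ?m \<omega> + block_sum ((2 * k + 1) * ?m) ?m \<omega>"
      proof -
        have e: "2 * k * ?m = k * (?m + ?m)" "(2 * k + 1) * ?m = k * (?m + ?m) + ?m"
          by (simp_all add: algebra_simps)
        show ?thesis unfolding e by (rule block_sum_add)
      qed
      then show ?thesis unfolding D_def m by (simp add: distrib_left)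
    qed
    have abs: "\<bar>D l k \<omega>\<bar> powr mord = c powr mord * \<bar>block_sum (k * 2 ^ (n - l)) (2 ^ (n - l)) \<omega>\<bar> powr mord" for l k \<omega>
      unfolding D_def using c by (simp add: abs_mult powr_mult)
    have int: "integrable M (\<lambda>\<omega>. \<bar>D l k \<omega>\<bar> powr mord)" for l k
      unfolding abs using block_sum_moment_trivial(1) by simp
    have mom: "expectation (\<lambda>\<omega>. \<bar>D l k \<omega>\<bar> powr mord) \<le> (K * 2 powr (- real l / 2)) powr mord" if "l \<le> n" for l k
    proof -
      have "expectation (\<lambda>\<omega>. \<bar>D l k \<omega>\<bar> powr mord) = c powr mord * expectation (\<lambda>\<omega>. \<bar>block_sum (k * 2 ^ (n - l)) (2 ^ (n - l)) \<omega>\<bar> powr mord)"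
        unfolding abs by simp
      also have "\<dots> \<le> c powr mord * (K * sqrt (2 ^ (n - l))) powr mord" by (intro mult_left_mono K(2)) auto
      also have "\<dots> = (K * (c * sqrt (2 ^ (n - l)))) powr mord" by (simp add: powr_mult ac_simps)
      also have "c * sqrt (2 ^ (n - l)) = 2 powr (- real l / 2)"
      proof -
        have "sqrt (2 ^ (n - l)) = 2 powr ((real n - real l) / 2)"
          using that by (simp add: powr_half_sqrt[symmetric] powr_realpow[symmetric] powr_powr of_nat_diff)
        moreover have "- real n / 2 + (real n - real l) / 2 = - real l / 2" by (simp add: field_simps)
        ultimately show ?thesis unfolding c_def by (metis powr_add)
      qed
      finally show ?thesis .
    qed
    let ?Y = "\<lambda>l \<omega>. f (step_path (2 ^ l) (\<lambda>k. D l k \<omega>))"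
    have "integrable M (\<lambda>\<omega>. \<bar>?Y n \<omega> - ?Y j \<omega>\<bar>)"
      "expectation (\<lambda>\<omega>. \<bar>?Y n \<omega> - ?Y j \<omega>\<bar>) \<le> chain_const mord * K * 2 powr (- real j * (1 / 2 - 1 / mord))"
      by (rule dyadic_chain[OF f p K(1) jn Dm]; (use refine int mom in auto))+
    moreover have iY: "integrable M (?Y l)" for l
    proof (rule coord_lip_integrable[OF prob_space_axioms, of "2 ^ l" "\<lambda>x. f (step_path (2 ^ l) x)" "D l"])
      show "coord_lip (2 ^ l) (\<lambda>x. f (step_path (2 ^ l) x))"
        unfolding coord_lip_def using lipschitz_step_bound[OF f] by simp
      show "integrable M (D l k)" for k unfolding D_def using block_sum_int by simp
    qed (rule Dm)
    moreover have "\<bar>expectation (?Y n) - expectation (?Y j)\<bar> \<le> expectation (\<lambda>\<omega>. \<bar>?Y n \<omega> - ?Y j \<omega>\<bar>)"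
      using integral_abs_bound[of M "\<lambda>\<omega>. ?Y n \<omega> - ?Y j \<omega>"] iY by simp
    ultimately have "\<bar>expectation (?Y n) - expectation (?Y j)\<bar> \<le> chain_const mord * K * 2 powr (- real j * (1 / 2 - 1 / mord))"
      by linarith
    moreover have "D n k \<omega> = c * X k \<omega>" for k \<omega> by (simp add: D_def block_sum_def)
    ultimately show ?thesis by (simp add: D_def c_def)
  qed
  then show ?thesis using K(1) by blast
qed

lemma block_stage:
  fixes f :: "cadlag \<Rightarrow> real" and B :: "real \<Rightarrow> 'b \<Rightarrow> real"
  assumes BM: "standard_BM01 M' B" and \<sigma>: "\<sigma> > 0" and f: "1-lipschitz_on UNIV f" and jn: "j \<le> n"
    and W: "\<And>q H. past_lipschitz q H \<Longrightarrow>
       \<bar>expectation (\<lambda>\<omega>. H \<omega> (block_sum q (2 ^ (n - j)) \<omega>)) - expectation (\<lambda>\<omega>. gsmooth 0 (\<sigma> * sqrt (2 ^ (n - j))) (H \<omega>) 0)\<bar> \<le> W"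
  shows "\<bar>expectation (\<lambda>\<omega>. f (step_path (2 ^ j) (\<lambda>k. 2 powr (- real n / 2) * block_sum (k * 2 ^ (n - j)) (2 ^ (n - j)) \<omega>)))
     - (\<integral>\<omega>. f (step_path (2 ^ j) (\<lambda>k. bm_increment B \<sigma> j k \<omega>)) \<partial>M')\<bar> \<le> 2 powr (- real n / 2) * (2 ^ j * W)"
proof -
  define c where "c = 2 powr (- real n / 2)"
  have c: "c > 0" by (simp add: c_def)
  \<comment> \<open>Dividing by \<open>c\<close> restores the Lipschitz constant 1 in the unscaled
    block sums; multiplying back at the end gives the factor in the claim.\<close>
  define \<Phi> where "\<Phi> x = 1 / c * f (step_path (2 ^ j) (\<lambda>k. c * x k))" for x
  have \<Phi>: "coord_lip (2 ^ j) \<Phi>"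
    unfolding coord_lip_def
  proof (intro allI)
    fix x y :: "nat \<Rightarrow> real"
    have "\<bar>f (step_path (2 ^ j) (\<lambda>k. c * x k)) - f (step_path (2 ^ j) (\<lambda>k. c * y k))\<bar> \<le> (\<Sum>k<2 ^ j. \<bar>c * x k - c * y k\<bar>)"
      by (rule lipschitz_step_bound[OF f]) simp
    also have "\<dots> = c * (\<Sum>k<2 ^ j. \<bar>x k - y k\<bar>)"
      using c by (simp add: sum_distrib_left abs_mult flip: right_diff_distrib)
    finally have "1 / c * \<bar>f (step_path (2 ^ j) (\<lambda>k. c * x k)) - f (step_path (2 ^ j) (\<lambda>k. c * y k))\<bar> \<le> 1 / c * (c * (\<Sum>k<2 ^ j. \<bar>x k - y k\<bar>))"
      using c by (intro mult_left_mono) auto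
    then show "\<bar>\<Phi> x - \<Phi> y\<bar> \<le> (\<Sum>k<2 ^ j. \<bar>x k - y k\<bar>)"
      using c by (simp add: \<Phi>_def abs_mult flip: right_diff_distrib diff_divide_distrib)
  qed
  define s where "s = \<sigma> * sqrt (2 ^ (n - j))"
  have s: "s > 0" using \<sigma> by (simp add: s_def)
  \<comment> \<open>Increments of level \<open>j\<close>, scaled back by \<open>1 / c\<close>, have
    the same standard deviation as the Gaussian substitute of a block of length
    \<open>2 ^ (n - j)\<close>.\<close>
  have s': "1 / c * \<sigma> * sqrt (1 / 2 ^ j) = s"
  proof -
    have "1 / c = sqrt (2 ^ n)"
      by (simp add: c_def powr_half_sqrt[symmetric] powr_realpow[symmetric] powr_powr powr_minus_divide)
    moreover have "sqrt (2 ^ n) * sqrt (1 / 2 ^ j) = sqrt (2 ^ (n - j))"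
      using jn by (simp add: real_sqrt_mult[symmetric] power_diff)
    ultimately show ?thesis by (simp add: s_def ac_simps)
  qed
  have "\<bar>expectation (\<lambda>\<omega>. \<Phi> (\<lambda>k. block_sum (k * 2 ^ (n - j)) (2 ^ (n - j)) \<omega>)) - gauss_tail s (2 ^ j) \<Phi> (2 ^ j) (\<lambda>_. 0)\<bar> \<le> real (2 ^ j) * W"
    by (rule replace_all_blocks[OF \<Phi> s]) (use W in \<open>simp add: s_def\<close>)
  moreover have "(\<integral>\<omega>. \<Phi> (\<lambda>k. 1 / c * bm_increment B \<sigma> j k \<omega>) \<partial>M') = gauss_tail s (2 ^ j) \<Phi> (2 ^ j) (\<lambda>_. 0)"
    using bm_gauss_tail[OF BM \<sigma> \<Phi>, of "1 / c"] c unfolding s' by simp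
  ultimately have "\<bar>expectation (\<lambda>\<omega>. \<Phi> (\<lambda>k. block_sum (k * 2 ^ (n - j)) (2 ^ (n - j)) \<omega>)) - (\<integral>\<omega>. \<Phi> (\<lambda>k. 1 / c * bm_increment B \<sigma> j k \<omega>) \<partial>M')\<bar> \<le> 2 ^ j * W"
    by simp
  then have "c * \<bar>1 / c * expectation (\<lambda>\<omega>. f (step_path (2 ^ j) (\<lambda>k. c * block_sum (k * 2 ^ (n - j)) (2 ^ (n - j)) \<omega>)))
     - 1 / c * (\<integral>\<omega>. f (step_path (2 ^ j) (\<lambda>k. bm_increment B \<sigma> j k \<omega>)) \<partial>M')\<bar> \<le> c * (2 ^ j * W)"
    using c by (intro mult_left_mono) (auto simp: \<Phi>_def)
  then have "\<bar>expectation (\<lambda>\<omega>. f (step_path (2 ^ j) (\<lambda>k. c * block_sum (k * 2 ^ (n - j)) (2 ^ (n - j)) \<omega>)))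
     - (\<integral>\<omega>. f (step_path (2 ^ j) (\<lambda>k. bm_increment B \<sigma> j k \<omega>)) \<partial>M')\<bar> \<le> c * (2 ^ j * W)"
    using c by (simp add: abs_mult flip: right_diff_distrib diff_divide_distrib)
  then show ?thesis unfolding c_def .
qed

end


theorem theorem3p15:
  fixes M :: "'a measure" and X :: "nat \<Rightarrow> 'a \<Rightarrow> real"
    and M' :: "'b measure" and B :: "real \<Rightarrow> 'b \<Rightarrow> real"
    and \<delta> \<rho> \<theta> \<sigma> p d c :: real
  assumes "prob_space M"
    and "\<delta> > 0" and "\<rho> = (1 + \<delta>) / (2 + \<delta>)" and "\<theta> > 0" and "\<rho> * \<theta> > 2"
    and "X \<in> W_phi_theta_class M \<delta> \<theta>"
    and "\<sigma>\<^sup>2 = autocov M X 0 + 2 * (\<Sum>j. autocov M X (Suc j))" and "\<sigma> > 0"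
    and "standard_BM01 M' B"
    and "2 < p" and "p \<le> 2 + \<delta>"
    and "d = min \<delta> 1" and "c = d / (2 + d)" and "2 * \<rho> * \<theta> * c > 1"
  shows "(\<exists>K::real. \<forall>n\<ge>1.
            KR_dist (path_law M (random_walk X n)) (path_law M' (\<lambda>t \<omega>. \<sigma> * B t \<omega>))
              \<le> ereal (K * (2 ^ n) powr (- (gamma_tilde (\<rho> * \<theta>) d p * (1 / 2 - 1 / p)))
                         * ln (2 ^ n)))
       \<and> gamma_tilde (\<rho> * \<theta>) d p > gamma_star (\<rho> * \<theta>) c
       \<and> (gamma_tilde (\<rho> * \<theta>) d \<longlongrightarrow> gamma_star (\<rho> * \<theta>) c) at_top
       \<and> strict_mono_on {2<..} (\<lambda>q. gamma_tilde (\<rho> * \<theta>) d q * (1 / 2 - 1 / q))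
       \<and> (\<forall>q\<in>{2<..2 + \<delta>}. gamma_tilde (\<rho> * \<theta>) d q * (1 / 2 - 1 / q)
             \<le> gamma_tilde (\<rho> * \<theta>) d (2 + \<delta>) * (1 / 2 - 1 / (2 + \<delta>)))"
proof -
  note \<delta> = \<open>\<delta> > 0\<close> and \<theta> = \<open>\<theta> > 0\<close> and \<sigma> = \<open>\<sigma> > 0\<close> and BM = \<open>standard_BM01 M' B\<close>
  define r where "r = \<rho> * \<theta>"
  have r: "r > 2" using assms by (simp add: r_def)
  have r0: "r > 0" using r by simp
  have d: "0 < d" "d \<le> 1" "d \<le> \<delta>" using assms by auto
  have cd: "2 * r * (d / (2 + d)) > 1"
    using assms(14) unfolding assms(13) r_def by (simp only: mult.assoc)
  note mono = rate_exponent_strict_mono[OF r0 d(1) cd]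
  have best: "gamma_tilde r d q * (1 / 2 - 1 / q) \<le> gamma_tilde r d (2 + \<delta>) * (1 / 2 - 1 / (2 + \<delta>))"
    if "q \<in> {2<..2 + \<delta>}" for q
    using strict_mono_on_leD[OF mono, of q "2 + \<delta>"] that \<delta> by auto
  obtain c\<^sub>X where "mixing_sequence M X \<delta> \<theta> (2 powr \<theta>) c\<^sub>X"
    using mixing_sequence_of_W_class[OF assms(1) \<delta> \<theta> assms(6)] by blast
  then interpret mixing_sequence M X \<delta> \<theta> "2 powr \<theta>" c\<^sub>X .
  have rate_eq: "rate = r" by (simp add: r_def assms(3))
  have r1: "rate > 1" and r2: "rate > 2" using r unfolding rate_eq by simp_all
  define a where "a = r * \<delta> / (1 + \<delta>)"
  have a: "a > 0" using r \<delta> by (simp add: a_def)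
  have arate_eq: "arate = a" using \<delta> by (simp add: a_def r_def assms(3))
  \<comment> \<open>The number of blocks is governed by the moment order
    \<open>2 + \<delta>\<close>, whatever the value of \<open>p\<close>.\<close>
  define g \<alpha> \<kappa> where "g = gamma_tilde r d (2 + \<delta>)" and "\<alpha> = 1 / 2 - 1 / (2 + \<delta>)" and "\<kappa> = d * a / (2 * (2 * d + a))"
  note bal = gamma_tilde_balance[OF r \<delta> assms(12) cd, folded a_def g_def]
  have \<alpha>: "0 \<le> \<alpha>" "\<alpha> \<le> 1" using \<delta> by (auto simp: \<alpha>_def field_simps)
  have \<kappa>: "\<kappa> \<ge> 0" using d a by (simp add: \<kappa>_def)
  have bal': "g * (1 / 2 + \<alpha>) \<le> (1 - g) * \<kappa>" using bal(3) by (simp add: \<alpha>_def \<kappa>_def)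
  obtain C where C: "C > 0" "\<And>q m L H. 1 \<le> m \<Longrightarrow> 1 \<le> L \<Longrightarrow> past_lipschitz q H \<Longrightarrow>
     \<bar>expectation (\<lambda>\<omega>. H \<omega> (block_sum q m \<omega>)) - expectation (\<lambda>\<omega>. gsmooth 0 (\<sigma> * sqrt (real m)) (H \<omega>) 0)\<bar>
      \<le> C * ((1 + ln (real m)) * real m powr ((1 - d) / 2) * real L powr d
          + sqrt (real m) * real L powr (- a / 2) + real L)"
    using block_gaussian_approximation[OF \<sigma> assms(7) r2 d] unfolding arate_eq by blast
  obtain K\<^sub>X where KX: "K\<^sub>X > 0" "\<And>f n j. 1-lipschitz_on UNIV f \<Longrightarrow> j \<le> n \<Longrightarrow>
    \<bar>expectation (\<lambda>\<omega>. f (step_path (2 ^ n) (\<lambda>k. 2 powr (- real n / 2) * X k \<omega>)))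
     - expectation (\<lambda>\<omega>. f (step_path (2 ^ j) (\<lambda>k. 2 powr (- real n / 2) * block_sum (k * 2 ^ (n - j)) (2 ^ (n - j)) \<omega>)))\<bar>
    \<le> chain_const mord * K\<^sub>X * 2 powr (- real j * \<alpha>)"
    using walk_chain[OF r1] unfolding \<alpha>_def by blast
  define K\<^sub>B where "K\<^sub>B = bm_const \<sigma> mord"
  \<comment> \<open>The factors 4 come from \<open>dyadic_rate_balance\<close>, and 15 is the
    product of the 5 in \<open>block_error_balance\<close> and the 3 in
    \<open>dyadic_rate_balance\<close>. Absolute values make \<open>K\<close> nonnegative without an
    argument about the sign of \<open>chain_const\<close>.\<close>
  define K where "K = 4 * \<bar>chain_const mord * K\<^sub>X\<bar> + 4 * \<bar>chain_const mord * K\<^sub>B\<bar> + 15 * C"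
  have K0: "K \<ge> 0" using C by (simp add: K_def)
  have KR: "KR_dist (path_law M (random_walk X n)) (path_law M' (\<lambda>t \<omega>. \<sigma> * B t \<omega>))
      \<le> ereal (K * ((2 ^ n) powr (- (g * \<alpha>)) * ln (2 ^ n)))" if n: "n \<ge> 1" for n
  proof (rule KR_dist_le)
    fix f :: "cadlag \<Rightarrow> real" assume f: "1-lipschitz_on UNIV f"
    define j where "j = nat \<lfloor>real n * g\<rfloor>"
    note R = dyadic_rate_balance[OF n bal(1,2) \<alpha> \<kappa> bal', folded j_def]
    let ?N = "(2 ^ n) powr (- (g * \<alpha>)) * ln (2 ^ n) :: real"
    define M0 where "M0 = (2 ^ (n - j) :: real)"
    have M0: "M0 \<ge> 1" "real (2 ^ (n - j)) = M0" by (simp_all add: M0_def)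
    define L where "L = nat \<lceil>M0 powr (d / (2 * d + a))\<rceil>"
    note bL = block_error_balance[OF d(1,2) a M0(1), folded L_def \<kappa>_def]
    define W where "W = C * (5 * ((1 + ln M0) * M0 powr (1 / 2 - \<kappa>)))"
    have W: "\<bar>expectation (\<lambda>\<omega>. H \<omega> (block_sum q (2 ^ (n - j)) \<omega>)) - expectation (\<lambda>\<omega>. gsmooth 0 (\<sigma> * sqrt (2 ^ (n - j))) (H \<omega>) 0)\<bar> \<le> W"
      if "past_lipschitz q H" for q H
    proof -
      have "\<bar>expectation (\<lambda>\<omega>. H \<omega> (block_sum q (2 ^ (n - j)) \<omega>)) - expectation (\<lambda>\<omega>. gsmooth 0 (\<sigma> * sqrt M0) (H \<omega>) 0)\<bar>
        \<le> C * ((1 + ln M0) * M0 powr ((1 - d) / 2) * real L powr d + sqrt M0 * real L powr (- a / 2) + real L)"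
        using C(2)[OF _ bL(1) that, of "2 ^ (n - j)"] unfolding M0(2) by simp
      also have "\<dots> \<le> W" unfolding W_def using C(1) by (intro mult_left_mono bL(2)) auto
      finally show ?thesis by (simp add: M0_def)
    qed
    let ?A = "expectation (\<lambda>\<omega>. f (step_path (2 ^ n) (\<lambda>k. 2 powr (- real n / 2) * X k \<omega>)))"
      and ?A' = "expectation (\<lambda>\<omega>. f (step_path (2 ^ j) (\<lambda>k. 2 powr (- real n / 2) * block_sum (k * 2 ^ (n - j)) (2 ^ (n - j)) \<omega>)))"
      and ?B' = "\<integral>\<omega>. f (step_path (2 ^ j) (\<lambda>k. bm_increment B \<sigma> j k \<omega>)) \<partial>M'"
      and ?B = "\<integral>\<omega>. f (to_cadlag (\<lambda>t. \<sigma> * B t \<omega>)) \<partial>M'"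
    have p: "mord > 2" using \<delta> by simp
    have e1: "\<bar>?A - ?A'\<bar> \<le> chain_const mord * K\<^sub>X * 2 powr (- real j * \<alpha>)" by (rule KX(2)[OF f R(1)])
    have e2: "\<bar>?A' - ?B'\<bar> \<le> 2 powr (- real n / 2) * (2 ^ j * W)" by (rule block_stage[OF BM \<sigma> f R(1) W])
    have e3: "\<bar>?B - ?B'\<bar> \<le> chain_const mord * K\<^sub>B * 2 powr (- real j * \<alpha>)"
      unfolding \<alpha>_def K\<^sub>B_def by (rule bm_chain(3)[OF BM \<sigma> f p])
    have up: "x * 2 powr (- real j * \<alpha>) \<le> 4 * \<bar>x\<bar> * ?N" for x :: real
    proof -
      have "x * 2 powr (- real j * \<alpha>) \<le> \<bar>x\<bar> * 2 powr (- real j * \<alpha>)" by (intro mult_right_mono) auto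
      also have "\<dots> \<le> \<bar>x\<bar> * (4 * ?N)" by (intro mult_left_mono R(2)) auto
      finally show ?thesis by simp
    qed
    have e2': "2 powr (- real n / 2) * (2 ^ j * W) \<le> 15 * C * ?N"
    proof -
      have "2 powr (- real n / 2) * (2 ^ j * W) = 5 * C * (2 powr (- real n / 2) * (2 ^ j * ((1 + ln M0) * M0 powr (1 / 2 - \<kappa>))))"
        unfolding W_def by (simp only: ac_simps)
      also have "\<dots> \<le> 5 * C * (3 * ?N)" unfolding M0_def using C(1) by (intro mult_left_mono R(3)) auto
      finally show ?thesis by simp
    qed
    have sum_mult: "x * z + w * z + y * z = (x + y + w) * z" for x y z w :: real
      by (simp add: algebra_simps)
    have "?A - ?B \<le> 4 * \<bar>chain_const mord * K\<^sub>X\<bar> * ?N + 15 * C * ?N + 4 * \<bar>chain_const mord * K\<^sub>B\<bar> * ?N"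
      using e1 e2 e3 e2' up[of "chain_const mord * K\<^sub>X"] up[of "chain_const mord * K\<^sub>B"] by linarith
    also have "\<dots> = K * ?N" unfolding K_def by (rule sum_mult)
    finally have AB: "?A - ?B \<le> K * ?N" .
    have "(\<lambda>\<omega>. step_path (2 ^ n) (\<lambda>k. 2 powr (- real n / 2) * X k \<omega>)) \<in> borel_measurable M"
      by (rule measurable_compose[OF measurable_sequence step_path_measurable]) auto
    then have "integral\<^sup>L (path_law M (random_walk X n)) f = ?A"
      unfolding path_law_def random_walk_path by (rule integral_distr[OF _ lipschitz_cadlag_measurable[OF f]])
    moreover have "integral\<^sup>L (path_law M' (\<lambda>t \<omega>. \<sigma> * B t \<omega>)) f = ?B"
      unfolding path_law_def by (rule integral_distr[OF bm_path_measurable[OF BM \<sigma>] lipschitz_cadlag_measurable[OF f]])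
    ultimately show "integral\<^sup>L (path_law M (random_walk X n)) f - integral\<^sup>L (path_law M' (\<lambda>t \<omega>. \<sigma> * B t \<omega>)) f \<le> K * ?N"
      using AB by simp
  qed
  \<comment> \<open>For smaller \<open>p\<close> the exponent is smaller, so the bound already
    proved is the stronger one; the same \<open>K\<close> serves because it is nonnegative.\<close>
  have "KR_dist (path_law M (random_walk X n)) (path_law M' (\<lambda>t \<omega>. \<sigma> * B t \<omega>))
      \<le> ereal (K * (2 ^ n) powr (- (gamma_tilde r d p * (1 / 2 - 1 / p))) * ln (2 ^ n))" if n: "n \<ge> 1" for n
  proof -
    have "(2 ^ n) powr (- (g * \<alpha>)) \<le> (2 ^ n :: real) powr (- (gamma_tilde r d p * (1 / 2 - 1 / p)))"
      using best[of p] assms(10,11) by (intro powr_mono) (auto simp: g_def \<alpha>_def)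
    then have "K * ((2 ^ n) powr (- (g * \<alpha>)) * ln (2 ^ n)) \<le> K * ((2 ^ n) powr (- (gamma_tilde r d p * (1 / 2 - 1 / p))) * ln (2 ^ n))"
      using K0 by (intro mult_left_mono mult_right_mono) auto
    then show ?thesis using order_trans[OF KR[OF n]] by (simp add: mult.assoc)
  qed
  then show ?thesis
    using gamma_tilde_gt_gamma_star[OF r0 d(1) assms(10) cd] gamma_tilde_tendsto_gamma_star[OF r0 d(1)] mono best
    unfolding r_def assms(13) by blast
qed

end
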